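(* Fix an integer $d\geq 2$. Let $p$ be a prime coprime to $d$ and $q=p^\nu$ with $\nu\ge 1$. Let $X/\mathbb{F}_q$ be an Artin-Schreier curve of genus $\geq 3$ whose affine equation is $y^p-y=\tilde f(x)$, where $\tilde f(x)\in\mathbb{F}_q[x]$ is monic of degree $d$. (a) If $p>d$ then $\mathrm{NP}_1(X/\mathbb{F}_q)\geq \dfrac{\lceil\frac{p-1}{d}\rceil}{p-1}$. (b) If $p>2d$ and $\big[\tilde f(x)^{\lceil\frac{p-1}{d}\rceil}\big]_{p-1}\neq 0$ in $\mathbb{F}_q$, then $\mathrm{NP}_1(X/\mathbb{F}_q)=\dfrac{\lceil\frac{p-1}{d}\rceil}{p-1}$.
   Context: A curve is a smooth, projective, geometrically integral variety of dimension one; "the curve with affine equation $y^p-y=\tilde f(x)$" is the smooth projective model; it has genus $(p-1)(d-1)/2$ when $p\nmid d=\deg\tilde f$. Newton polygon: for a curve $X$ of genus $g$ over $\mathbb{F}_q$, $q=p^\nu$, write $\exp\big(\sum_{n\ge1}(q^n+1-\#X(\mathbb{F}_{q^n}))\frac{T^n}{n}\big)=\frac{1}{P(T)}$ with $P(T)=1+\sum_{\ell=1}^{2g}b_\ell T^\ell\in\mathbb{Z}[T]$. $\mathrm{NP}(X/\mathbb{F}_q)$ is the lower convex hull in $\mathbb{R}^2$ of $(0,0)$ and the points $(\ell,\frac{\mathrm{ord}_p b_\ell}{\nu})$, $1\le\ell\le 2g$ (with $\mathrm{ord}_p 0=\infty$). $\mathrm{NP}_1(X/\mathbb{F}_q)$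 is its first (smallest) slope. For a polynomial $h(x)$ over a commutative ring, $[h(x)^N]_r$ denotes the coefficient of $x^r$ in $h(x)^N$. *)

theory Defs
  imports
    "HOL-Algebra.Algebraic_Closure_Type"
    "HOL-Analysis.Analysis"
    "HOL-Computational_Algebra.Computational_Algebra"
begin

text \<open>
  A smooth projective, geometrically integral curve over a perfect field is determined by its
  function field, and its points are the places (valuation rings) of that field.  This is
  how the smooth projective model of an affine plane curve is realised below.  All function fields
  live in one big algebraically closed field \<open>\<Omega>\<close>, an algebraic closure of \<open>k(x)\<close>, where
  \<open>'k\<close> is itself going to be an algebraic closure of the finite ground field.
\<close>

type_synonym 'k ratfun_closure = "'k poly fract alg_closure"

definition cst :: "'k::field \<Rightarrow> 'k ratfun_closure" where
  "cst c = to_ac (Fract [:c:] 1)"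

definition xvar :: "'k::field ratfun_closure" where
  "xvar = to_ac (Fract [:0, 1:] 1)"

text \<open>
  In characteristic \<open>p\<close> the roots of \<open>Y\<^sup>p - Y = f(x)\<close> in \<open>\<Omega>\<close> differ from each other by elements
  of the prime field, so the field generated by \<open>x\<close> and \<open>y\<close> does not depend on the choice.
\<close>

definition yvar :: "nat \<Rightarrow> 'k::field poly \<Rightarrow> 'k ratfun_closure" where
  "yvar p f = (SOME y. y ^ p - y = poly (map_poly cst f) xvar)"

inductive_set field_gen :: "'b::field set \<Rightarrow> 'b set" for S where
  base: "a \<in> S \<Longrightarrow> a \<in> field_gen S"
| one: "1 \<in> field_gen S"
| minus: "a \<in> field_gen S \<Longrightarrow> b \<in> field_gen S \<Longrightarrow> a - b \<in> field_gen S"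
| times: "a \<in> field_gen S \<Longrightarrow> b \<in> field_gen S \<Longrightarrow> a * b \<in> field_gen S"
| inverse: "a \<in> field_gen S \<Longrightarrow> inverse a \<in> field_gen S"

text \<open>
  Here \<open>k\<close> is a subfield of \<open>'k\<close> that contains the coefficients of \<open>f\<close>.  For
  \<open>k = UNIV\<close> one obtains the function field of the base change of the curve to \<open>'k\<close>.
\<close>

definition as_function_field :: "'k::field set \<Rightarrow> nat \<Rightarrow> 'k poly \<Rightarrow> 'k ratfun_closure set" where
  "as_function_field k p f = field_gen (cst ` k \<union> {xvar, yvar p f})"

definition subring_set :: "'b::field set \<Rightarrow> bool" where
  "subring_set R \<longleftrightarrow> 1 \<in> R \<and> (\<forall>a\<in>R. \<forall>b\<in>R. a - b \<in> R \<and> a * b \<in> R)"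

definition places :: "'k::field set \<Rightarrow> 'k ratfun_closure set \<Rightarrow> 'k ratfun_closure set set" where
  "places k K = {R. subring_set R \<and> cst ` k \<subseteq> R \<and> R \<subset> K \<and> (\<forall>z\<in>K. z \<in> R \<or> inverse z \<in> R)}"

definition max_ideal :: "'b::field set \<Rightarrow> 'b set" where
  "max_ideal R = {z \<in> R. z = 0 \<or> inverse z \<notin> R}"

text \<open>The points rational over \<open>k\<close>: the places whose residue field is \<open>k\<close>.\<close>

definition rational_places ::
    "'k::field set \<Rightarrow> 'k ratfun_closure set \<Rightarrow> 'k ratfun_closure set set" where
  "rational_places k K = {R \<in> places k K. \<forall>z\<in>R. \<exists>c\<in>k. z - cst c \<in> max_ideal R}"

text \<open>
  The genus, as in Riemann's theorem: the maximum of \<open>deg D - \<ell>(D) + 1\<close> over all divisors \<open>D\<close>.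
  It is computed over the algebraically closed field \<open>'k\<close>, where every place has degree one.
\<close>

definition uniformizer :: "'b::field set \<Rightarrow> 'b \<Rightarrow> bool" where
  "uniformizer R t \<longleftrightarrow> t \<in> R \<and> max_ideal R = (\<lambda>z. t * z) ` R"

definition divisors :: "'k::field ratfun_closure set \<Rightarrow> ('k ratfun_closure set \<Rightarrow> int) set" where
  "divisors K = {D. finite {R. D R \<noteq> 0} \<and> {R. D R \<noteq> 0} \<subseteq> places UNIV K}"

definition divisor_deg :: "('k::field ratfun_closure set \<Rightarrow> int) \<Rightarrow> int" where
  "divisor_deg D = (\<Sum>R | D R \<noteq> 0. D R)"

text \<open>With \<open>t\<close> a uniformizer at \<open>R\<close>, the membership below says that \<open>v\<^sub>R(z) \<ge> - D(R)\<close>.\<close>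

definition riemann_roch_space ::
    "'k::field ratfun_closure set \<Rightarrow> ('k ratfun_closure set \<Rightarrow> int) \<Rightarrow> 'k ratfun_closure set" where
  "riemann_roch_space K D =
     {z \<in> K. \<forall>R \<in> places UNIV K. \<forall>t. uniformizer R t \<longrightarrow> z * t powi (D R) \<in> R}"

definition riemann_roch_dim ::
    "'k::field ratfun_closure set \<Rightarrow> ('k ratfun_closure set \<Rightarrow> int) \<Rightarrow> nat" where
  "riemann_roch_dim K D = vector_space.dim (\<lambda>c z. cst c * z) (riemann_roch_space K D)"

definition genus :: "'k::field ratfun_closure set \<Rightarrow> nat" where
  "genus K = nat (SUP D \<in> divisors K. divisor_deg D - int (riemann_roch_dim K D) + 1)"

text \<open>The subfield of order \<open>q\<^sup>n\<close> of the algebraic closure of a field of order \<open>q\<close>.\<close>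

definition GF_ext :: "nat \<Rightarrow> 'a::{field,finite} alg_closure set" where
  "GF_ext n = {c. c ^ (CARD('a) ^ n) = c}"

definition as_genus :: "nat \<Rightarrow> 'a::{field,finite} poly \<Rightarrow> nat" where
  "as_genus p f = genus (as_function_field UNIV p (map_poly to_ac f))"

definition as_points :: "nat \<Rightarrow> 'a::{field,finite} poly \<Rightarrow> nat \<Rightarrow> nat" where
  "as_points p f n =
     card (rational_places (GF_ext n) (as_function_field (GF_ext n) p (map_poly to_ac f)))"

text \<open>The polynomial \<open>P(T)\<close>, as the formal power series that defines it.\<close>

definition as_log_zeta :: "nat \<Rightarrow> 'a::{field,finite} poly \<Rightarrow> rat fps" where
  "as_log_zeta p f = Abs_fps (\<lambda>n. if n = 0 then 0
     else (of_nat (CARD('a) ^ n) + 1 - of_nat (as_points p f n)) / of_nat n)"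

definition as_P :: "nat \<Rightarrow> 'a::{field,finite} poly \<Rightarrow> rat fps" where
  "as_P p f = inverse (fps_exp 1 oo as_log_zeta p f)"

definition ord_rat :: "nat \<Rightarrow> rat \<Rightarrow> int" where
  "ord_rat p r = (case quotient_of r of (a, b) \<Rightarrow>
     int (multiplicity (int p) a) - int (multiplicity (int p) b))"

definition lower_hull :: "(real \<times> real) set \<Rightarrow> real \<Rightarrow> real" where
  "lower_hull S t = Inf {y. (t, y) \<in> convex hull S}"

definition first_slope :: "(real \<Rightarrow> real) \<Rightarrow> real" where
  "first_slope N = (THE s. \<exists>e>0. \<forall>t\<in>{0..e}. N t = N 0 + s * t)"

text \<open>Coefficients \<open>b\<^sub>l = 0\<close>, which have order \<open>\<infinity>\<close>, contribute no point.\<close>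

definition NP_points :: "nat \<Rightarrow> nat \<Rightarrow> 'a::{field,finite} poly \<Rightarrow> (real \<times> real) set" where
  "NP_points p \<nu> f = insert (0, 0)
     {(real l, real_of_int (ord_rat p (fps_nth (as_P p f) l)) / real \<nu>) | l.
        1 \<le> l \<and> l \<le> 2 * as_genus p f \<and> fps_nth (as_P p f) l \<noteq> 0}"

definition NP :: "nat \<Rightarrow> nat \<Rightarrow> 'a::{field,finite} poly \<Rightarrow> real \<Rightarrow> real" where
  "NP p \<nu> f = lower_hull (NP_points p \<nu> f)"

definition NP\<^sub>1 :: "nat \<Rightarrow> nat \<Rightarrow> 'a::{field,finite} poly \<Rightarrow> real" where
  "NP\<^sub>1 p \<nu> f = first_slope (NP p \<nu> f)"

end

theory Submission
  imports Defs "HOL-Number_Theory.Residues"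
begin

text \<open>
  \<open>P\<close> is the product of the \<open>p - 1\<close> polynomials \<open>L\<^sub>a(T) = \<Sum>\<^sub>g \<psi>\<^sub>a(\<Sum>\<^sub>b f(b)) T\<^bsup>deg g\<^esup>\<close>, where \<open>g\<close> runs over the monic polynomials over
  the ground field, \<open>b\<close> over the roots of \<open>g\<close>, and \<open>\<psi>\<^sub>a\<close> over the nontrivial additive characters.  Each \<open>L\<^sub>a\<close>
  has degree \<open>d - 1\<close>, and \<open>l c\<^sub>l = \<Sum>\<^sub>n S\<^sub>n c\<^bsub>l-n\<^esub>\<close> relates its coefficients to the exponential sums \<open>S\<^sub>n\<close>.

  Put \<open>\<pi> = \<zeta> - 1\<close> and \<open>w = \<lceil>(p-1)/d\<rceil>\<close>.  Expanding \<open>S\<^sub>n\<close> in Gauss sums, Stickelberger's congruence shows that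
  \<open>S\<^sub>n\<close> is divisible by \<open>\<pi>\<^bsup>\<nu>nw\<^esup>\<close>, and for \<open>p > 2d\<close> the quotient is congruent to \<open>-\<gamma>\<^sup>n\<close>, where \<open>\<gamma>\<close> is the norm of
  \<open>[f\<^sup>w]\<^bsub>p-1\<^esub> / w!\<close>.  As \<open>l < p\<close> is invertible for \<open>l \<le> d - 1\<close>, the recursion carries the divisibility over to
  \<open>c\<^sub>l\<close> and hence to \<open>P\<close>, which bounds the slopes; for \<open>p > 2d\<close> it also gives \<open>L\<^sub>a \<equiv> 1 - \<gamma>\<^sub>a T\<close> after rescaling
  \<open>T\<close>, so the coefficient of \<open>T\<^bsup>p-1\<^esup>\<close> in \<open>P\<close> attains the bound.  That this coefficient lies in the range of the Newton polygon,
  and that some point does, follows from \<open>2g \<ge> (p-1)(d-1)\<close>.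
\<close>

section \<open>Evaluation of bivariate polynomials\<close>

text \<open>Characters and L-functions live in the complex numbers, and congruences between them are
  read off from a residue map: Z[\<xi>], with \<xi> a root of unity of order p(p^M - 1), is
  localised at the kernel of a homomorphism to the algebraic closure of F_p, where M is a multiple
  of all degrees that occur. The obstacle is that the curve is given by its function field alone, so
  point counts and genus must be extracted from places. Each point gets a Laurent parametrisation: x
  - c is a local parameter at every affine point, as the equation has derivative -1 in y, and at
  infinity x and y have poles of order p and d. Since p and d are coprime, the monomials x^i y^j
  with j < p have distinct pole orders there; this yields the irreducibility of the equation, the
  uniqueness of the place at infinity, and a basis of the functions regular elsewhere. In the digit
  estimate, divisibility of an exponent by p^m - 1 produces carries that are at least 1. For p > 2d
  the extremal terms have all carries equal to 1, so each digit position satisfies the same two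
  equations and the extremal terms factor into terms of [f^w]_(p-1).\<close>

definition rhom :: "('a::comm_ring_1 \<Rightarrow> 'b::comm_ring_1) \<Rightarrow> bool" where
  "rhom h \<longleftrightarrow> h 1 = 1 \<and> (\<forall>x y. h (x + y) = h x + h y) \<and> (\<forall>x y. h (x * y) = h x * h y)"

lemma rhomI:
  "h 1 = 1 \<Longrightarrow> (\<And>x y. h (x + y) = h x + h y) \<Longrightarrow> (\<And>x y. h (x * y) = h x * h y) \<Longrightarrow> rhom h"
  by (simp add: rhom_def)

lemma rhom_1: "rhom h \<Longrightarrow> h 1 = 1"
  and rhom_add: "rhom h \<Longrightarrow> h (x + y) = h x + h y"
  and rhom_mult: "rhom h \<Longrightarrow> h (x * y) = h x * h y"
  by (simp_all add: rhom_def)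

lemma rhom_0: "rhom h \<Longrightarrow> h 0 = 0"
  using rhom_add[of h 0 0] by simp

lemma rhom_uminus: "rhom h \<Longrightarrow> h (- x) = - h x"
  using rhom_add[of h x "- x"] by (simp add: rhom_0 eq_neg_iff_add_eq_0 add.commute)

lemma rhom_diff: "rhom h \<Longrightarrow> h (x - y) = h x - h y"
  using rhom_add[of h x "- y"] by (simp add: rhom_uminus)

lemma rhom_power: "rhom h \<Longrightarrow> h (x ^ n) = h x ^ n"
  by (induction n) (simp_all add: rhom_1 rhom_mult)

lemma rhom_sum: "rhom h \<Longrightarrow> h (sum u A) = (\<Sum>a\<in>A. h (u a))"
  by (induction A rule: infinite_finite_induct) (simp_all add: rhom_0 rhom_add)

lemma rhom_of_nat: "rhom h \<Longrightarrow> h (of_nat n) = of_nat n"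
  by (induction n) (simp_all add: rhom_0 rhom_1 rhom_add)

lemma rhom_id: "rhom (\<lambda>x. x)"
  by (simp add: rhom_def)

lemma rhom_comp: "rhom g \<Longrightarrow> rhom h \<Longrightarrow> rhom (\<lambda>x. g (h x))"
  by (simp add: rhom_def)

lemmas rhom_simps = rhom_0 rhom_1 rhom_add rhom_mult rhom_uminus rhom_diff rhom_power rhom_of_nat

lemma rhom_eq_0_iff: "rhom h \<Longrightarrow> h x = 0 \<longleftrightarrow> x = 0"
  for h :: "'a::field \<Rightarrow> 'b::{comm_ring_1, ring_1_no_zero_divisors}"
  by (metis mult_zero_left rhom_0 rhom_1 rhom_mult right_inverse zero_neq_one)

text \<open>The coefficient map is a parameter because the same polynomial is evaluated in the
  function field, in Laurent and power series, in residue fields and in the complex numbers.\<close>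

definition pev :: "('a::comm_ring_1 \<Rightarrow> 'b::comm_ring_1) \<Rightarrow> 'b \<Rightarrow> 'a poly \<Rightarrow> 'b" where
  "pev h x q = poly (map_poly h q) x"

context
  fixes h :: "'a::comm_ring_1 \<Rightarrow> 'b::comm_ring_1"
  assumes h: "rhom h"
begin

lemma pev_0 [simp]: "pev h x 0 = 0"
  by (simp add: pev_def)

lemma pev_pCons: "pev h x (pCons a q) = h a + x * pev h x q"
  by (simp add: pev_def map_poly_pCons rhom_0[OF h])

lemma pev_const: "pev h x [:a:] = h a"
  by (simp add: pev_pCons)

lemma pev_add: "pev h x (q + r) = pev h x q + pev h x r"
  by (induction q r rule: poly_induct2) (simp_all add: pev_pCons rhom_add[OF h] algebra_simps)

lemma pev_smult: "pev h x (smult a q) = h a * pev h x q"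
  by (induction q) (simp_all add: pev_pCons rhom_mult[OF h] algebra_simps)

lemma pev_mult: "pev h x (q * r) = pev h x q * pev h x r"
  by (induction q) (simp_all add: pev_pCons pev_add pev_smult rhom_0[OF h] algebra_simps)

lemma rhom_pev: "rhom (pev h x)"
  by (rule rhomI) (simp_all add: pev_add pev_mult one_pCons pev_const rhom_1[OF h])

lemma pev_monom: "pev h x (monom a n) = h a * x ^ n"
  by (simp add: pev_def map_poly_monom rhom_0[OF h] poly_monom)

lemma pev_altdef: "pev h x q = (\<Sum>i\<le>degree q. h (coeff q i) * x ^ i)"
proof -
  have "pev h x (\<Sum>i\<le>degree q. monom (coeff q i) i) = (\<Sum>i\<le>degree q. h (coeff q i) * x ^ i)"
    by (simp add: rhom_sum[OF rhom_pev] pev_monom)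
  thus ?thesis by (simp add: poly_as_sum_of_monoms)
qed

lemma pev_comp: "rhom g \<Longrightarrow> g (pev h x q) = pev (\<lambda>a. g (h a)) (g x) q"
  by (induction q)
     (simp_all add: pev_pCons rhom_simps rhom_comp[OF _ h] pev_def map_poly_pCons rhom_0[OF h])

end

lemma pev_id: "pev (\<lambda>x. x) x q = poly q x"
  by (simp add: pev_def)

text \<open>Polynomials in y with coefficients in k[x]: the inner variable is x, the outer one
  y.\<close>

definition ev :: "('a::comm_ring_1 \<Rightarrow> 'b::comm_ring_1) \<Rightarrow> 'b \<Rightarrow> 'b \<Rightarrow> 'a poly poly \<Rightarrow> 'b" where
  "ev h x y g = pev (pev h x) y g"

lemma rhom_ev: "rhom h \<Longrightarrow> rhom (ev h x y)"
  unfolding ev_def by (intro rhom_pev)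

lemma ev_const: "rhom h \<Longrightarrow> ev h x y [:q:] = pev h x q"
  by (simp add: ev_def pev_const rhom_pev)

lemma ev_pCons: "rhom h \<Longrightarrow> ev h x y (pCons q g) = pev h x q + y * ev h x y g"
  by (simp add: ev_def pev_pCons rhom_pev)

lemma ev_monom: "rhom h \<Longrightarrow> ev h x y (monom q n) = pev h x q * y ^ n"
  by (simp add: ev_def pev_monom rhom_pev)

lemma ev_smult: "rhom h \<Longrightarrow> ev h x y (smult q g) = pev h x q * ev h x y g"
  by (simp add: ev_def pev_smult rhom_pev)

lemma ev_altdef: "rhom h \<Longrightarrow> ev h x y g = (\<Sum>j\<le>degree g. pev h x (coeff g j) * y ^ j)"
  by (simp add: ev_def pev_altdef rhom_pev)

lemma ev_comp:
  assumes h: "rhom h" and g: "rhom g"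
  shows "g (ev h x y q) = ev (\<lambda>a. g (h a)) (g x) (g y) q"
proof -
  have "(\<lambda>a. g (pev h x a)) = pev (\<lambda>a. g (h a)) (g x)"
    using pev_comp[OF h g] by auto
  thus ?thesis
    unfolding ev_def using pev_comp[OF rhom_pev[OF h] g, of x y q] by simp
qed

section \<open>Hensel lifting for power series and orders of Laurent series\<close>

lemma poly_expand2:
  fixes F :: "'a::idom poly"
  shows "\<exists>R. poly F (z + h) = poly F z + h * poly (pderiv F) z + h ^ 2 * R"
proof (induction F)
  case 0
  show ?case by (rule exI[of _ 0]) simp
next
  case (pCons a F)
  then obtain R where R: "poly F (z + h) = poly F z + h * poly (pderiv F) z + h ^ 2 * R"
    by blast
  show ?case
    unfolding poly_pCons R pderiv_pCons poly_add
    by (rule exI[of _ "poly (pderiv F) z + (z + h) * R"]) (simp add: algebra_simps power2_eq_square)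
qed

lemma rhom_fps_nth_0: "rhom (\<lambda>s::'a::comm_ring_1 fps. fps_nth s 0)"
  by (rule rhomI) auto

text \<open>Newton iteration, correcting one coefficient per step. The derivative of
  \<open>F\<close> at every approximation has the constant term \<open>D\<close>, so dividing by the
  fixed constant \<open>D\<close> is enough.\<close>

lemma fps_hensel:
  fixes F :: "'a::field fps poly" and a :: 'a
  assumes root: "pev (\<lambda>s. fps_nth s 0) a F = 0"
    and simple: "pev (\<lambda>s. fps_nth s 0) a (pderiv F) \<noteq> 0"
  shows "\<exists>z. fps_nth z 0 = a \<and> poly F z = 0"
proof -
  define D where "D = pev (\<lambda>s. fps_nth s 0) a (pderiv F)"
  have nth0: "fps_nth (poly G z) 0 = pev (\<lambda>s. fps_nth s 0) (fps_nth z 0) G" for G :: "'a fps poly" and z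
    using pev_comp[OF rhom_id rhom_fps_nth_0, of z G] by (simp add: pev_id)
  define zs where "zs = rec_nat (fps_const a)
     (\<lambda>n z. z - fps_const (fps_nth (poly F z) (Suc n) / D) * fps_X ^ Suc n)"
  have zs0: "zs 0 = fps_const a"
    and zsS: "zs (Suc n) = zs n - fps_const (fps_nth (poly F (zs n)) (Suc n) / D) * fps_X ^ Suc n" for n
    by (simp_all add: zs_def)
  have inv: "fps_nth (zs n) 0 = a \<and> (\<forall>i\<le>n. fps_nth (poly F (zs n)) i = 0)" for n
  proof (induction n)
    case 0
    show ?case by (simp add: zs0 nth0 root)
  next
    case (Suc n)
    define c where "c = fps_nth (poly F (zs n)) (Suc n) / D"
    obtain R where R: "poly F (zs n + (- fps_const c * fps_X ^ Suc n)) = poly F (zs n)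
        + (- fps_const c * fps_X ^ Suc n) * poly (pderiv F) (zs n) + (- fps_const c * fps_X ^ Suc n) ^ 2 * R"
      using poly_expand2 by blast
    have e: "(- fps_const c * fps_X ^ Suc n) ^ 2 * R = fps_X ^ Suc n * (fps_X ^ Suc n * (fps_const c ^ 2 * R))"
      by (simp add: power2_eq_square algebra_simps)
    have e2: "(- fps_const c * fps_X ^ Suc n) * poly (pderiv F) (zs n) = - (fps_X ^ Suc n * (fps_const c * poly (pderiv F) (zs n)))"
      by (simp only: minus_mult_left [symmetric] mult.assoc mult.left_commute [of "fps_const c"])
    have "poly F (zs (Suc n)) = poly F (zs n) - fps_X ^ Suc n * (fps_const c * poly (pderiv F) (zs n))
        + fps_X ^ Suc n * (fps_X ^ Suc n * (fps_const c ^ 2 * R))"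
      using R unfolding e e2 by (simp only: zsS c_def [symmetric] mult_minus_left add_uminus_conv_diff)
    moreover have "fps_nth (poly (pderiv F) (zs n)) 0 = D"
      using Suc by (simp add: nth0 D_def)
    moreover have "D \<noteq> 0" using simple by (simp add: D_def)
    ultimately have "fps_nth (poly F (zs (Suc n))) i = 0" if "i \<le> Suc n" for i
      using Suc that by (cases "i = Suc n")
        (auto simp: fps_X_power_mult_nth c_def simp del: power_Suc)
    thus ?case using Suc by (auto simp: zsS fps_X_power_mult_right_nth simp del: power_Suc)
  qed
  \<comment> \<open>The limit is the diagonal: from stage \<open>n\<close> on the coefficient of
    index \<open>n\<close> no longer changes.\<close>
  define z where "z = Abs_fps (\<lambda>n. fps_nth (zs n) n)"
  have stab: "n \<le> k \<Longrightarrow> fps_nth (zs k) n = fps_nth (zs n) n" for n k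
    by (induction k rule: dec_induct)
       (simp_all add: zsS fps_X_power_mult_right_nth del: power_Suc)
  have "fps_nth (poly F z) n = 0" for n
  proof -
    define r where "r = Abs_fps (\<lambda>i. fps_nth (z - zs n) (i + Suc n))"
    have r: "z = zs n + fps_X ^ Suc n * r"
    proof (rule fps_ext)
      fix i
      show "fps_nth z i = fps_nth (zs n + fps_X ^ Suc n * r) i"
        using stab[of i n] by (cases "i \<le> n") (simp_all add: r_def z_def fps_X_power_mult_nth del: power_Suc)
    qed
    obtain R where R: "poly F (zs n + fps_X ^ Suc n * r) = poly F (zs n)
        + (fps_X ^ Suc n * r) * poly (pderiv F) (zs n) + (fps_X ^ Suc n * r) ^ 2 * R"
      using poly_expand2 by blast
    have "poly F z = poly F (zs n) + fps_X ^ Suc n * (r * poly (pderiv F) (zs n) + fps_X ^ Suc n * (r ^ 2 * R))"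
      unfolding r R by (simp add: algebra_simps power2_eq_square)
    thus ?thesis using inv[of n] by (simp add: fps_X_power_mult_nth del: power_Suc)
  qed
  hence "poly F z = 0" by (intro fps_ext) simp
  moreover have "fps_nth z 0 = a" using inv[of 0] by (simp add: z_def)
  ultimately show ?thesis by blast
qed

text \<open>The term of strictly smallest order cannot be cancelled; this is how orders of
  polynomials in x and y at infinity are computed.\<close>

lemma fls_sum_dominant:
  fixes u :: "'i \<Rightarrow> 'a::ring_1 fls"
  assumes "finite A" "i \<in> A" "u i \<noteq> 0"
    and dom: "\<And>j. j \<in> A \<Longrightarrow> j \<noteq> i \<Longrightarrow> u j \<noteq> 0 \<Longrightarrow> fls_subdegree (u i) < fls_subdegree (u j)"
  shows "sum u A \<noteq> 0" "fls_subdegree (sum u A) = fls_subdegree (u i)"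
proof -
  have "fls_nth (sum u A) n = (if n = fls_subdegree (u i) then fls_nth (u i) n else 0)"
    if "n \<le> fls_subdegree (u i)" for n
  proof -
    have "fls_nth (u j) n = 0" if "j \<in> A - {i}" for j
      using dom[of j] that \<open>n \<le> _\<close> by (cases "u j = 0") auto
    hence "fls_nth (sum u A) n = fls_nth (u i) n"
      by (simp add: fls_nth_sum sum.remove[OF assms(1,2)])
    thus ?thesis using that by auto
  qed
  hence *: "fls_nth (sum u A) (fls_subdegree (u i)) \<noteq> 0"
    "\<And>k. k < fls_subdegree (u i) \<Longrightarrow> fls_nth (sum u A) k = 0"
    using assms(3) by auto
  show "sum u A \<noteq> 0" using * by auto
  show "fls_subdegree (sum u A) = fls_subdegree (u i)" by (rule fls_subdegree_eqI[OF *])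
qed

lemma rhom_fls_const: "rhom (fls_const :: 'a::comm_ring_1 \<Rightarrow> 'a fls)"
  by (rule rhomI) (simp_all add: fls_plus_const)

lemma rhom_fps_const: "rhom (fps_const :: 'a::comm_ring_1 \<Rightarrow> 'a fps)"
  by (rule rhomI) simp_all

lemma rhom_fps_to_fls: "rhom (fps_to_fls :: 'a::comm_ring_1 fps \<Rightarrow> 'a fls)"
  by (rule rhomI) (simp_all add: fls_times_fps_to_fls)

text \<open>Horner's scheme: multiplication by \<open>z\<close> produces a pole, which adding a
  constant cannot remove. In particular an element with a pole is transcendental over the
  constants.\<close>

lemma fls_subdegree_pev_neg:
  fixes z :: "'a::field fls"
  assumes z: "fls_subdegree z = - int n" "n > 0" and "g \<noteq> 0"
  shows "pev fls_const z g \<noteq> 0 \<and> fls_subdegree (pev fls_const z g) = - int (n * degree g)"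
  using \<open>g \<noteq> 0\<close>
proof (induction g)
  case (pCons a q)
  show ?case
  proof (cases "q = 0")
    case True
    thus ?thesis using pCons by (simp add: pev_const rhom_fls_const)
  next
    case False
    have X0: "z \<noteq> 0" using z by auto
    have *: "pev fls_const z q \<noteq> 0" "fls_subdegree (pev fls_const z q) = - int (n * degree q)"
      using pCons False by auto
    have "fls_subdegree (z * pev fls_const z q) = - int (n * Suc (degree q))"
      using * X0 z by (simp add: algebra_simps)
    moreover have "z * pev fls_const z q \<noteq> 0" using * X0 by simp
    moreover have "- int (n * Suc (degree q)) < 0" using z(2) by (simp del: of_nat_mult of_nat_Suc)
    ultimately show ?thesis using False fls_subdegree_add_eq2[of "z * pev fls_const z q" "fls_const a"]
      by (auto simp: pev_pCons rhom_fls_const simp del: fls_subdegree_mult)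
  qed
qed simp

section \<open>The function field and its places\<close>

text \<open>The condition of \<open>subring_set\<close>, stated over commutative rings so that it
  also covers polynomial rings.\<close>

definition subrng :: "'a::comm_ring_1 set \<Rightarrow> bool" where
  "subrng S \<longleftrightarrow> 1 \<in> S \<and> (\<forall>a\<in>S. \<forall>b\<in>S. a - b \<in> S \<and> a * b \<in> S)"

context
  fixes S :: "'a::comm_ring_1 set"
  assumes S: "subrng S"
begin

lemma subrng_1: "1 \<in> S"
  and subrng_diff: "a \<in> S \<Longrightarrow> b \<in> S \<Longrightarrow> a - b \<in> S"
  and subrng_mult: "a \<in> S \<Longrightarrow> b \<in> S \<Longrightarrow> a * b \<in> S"
  using S by (auto simp: subrng_def)

lemma subrng_0: "0 \<in> S"
  using subrng_diff[OF subrng_1 subrng_1] by simp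

lemma subrng_uminus: "a \<in> S \<Longrightarrow> - a \<in> S"
  using subrng_diff[OF subrng_0, of a] by simp

lemma subrng_add: "a \<in> S \<Longrightarrow> b \<in> S \<Longrightarrow> a + b \<in> S"
  using subrng_diff[of a "- b"] subrng_uminus[of b] by simp

lemma subrng_power: "a \<in> S \<Longrightarrow> a ^ n \<in> S"
  by (induction n) (auto intro: subrng_1 subrng_mult)

lemma subrng_sum: "(\<And>i. i \<in> A \<Longrightarrow> u i \<in> S) \<Longrightarrow> sum u A \<in> S"
  by (induction A rule: infinite_finite_induct) (auto intro: subrng_0 subrng_add)

lemma subrng_prod: "(\<And>i. i \<in> A \<Longrightarrow> u i \<in> S) \<Longrightarrow> prod u A \<in> S"
  by (induction A rule: infinite_finite_induct) (auto intro: subrng_1 subrng_mult)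

end

text \<open>Descent to a smaller ground field is expressed by sets: for a subfield \<open>k\<close>
  of the algebraically closed field, \<open>poly_over (poly_over k)\<close> plays the role of
  k[x][y].\<close>

definition poly_over :: "'a::comm_ring_1 set \<Rightarrow> 'a poly set" where
  "poly_over S = {q. \<forall>j. coeff q j \<in> S}"

lemma subrng_poly_over: "subrng S \<Longrightarrow> subrng (poly_over S)"
  unfolding subrng_def[of "poly_over S"]
  by (auto simp: poly_over_def coeff_mult coeff_1 intro!: subrng_sum subrng_mult subrng_diff intro: subrng_0 subrng_1)

lemma const_poly_over: "subrng S \<Longrightarrow> a \<in> S \<Longrightarrow> [:a:] \<in> poly_over S"
  by (auto simp: poly_over_def coeff_pCons subrng_0 split: nat.splits)

lemma monom_poly_over: "subrng S \<Longrightarrow> a \<in> S \<Longrightarrow> monom a n \<in> poly_over S"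
  by (auto simp: poly_over_def subrng_0)

lemma pCons_poly_over: "pCons a q \<in> poly_over S \<longleftrightarrow> a \<in> S \<and> q \<in> poly_over S"
  by (auto simp: poly_over_def coeff_pCons split: nat.splits)

lemma poly_over_UNIV: "poly_over UNIV = UNIV"
  by (auto simp: poly_over_def)

lemma poly_poly_over: "subrng S \<Longrightarrow> q \<in> poly_over S \<Longrightarrow> a \<in> S \<Longrightarrow> poly q a \<in> S"
  unfolding poly_altdef
  by (auto simp: poly_over_def intro!: subrng_sum subrng_mult subrng_power)

lemma synthetic_div_poly_over:
  "subrng S \<Longrightarrow> q \<in> poly_over S \<Longrightarrow> a \<in> S \<Longrightarrow> synthetic_div q a \<in> poly_over S"
proof (induction q)
  case 0
  thus ?case using subrng_0[OF subrng_poly_over[of S]] by simp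
next
  case (pCons b q)
  thus ?case by (simp add: pCons_poly_over poly_poly_over)
qed

lemma poly_split_root:
  assumes "subrng S" "q \<in> poly_over S" "a \<in> S"
  obtains r where "r \<in> poly_over S" "q = [:-a, 1:] * r + [:poly q a:]"
proof
  show "synthetic_div q a \<in> poly_over S" using assms by (rule synthetic_div_poly_over)
  show "q = [:-a, 1:] * synthetic_div q a + [:poly q a:]"
    using synthetic_div_correct'[of a q] by simp
qed

lemma rhom_cst: "rhom (cst :: 'k::field \<Rightarrow> 'k ratfun_closure)"
proof (rule rhomI)
  have "Fract [:1:] 1 = (1 :: 'k poly fract)" by (simp add: One_fract_def one_pCons)
  thus "cst 1 = (1 :: 'k ratfun_closure)" by (simp add: cst_def)
  have "to_ac (Fract [:a:] 1) + to_ac (Fract [:b:] 1) = to_ac (Fract [:a + b:] 1)" for a b :: 'k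
    by (subst to_ac_add [symmetric]) simp
  thus "cst (a + b) = cst a + cst b" for a b :: 'k by (simp only: cst_def)
  have "to_ac (Fract [:a:] 1) * to_ac (Fract [:b:] 1) = to_ac (Fract [:a * b:] 1)" for a b :: 'k
    by (subst to_ac_mult [symmetric]) (simp add: mult.commute)
  thus "cst (a * b) = cst a * cst b" for a b :: 'k by (simp only: cst_def)
qed

text \<open>Shows that \<open>xvar\<close> is transcendental over the constants, as both embeddings
  on the right are injective.\<close>

lemma pev_cst_xvar: "pev cst xvar g = to_ac (to_fract g)"
proof (induction g)
  case 0
  thus ?case by (simp add: pev_0[OF rhom_cst])
next
  case (pCons a q)
  have *: "to_fract (pCons a q) = Fract [:a:] 1 + Fract [:0, 1:] 1 * to_fract q"
    by (simp add: to_fract_def)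
  show ?case
    by (simp only: pev_pCons[OF rhom_cst] pCons.IH) (simp only: cst_def xvar_def * to_ac_add to_ac_mult)
qed

lemma pderiv_sum: "pderiv (sum u A) = (\<Sum>i\<in>A. pderiv (u i))"
  by (induction A rule: infinite_finite_induct) (simp_all add: pderiv_add)

section \<open>The equation of the curve and its generic points\<close>

locale as_curve =
  fixes p d :: nat and f :: "'k::alg_closed_field poly"
  assumes prime_p: "prime p" and char_p: "CHAR('k) = p" and deg_f: "degree f = d"
    and lc_f: "lead_coeff f = 1" and coprime_pd: "coprime p d" and d_ge_2: "d \<ge> 2"
begin

lemma p_ge_2: "p \<ge> 2"
  using prime_ge_2_nat[OF prime_p] .

lemma frob_add: "(a + b) ^ p = a ^ p + b ^ p" for a b :: 'k
  by (rule freshmans_dream) (simp_all add: char_p prime_p)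

definition mp :: "'k poly poly" where
  "mp = monom 1 p - monom 1 1 - [:f:]"

lemma degree_mp: "degree mp = p" and lc_mp: "coeff mp p = 1" and mp_neq_0: "mp \<noteq> 0"
proof -
  have "degree (- monom 1 1 - [:f:] :: 'k poly poly) < degree (monom 1 p :: 'k poly poly)"
    using p_ge_2 by (intro le_less_trans[OF degree_diff_le_max]) (auto simp: degree_monom_eq)
  hence "degree (monom 1 p + (- monom 1 1 - [:f:]) :: 'k poly poly) = p"
    by (subst degree_add_eq_left) (simp_all add: degree_monom_eq)
  thus "degree mp = p" by (simp add: mp_def algebra_simps)
  show "coeff mp p = 1"
    using p_ge_2 by (auto simp: mp_def coeff_pCons split: nat.splits)
  thus "mp \<noteq> 0" by auto
qed

text \<open>A generic point in the sense of Weil: a solution of the equation whose x-coordinate is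
  transcendental over the constants. The function field and all Laurent expansions arise from such
  points.\<close>

definition generic :: "('k \<Rightarrow> 'l::field) \<Rightarrow> 'l \<Rightarrow> 'l \<Rightarrow> bool" where
  "generic h x y \<longleftrightarrow> rhom h \<and> y ^ p - y = pev h x f \<and> (\<forall>g. pev h x g = 0 \<longrightarrow> g = 0)"

lemma generic_rhom: "generic h x y \<Longrightarrow> rhom h"
  by (simp add: generic_def)

lemma ev_mp: "rhom h \<Longrightarrow> y ^ p - y = pev h x f \<Longrightarrow> ev h x y mp = 0"
  by (simp add: mp_def rhom_diff[OF rhom_ev] ev_monom ev_const rhom_1[OF rhom_pev])

text \<open>Modulo \<open>p\<close> the weight determines \<open>d * j\<close>, hence
  \<open>j\<close>, because \<open>d\<close> is invertible modulo \<open>p\<close>.\<close>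

lemma wt_inj:
  assumes "p * a + d * i = p * b + d * j" "i < p" "j < p"
  shows "i = j"
proof -
  have "[p * a + d * i = d * i] (mod p)" "[p * b + d * j = d * j] (mod p)"
    by (simp_all add: cong_def)
  hence "[d * i = d * j] (mod p)" using assms(1) by (metis cong_sym cong_trans)
  hence "[i = j] (mod p)" using coprime_pd by (simp add: cong_mult_lcancel_nat coprime_commute)
  thus ?thesis using assms by (simp add: cong_less_modulus_unique_nat)
qed

text \<open>The pole order of the \<open>j\<close>-th term at the point at infinity, where x and y
  have poles of order \<open>p\<close> and \<open>d\<close>.\<close>

definition wt :: "'k poly poly \<Rightarrow> nat \<Rightarrow> nat" where
  "wt g j = p * degree (coeff g j) + d * j"

definition dominant :: "'k poly poly \<Rightarrow> nat \<Rightarrow> bool" where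
  "dominant g j \<longleftrightarrow> coeff g j \<noteq> 0 \<and> (\<forall>i. coeff g i \<noteq> 0 \<longrightarrow> i \<noteq> j \<longrightarrow> wt g i < wt g j)"

text \<open>By \<open>wt_inj\<close> distinct exponents below \<open>p\<close> carry distinct
  weights, so the maximum is attained only once.\<close>

lemma ex_dominant:
  assumes "g \<noteq> 0" "degree g < p"
  shows "\<exists>j. dominant g j"
proof -
  let ?A = "{j. coeff g j \<noteq> 0}"
  have fin: "finite ?A" by (rule finite_subset[of _ "{..degree g}"]) (auto simp: le_degree)
  moreover have "?A \<noteq> {}" using assms(1) by (auto simp: poly_eq_iff)
  ultimately have "Max (wt g ` ?A) \<in> wt g ` ?A" by (intro Max_in) auto
  then obtain j where j: "j \<in> ?A" "wt g j = Max (wt g ` ?A)" by auto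
  have "wt g i < wt g j" if "coeff g i \<noteq> 0" "i \<noteq> j" for i
  proof -
    have "wt g i \<le> wt g j" using that fin j by auto
    moreover have "wt g i \<noteq> wt g j"
      using wt_inj[of "degree (coeff g i)" i "degree (coeff g j)" j] that j assms(2)
        le_degree[of g i] le_degree[of g j] by (auto simp: wt_def)
    ultimately show ?thesis by simp
  qed
  thus ?thesis using j by (auto simp: dominant_def)
qed

lemma ev_inf:
  fixes x y :: "'k fls"
  assumes x: "fls_subdegree x = - int p" and y: "fls_subdegree y = - int d" and j: "dominant g j"
  shows "ev fls_const x y g \<noteq> 0" "fls_subdegree (ev fls_const x y g) = - int (wt g j)"
proof -
  have p0: "p > 0" "d > 0" using p_ge_2 d_ge_2 by auto
  have y0: "y \<noteq> 0" using y p0 by auto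
  define u where "u = (\<lambda>i. pev fls_const x (coeff g i) * y ^ i)"
  have u: "u i \<noteq> 0" "fls_subdegree (u i) = - int (wt g i)" if "coeff g i \<noteq> 0" for i
    using fls_subdegree_pev_neg[OF x p0(1) that] y0 y
    by (simp_all add: u_def wt_def fls_subdegree_pow algebra_simps)
  have nz: "coeff g i \<noteq> 0" if "u i \<noteq> 0" for i
    using that by (auto simp: u_def pev_0[OF rhom_fls_const])
  have ev: "ev fls_const x y g = sum u {..degree g}"
    by (simp add: ev_altdef[OF rhom_fls_const] u_def)
  have jg: "coeff g j \<noteq> 0" using j by (simp add: dominant_def)
  have "fls_subdegree (u j) < fls_subdegree (u i)" if "i \<noteq> j" "u i \<noteq> 0" for i
    using u[OF nz[OF that(2)]] u[OF jg] that nz[OF that(2)] j by (simp add: dominant_def)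
  hence "sum u {..degree g} \<noteq> 0 \<and> fls_subdegree (sum u {..degree g}) = fls_subdegree (u j)"
    using fls_sum_dominant[of "{..degree g}" j u] u[OF jg] jg le_degree[of g j] by auto
  thus "ev fls_const x y g \<noteq> 0" "fls_subdegree (ev fls_const x y g) = - int (wt g j)"
    using u[OF jg] by (simp_all add: ev)
qed

lemma of_nat_d_neq_0: "(of_nat d :: 'k) \<noteq> 0"
proof -
  have "\<not> p dvd d"
    using coprime_pd prime_p by (metis coprime_common_divisor_nat dvd_refl not_prime_1)
  thus ?thesis using char_p by (simp add: of_nat_eq_0_iff_char_dvd)
qed

text \<open>With T the series variable and s = 1/T, put x = s^p z and y = s^d. Multiplied by T^(pd)
  the equation becomes T^(pd) f(s^p z) = 1 - T^((p-1)d), whose left side is \<open>G\<close>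
  evaluated at z. At T = 0 it reads z^d = 1, and the root 1 is simple because \<open>p\<close> does
  not divide \<open>d\<close>.\<close>

lemma ex_inf_point:
  "\<exists>x y :: 'k fls. fls_subdegree x = - int p \<and> fls_subdegree y = - int d \<and> y ^ p - y = pev fls_const x f"
proof -
  let ?c = "\<lambda>s::'k fps. fps_nth s 0"
  define G where "G = (\<Sum>i\<le>d. monom (fps_const (coeff f i) * fps_X ^ (p * (d - i))) i :: 'k fps poly)"
  define F where "F = G - [:1 - fps_X ^ ((p - 1) * d):]"
  have pd: "(p - 1) * d > 0" "p > 0" using p_ge_2 d_ge_2 by auto
  have c: "?c (fps_const a * fps_X ^ (p * (d - i))) = (if i = d then a else 0)" if "i \<le> d" for i a
    using that p_ge_2 by (auto simp: fps_X_power_nth)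
  have lc: "coeff f d = 1" using lc_f deg_f by simp
  have "pev ?c 1 G = (\<Sum>i\<le>d. if i = d then coeff f i else 0)"
    unfolding G_def rhom_sum[OF rhom_pev[OF rhom_fps_nth_0]]
    using pd(2) by (intro sum.cong) (auto simp: pev_monom[OF rhom_fps_nth_0] c)
  hence "pev ?c 1 F = 0"
    using pd by (simp add: F_def rhom_diff[OF rhom_pev[OF rhom_fps_nth_0]] pev_const[OF rhom_fps_nth_0] lc fps_X_power_nth)
  moreover have "pev ?c 1 (pderiv F) \<noteq> 0"
  proof -
    have "pderiv F = (\<Sum>i\<le>d. monom (of_nat i * (fps_const (coeff f i) * fps_X ^ (p * (d - i)))) (i - 1))"
      by (simp add: F_def G_def pderiv_diff pderiv_sum pderiv_monom pderiv_pCons)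
    hence "pev ?c 1 (pderiv F) = (\<Sum>i\<le>d. of_nat i * (if i = d then coeff f i else 0))"
      unfolding \<open>pderiv F = _\<close> rhom_sum[OF rhom_pev[OF rhom_fps_nth_0]]
    proof (intro sum.cong refl)
      fix i assume "i \<in> {..d}"
      thus "pev ?c 1 (monom (of_nat i * (fps_const (coeff f i) * fps_X ^ (p * (d - i)))) (i - 1))
          = of_nat i * (if i = d then coeff f i else 0)"
        using c[of i "coeff f i"]
        unfolding pev_monom[OF rhom_fps_nth_0] rhom_mult[OF rhom_fps_nth_0, of "of_nat i"] rhom_of_nat[OF rhom_fps_nth_0]
        by simp
    qed
    also have "\<dots> = (\<Sum>i\<le>d. if i = d then of_nat d * coeff f d else 0)"
      by (intro sum.cong) auto
    also have "\<dots> = of_nat d" by (simp add: lc)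
    finally show ?thesis using of_nat_d_neq_0 by simp
  qed
  ultimately obtain z where z: "fps_nth z 0 = 1" "poly F z = 0"
    using fps_hensel by blast
  define s :: "'k fls" where "s = inverse fls_X"
  have sX: "s * fls_X = 1" and s0: "s \<noteq> 0" by (simp_all add: s_def)
  have "fls_subdegree (s * fls_X) = fls_subdegree s + 1"
    by (subst fls_subdegree_mult) (auto simp: s0)
  hence subs: "fls_subdegree s = -1" by (simp add: sX)
  define zz where "zz = fps_to_fls z"
  have zz: "fls_subdegree zz = 0" "zz \<noteq> 0"
  proof -
    have "subdegree z = 0" using z(1) by simp
    thus "fls_subdegree zz = 0" by (simp add: zz_def fls_subdegree_fls_to_fps)
    show "zz \<noteq> 0" using z(1) by (auto simp: zz_def)
  qed
  have Gz: "fps_to_fls (poly G z) = 1 - fls_X ^ ((p - 1) * d)"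
    using z(2) by (simp add: F_def rhom_simps[OF rhom_fps_to_fls] fps_to_fls_power)
  have "fps_to_fls (poly G z) = (\<Sum>i\<le>d. fls_const (coeff f i) * fls_X ^ (p * (d - i)) * zz ^ i)"
    by (simp add: G_def poly_sum poly_monom rhom_sum[OF rhom_fps_to_fls] rhom_mult[OF rhom_fps_to_fls]
        rhom_power[OF rhom_fps_to_fls] zz_def)
  hence sum: "(\<Sum>i\<le>d. fls_const (coeff f i) * fls_X ^ (p * (d - i)) * zz ^ i) = 1 - fls_X ^ ((p - 1) * d)"
    using Gz by simp
  have sXpow: "s ^ (m + n) * fls_X ^ n = s ^ m" for m n
    by (simp add: power_add mult.assoc flip: power_mult_distrib) (simp add: sX)
  have "pev fls_const (s ^ p * zz) f = (\<Sum>i\<le>d. fls_const (coeff f i) * (s ^ (p * i) * zz ^ i))"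
    by (simp add: pev_altdef[OF rhom_fls_const] deg_f power_mult_distrib flip: power_mult)
  also have "\<dots> = (\<Sum>i\<le>d. s ^ (p * d) * (fls_const (coeff f i) * fls_X ^ (p * (d - i)) * zz ^ i))"
  proof (intro sum.cong refl)
    fix i assume "i \<in> {..d}"
    hence "s ^ (p * d) = s ^ (p * i + p * (d - i))" by (simp flip: distrib_left)
    thus "fls_const (coeff f i) * (s ^ (p * i) * zz ^ i) = s ^ (p * d) * (fls_const (coeff f i) * fls_X ^ (p * (d - i)) * zz ^ i)"
      using sXpow[of "p * i" "p * (d - i)"] by (simp add: algebra_simps)
  qed
  also have "\<dots> = s ^ (p * d) * (1 - fls_X ^ ((p - 1) * d))"
    unfolding sum[symmetric] by (simp add: sum_distrib_left)
  also have "\<dots> = (s ^ d) ^ p - s ^ d"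
  proof -
    have "p * d = d + (p - 1) * d" using pd by (simp add: algebra_simps)
    hence "s ^ (p * d) * fls_X ^ ((p - 1) * d) = s ^ d" using sXpow[of d "(p - 1) * d"] by simp
    thus ?thesis by (simp add: algebra_simps flip: power_mult)
  qed
  finally have "(s ^ d) ^ p - s ^ d = pev fls_const (s ^ p * zz) f" by simp
  moreover have "fls_subdegree (s ^ p * zz) = - int p" "fls_subdegree (s ^ d) = - int d"
    using s0 zz by (simp_all add: fls_subdegree_pow subs)
  ultimately show ?thesis by blast
qed

text \<open>
  A relation of minimal degree in \<open>y\<close> would divide the equation of the curve up to a factor in
  \<open>k[x]\<close>, which is impossible because the orders at infinity of \<open>x\<^sup>i y\<^sup>j\<close>, \<open>j < p\<close>, are distinct.
\<close>
lemma generic_independent: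
  fixes x y :: "'l::field"
  assumes gen: "generic h x y" and "ev h x y g = 0" "degree g < p"
  shows "g = 0"
proof (rule ccontr)
  assume "g \<noteq> 0"
  note h = generic_rhom[OF gen]
  let ?P = "\<lambda>g. g \<noteq> 0 \<and> ev h x y g = 0 \<and> degree g < p"
  have "\<exists>g. ?P g \<and> (\<forall>g'. ?P g' \<longrightarrow> degree g \<le> degree g')"
    by (rule ex_has_least_nat[of ?P g]) (use assms \<open>g \<noteq> 0\<close> in auto)
  then obtain g where g: "?P g" and min: "\<And>g'. ?P g' \<Longrightarrow> degree g \<le> degree g'" by blast
  have deg: "degree g > 0"
  proof (rule ccontr)
    assume "\<not> degree g > 0"
    then obtain c where "g = [:c:]" using degree_eq_zeroE by blast
    thus False using g gen by (auto simp: ev_const[OF h] generic_def)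
  qed
  obtain q r where qr: "pseudo_divmod mp g = (q, r)" by fastforce
  define c where "c = coeff g (degree g) ^ (Suc (degree mp) - degree g)"
  have eq: "smult c mp = g * q + r" and r: "r = 0 \<or> degree r < degree g"
    using pseudo_divmod[OF _ qr] g by (auto simp: c_def)
  have c0: "c \<noteq> 0" using g by (auto simp: c_def)
  have "ev h x y mp = 0" using gen by (intro ev_mp) (auto simp: generic_def)
  hence "ev h x y r = 0"
    using arg_cong[OF eq, of "ev h x y"] g by (simp add: ev_smult[OF h] rhom_simps[OF rhom_ev[OF h]])
  hence "r = 0" using r min[of r] g by force
  hence eq: "smult c mp = g * q" using eq by simp
  have q0: "q \<noteq> 0" using eq c0 mp_neq_0 by auto
  have "p = degree g + degree q"
    using arg_cong[OF eq, of degree] g q0 c0 by (simp add: degree_mp degree_mult_eq)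
  hence dq: "degree q < p" using deg by simp
  obtain u v :: "'k fls" where uv: "fls_subdegree u = - int p" "fls_subdegree v = - int d" "v ^ p - v = pev fls_const u f"
    using ex_inf_point by blast
  obtain i j where "dominant g i" "dominant q j"
    using ex_dominant[of g] ex_dominant[of q] g q0 dq by blast
  hence "ev fls_const u v (g * q) \<noteq> 0"
    using ev_inf(1)[OF uv(1,2)] by (simp add: rhom_mult[OF rhom_ev[OF rhom_fls_const]])
  moreover have "ev fls_const u v (smult c mp) = 0"
    using ev_mp[OF rhom_fls_const uv(3)] by (simp add: ev_smult[OF rhom_fls_const])
  ultimately show False using eq by simp
qed

text \<open>Division by \<open>mp\<close> stays within the subring because \<open>mp\<close> is
  monic in y.\<close>

lemma reduce_degree:
  assumes "subrng S" "f \<in> poly_over S" "g \<in> poly_over (poly_over S)"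
  shows "\<exists>r q. r \<in> poly_over (poly_over S) \<and> degree r < p \<and> g = mp * q + r"
  using assms(3)
proof (induction "degree g" arbitrary: g rule: less_induct)
  case less
  note S1 = subrng_poly_over[OF assms(1)]
  note S2 = subrng_poly_over[OF S1]
  show ?case
  proof (cases "degree g < p")
    case True
    thus ?thesis using less by (intro exI[of _ g] exI[of _ 0]) auto
  next
    case False
    define n where "n = degree g"
    define t where "t = monom (coeff g n) (n - p)"
    have n: "n \<ge> p" "n > 0" using False p_ge_2 by (auto simp: n_def)
    have mpS: "mp \<in> poly_over (poly_over S)"
      unfolding mp_def by (intro subrng_diff[OF S2] monom_poly_over[OF S1] subrng_1[OF S1] const_poly_over[OF S1] assms)
    have tS: "t \<in> poly_over (poly_over S)"
      unfolding t_def using less.prems by (intro monom_poly_over[OF S1]) (auto simp: poly_over_def)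
    have gS: "g - mp * t \<in> poly_over (poly_over S)"
      using less.prems by (intro subrng_diff[OF S2] subrng_mult[OF S2] mpS tS)
    have "degree (g - mp * t) \<le> n"
    proof (rule degree_diff_le)
      show "degree (mp * t) \<le> n"
        using degree_mult_le[of mp t] degree_monom_le[of "coeff g n" "n - p"] n by (simp add: t_def degree_mp)
    qed (simp add: n_def)
    moreover have "coeff (g - mp * t) n = 0"
    proof -
      have "coeff (mp * t) n = coeff mp p * coeff g n"
        using n coeff_mult_degree_sum[of mp "monom 1 (n-p)"]
        by (simp add: t_def mult.commute[of mp] coeff_monom_mult)
      thus ?thesis by (simp add: lc_mp)
    qed
    ultimately have "degree (g - mp * t) < n \<or> g - mp * t = 0"
      by (metis le_neq_implies_less leading_coeff_0_iff)
    hence lt: "degree (g - mp * t) < degree g"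
      using n by (auto simp: n_def)
    from less.hyps[OF lt gS] obtain r q where
      "r \<in> poly_over (poly_over S)" "degree r < p" "g - mp * t = mp * q + r" by blast
    thus ?thesis by (intro exI[of _ r] exI[of _ "q + t"]) (auto simp: algebra_simps)
  qed
qed

text \<open>The relations between x and y do not depend on the generic point, which is what makes
  the embeddings \<open>Phi\<close> of the function field well defined.\<close>

lemma generic_eq_0_iff:
  assumes "generic h x y"
  shows "ev h x y g = 0 \<longleftrightarrow> mp dvd g"
proof -
  obtain r q where rq: "degree r < p" "g = mp * q + r"
    using reduce_degree[of UNIV g] by (auto simp: poly_over_UNIV subrng_def)
  have "ev h x y mp = 0" using assms by (intro ev_mp) (auto simp: generic_def)
  hence ev: "ev h x y (mp * q) = 0" for q
    by (simp add: rhom_simps[OF rhom_ev[OF generic_rhom[OF assms]]])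
  hence "ev h x y g = ev h x y r"
    by (simp add: rq rhom_simps[OF rhom_ev[OF generic_rhom[OF assms]]] del: rhom_mult)
  thus ?thesis using generic_independent[OF assms, of r] rq ev
    by (auto elim!: dvdE)
qed

end

section \<open>Subfields and abstract valuation rings\<close>

definition subfld :: "'a::field set \<Rightarrow> bool" where
  "subfld k \<longleftrightarrow> subrng k \<and> (\<forall>a\<in>k. inverse a \<in> k)"

lemma subfld_subrng: "subfld k \<Longrightarrow> subrng k"
  and subfld_inverse: "subfld k \<Longrightarrow> a \<in> k \<Longrightarrow> inverse a \<in> k"
  by (simp_all add: subfld_def)

lemma subfld_divide: "subfld k \<Longrightarrow> a \<in> k \<Longrightarrow> b \<in> k \<Longrightarrow> a / b \<in> k"
  unfolding divide_inverse by (intro subrng_mult subfld_subrng subfld_inverse)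

lemma subfld_UNIV: "subfld UNIV"
  by (simp add: subfld_def subrng_def)

lemma subfld_powi: "subfld k \<Longrightarrow> a \<in> k \<Longrightarrow> a powi n \<in> k"
  unfolding power_int_def by (auto intro: subrng_power subfld_subrng subfld_inverse)

lemma subfld_field_gen: "subfld (field_gen S)"
  by (auto simp: subfld_def subrng_def intro: field_gen.intros)

lemma field_gen_minimal: "subfld F \<Longrightarrow> S \<subseteq> F \<Longrightarrow> field_gen S \<subseteq> F"
proof
  fix z assume F: "subfld F" "S \<subseteq> F" and "z \<in> field_gen S"
  from this(3) show "z \<in> F"
    by induction (use F in \<open>auto intro: subfld_subrng subfld_inverse subrng_1 subrng_diff subrng_mult\<close>)
qed

locale valuation_ring =
  fixes K R :: "'b::field set"
  assumes K: "subfld K" and R: "subrng R" and R_sub_K: "R \<subseteq> K"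
    and R_or_inverse: "z \<in> K \<Longrightarrow> z \<in> R \<or> inverse z \<in> R"
begin

lemma max_ideal_sub: "max_ideal R \<subseteq> R"
  by (auto simp: max_ideal_def)

lemma zero_max: "0 \<in> max_ideal R"
  by (simp add: max_ideal_def subrng_0[OF R])

lemma one_not_max: "1 \<notin> max_ideal R"
  by (simp add: max_ideal_def subrng_1[OF R])

lemma unit_inverse: "z \<in> R \<Longrightarrow> z \<notin> max_ideal R \<Longrightarrow> inverse z \<in> R"
  by (auto simp: max_ideal_def)

lemma not_in_R: "z \<in> K \<Longrightarrow> z \<notin> R \<Longrightarrow> inverse z \<in> max_ideal R"
  using R_or_inverse[of z] by (auto simp: max_ideal_def)

lemma max_mult: "a \<in> R \<Longrightarrow> b \<in> max_ideal R \<Longrightarrow> a * b \<in> max_ideal R"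
proof -
  assume a: "a \<in> R" and b: "b \<in> max_ideal R"
  show ?thesis
  proof (cases "a * b = 0")
    case False
    have "inverse (a * b) \<notin> R"
    proof
      assume "inverse (a * b) \<in> R"
      hence "a * inverse (a * b) \<in> R" by (intro subrng_mult[OF R] a)
      also have "a * inverse (a * b) = inverse b" using False by (simp add: field_simps)
      finally show False using b False by (auto simp: max_ideal_def)
    qed
    thus ?thesis using a b by (auto simp: max_ideal_def intro: subrng_mult[OF R])
  qed (use zero_max in auto)
qed

lemma max_add_aux:
  assumes "a \<in> max_ideal R" "b \<in> max_ideal R" "b \<noteq> 0" "a / b \<in> R"
  shows "a + b \<in> max_ideal R"
proof -
  have "(a / b + 1) * b \<in> max_ideal R"
    using assms by (intro max_mult subrng_add[OF R] subrng_1[OF R])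
  also have "(a / b + 1) * b = a + b" using assms(3) by (simp add: distrib_right)
  finally show ?thesis .
qed

text \<open>One of \<open>a / b\<close> and \<open>b / a\<close> lies in \<open>R\<close>, so one of
  the two elements can be factored out of the sum.\<close>

lemma max_add:
  assumes "a \<in> max_ideal R" "b \<in> max_ideal R"
  shows "a + b \<in> max_ideal R"
proof (cases "a = 0 \<or> b = 0")
  case False
  have "a / b \<in> K" using assms max_ideal_sub R_sub_K by (intro subfld_divide[OF K]) auto
  hence "a / b \<in> R \<or> b / a \<in> R" using R_or_inverse[of "a / b"] by (simp add: field_simps)
  thus ?thesis using max_add_aux[of a b] max_add_aux[of b a] assms False by (auto simp: add.commute)
qed (use assms in auto)

lemma max_uminus: "a \<in> max_ideal R \<Longrightarrow> - a \<in> max_ideal R"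
  using max_mult[of "-1" a] by (simp add: subrng_uminus[OF R] subrng_1[OF R])

lemma max_diff: "a \<in> max_ideal R \<Longrightarrow> b \<in> max_ideal R \<Longrightarrow> a - b \<in> max_ideal R"
  using max_add[of a "- b"] max_uminus[of b] by simp

lemma max_sum: "(\<And>i. i \<in> A \<Longrightarrow> u i \<in> max_ideal R) \<Longrightarrow> sum u A \<in> max_ideal R"
  by (induction A rule: infinite_finite_induct) (auto intro: zero_max max_add)

text \<open>Otherwise \<open>inverse z\<close> would lie in \<open>R\<close>, and multiplying
  \<open>z ^ n\<close> by its \<open>n\<close>-th power would put 1 into the maximal ideal.\<close>

lemma max_power_cancel: "z \<in> K \<Longrightarrow> z ^ n \<in> max_ideal R \<Longrightarrow> z \<in> max_ideal R"
proof (rule ccontr)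
  assume z: "z \<in> K" "z ^ n \<in> max_ideal R" "z \<notin> max_ideal R"
  hence z0: "z \<noteq> 0" using zero_max by auto
  have "inverse z \<in> R" using z not_in_R unit_inverse max_ideal_sub by blast
  hence "inverse z ^ n * z ^ n \<in> max_ideal R" using z(2) by (intro max_mult subrng_power[OF R])
  thus False using z0 one_not_max by (simp add: field_simps flip: power_mult_distrib)
qed

lemma prime_max: "a \<in> R \<Longrightarrow> b \<in> R \<Longrightarrow> a * b \<in> max_ideal R \<Longrightarrow> a \<in> max_ideal R \<or> b \<in> max_ideal R"
proof (rule ccontr)
  assume ab: "a \<in> R" "b \<in> R" "a * b \<in> max_ideal R" and n: "\<not> (a \<in> max_ideal R \<or> b \<in> max_ideal R)"
  have nz: "a \<noteq> 0" "b \<noteq> 0" using zero_max n by auto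
  have i: "inverse a \<in> R" "inverse b \<in> R" using unit_inverse ab n by auto
  have "(inverse a * inverse b) * (a * b) \<in> max_ideal R"
    by (rule max_mult[OF subrng_mult[OF R i] ab(3)])
  also have "(inverse a * inverse b) * (a * b) = 1" using nz by (simp add: field_simps)
  finally show False using one_not_max by simp
qed

text \<open>The elements congruent to 1 form a multiplicative group. At infinity they measure the
  deviation of a function from its leading monomial.\<close>

lemma one_unit: "z - 1 \<in> max_ideal R \<Longrightarrow> z \<in> R \<and> z \<noteq> 0 \<and> inverse z \<in> R \<and> inverse z - 1 \<in> max_ideal R"
proof -
  assume z: "z - 1 \<in> max_ideal R"
  have "(z - 1) + 1 \<in> R" using z max_ideal_sub by (intro subrng_add[OF R] subrng_1[OF R]) auto
  hence zR: "z \<in> R" by simp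
  have nM: "z \<notin> max_ideal R" using z one_not_max max_diff[of z "z - 1"] by auto
  hence z0: "z \<noteq> 0" using zero_max by auto
  have i: "inverse z \<in> R" by (rule unit_inverse[OF zR nM])
  have "- inverse z * (z - 1) \<in> max_ideal R" by (intro max_mult z subrng_uminus[OF R] i)
  also have "- inverse z * (z - 1) = inverse z - 1" using z0 by (simp add: field_simps)
  finally show ?thesis using zR z0 i by simp
qed

lemma one_unit_mult: "z - 1 \<in> max_ideal R \<Longrightarrow> w - 1 \<in> max_ideal R \<Longrightarrow> z * w - 1 \<in> max_ideal R"
proof -
  assume a: "z - 1 \<in> max_ideal R" "w - 1 \<in> max_ideal R"
  have "w * (z - 1) + (w - 1) \<in> max_ideal R"
    using a one_unit[of w] by (intro max_add max_mult) auto
  thus ?thesis by (simp add: algebra_simps)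
qed

lemma one_unit_power: "z - 1 \<in> max_ideal R \<Longrightarrow> z ^ n - 1 \<in> max_ideal R"
  by (induction n) (auto intro: zero_max one_unit_mult)

lemma one_unit_powi: "z - 1 \<in> max_ideal R \<Longrightarrow> z powi n - 1 \<in> max_ideal R"
  using one_unit[of z] by (auto simp: power_int_def intro: one_unit_power)

end

section \<open>The function field and its embeddings\<close>

context as_curve
begin

abbreviation yy :: "'k ratfun_closure" where "yy \<equiv> yvar p f"
abbreviation E :: "'k poly poly \<Rightarrow> 'k ratfun_closure" where "E \<equiv> ev cst xvar yy"
abbreviation KK :: "'k set \<Rightarrow> 'k ratfun_closure set" where "KK k \<equiv> as_function_field k p f"

lemma yvar_eq: "yy ^ p - yy = pev cst xvar f"
proof -
  define c where "c = poly (map_poly cst f) xvar"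
  define Q where "Q = monom 1 p + (- monom 1 1 - [:c:])"
  have "degree (- monom 1 1 - [:c:]) < degree (monom 1 p :: 'k ratfun_closure poly)"
    using p_ge_2 by (intro le_less_trans[OF degree_diff_le_max]) (auto simp: degree_monom_eq)
  hence "degree Q = p"
    unfolding Q_def by (subst degree_add_eq_left) (simp_all add: degree_monom_eq)
  hence "\<exists>y. poly Q y = 0" using p_ge_2 by (intro alg_closed_imp_poly_has_root) simp
  then obtain y where "poly Q y = 0" by blast
  hence "y ^ p - y = c" by (simp add: Q_def poly_monom algebra_simps)
  hence "\<exists>y. y ^ p - y = poly (map_poly cst f) xvar" unfolding c_def by blast
  hence "yvar p f ^ p - yvar p f = poly (map_poly cst f) xvar"
    unfolding yvar_def by (rule someI_ex)
  thus ?thesis by (simp add: pev_def)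
qed

lemma generic_E: "generic cst xvar yy"
  unfolding generic_def by (auto simp: rhom_cst yvar_eq pev_cst_xvar)

lemma rhom_E: "rhom E"
  by (rule rhom_ev[OF rhom_cst])

lemmas E_simps = rhom_simps[OF rhom_E]

abbreviation kp :: "'k set \<Rightarrow> 'k poly poly set" where "kp k \<equiv> poly_over (poly_over k)"

definition px :: "'k poly poly" where "px = [:[:0, 1:]:]"
definition py :: "'k poly poly" where "py = [:0, 1:]"
definition pc :: "'k \<Rightarrow> 'k poly poly" where "pc c = [:[:c:]:]"

lemma ev_px: "rhom h \<Longrightarrow> ev h x y px = x"
  by (simp add: px_def ev_const pev_pCons rhom_0 rhom_1)

lemma ev_py: "rhom h \<Longrightarrow> ev h x y py = y"
  by (simp add: py_def ev_pCons pev_0 rhom_1[OF rhom_pev] rhom_0[OF rhom_ev])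

lemma ev_pc: "rhom h \<Longrightarrow> ev h x y (pc c) = h c"
  by (simp add: pc_def ev_const pev_const)

lemmas E_px = ev_px[OF rhom_cst] and E_py = ev_py[OF rhom_cst] and E_pc = ev_pc[OF rhom_cst]

lemma kp_subrng: "subfld k \<Longrightarrow> subrng (kp k)"
  by (intro subrng_poly_over subfld_subrng)

lemma kp_px: "subfld k \<Longrightarrow> px \<in> kp k"
  and kp_py: "subfld k \<Longrightarrow> py \<in> kp k"
  and kp_pc: "subfld k \<Longrightarrow> c \<in> k \<Longrightarrow> pc c \<in> kp k"
  unfolding px_def py_def pc_def
  by (auto simp: pCons_poly_over subrng_0 subrng_1 subfld_subrng subrng_poly_over const_poly_over one_pCons
       simp flip: one_pCons intro!: const_poly_over subrng_1 subrng_0)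

lemma kp_const: "subfld k \<Longrightarrow> q \<in> poly_over k \<Longrightarrow> [:q:] \<in> kp k"
  by (intro const_poly_over subrng_poly_over subfld_subrng)

lemma KK_gen: "cst ` k \<subseteq> KK k" "xvar \<in> KK k" "yy \<in> KK k"
  unfolding as_function_field_def by (auto intro: field_gen.base)

lemma KK_subfld: "subfld (KK k)"
  unfolding as_function_field_def by (rule subfld_field_gen)

lemmas KK_ops = subrng_1[OF subfld_subrng[OF KK_subfld]] subrng_0[OF subfld_subrng[OF KK_subfld]]
  subrng_diff[OF subfld_subrng[OF KK_subfld]] subrng_add[OF subfld_subrng[OF KK_subfld]]
  subrng_mult[OF subfld_subrng[OF KK_subfld]] subrng_uminus[OF subfld_subrng[OF KK_subfld]]
  subrng_power[OF subfld_subrng[OF KK_subfld]] subfld_inverse[OF KK_subfld] subfld_divide[OF KK_subfld]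
  subrng_sum[OF subfld_subrng[OF KK_subfld]] subrng_prod[OF subfld_subrng[OF KK_subfld]]
  subfld_powi[OF KK_subfld]

lemma E_in_KK: "g \<in> kp k \<Longrightarrow> E g \<in> KK k"
proof -
  assume g: "g \<in> kp k"
  have "pev cst xvar q \<in> KK k" if "q \<in> poly_over k" for q
    using that KK_gen by (auto simp: pev_altdef[OF rhom_cst] poly_over_def intro!: KK_ops)
  thus ?thesis using g KK_gen by (auto simp: ev_altdef[OF rhom_cst] poly_over_def[of "poly_over k"] intro!: KK_ops)
qed

text \<open>The fractions of polynomials over \<open>k\<close> already form a field that contains
  the generators.\<close>

lemma KK_eq:
  assumes k: "subfld k"
  shows "KK k = {E g / E h | g h. g \<in> kp k \<and> h \<in> kp k \<and> E h \<noteq> 0}" (is "_ = ?F")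
proof
  note S = kp_subrng[OF k]
  have "subfld ?F"
    unfolding subfld_def subrng_def
  proof (intro conjI ballI)
    show "1 \<in> ?F" using subrng_1[OF S] by (auto intro!: exI[of _ 1] simp: E_simps)
  next
    fix a b assume "a \<in> ?F" "b \<in> ?F"
    then obtain g h g' h' where a: "a = E g / E h" "g \<in> kp k" "h \<in> kp k" "E h \<noteq> 0"
      and b: "b = E g' / E h'" "g' \<in> kp k" "h' \<in> kp k" "E h' \<noteq> 0" by blast
    have "a - b = E (g * h' - g' * h) / E (h * h')"
      unfolding a(1) b(1) using a(4) b(4) by (simp add: E_simps diff_frac_eq)
    thus "a - b \<in> ?F" using a b
      by (intro CollectI exI[of _ "g * h' - g' * h"] exI[of _ "h * h'"] conjI subrng_diff[OF S] subrng_mult[OF S])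
         (auto simp: E_simps)
    have "a * b = E (g * g') / E (h * h')" using a b by (simp add: E_simps)
    thus "a * b \<in> ?F" using a b
      by (intro CollectI exI[of _ "g * g'"] exI[of _ "h * h'"] conjI subrng_mult[OF S]) (auto simp: E_simps)
  next
    fix a assume "a \<in> ?F"
    then obtain g h where a: "a = E g / E h" "g \<in> kp k" "h \<in> kp k" "E h \<noteq> 0" by blast
    show "inverse a \<in> ?F"
    proof (cases "E g = 0")
      case True
      hence "inverse a = E 0 / E h" using a(1) by (simp add: E_simps)
      thus ?thesis using a subrng_0[OF S] by blast
    next
      case False
      moreover have "inverse a = E h / E g" using a(1) by simp
      ultimately show ?thesis using a by blast
    qed
  qed
  moreover have "E g \<in> ?F" if "g \<in> kp k" for g
  proof -
    have "E g = E g / E 1" "E 1 \<noteq> 0" by (simp_all add: E_simps)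
    thus ?thesis using that subrng_1[OF S] by blast
  qed
  hence "cst ` k \<union> {xvar, yy} \<subseteq> ?F"
    using kp_px[OF k] kp_py[OF k] kp_pc[OF k] by (metis (no_types, lifting) E_pc E_px E_py Un_insert_right image_subset_iff insert_subset sup_bot.right_neutral)
  ultimately show "KK k \<subseteq> ?F" unfolding as_function_field_def by (rule field_gen_minimal)
  show "?F \<subseteq> KK k" using E_in_KK by (auto intro!: KK_ops)
qed

lemma KK_cases:
  assumes "subfld k" "z \<in> KK k"
  obtains g h where "g \<in> kp k" "h \<in> kp k" "E h \<noteq> 0" "z = E g / E h"
  using assms KK_eq by blast

lemma KK_mono: "k \<subseteq> k' \<Longrightarrow> KK k \<subseteq> KK k'"
  unfolding as_function_field_def
  by (intro field_gen_minimal subfld_field_gen) (auto intro: field_gen.base)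

lemma KU_cases:
  assumes "z \<in> KK UNIV"
  obtains g h where "E h \<noteq> 0" "z = E g / E h"
  using KK_cases[OF subfld_UNIV assms] by blast

text \<open>The embedding of the function field given by a generic point: a function is written as a
  fraction of polynomials in x and y, and these are evaluated at the point. The choice of the
  fraction is immaterial by \<open>Phi_frac\<close>.\<close>

definition Phi :: "('k \<Rightarrow> 'l::field) \<Rightarrow> 'l \<Rightarrow> 'l \<Rightarrow> 'k ratfun_closure \<Rightarrow> 'l" where
  "Phi h x y z = (SOME w. \<exists>g q. E q \<noteq> 0 \<and> z = E g / E q \<and> w = ev h x y g / ev h x y q)"

context
  fixes h :: "'k \<Rightarrow> 'l::field" and x y
  assumes gen: "generic h x y"
begin

lemma ev_0_iff: "ev h x y g = 0 \<longleftrightarrow> E g = 0"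
  by (simp add: generic_eq_0_iff[OF gen] generic_eq_0_iff[OF generic_E])

lemma Phi_frac:
  assumes "E q \<noteq> 0"
  shows "Phi h x y (E g / E q) = ev h x y g / ev h x y q"
proof -
  note [simp] = rhom_simps[OF rhom_ev[OF generic_rhom[OF gen]]]
  have "\<exists>w g' q'. E q' \<noteq> 0 \<and> E g / E q = E g' / E q' \<and> w = ev h x y g' / ev h x y q'"
    using assms by blast
  from someI_ex[OF this] obtain g' q' where *: "E q' \<noteq> 0" "E g / E q = E g' / E q'"
    "Phi h x y (E g / E q) = ev h x y g' / ev h x y q'"
    unfolding Phi_def by blast
  have "E (g * q' - g' * q) = 0" using * assms by (simp add: E_simps field_simps)
  hence "ev h x y (g * q' - g' * q) = 0" by (simp only: ev_0_iff)
  hence "ev h x y g * ev h x y q' = ev h x y g' * ev h x y q" by simp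
  thus ?thesis unfolding *(3) using *(1) assms by (simp add: ev_0_iff[symmetric] frac_eq_eq)
qed

lemma Phi_E: "Phi h x y (E g) = ev h x y g"
  using Phi_frac[of 1 g] by (simp add: E_simps rhom_simps[OF rhom_ev[OF generic_rhom[OF gen]]])

lemma Phi_hom:
  assumes "z \<in> KK UNIV" "w \<in> KK UNIV"
  shows "Phi h x y (z + w) = Phi h x y z + Phi h x y w" "Phi h x y (z * w) = Phi h x y z * Phi h x y w"
    "Phi h x y (z - w) = Phi h x y z - Phi h x y w"
proof -
  note [simp] = rhom_simps[OF rhom_ev[OF generic_rhom[OF gen]]]
  obtain g q g' q' where z: "E q \<noteq> 0" "z = E g / E q" and w: "E q' \<noteq> 0" "w = E g' / E q'"
    using KU_cases[OF assms(1)] KU_cases[OF assms(2)] by metis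
  have nz: "ev h x y q \<noteq> 0" "ev h x y q' \<noteq> 0" using z w by (auto simp: ev_0_iff)
  have qq: "E (q * q') \<noteq> 0" using z w by (simp add: E_simps)
  have e: "z + w = E (g * q' + g' * q) / E (q * q')" "z * w = E (g * g') / E (q * q')"
    "z - w = E (g * q' - g' * q) / E (q * q')"
    unfolding z(2) w(2) using z(1) w(1) by (simp_all add: E_simps add_frac_eq diff_frac_eq)
  show "Phi h x y (z + w) = Phi h x y z + Phi h x y w" "Phi h x y (z * w) = Phi h x y z * Phi h x y w"
    "Phi h x y (z - w) = Phi h x y z - Phi h x y w"
    unfolding e Phi_frac[OF qq] unfolding z(2) w(2) Phi_frac[OF z(1)] Phi_frac[OF w(1)]
    using nz by (simp_all add: field_simps)
qed

lemma Phi_eq_0_iff: "z \<in> KK UNIV \<Longrightarrow> Phi h x y z = 0 \<longleftrightarrow> z = 0"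
proof (elim KU_cases)
  fix g q assume "E q \<noteq> 0" "z = E g / E q"
  thus ?thesis by (simp add: Phi_frac ev_0_iff)
qed

end

end

section \<open>Points, Laurent expansions and the orders they define\<close>

context as_curve
begin

text \<open>\<open>None\<close> stands for the point at infinity.\<close>

definition pts :: "'k set \<Rightarrow> ('k \<times> 'k) option set" where
  "pts k = insert None (Some ` {(c, b). c \<in> k \<and> b \<in> k \<and> b ^ p - b = poly f c})"

lemma pts_mono: "k \<subseteq> k' \<Longrightarrow> pts k \<subseteq> pts k'"
  by (auto simp: pts_def)

text \<open>At an affine point x - c is taken as the series variable; this is possible at all of
  them because the derivative of the equation with respect to y is -1. At infinity only the pole
  orders are fixed.\<close>

definition local_at :: "('k \<times> 'k) option \<Rightarrow> 'k fls \<Rightarrow> 'k fls \<Rightarrow> bool" where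
  "local_at P x y \<longleftrightarrow> y ^ p - y = pev fls_const x f \<and> (case P of
     None \<Rightarrow> fls_subdegree x = - int p \<and> fls_subdegree y = - int d
   | Some (c, b) \<Rightarrow> x = fps_to_fls (fps_const c + fps_X) \<and> (\<exists>s. y = fps_to_fls s \<and> fps_nth s 0 = b))"

lemma of_nat_p_0: "(of_nat p :: 'k) = 0"
  using of_nat_CHAR[where 'a='k] by (simp only: char_p)

lemma nth_0_pev_fps: "fps_nth (pev fps_const s q) 0 = poly q (fps_nth s 0)"
  using pev_comp[OF rhom_fps_const rhom_fps_nth_0, of s q] by (simp add: pev_id)

lemma ex_local:
  assumes "P \<in> pts UNIV"
  shows "\<exists>xy. local_at P (fst xy) (snd xy)"
proof (cases P)
  case None
  thus ?thesis using ex_inf_point by (auto simp: local_at_def)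
next
  case (Some cb)
  then obtain c b where P: "P = Some (c, b)" by (cases cb) auto
  have cb: "b ^ p - b = poly f c" using assms P by (auto simp: pts_def)
  define F where "F = monom 1 p - monom 1 1 - [:pev fps_const (fps_const c + fps_X) f:]"
  let ?c = "\<lambda>s::'k fps. fps_nth s 0"
  note [simp] = rhom_simps[OF rhom_pev[OF rhom_fps_nth_0]] pev_monom[OF rhom_fps_nth_0] pev_const[OF rhom_fps_nth_0]
  have "pev ?c b F = 0"
    using cb by (simp add: F_def nth_0_pev_fps)
  moreover have "pev ?c b (pderiv F) = -1"
  proof -
    have "pderiv F = monom (of_nat p) (p - 1) - 1"
      by (simp add: F_def pderiv_diff pderiv_monom pderiv_pCons)
    moreover have "?c (of_nat p) = 0"
      using rhom_of_nat[OF rhom_fps_nth_0, of p] of_nat_p_0 by simp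
    ultimately show ?thesis by simp
  qed
  ultimately obtain s where s: "fps_nth s 0 = b" "poly F s = 0"
    using fps_hensel[of b F] by auto
  have "s ^ p - s = pev fps_const (fps_const c + fps_X) f"
    using s(2) by (simp add: F_def poly_monom)
  from arg_cong[OF this, of fps_to_fls]
  have "fps_to_fls s ^ p - fps_to_fls s = pev fls_const (fps_to_fls (fps_const c + fps_X)) f"
    using pev_comp[OF rhom_fps_const rhom_fps_to_fls, of "fps_const c + fps_X" f]
    by (simp add: rhom_simps[OF rhom_fps_to_fls])
  thus ?thesis using s by (intro exI[of _ "(fps_to_fls (fps_const c + fps_X), fps_to_fls s)"])
    (auto simp: local_at_def P)
qed

definition loc :: "('k \<times> 'k) option \<Rightarrow> 'k fls \<times> 'k fls" where
  "loc P = (SOME xy. local_at P (fst xy) (snd xy))"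

lemma local_loc: "P \<in> pts UNIV \<Longrightarrow> local_at P (fst (loc P)) (snd (loc P))"
  unfolding loc_def by (rule someI_ex[OF ex_local])

text \<open>The power of x - c that is split off from \<open>g\<close> becomes a power of the series
  variable, and the remaining factor has a nonzero constant term.\<close>

lemma pev_local_nonzero:
  assumes "pev fls_const (fps_to_fls (fps_const c + fps_X)) g = 0"
  shows "g = (0 :: 'k poly)"
proof (rule ccontr)
  assume "g \<noteq> 0"
  then obtain q where q: "g = [:-c, 1:] ^ order c g * q" "\<not> [:-c, 1:] dvd q"
    using order_decomp by blast
  let ?x = "fps_const c + fps_X"
  have "fps_to_fls (pev fps_const ?x g) = 0"
    using assms pev_comp[OF rhom_fps_const rhom_fps_to_fls, of ?x g] by simp
  hence "pev fps_const ?x g = 0" by simp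
  moreover have "pev fps_const ?x g = fps_X ^ order c g * pev fps_const ?x q"
    by (subst q(1)) (simp add: rhom_simps[OF rhom_pev[OF rhom_fps_const]] pev_pCons[OF rhom_fps_const] pev_0[OF rhom_fps_const]
      flip: fps_const_neg)
  ultimately have "pev fps_const ?x q = 0" by simp
  hence "poly q c = 0" using nth_0_pev_fps[of ?x q] by simp
  thus False using q(2) by (simp add: poly_eq_0_iff_dvd)
qed

lemma generic_loc: "P \<in> pts UNIV \<Longrightarrow> generic fls_const (fst (loc P)) (snd (loc P))"
proof -
  assume "P \<in> pts UNIV"
  note * = local_loc[OF this]
  have "g = 0" if "pev fls_const (fst (loc P)) g = 0" for g :: "'k poly"
  proof (cases P)
    case None
    thus ?thesis using that * fls_subdegree_pev_neg[of "fst (loc P)" p g] p_ge_2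
      by (auto simp: local_at_def)
  next
    case (Some cb)
    thus ?thesis using that * pev_local_nonzero[of "fst cb" g]
      by (auto simp: local_at_def split: prod.splits)
  qed
  thus ?thesis using * by (auto simp: generic_def local_at_def rhom_fls_const)
qed

definition phi :: "('k \<times> 'k) option \<Rightarrow> 'k ratfun_closure \<Rightarrow> 'k fls" where
  "phi P = Phi fls_const (fst (loc P)) (snd (loc P))"

text \<open>The zero function gets the order 0, so statements about positive or bounded orders treat
  it separately.\<close>

definition ordv :: "('k \<times> 'k) option \<Rightarrow> 'k ratfun_closure \<Rightarrow> int" where
  "ordv P z = fls_subdegree (phi P z)"

abbreviation KU :: "'k ratfun_closure set" where "KU \<equiv> KK UNIV"

lemma KK_sub_KU: "z \<in> KK k \<Longrightarrow> z \<in> KU"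
  using KK_mono[of k UNIV] by auto

lemma cst_KU: "cst c \<in> KU"
  using KK_gen(1)[of UNIV] by auto

context
  fixes P assumes P: "P \<in> pts UNIV"
begin

lemma phi_0_iff: "z \<in> KU \<Longrightarrow> phi P z = 0 \<longleftrightarrow> z = 0"
  unfolding phi_def by (rule Phi_eq_0_iff[OF generic_loc[OF P]])

lemmas phi_hom = Phi_hom[OF generic_loc[OF P], folded phi_def]
lemmas phi_E = Phi_E[OF generic_loc[OF P], folded phi_def]

lemma phi_cst: "phi P (cst c) = fls_const c"
  using phi_E[of "pc c"] by (simp add: E_pc ev_pc[OF rhom_fls_const])

lemma phi_x: "phi P xvar = fst (loc P)"
  using phi_E[of px] by (simp add: E_px ev_px[OF rhom_fls_const])

lemma phi_y: "phi P yy = snd (loc P)"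
  using phi_E[of py] by (simp add: E_py ev_py[OF rhom_fls_const])

lemma ordv_mult: "z \<in> KU \<Longrightarrow> w \<in> KU \<Longrightarrow> z \<noteq> 0 \<Longrightarrow> w \<noteq> 0 \<Longrightarrow> ordv P (z * w) = ordv P z + ordv P w"
  by (simp add: ordv_def phi_hom phi_0_iff)

lemma ordv_0_cst: "ordv P 0 = 0" "ordv P 1 = 0" "ordv P (cst c) = 0"
  using phi_cst[of 0] phi_cst[of 1] by (simp_all add: ordv_def phi_cst rhom_simps[OF rhom_cst])

lemma ordv_inverse: "z \<in> KU \<Longrightarrow> ordv P (inverse z) = - ordv P z"
proof (cases "z = 0")
  case False
  assume "z \<in> KU"
  hence "ordv P (z * inverse z) = ordv P z + ordv P (inverse z)"
    using False by (intro ordv_mult KK_ops) auto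
  thus ?thesis using False by (simp add: ordv_0_cst)
qed (simp add: ordv_0_cst)

lemma ordv_power: "z \<in> KU \<Longrightarrow> z \<noteq> 0 \<Longrightarrow> ordv P (z ^ n) = int n * ordv P z"
  by (induction n) (simp_all add: ordv_0_cst ordv_mult KK_ops algebra_simps)

lemma ordv_powi: "z \<in> KU \<Longrightarrow> z \<noteq> 0 \<Longrightarrow> ordv P (z powi n) = n * ordv P z"
  by (simp add: power_int_def ordv_power ordv_inverse KK_ops)

lemma ordv_add: "z \<in> KU \<Longrightarrow> w \<in> KU \<Longrightarrow> z + w \<noteq> 0 \<Longrightarrow> n \<le> ordv P z \<Longrightarrow> n \<le> ordv P w \<Longrightarrow> n \<le> ordv P (z + w)"
  using fls_plus_subdegree[of "phi P z" "phi P w"] phi_0_iff[of "z + w"]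
  by (auto simp: ordv_def phi_hom KK_ops)

lemma ordv_add_ge0: "z \<in> KU \<Longrightarrow> w \<in> KU \<Longrightarrow> 0 \<le> ordv P z \<Longrightarrow> 0 \<le> ordv P w \<Longrightarrow> 0 \<le> ordv P (z + w)"
  using ordv_add[of z w 0] by (cases "z + w = 0") (auto simp: ordv_0_cst)

lemma ordv_mult_ge0: "z \<in> KU \<Longrightarrow> w \<in> KU \<Longrightarrow> 0 \<le> ordv P z \<Longrightarrow> 0 \<le> ordv P w \<Longrightarrow> 0 \<le> ordv P (z * w)"
  using ordv_mult[of z w] by (cases "z = 0 \<or> w = 0") (auto simp: ordv_0_cst)

lemma ordv_uminus: "z \<in> KU \<Longrightarrow> ordv P (- z) = ordv P z"
  using phi_hom(3)[of 0 z] phi_0_iff[of 0] by (simp add: ordv_def KK_ops)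

text \<open>The residue is the constant coefficient of the Laurent expansion; subtracting it leaves
  only positive powers.\<close>

lemma ordv_residue: "z \<in> KU \<Longrightarrow> 0 \<le> ordv P z \<Longrightarrow> z - cst (fls_nth (phi P z) 0) = 0 \<or> 0 < ordv P (z - cst (fls_nth (phi P z) 0))"
proof -
  assume z: "z \<in> KU" "0 \<le> ordv P z"
  define w where "w = z - cst (fls_nth (phi P z) 0)"
  have w: "phi P w = phi P z - fls_const (fls_nth (phi P z) 0)" "w \<in> KU"
    unfolding w_def using z by (auto simp: phi_hom phi_cst cst_KU intro!: KK_ops)
  have "0 < fls_subdegree (phi P w)" if "w \<noteq> 0"
  proof (rule fls_subdegree_greaterI)
    show "phi P w \<noteq> 0" using that phi_0_iff[OF w(2)] by simp
    show "fls_nth (phi P w) k = 0" if "k \<le> 0" for k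
      using that z by (auto simp: w ordv_def)
  qed
  thus ?thesis by (auto simp: w_def ordv_def)
qed

end

definition at2 :: "'k \<Rightarrow> 'k \<Rightarrow> 'k poly poly \<Rightarrow> 'k" where
  "at2 c b g = ev (\<lambda>a. a) c b g"

lemma rhom_at2: "rhom (at2 c b)"
  using rhom_ev[OF rhom_id, of c b] by (simp add: at2_def [abs_def])

lemmas at2_simps = rhom_simps[OF rhom_at2]

lemma at2_gens: "at2 c b px = c" "at2 c b py = b" "at2 c b (pc a) = a" "at2 c b [:q:] = poly q c"
  by (simp_all add: at2_def ev_px ev_py ev_pc ev_const rhom_id pev_id)

lemma phi_fin_E:
  assumes P: "Some (c, b) \<in> pts UNIV"
  shows "0 \<le> ordv (Some (c, b)) (E g)" "fls_nth (phi (Some (c, b)) (E g)) 0 = at2 c b g"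
proof -
  from local_loc[OF P] obtain s where s: "fst (loc (Some (c, b))) = fps_to_fls (fps_const c + fps_X)"
    "snd (loc (Some (c, b))) = fps_to_fls s" "fps_nth s 0 = b"
    by (auto simp: local_at_def)
  have "phi (Some (c, b)) (E g) = fps_to_fls (ev fps_const (fps_const c + fps_X) s g)"
    unfolding phi_E[OF P] s using ev_comp[OF rhom_fps_const rhom_fps_to_fls, of "fps_const c + fps_X" s g] by simp
  moreover have "fps_nth (ev fps_const (fps_const c + fps_X) s g) 0 = at2 c b g"
    using ev_comp[OF rhom_fps_const rhom_fps_nth_0, of "fps_const c + fps_X" s g] s(3) by (simp add: at2_def)
  ultimately show "0 \<le> ordv (Some (c, b)) (E g)" "fls_nth (phi (Some (c, b)) (E g)) 0 = at2 c b g"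
    by (simp_all add: ordv_def fls_subdegree_fls_to_fps_gt0)
qed

lemma ordv_E_eq_0:
  assumes "Some (c, b) \<in> pts UNIV" "at2 c b g \<noteq> 0"
  shows "E g \<noteq> 0" "ordv (Some (c, b)) (E g) = 0"
proof -
  have "fls_nth (phi (Some (c, b)) (E g)) 0 \<noteq> 0" using phi_fin_E(2)[OF assms(1)] assms(2) by simp
  hence "ordv (Some (c, b)) (E g) \<le> 0" unfolding ordv_def by (intro fls_subdegree_leI)
  thus "ordv (Some (c, b)) (E g) = 0" using phi_fin_E(1)[OF assms(1), of g] by simp
  show "E g \<noteq> 0"
    using phi_fin_E(2)[OF assms(1), of g] assms phi_E[OF assms(1), of 0] by (auto simp: E_simps rhom_0[OF rhom_ev[OF rhom_fls_const]])
qed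

lemma ordv_E_pos:
  assumes "Some (c, b) \<in> pts UNIV" "at2 c b g = 0" "E g \<noteq> 0"
  shows "0 < ordv (Some (c, b)) (E g)"
  using ordv_residue[OF assms(1), of "E g"] phi_fin_E[OF assms(1), of g] assms
  by (simp add: rhom_0[OF rhom_cst] E_in_KK poly_over_UNIV)

lemma E_KU: "E g \<in> KU"
  by (rule E_in_KK) (simp add: poly_over_UNIV)

lemma x_minus_c: "xvar - cst c = E (px - pc c)" "xvar - cst c \<noteq> 0"
proof -
  show *: "xvar - cst c = E (px - pc c)" by (simp add: E_simps E_px E_pc)
  have "pev cst xvar [:-c, 1:] \<noteq> 0" by (simp add: pev_cst_xvar)
  thus "xvar - cst c \<noteq> 0" by (simp add: pev_pCons[OF rhom_cst] pev_0[OF rhom_cst] rhom_simps[OF rhom_cst])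
qed

lemma ordv_x_minus_c: "Some (c, b) \<in> pts UNIV \<Longrightarrow> ordv (Some (c, b)) (xvar - cst c) = 1"
proof -
  assume P: "Some (c, b) \<in> pts UNIV"
  have "phi (Some (c, b)) (xvar - cst c) = fls_X"
    using local_loc[OF P] by (simp add: phi_hom[OF P] cst_KU KK_gen phi_x[OF P] phi_cst[OF P] local_at_def)
  thus ?thesis by (simp add: ordv_def)
qed

lemma rhom_frob_diff: "rhom (h :: 'k \<Rightarrow> 'l::field) \<Longrightarrow> (a - b :: 'l) ^ p = a ^ p - b ^ p"
proof -
  assume h: "rhom h"
  have "of_nat p = (0 :: 'l)" using rhom_of_nat[OF h, of p] of_nat_p_0 by (simp add: rhom_0[OF h])
  hence "CHAR('l) dvd p" by (simp add: of_nat_eq_0_iff_char_dvd)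
  hence "CHAR('l) = p" using prime_p CHAR_not_1'[where 'a='l] by (auto simp: prime_nat_iff)
  hence add: "(u + v :: 'l) ^ p = u ^ p + v ^ p" for u v
    by (intro freshmans_dream) (simp_all add: prime_p)
  show ?thesis using add[of "a - b" b] by (simp add: algebra_simps)
qed

text \<open>Division by y - b over k[x], then by x - c over k; the constant left over is the value
  at the point.\<close>

lemma kp_decomp:
  assumes k: "subfld k" and c: "c \<in> k" and b: "b \<in> k" and g: "g \<in> kp k"
  obtains g1 g2 where "g1 \<in> kp k" "g2 \<in> kp k" "g = (py - pc b) * g2 + (px - pc c) * g1 + pc (at2 c b g)"
proof -
  note S = subfld_subrng[OF k]
  obtain g2 where g2: "g2 \<in> kp k" "g = [:-[:b:], 1:] * g2 + [:poly g [:b:]:]"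
    using poly_split_root[OF subrng_poly_over[OF S] g, of "[:b:]"] const_poly_over[OF S b] by blast
  have q: "poly g [:b:] \<in> poly_over k"
    by (intro poly_poly_over[OF subrng_poly_over[OF S] g] const_poly_over[OF S b])
  obtain r where r: "r \<in> poly_over k" "poly g [:b:] = [:-c, 1:] * r + [:poly (poly g [:b:]) c:]"
    using poly_split_root[OF S q c] by blast
  have e1: "[:-[:b:], 1:] = py - pc b" and e2: "[:[:-c, 1:]:] = px - pc c"
    by (simp_all add: py_def pc_def px_def)
  have "[:poly g [:b:]:] = [:[:-c, 1:]:] * [:r:] + pc (poly (poly g [:b:]) c)"
    unfolding pc_def by (subst r(2)) simp
  hence eq: "g = (py - pc b) * g2 + (px - pc c) * [:r:] + pc (poly (poly g [:b:]) c)"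
    using g2(2) unfolding e1 e2 by (simp add: add.assoc)
  have "at2 c b ((py - pc b) * g2 + (px - pc c) * [:r:] + pc a) = a" for a
    by (simp only: at2_simps at2_gens) simp
  hence "at2 c b g = poly (poly g [:b:]) c" using eq by metis
  thus ?thesis using that[of "[:r:]" g2] g2 r eq kp_const[OF k] by simp
qed

text \<open>The cofactor of y - b in (y - b)^p - (y - b), which equals f(x) - f(c) when (c, b) is a
  point of the curve. It has the value -1 there, hence is a unit of the local ring, and so exhibits
  y - b as a multiple of x - c in that ring.\<close>

definition uu :: "'k \<Rightarrow> 'k poly poly" where "uu b = (py - pc b) ^ (p - 1) - 1"

lemma at2_uu: "at2 c b (uu b) = -1"
  using p_ge_2 by (simp add: uu_def at2_simps at2_gens)

text \<open>In \<open>kp_decomp\<close> the constant vanishes, and multiplying by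
  \<open>uu b\<close> turns the factor y - b into a multiple of x - c. Nothing is divided by, so the
  coefficients stay in \<open>k\<close>.\<close>

lemma fin_step:
  assumes k: "subfld k" and f: "f \<in> poly_over k" and P: "Some (c, b) \<in> pts k" and g: "g \<in> kp k"
    and at: "at2 c b g = 0"
  shows "\<exists>g'\<in>kp k. E (uu b) * E g = (xvar - cst c) * E g'"
proof -
  note S = subfld_subrng[OF k] and S2 = kp_subrng[OF k]
  have cb: "c \<in> k" "b \<in> k" "b ^ p - b = poly f c" using P by (auto simp: pts_def)
  obtain g1 g2 where g12: "g1 \<in> kp k" "g2 \<in> kp k" "g = (py - pc b) * g2 + (px - pc c) * g1 + pc (at2 c b g)"
    using kp_decomp[OF k cb(1,2) g] by blast
  obtain f1 where f1: "f1 \<in> poly_over k" "f = [:-c, 1:] * f1 + [:poly f c:]"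
    using poly_split_root[OF S f cb(1)] by blast
  have uk: "uu b \<in> kp k"
    unfolding uu_def by (intro subrng_diff[OF S2] subrng_power[OF S2] subrng_1[OF S2] kp_py[OF k] kp_pc[OF k] cb)
  have "E (uu b) * (yy - cst b) = (yy - cst b) ^ p - (yy - cst b)"
  proof -
    have "E (uu b) = (yy - cst b) ^ (p - 1) - 1" by (simp add: uu_def E_simps E_py E_pc)
    moreover have "(yy - cst b) ^ (p - 1) * (yy - cst b) = (yy - cst b) ^ p"
      using p_ge_2 by (intro power_minus_mult) simp
    ultimately show ?thesis by (simp only: left_diff_distrib) simp
  qed
  also have "\<dots> = (yy ^ p - yy) - (cst b ^ p - cst b)"
    by (simp add: rhom_frob_diff[OF rhom_cst])
  also have "\<dots> = pev cst xvar f - cst (poly f c)"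
    using cb(3) by (simp add: yvar_eq flip: rhom_power[OF rhom_cst] rhom_diff[OF rhom_cst])
  also have "\<dots> = (xvar - cst c) * E [:f1:]"
    by (subst f1(2)) (simp add: rhom_simps[OF rhom_pev[OF rhom_cst]] pev_pCons[OF rhom_cst] pev_0[OF rhom_cst]
      rhom_simps[OF rhom_cst] ev_const[OF rhom_cst] pev_smult[OF rhom_cst] left_diff_distrib)
  finally have *: "E (uu b) * (yy - cst b) = (xvar - cst c) * E [:f1:]" .
  have "E (uu b) * E g = (E (uu b) * (yy - cst b)) * E g2 + (xvar - cst c) * (E (uu b) * E g1)"
    by (subst g12(3)) (simp add: at E_simps E_px E_py E_pc rhom_0[OF rhom_cst] algebra_simps)
  also have "\<dots> = (xvar - cst c) * E ([:f1:] * g2 + uu b * g1)"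
    unfolding * by (simp only: E_simps) (simp add: algebra_simps)
  finally show ?thesis
    using f1 g12 uk kp_const[OF k] by (intro bexI[of _ "[:f1:] * g2 + uu b * g1"] subrng_add[OF S2] subrng_mult[OF S2])
qed

text \<open>Repeating \<open>fin_step\<close> extracts factors x - c; each lowers the order at the
  point by one, so this ends.\<close>

lemma fin_decomp:
  assumes k: "subfld k" and f: "f \<in> poly_over k" and P: "Some (c, b) \<in> pts k"
    and "g \<in> kp k" "E g \<noteq> 0"
  shows "\<exists>n a h. a \<in> kp k \<and> h \<in> kp k \<and> at2 c b a \<noteq> 0 \<and> at2 c b h \<noteq> 0 \<and> E g = (xvar - cst c) ^ n * E a / E h"
  using assms(4,5)
proof (induction "nat (ordv (Some (c, b)) (E g))" arbitrary: g rule: less_induct)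
  case less
  note S2 = kp_subrng[OF k]
  have PU: "Some (c, b) \<in> pts UNIV" using P pts_mono[of k UNIV] by auto
  have bk: "b \<in> k" using P by (auto simp: pts_def)
  show ?case
  proof (cases "at2 c b g = 0")
    case False
    thus ?thesis using less.prems subrng_1[OF S2]
      by (intro exI[of _ 0] exI[of _ g] exI[of _ 1]) (auto simp: at2_simps E_simps)
  next
    case True
    obtain g' where g': "g' \<in> kp k" "E (uu b) * E g = (xvar - cst c) * E g'"
      using fin_step[OF k f P less.prems(1) True] by blast
    have u: "E (uu b) \<noteq> 0" "ordv (Some (c, b)) (E (uu b)) = 0"
      using ordv_E_eq_0[OF PU, of "uu b"] at2_uu by auto
    hence "E g' \<noteq> 0" using g' less.prems by auto
    have "ordv (Some (c, b)) (E (uu b) * E g) = ordv (Some (c, b)) (E g)"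
      using u less.prems by (subst ordv_mult[OF PU]) (auto simp: E_KU)
    moreover have "ordv (Some (c, b)) ((xvar - cst c) * E g') = 1 + ordv (Some (c, b)) (E g')"
      using \<open>E g' \<noteq> 0\<close> x_minus_c(2)[of c]
      by (subst ordv_mult[OF PU]) (auto simp: E_KU ordv_x_minus_c[OF PU] KK_ops cst_KU KK_gen)
    ultimately have "ordv (Some (c, b)) (E g') < ordv (Some (c, b)) (E g)" using g'(2) by simp
    moreover have "0 < ordv (Some (c, b)) (E g)" using ordv_E_pos[OF PU True less.prems(2)] .
    ultimately have "nat (ordv (Some (c, b)) (E g')) < nat (ordv (Some (c, b)) (E g))" by simp
    from less.hyps[OF this g'(1) \<open>E g' \<noteq> 0\<close>] obtain n a h where
      *: "a \<in> kp k" "h \<in> kp k" "at2 c b a \<noteq> 0" "at2 c b h \<noteq> 0" "E g' = (xvar - cst c) ^ n * E a / E h" by blast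
    have "E g = (xvar - cst c) * E g' / E (uu b)" using g'(2) u by (simp add: field_simps)
    also have "\<dots> = (xvar - cst c) ^ Suc n * E a / E (uu b * h)" by (simp add: * E_simps mult_ac)
    finally have "E g = (xvar - cst c) ^ Suc n * E a / E (uu b * h)" .
    moreover have "uu b \<in> kp k"
      unfolding uu_def by (intro subrng_diff[OF S2] subrng_power[OF S2] subrng_1[OF S2] kp_py[OF k] kp_pc[OF k] bk)
    ultimately show ?thesis using * at2_uu[of c b]
      by (intro exI[of _ "Suc n"] exI[of _ a] exI[of _ "uu b * h"] conjI subrng_mult[OF S2]) (auto simp: at2_simps)
  qed
qed

text \<open>Identifies the functions of nonnegative order with the local ring of the point, over the
  small field \<open>k\<close>: the powers of x - c in numerator and denominator cancel.\<close>

lemma fin_regular: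
  assumes k: "subfld k" and f: "f \<in> poly_over k" and P: "Some (c, b) \<in> pts k"
    and z: "z \<in> KK k" "0 \<le> ordv (Some (c, b)) z"
  shows "\<exists>a h. a \<in> kp k \<and> h \<in> kp k \<and> at2 c b h \<noteq> 0 \<and> z = E a / E h"
proof (cases "z = 0")
  case True
  thus ?thesis using subrng_0[OF kp_subrng[OF k]] subrng_1[OF kp_subrng[OF k]]
    by (intro exI[of _ 0] exI[of _ 1]) (auto simp: at2_simps E_simps)
next
  case False
  note S2 = kp_subrng[OF k]
  have PU: "Some (c, b) \<in> pts UNIV" using P pts_mono[of k UNIV] by auto
  have ck: "c \<in> k" using P by (auto simp: pts_def)
  obtain g q where gq: "g \<in> kp k" "q \<in> kp k" "E q \<noteq> 0" "z = E g / E q" using KK_cases[OF k z(1)] by blast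
  have "E g \<noteq> 0" using gq False by auto
  obtain n a h where 1: "a \<in> kp k" "h \<in> kp k" "at2 c b a \<noteq> 0" "at2 c b h \<noteq> 0" "E g = (xvar - cst c) ^ n * E a / E h"
    using fin_decomp[OF k f P gq(1) \<open>E g \<noteq> 0\<close>] by blast
  obtain n' a' h' where 2: "a' \<in> kp k" "h' \<in> kp k" "at2 c b a' \<noteq> 0" "at2 c b h' \<noteq> 0" "E q = (xvar - cst c) ^ n' * E a' / E h'"
    using fin_decomp[OF k f P gq(2,3)] by blast
  note o1 = ordv_E_eq_0[OF PU 1(3)] ordv_E_eq_0[OF PU 1(4)] ordv_E_eq_0[OF PU 2(3)] ordv_E_eq_0[OF PU 2(4)]
  let ?v = "ordv (Some (c, b))" and ?t = "xvar - cst c"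
  have tK: "?t \<in> KU" by (intro KK_ops cst_KU KK_gen)
  note t0 = x_minus_c(2)[of c]
  have "?v (?t ^ n' * E a' * E h * z) = ?v (?t ^ n * E a * E h')"
  proof -
    have A: "?t ^ n * E a = E g * E h" using 1(5) o1 by simp
    have B: "?t ^ n' * E a' = E q * E h'" using 2(5) o1 by simp
    show ?thesis unfolding A B using gq by (simp add: mult_ac)
  qed
  moreover have "?v (?t ^ n' * E a' * E h * z) = int n' + ?v z"
    using False z KK_sub_KU[OF z(1)] o1 t0 tK
    by (simp add: ordv_mult[OF PU] ordv_power[OF PU] ordv_x_minus_c[OF PU] KK_ops E_KU)
  moreover have "?v (?t ^ n * E a * E h') = int n"
    using o1 t0 tK by (simp add: ordv_mult[OF PU] ordv_power[OF PU] ordv_x_minus_c[OF PU] KK_ops E_KU)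
  ultimately have "n' \<le> n" using z by simp
  have "z = E ((px - pc c) ^ (n - n') * a * h') / E (h * a')"
  proof -
    have "z = ?t ^ n * E a * E h' / (?t ^ n' * E h * E a')"
      using gq(4) 1(5) 2(5) o1 t0 by (simp add: field_simps)
    also have "?t ^ n = ?t ^ n' * ?t ^ (n - n')" using \<open>n' \<le> n\<close> by (simp flip: power_add)
    finally show ?thesis using t0 by (simp add: E_simps E_px E_pc)
  qed
  thus ?thesis using 1 2
    by (intro exI[of _ "(px - pc c) ^ (n - n') * a * h'"] exI[of _ "h * a'"] conjI subrng_mult[OF S2]
          subrng_power[OF S2] subrng_diff[OF S2] kp_px[OF k] kp_pc[OF k] ck) (auto simp: at2_simps)
qed

end

section \<open>Places as rings of functions regular at a point\<close>

context as_curve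
begin

definition place_ring :: "'k set \<Rightarrow> ('k \<times> 'k) option \<Rightarrow> 'k ratfun_closure set" where
  "place_ring k P = {z \<in> KK k. 0 \<le> ordv P z}"

lemma places_alt:
  "R \<in> places k (KK k) \<longleftrightarrow> valuation_ring (KK k) R \<and> cst ` k \<subseteq> R \<and> R \<noteq> KK k"
  by (auto simp: places_def valuation_ring_def subring_set_def subrng_def KK_subfld)

lemma valuation_place_ring: "P \<in> pts UNIV \<Longrightarrow> valuation_ring (KK k) (place_ring k P)"
proof (unfold_locales)
  assume P: "P \<in> pts UNIV"
  show "subfld (KK k)" by (rule KK_subfld)
  have d: "0 \<le> ordv P (a - b)" if "a \<in> place_ring k P" "b \<in> place_ring k P" for a b
    using that ordv_add_ge0[OF P, of a "- b"] ordv_uminus[OF P, of b]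
    by (auto simp: place_ring_def KK_sub_KU KK_ops)
  show "subrng (place_ring k P)"
    unfolding subrng_def using d
    by (auto simp: place_ring_def ordv_0_cst[OF P] KK_ops KK_sub_KU intro!: ordv_mult_ge0[OF P])
  show "place_ring k P \<subseteq> KK k" by (auto simp: place_ring_def)
  show "z \<in> place_ring k P \<or> inverse z \<in> place_ring k P" if "z \<in> KK k" for z
    using that ordv_inverse[OF P KK_sub_KU[OF that]] by (auto simp: place_ring_def KK_ops)
qed

lemma max_place_ring: "P \<in> pts UNIV \<Longrightarrow> max_ideal (place_ring k P) = {z \<in> KK k. z = 0 \<or> 0 < ordv P z}"
  by (auto simp: max_ideal_def place_ring_def ordv_inverse KK_sub_KU KK_ops ordv_0_cst)

lemma ordv_loc_None: "ordv None xvar = - int p" "ordv None yy = - int d"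
proof -
  have N: "None \<in> pts UNIV" by (simp add: pts_def)
  show "ordv None xvar = - int p" "ordv None yy = - int d"
    using local_loc[OF N] by (simp_all add: ordv_def phi_x[OF N] phi_y[OF N] local_at_def)
qed

lemma xvar_neq_0: "xvar \<noteq> (0 :: 'k ratfun_closure)" and yy_neq_0: "yy \<noteq> 0"
proof -
  have N: "None \<in> pts UNIV" by (simp add: pts_def)
  show "xvar \<noteq> (0 :: 'k ratfun_closure)" "yy \<noteq> 0"
    using ordv_loc_None ordv_0_cst[OF N] p_ge_2 d_ge_2 by auto
qed

lemma ex_neg_ord:
  assumes "P \<in> pts k"
  shows "\<exists>z\<in>KK k. z \<noteq> 0 \<and> ordv P z < 0"
proof (cases P)
  case None
  thus ?thesis using ordv_loc_None p_ge_2 xvar_neq_0 KK_gen by (intro bexI[of _ xvar]) auto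
next
  case (Some cb)
  then obtain c b where P: "P = Some (c, b)" by (cases cb) auto
  have PU: "Some (c, b) \<in> pts UNIV" using assms P pts_mono[of k UNIV] by auto
  have c: "c \<in> k" using assms P by (auto simp: pts_def)
  have t: "xvar - cst c \<in> KK k" using c KK_gen by (intro KK_ops) auto
  have "ordv P (inverse (xvar - cst c)) = -1"
    unfolding P using ordv_inverse[OF PU KK_sub_KU[OF t]] ordv_x_minus_c[OF PU] by simp
  thus ?thesis using subfld_inverse[OF KK_subfld t] x_minus_c(2)[of c] by (intro bexI[of _ "inverse (xvar - cst c)"]) auto
qed

lemma cst_place_ring: "P \<in> pts UNIV \<Longrightarrow> cst ` k \<subseteq> place_ring k P"
  using KK_gen(1)[of k] by (auto simp: place_ring_def ordv_0_cst)

lemma place_ring_in_places: "P \<in> pts k \<Longrightarrow> place_ring k P \<in> places k (KK k)"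
proof -
  assume P: "P \<in> pts k"
  hence PU: "P \<in> pts UNIV" using pts_mono[of k UNIV] by auto
  obtain z where z: "z \<in> KK k" "ordv P z < 0" using ex_neg_ord[OF P] by auto
  hence "z \<notin> place_ring k P" by (auto simp: place_ring_def)
  hence "place_ring k P \<noteq> KK k" using z by auto
  thus ?thesis unfolding places_alt using valuation_place_ring[OF PU] cst_place_ring[OF PU] by blast
qed

text \<open>The order is integer-valued: a power of one element of negative order absorbs the poles
  of any given function, so a strictly larger ring would be the whole field.\<close>

lemma place_ring_maximal:
  assumes P: "P \<in> pts k" and R: "R \<in> places k (KK k)" and sub: "place_ring k P \<subseteq> R"
  shows "R = place_ring k P"
proof (rule ccontr)
  assume "R \<noteq> place_ring k P"
  have PU: "P \<in> pts UNIV" using P pts_mono[of k UNIV] by auto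
  interpret R: valuation_ring "KK k" R using R by (simp add: places_alt)
  obtain z where z: "z \<in> R" "z \<notin> place_ring k P" using \<open>R \<noteq> _\<close> sub by auto
  have zK: "z \<in> KK k" using z R.R_sub_K by auto
  have zo: "ordv P z < 0" using z zK by (auto simp: place_ring_def)
  have z0: "z \<noteq> 0" using zo ordv_0_cst[OF PU] by auto
  have "w \<in> R" if w: "w \<in> KK k" for w
  proof (cases "w = 0")
    case True
    thus ?thesis using subrng_0[OF R.R] by simp
  next
    case False
    define n where "n = nat (- ordv P w)"
    have "ordv P (w * inverse (z ^ n)) = ordv P w - int n * ordv P z"
      using w zK z0 False
      by (subst ordv_mult[OF PU]) (auto simp: ordv_inverse[OF PU] ordv_power[OF PU] KK_ops KK_sub_KU)
    also have "\<dots> \<ge> 0"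
    proof -
      have "int n * ordv P z \<le> - int n"
        using mult_left_mono[of "ordv P z" "-1" "int n"] zo by simp
      moreover have "- ordv P w \<le> int n" by (simp add: n_def)
      ultimately show ?thesis by linarith
    qed
    finally have "w * inverse (z ^ n) \<in> R"
      using sub w zK by (auto simp: place_ring_def KK_ops)
    hence "w * inverse (z ^ n) * z ^ n \<in> R" by (rule subrng_mult[OF R.R _ subrng_power[OF R.R z(1)]])
    moreover have "w * inverse (z ^ n) * z ^ n = w" using z0 by (simp add: mult.assoc)
    ultimately show ?thesis by simp
  qed
  hence "R = KK k" using R.R_sub_K by auto
  thus False using R by (simp add: places_alt)
qed

text \<open>The residues c and b of x and y determine the residue of every polynomial in x and y. By
  \<open>fin_regular\<close> a function regular at the point has a denominator with nonzero value
  there, which is therefore a unit at \<open>R\<close>.\<close>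

lemma fin_place_sub:
  assumes k: "subfld k" and f: "f \<in> poly_over k" and P: "Some (c, b) \<in> pts k" and R: "R \<in> places k (KK k)"
    and xM: "xvar - cst c \<in> max_ideal R" and yM: "yy - cst b \<in> max_ideal R"
  shows "place_ring k (Some (c, b)) \<subseteq> R"
    and "g \<in> kp k \<Longrightarrow> E g - cst (at2 c b g) \<in> max_ideal R"
proof -
  interpret R: valuation_ring "KK k" R using R by (simp add: places_alt)
  have ck: "c \<in> k" "b \<in> k" using P by (auto simp: pts_def)
  have cR: "cst a \<in> R" if "a \<in> k" for a using R that by (auto simp: places_alt)
  have "(xvar - cst c) + cst c \<in> R" "(yy - cst b) + cst b \<in> R"
    using xM yM R.max_ideal_sub cR ck by (blast intro!: subrng_add[OF R.R])+
  hence xy: "xvar \<in> R" "yy \<in> R" by simp_all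
  have pevR: "pev cst xvar q \<in> R" if "q \<in> poly_over k" for q
    using that xy cR by (auto simp: pev_altdef[OF rhom_cst] poly_over_def
      intro!: subrng_sum[OF R.R] subrng_mult[OF R.R] subrng_power[OF R.R])
  have ER: "E g \<in> R" if "g \<in> kp k" for g
    using that xy pevR by (auto simp: ev_altdef[OF rhom_cst] poly_over_def[of "poly_over k"]
      intro!: subrng_sum[OF R.R] subrng_mult[OF R.R] subrng_power[OF R.R])
  have EM: "E g - cst (at2 c b g) \<in> max_ideal R" if g: "g \<in> kp k" for g
  proof -
    obtain g1 g2 where g12: "g1 \<in> kp k" "g2 \<in> kp k" "g = (py - pc b) * g2 + (px - pc c) * g1 + pc (at2 c b g)"
      using kp_decomp[OF k ck g] by blast
    have "E g - cst (at2 c b g) = E g2 * (yy - cst b) + E g1 * (xvar - cst c)"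
      by (subst g12(3)) (simp add: E_simps E_px E_py E_pc)
    thus ?thesis using xM yM ER g12 by (auto intro!: R.max_add R.max_mult)
  qed
  show "g \<in> kp k \<Longrightarrow> E g - cst (at2 c b g) \<in> max_ideal R" by (rule EM)
  show "place_ring k (Some (c, b)) \<subseteq> R"
  proof
    fix z assume "z \<in> place_ring k (Some (c, b))"
    then obtain a h where ah: "a \<in> kp k" "h \<in> kp k" "at2 c b h \<noteq> 0" "z = E a / E h"
      using fin_regular[OF k f P, of z] unfolding place_ring_def by blast
    have "at2 c b h \<in> k"
      using ah(2) ck poly_poly_over[OF subfld_subrng[OF k]] unfolding at2_def ev_altdef[OF rhom_id] pev_id
      by (auto simp: poly_over_def[of "poly_over k"] intro!: subrng_sum[OF subfld_subrng[OF k]]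
        subrng_mult[OF subfld_subrng[OF k]] subrng_power[OF subfld_subrng[OF k]])
    hence iR: "cst (inverse (at2 c b h)) \<in> R" by (intro cR subfld_inverse[OF k])
    have "E h \<notin> max_ideal R"
    proof
      assume "E h \<in> max_ideal R"
      hence "E h - (E h - cst (at2 c b h)) \<in> max_ideal R" by (intro R.max_diff EM ah)
      hence "cst (inverse (at2 c b h)) * cst (at2 c b h) \<in> max_ideal R" using iR by (intro R.max_mult) auto
      thus False using ah(3) R.one_not_max by (simp flip: rhom_mult[OF rhom_cst]) (simp add: rhom_1[OF rhom_cst])
    qed
    hence "inverse (E h) \<in> R" by (intro R.unit_inverse ER ah)
    thus "z \<in> R" using ER[OF ah(1)] by (simp add: ah(4) divide_inverse subrng_mult[OF R.R])
  qed
qed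

lemma cst_divide: "cst (a / b) = cst a / cst (b :: 'k)"
proof (cases "b = 0")
  case False
  thus ?thesis
    using rhom_mult[OF rhom_cst, of "a / b" b] rhom_eq_0_iff[OF rhom_cst, of b] by (simp add: field_simps)
qed (simp add: rhom_0[OF rhom_cst])

text \<open>With integer exponents, quotients of monomials are again monomials.\<close>

definition mon :: "int \<Rightarrow> int \<Rightarrow> 'k ratfun_closure" where
  "mon i j = xvar powi i * yy powi j"

lemma ordv_mon: "ordv None (mon i j) = - (int p * i + int d * j)"
proof -
  have N: "None \<in> pts UNIV" by (simp add: pts_def)
  show ?thesis unfolding mon_def using xvar_neq_0 yy_neq_0
    by (subst ordv_mult[OF N])
       (auto simp: ordv_powi[OF N] ordv_loc_None KK_ops KK_gen power_int_not_zero algebra_simps)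
qed

lemma mon_neq_0: "mon i j \<noteq> 0"
  using xvar_neq_0 yy_neq_0 by (simp add: mon_def power_int_not_zero)

lemma mon_KK: "mon i j \<in> KK k"
  unfolding mon_def by (intro KK_ops KK_gen)

lemma mon_diff: "mon (i - i') (j - j') = mon i j / mon i' j'"
  using xvar_neq_0 yy_neq_0 by (simp add: mon_def power_int_diff)

lemma mon_nat: "mon (int i) (int j) = xvar ^ i * yy ^ j"
  by (simp add: mon_def)

section \<open>An arbitrary place that does not contain x\<close>

context
  fixes k :: "'k set" and R :: "'k ratfun_closure set"
  assumes k: "subfld k" and f: "f \<in> poly_over k" and R: "R \<in> places k (KK k)" and xR: "xvar \<notin> R"
begin

interpretation R: valuation_ring "KK k" R
  using R by (simp add: places_alt)

lemma inf_cR: "a \<in> k \<Longrightarrow> cst a \<in> R"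
  using R by (auto simp: places_alt)

lemma inf_xinv: "inverse xvar \<in> max_ideal R"
  by (intro R.not_in_R KK_gen xR)

lemma inf_xinv_power: "n > 0 \<Longrightarrow> inverse xvar ^ n \<in> max_ideal R"
  using inf_xinv R.max_ideal_sub
  by (cases n) (auto intro!: R.max_mult[OF _ inf_xinv] subrng_power[OF R.R] simp: power_Suc2 simp del: power_Suc)

lemma inf_f: "pev cst xvar f / xvar ^ d - 1 \<in> max_ideal R"
proof -
  have "pev cst xvar f / xvar ^ d = (\<Sum>i\<le>d. cst (coeff f i) * inverse xvar ^ (d - i))"
    unfolding pev_altdef[OF rhom_cst] deg_f sum_divide_distrib
    by (intro sum.cong refl) (simp add: field_simps power_diff xvar_neq_0)
  also have "{..d} = insert d {..<d}" by auto
  also have "(\<Sum>i\<in>insert d {..<d}. cst (coeff f i) * inverse xvar ^ (d - i))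
      = 1 + (\<Sum>i<d. cst (coeff f i) * inverse xvar ^ (d - i))"
    using lc_f deg_f by (simp add: rhom_1[OF rhom_cst])
  finally have "pev cst xvar f / xvar ^ d - 1 = (\<Sum>i<d. cst (coeff f i) * inverse xvar ^ (d - i))" by simp
  also have "\<dots> \<in> max_ideal R"
    using f by (intro R.max_sum R.max_mult inf_cR inf_xinv_power) (auto simp: poly_over_def)
  finally show ?thesis .
qed

lemma inf_yR: "yy \<notin> R"
proof
  assume "yy \<in> R"
  hence "inverse xvar ^ d * (yy ^ p - yy) \<in> max_ideal R"
    using inf_xinv_power[of d] d_ge_2
    by (subst mult.commute) (intro R.max_mult subrng_diff[OF R.R] subrng_power[OF R.R], auto)
  hence "pev cst xvar f / xvar ^ d \<in> max_ideal R"
    by (simp add: yvar_eq divide_inverse power_inverse mult.commute)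
  from R.max_diff[OF this inf_f] show False using R.one_not_max by simp
qed

text \<open>The equation says y^p (1 - y^(1-p)) = f(x). Since neither x nor y lies in
  \<open>R\<close>, the bracket and f(x) / x^d are both congruent to 1.\<close>

lemma inf_u0: "yy ^ p / xvar ^ d - 1 \<in> max_ideal R"
proof -
  have yi: "inverse yy \<in> max_ideal R" by (intro R.not_in_R KK_gen inf_yR)
  have "inverse yy ^ (p - 1) = inverse yy ^ (p - 2) * inverse yy"
    using p_ge_2 power_minus_mult[of "p - 1" "inverse yy"] by (simp add: numeral_2_eq_2)
  also have "\<dots> \<in> max_ideal R"
    using yi R.max_ideal_sub by (intro R.max_mult subrng_power[OF R.R]) auto
  finally have "(1 - inverse yy ^ (p - 1)) - 1 \<in> max_ideal R" using R.max_uminus by simp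
  hence 1: "inverse (1 - inverse yy ^ (p - 1)) - 1 \<in> max_ideal R" "1 - inverse yy ^ (p - 1) \<noteq> 0"
    using R.one_unit by blast+
  have "yy ^ p * inverse yy ^ (p - 1) = yy"
    using power_minus_mult[of p yy] p_ge_2 yy_neq_0 by (simp add: field_simps)
  hence eq: "yy ^ p * (1 - inverse yy ^ (p - 1)) = pev cst xvar f"
    by (simp add: yvar_eq[symmetric] algebra_simps)
  have eq2: "yy ^ p / xvar ^ d = (pev cst xvar f / xvar ^ d) * inverse (1 - inverse yy ^ (p - 1))"
    unfolding eq[symmetric] using 1(2) by (simp add: divide_inverse)
  show ?thesis using R.one_unit_mult[OF inf_f 1(1)] by (simp only: eq2)
qed

text \<open>The \<open>p\<close>-th power of x^i y^j is x^(pi + dj) times a power of the one-unit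
  y^p / x^d, and 1/x lies in the maximal ideal.\<close>

lemma inf_mon_neg:
  assumes "int p * i + int d * j < 0"
  shows "mon i j \<in> max_ideal R"
proof (rule R.max_power_cancel)
  show "mon i j \<in> KK k" by (rule mon_KK)
  define n where "n = nat (- (int p * i + int d * j))"
  have n: "int p * i + int d * j = - int n" "n > 0" using assms by (auto simp: n_def)
  have "(a powi i) ^ p = a powi (int p * i)" for a :: "'k ratfun_closure" and i
    using power_int_mult[of a i "int p"] by (simp add: mult.commute)
  moreover have "yy powi (int p * j) = (yy ^ p) powi j" by (simp add: power_int_mult)
  ultimately have "mon i j ^ p = xvar powi (int p * i) * (yy ^ p) powi j"
    by (simp add: mon_def power_mult_distrib)
  also have "(yy ^ p) powi j = (xvar ^ d) powi j * (yy ^ p / xvar ^ d) powi j"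
    using xvar_neq_0 by (simp flip: power_int_mult_distrib)
  also have "xvar powi (int p * i) * ((xvar ^ d) powi j * (yy ^ p / xvar ^ d) powi j)
      = xvar powi (int p * i + int d * j) * (yy ^ p / xvar ^ d) powi j"
    using xvar_neq_0 by (simp add: power_int_add power_int_mult)
  also have "\<dots> = (yy ^ p / xvar ^ d) powi j * inverse xvar ^ n"
    unfolding n by (simp add: power_int_minus power_inverse mult.commute)
  also have "\<dots> \<in> max_ideal R"
    using R.one_unit[OF R.one_unit_powi[OF inf_u0]] by (intro R.max_mult inf_xinv_power n) auto
  finally show "mon i j ^ p \<in> max_ideal R" .
qed

text \<open>As \<open>p\<close> and \<open>d\<close> are coprime, the exponents are -ds and ps for
  some s, so the monomial is a power of y^p / x^d.\<close>

lemma inf_mon_0: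
  assumes "int p * i + int d * j = 0"
  shows "mon i j - 1 \<in> max_ideal R"
proof -
  have "int p dvd int d * j" using assms by (metis dvd_add_right_iff dvd_triv_left dvd_0_right)
  moreover have "coprime (int p) (int d)" using coprime_pd by simp
  ultimately have "int p dvd j" by (simp add: coprime_dvd_mult_right_iff)
  then obtain s where s: "j = int p * s" by (elim dvdE)
  have "int p * (i + int d * s) = 0" using assms s by (simp add: algebra_simps)
  hence i: "i = - (int d * s)" using p_ge_2 by simp
  have "mon i j = (yy ^ p / xvar ^ d) powi s"
  proof -
    have "xvar powi - (int d * s) = inverse ((xvar ^ d :: 'k ratfun_closure) powi s)"
      "yy powi (int p * s) = (yy ^ p) powi s"
      by (simp_all only: power_int_minus power_int_mult power_int_of_nat)
    thus ?thesis unfolding mon_def i s divide_inverse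
      by (simp only: power_int_mult_distrib power_int_inverse mult.commute)
  qed
  thus ?thesis using R.one_unit_powi[OF inf_u0] by simp
qed

text \<open>Divided by the dominant monomial, all other monomials acquire negative weight and lie in
  the maximal ideal by \<open>inf_mon_neg\<close>.\<close>

lemma inf_E:
  assumes g: "g \<in> kp k" "degree g < p" and j: "dominant g j"
  shows "E g / (cst (lead_coeff (coeff g j)) * mon (int (degree (coeff g j))) (int j)) - 1 \<in> max_ideal R"
proof -
  define i where "i = degree (coeff g j)"
  define a where "a = (\<lambda>(j, i). coeff (coeff g j) i)"
  define A where "A = Sigma {..degree g} (\<lambda>j. {..degree (coeff g j)})"
  have gj: "coeff g j \<noteq> 0" using j by (simp add: dominant_def)
  have ak: "a ji \<in> k" for ji using g by (auto simp: a_def poly_over_def split: prod.splits)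
  have a0: "a (j, i) \<noteq> 0" using gj by (simp add: a_def i_def)
  have cst0: "cst (a (j, i)) \<noteq> 0" using a0 by (simp add: rhom_eq_0_iff[OF rhom_cst])
  have finA: "finite A" and jiA: "(j, i) \<in> A" using gj by (auto simp: A_def i_def le_degree)
  define u where "u = (\<lambda>(j', i'). cst (a (j', i') / a (j, i)) * mon (int i' - int i) (int j' - int j))"
  have "E g = (\<Sum>j\<le>degree g. \<Sum>i\<le>degree (coeff g j). cst (a (j, i)) * mon (int i) (int j))"
    unfolding ev_altdef[OF rhom_cst] pev_altdef[OF rhom_cst]
    by (simp add: a_def mon_nat sum_distrib_left sum_distrib_right mult_ac)
  also have "\<dots> = (\<Sum>(j, i)\<in>A. cst (a (j, i)) * mon (int i) (int j))"
    unfolding A_def by (rule sum.Sigma) auto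
  finally have Eg: "E g = (\<Sum>(j, i)\<in>A. cst (a (j, i)) * mon (int i) (int j))" .
  have "E g / (cst (a (j, i)) * mon (int i) (int j)) = sum u A"
    unfolding Eg sum_divide_distrib by (intro sum.cong refl) (auto simp: u_def mon_diff cst_divide)
  also have "\<dots> = u (j, i) + sum u (A - {(j, i)})" by (rule sum.remove[OF finA jiA])
  also have "u (j, i) = 1" using a0 by (simp add: u_def mon_def rhom_1[OF rhom_cst])
  finally have "E g / (cst (a (j, i)) * mon (int i) (int j)) - 1 = sum u (A - {(j, i)})" by simp
  also have "\<dots> \<in> max_ideal R"
  proof (rule R.max_sum)
    fix ji' assume ji': "ji' \<in> A - {(j, i)}"
    obtain j' i' where [simp]: "ji' = (j', i')" by (cases ji')
    show "u ji' \<in> max_ideal R"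
    proof (cases "a ji' = 0")
      case True
      thus ?thesis using R.zero_max by (simp add: u_def rhom_0[OF rhom_cst])
    next
      case False
      have "p * i' + d * j' < p * i + d * j"
      proof (cases "j' = j")
        case True
        hence "i' < i" using ji' by (auto simp: A_def i_def)
        thus ?thesis using True p_ge_2 by simp
      next
        case ne: False
        have "coeff g j' \<noteq> 0" using False by (auto simp: a_def)
        hence "wt g j' < wt g j" using ne j by (simp add: dominant_def)
        moreover have "p * i' \<le> p * degree (coeff g j')" using ji' by (intro mult_le_mono2) (auto simp: A_def)
        ultimately show ?thesis unfolding wt_def i_def by linarith
      qed
      hence "int (p * i' + d * j') < int (p * i + d * j)" by linarith
      hence "int p * (int i' - int i) + int d * (int j' - int j) < 0" by (simp add: algebra_simps)
      hence "mon (int i' - int i) (int j' - int j) \<in> max_ideal R" by (rule inf_mon_neg)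
      thus ?thesis using ak by (auto simp: u_def intro!: R.max_mult inf_cR subfld_divide[OF k])
    qed
  qed
  finally show ?thesis by (simp add: a_def i_def)
qed

lemma inf_E':
  assumes g: "g \<in> kp k" "E g \<noteq> 0"
  shows "\<exists>c i j u. c \<in> k \<and> c \<noteq> 0 \<and> u - 1 \<in> max_ideal R \<and> E g = cst c * mon i j * u
      \<and> ordv None (E g) = - (int p * i + int d * j)"
proof -
  obtain r q where r: "r \<in> kp k" "degree r < p" "g = mp * q + r"
    using reduce_degree[OF subfld_subrng[OF k] f g(1)] by blast
  have "E mp = 0" by (intro ev_mp rhom_cst yvar_eq)
  hence Er: "E g = E r" by (simp add: r E_simps)
  hence "r \<noteq> 0" using g by (auto simp: E_simps)
  then obtain j where j: "dominant r j" using ex_dominant r by blast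
  define c where "c = lead_coeff (coeff r j)"
  define i where "i = degree (coeff r j)"
  define u where "u = E r / (cst c * mon (int i) (int j))"
  have c: "c \<in> k" "c \<noteq> 0" using r j by (auto simp: c_def poly_over_def dominant_def)
  hence "cst c \<noteq> 0" by (simp add: rhom_eq_0_iff[OF rhom_cst])
  hence 1: "E g = cst c * mon (int i) (int j) * u" by (simp add: u_def Er mon_neq_0)
  have 2: "u - 1 \<in> max_ideal R" using inf_E[OF r(1,2) j] by (simp add: u_def c_def i_def)
  have N: "None \<in> pts UNIV" by (simp add: pts_def)
  have "ordv None (E g) = - int (wt r j)"
    unfolding Er ordv_def phi_E[OF N] using local_loc[OF N] ev_inf(2)[OF _ _ j]
    by (auto simp: local_at_def)
  hence "ordv None (E g) = - (int p * int i + int d * int j)" by (simp add: wt_def i_def)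
  thus ?thesis using 1 2 c by blast
qed

text \<open>Ties the unknown place to \<open>None\<close>: the monomial that governs a function at
  \<open>R\<close> is also the one that gives its order at infinity.\<close>

lemma inf_form:
  assumes z: "z \<in> KK k" "z \<noteq> 0"
  shows "\<exists>c i j u. c \<in> k \<and> c \<noteq> 0 \<and> u - 1 \<in> max_ideal R \<and> z = cst c * mon i j * u
      \<and> ordv None z = - (int p * i + int d * j)"
proof -
  obtain g h where gh: "g \<in> kp k" "h \<in> kp k" "E h \<noteq> 0" "z = E g / E h" using KK_cases[OF k z(1)] by blast
  have "E g \<noteq> 0" using gh z by auto
  obtain c i j u where 1: "c \<in> k" "c \<noteq> 0" "u - 1 \<in> max_ideal R" "E g = cst c * mon i j * u"
    "ordv None (E g) = - (int p * i + int d * j)" using inf_E'[OF gh(1) \<open>E g \<noteq> 0\<close>] by blast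
  obtain c' i' j' u' where 2: "c' \<in> k" "c' \<noteq> 0" "u' - 1 \<in> max_ideal R" "E h = cst c' * mon i' j' * u'"
    "ordv None (E h) = - (int p * i' + int d * j')" using inf_E'[OF gh(2,3)] by blast
  have N: "None \<in> pts UNIV" by (simp add: pts_def)
  have "ordv None z = ordv None (E g) - ordv None (E h)"
    unfolding gh(4) divide_inverse using \<open>E g \<noteq> 0\<close> gh(3)
    by (subst ordv_mult[OF N]) (auto simp: ordv_inverse[OF N] E_KU KK_ops)
  hence "ordv None z = - (int p * (i - i') + int d * (j - j'))" by (simp only: 1(5) 2(5)) (simp add: algebra_simps)
  moreover have "z = cst (c / c') * mon (i - i') (j - j') * (u * inverse u')"
    unfolding cst_divide mon_diff gh(4) 1(4) 2(4) by (simp add: divide_inverse)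
  moreover have "u * inverse u' - 1 \<in> max_ideal R"
    using R.one_unit_mult[OF 1(3)] R.one_unit[OF 2(3)] by blast
  moreover have "c / c' \<in> k" "c / c' \<noteq> 0" using 1 2 subfld_divide[OF k] by auto
  ultimately show ?thesis by blast
qed

lemma inf_residue:
  assumes z: "z \<in> KK k" "0 \<le> ordv None z"
  shows "\<exists>c\<in>k. z - cst c \<in> max_ideal R"
proof (cases "z = 0")
  case True
  thus ?thesis using subrng_0[OF subfld_subrng[OF k]] R.zero_max by (intro bexI[of _ 0]) (auto simp: rhom_0[OF rhom_cst])
next
  case False
  obtain c i j u where 1: "c \<in> k" "u - 1 \<in> max_ideal R" "z = cst c * mon i j * u"
    "ordv None z = - (int p * i + int d * j)" using inf_form[OF z(1) False] by blast
  have uR: "u \<in> R" using R.one_unit 1 by blast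
  show ?thesis
  proof (cases "ordv None z = 0")
    case True
    hence "mon i j - 1 \<in> max_ideal R" using 1 by (intro inf_mon_0) simp
    hence "cst c * (mon i j * u - 1) \<in> max_ideal R" by (intro R.max_mult R.one_unit_mult inf_cR 1)
    hence "z - cst c \<in> max_ideal R" by (simp add: 1(3) algebra_simps)
    thus ?thesis using 1 by blast
  next
    case ne: False
    hence "mon i j \<in> max_ideal R" using 1 z by (intro inf_mon_neg) simp
    hence "(cst c * u) * mon i j \<in> max_ideal R" using uR inf_cR[OF 1(1)] by (intro R.max_mult subrng_mult[OF R.R])
    moreover have "z = (cst c * u) * mon i j" by (simp add: 1(3))
    ultimately show ?thesis using subrng_0[OF subfld_subrng[OF k]] by (intro bexI[of _ 0]) (auto simp: rhom_0[OF rhom_cst])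
  qed
qed

text \<open>By \<open>inf_residue\<close> every function regular at \<open>None\<close> is a
  constant plus an element of the maximal ideal of \<open>R\<close>, hence lies in \<open>R\<close>;
  then \<open>place_ring_maximal\<close> gives equality.\<close>

lemma inf_unique: "R = place_ring k None"
proof (rule place_ring_maximal[OF _ R])
  show "None \<in> pts k" by (simp add: pts_def)
  show "place_ring k None \<subseteq> R"
  proof
    fix z assume "z \<in> place_ring k None"
    then obtain c where "c \<in> k" "z - cst c \<in> max_ideal R" using inf_residue by (auto simp: place_ring_def)
    hence "(z - cst c) + cst c \<in> R" using R.max_ideal_sub inf_cR by (intro subrng_add[OF R.R]) auto
    thus "z \<in> R" by simp
  qed
qed

end

end

section \<open>Rational places, and all places over the algebraically closed field\<close>

context as_curve
begin

lemma place_ring_gens: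
  assumes P: "Some (c, b) \<in> pts k"
  shows "xvar \<in> place_ring k (Some (c, b))"
    and "xvar - cst c \<in> max_ideal (place_ring k (Some (c, b)))"
    and "yy - cst b \<in> max_ideal (place_ring k (Some (c, b)))"
proof -
  have PU: "Some (c, b) \<in> pts UNIV" using P pts_mono[of k UNIV] by auto
  have cb: "c \<in> k" "b \<in> k" using P by (auto simp: pts_def)
  have KK: "xvar - cst c \<in> KK k" "yy - cst b \<in> KK k" using KK_gen cb by (auto intro!: KK_ops)
  show "xvar \<in> place_ring k (Some (c, b))"
    using phi_fin_E(1)[OF PU, of px] KK_gen by (simp add: place_ring_def E_px)
  show "xvar - cst c \<in> max_ideal (place_ring k (Some (c, b)))"
    using KK ordv_x_minus_c[OF PU] by (simp add: max_place_ring[OF PU])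
  have "yy - cst b = E (py - pc b)" by (simp add: E_simps E_py E_pc)
  hence "yy - cst b = 0 \<or> 0 < ordv (Some (c, b)) (yy - cst b)"
    using ordv_E_pos[OF PU, of "py - pc b"] by (auto simp: at2_simps at2_gens)
  thus "yy - cst b \<in> max_ideal (place_ring k (Some (c, b)))"
    using KK by (auto simp: max_place_ring[OF PU])
qed

lemma xvar_not_in_inf: "xvar \<notin> place_ring k None"
  using p_ge_2 by (simp add: place_ring_def ordv_loc_None)

lemma at2_in: "subfld k \<Longrightarrow> c \<in> k \<Longrightarrow> b \<in> k \<Longrightarrow> g \<in> kp k \<Longrightarrow> at2 c b g \<in> k"
  using poly_poly_over[OF subfld_subrng, of k] unfolding at2_def ev_altdef[OF rhom_id] pev_id
  by (auto simp: poly_over_def[of "poly_over k"] intro!: subrng_sum subrng_mult subrng_power subfld_subrng)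

lemma rational_residue:
  assumes k: "subfld k" and f: "f \<in> poly_over k" and P: "P \<in> pts k" and z: "z \<in> place_ring k P"
  shows "\<exists>c\<in>k. z - cst c \<in> max_ideal (place_ring k P)"
proof (cases P)
  case None
  thus ?thesis
    using inf_residue[OF k f place_ring_in_places[OF P]] xvar_not_in_inf z by (auto simp: place_ring_def)
next
  case (Some cb)
  obtain c b where P': "P = Some (c, b)" using Some by (cases cb) auto
  note P0 = P[unfolded P']
  have PU: "Some (c, b) \<in> pts UNIV" using P0 pts_mono[of k UNIV] by auto
  have ck: "c \<in> k" "b \<in> k" using P0 by (auto simp: pts_def)
  let ?R = "place_ring k (Some (c, b))"
  interpret R: valuation_ring "KK k" ?R by (rule valuation_place_ring[OF PU])
  obtain a h where ah: "a \<in> kp k" "h \<in> kp k" "at2 c b h \<noteq> 0" "z = E a / E h"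
    using fin_regular[OF k f P0, of z] z unfolding P' place_ring_def by blast
  note res = fin_place_sub(2)[OF k f P0 place_ring_in_places[OF P0] place_ring_gens(2,3)[OF P0]]
  define e where "e = at2 c b a / at2 c b h"
  have ek: "e \<in> k" unfolding e_def by (intro subfld_divide[OF k] at2_in[OF k] ck ah)
  have h0: "E h \<noteq> 0" "ordv (Some (c, b)) (E h) = 0" using ordv_E_eq_0[OF PU ah(3)] by auto
  have ih: "inverse (E h) \<in> ?R" using h0 ah E_in_KK by (auto simp: place_ring_def ordv_inverse[OF PU] E_KU intro!: KK_ops)
  have "cst (at2 c b a) = cst e * cst (at2 c b h)" using ah(3) by (simp add: e_def flip: rhom_mult[OF rhom_cst])
  hence "z - cst e = inverse (E h) * ((E a - cst (at2 c b a)) - cst e * (E h - cst (at2 c b h)))"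
    using h0 by (simp add: ah(4) field_simps)
  also have "\<dots> \<in> max_ideal ?R"
    using cst_place_ring[OF PU, of k] ek by (intro R.max_mult ih R.max_diff res ah) auto
  finally show ?thesis using ek by (auto simp: P')
qed

text \<open>Reducing the equation of the curve at \<open>R\<close> gives a constant in the maximal
  ideal, which must be 0. So (c, b) is a point, and \<open>place_ring_maximal\<close>
  applies.\<close>

lemma fin_place_eq:
  assumes k: "subfld k" and f: "f \<in> poly_over k" and R: "R \<in> places k (KK k)" and cb: "c \<in> k" "b \<in> k"
    and xM: "xvar - cst c \<in> max_ideal R" and yM: "yy - cst b \<in> max_ideal R"
  shows "Some (c, b) \<in> pts k \<and> R = place_ring k (Some (c, b))"
proof -
  interpret R: valuation_ring "KK k" R using R by (simp add: places_alt)
  have cR: "cst a \<in> R" if "a \<in> k" for a using R that by (auto simp: places_alt)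
  obtain f1 where f1: "f1 \<in> poly_over k" "f = [:-c, 1:] * f1 + [:poly f c:]"
    using poly_split_root[OF subfld_subrng[OF k] f cb(1)] by blast
  have "(xvar - cst c) + cst c \<in> R"
    using xM R.max_ideal_sub cR cb by (blast intro!: subrng_add[OF R.R])
  hence xR: "xvar \<in> R" by simp
  have "pev cst xvar f1 \<in> R"
    using f1(1) xR cR by (auto simp: pev_altdef[OF rhom_cst] poly_over_def
      intro!: subrng_sum[OF R.R] subrng_mult[OF R.R] subrng_power[OF R.R])
  hence "pev cst xvar f1 * (xvar - cst c) \<in> max_ideal R" using xM by (rule R.max_mult)
  moreover have "pev cst xvar f1 * (xvar - cst c) = pev cst xvar f - cst (poly f c)"
    by (subst f1(2)) (simp add: rhom_simps[OF rhom_pev[OF rhom_cst]] pev_pCons[OF rhom_cst] pev_0[OF rhom_cst]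
      rhom_simps[OF rhom_cst] pev_smult[OF rhom_cst] algebra_simps)
  ultimately have 1: "pev cst xvar f - cst (poly f c) \<in> max_ideal R" by simp
  have "(yy - cst b) ^ (p - 1) \<in> R" using yM R.max_ideal_sub by (intro subrng_power[OF R.R]) auto
  hence "(yy - cst b) ^ (p - 1) * (yy - cst b) \<in> max_ideal R" using yM by (rule R.max_mult)
  hence "(yy - cst b) ^ p \<in> max_ideal R" using p_ge_2 power_minus_mult[of p "yy - cst b"] by simp
  hence "((yy - cst b) ^ p - (yy - cst b)) - (pev cst xvar f - cst (poly f c)) \<in> max_ideal R"
    by (intro R.max_diff yM 1)
  also have "((yy - cst b) ^ p - (yy - cst b)) - (pev cst xvar f - cst (poly f c)) = cst (poly f c - (b ^ p - b))"
    by (simp add: rhom_frob_diff[OF rhom_cst] rhom_simps[OF rhom_cst] yvar_eq[symmetric])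
  finally have *: "cst (poly f c - (b ^ p - b)) \<in> max_ideal R" .
  have "b ^ p - b = poly f c"
  proof (rule ccontr)
    assume "b ^ p - b \<noteq> poly f c"
    hence ne: "poly f c - (b ^ p - b) \<noteq> 0" by simp
    have "poly f c - (b ^ p - b) \<in> k"
      using subfld_subrng[OF k] cb f by (intro subrng_diff subrng_power poly_poly_over)
    hence "cst (inverse (poly f c - (b ^ p - b))) * cst (poly f c - (b ^ p - b)) \<in> max_ideal R"
      by (intro R.max_mult * cR subfld_inverse[OF k])
    thus False using ne R.one_not_max
      by (simp add: rhom_1[OF rhom_cst] del: right_diff_distrib left_diff_distrib flip: rhom_mult[OF rhom_cst])
  qed
  hence P: "Some (c, b) \<in> pts k" using cb by (auto simp: pts_def)
  thus ?thesis using place_ring_maximal[OF P R fin_place_sub(1)[OF k f P R xM yM]] by simp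
qed

text \<open>y is integral over k[x]: otherwise dividing the equation by y^p would express 1 by
  elements of the maximal ideal.\<close>

lemma y_in_R:
  assumes k: "subfld k" and f: "f \<in> poly_over k" and R: "R \<in> places k (KK k)" and xR: "xvar \<in> R"
  shows "yy \<in> R" "q \<in> poly_over k \<Longrightarrow> pev cst xvar q \<in> R"
proof -
  interpret R: valuation_ring "KK k" R using R by (simp add: places_alt)
  have cR: "cst a \<in> R" if "a \<in> k" for a using R that by (auto simp: places_alt)
  have pevR: "pev cst xvar q \<in> R" if "q \<in> poly_over k" for q
    using that xR cR by (auto simp: pev_altdef[OF rhom_cst] poly_over_def
      intro!: subrng_sum[OF R.R] subrng_mult[OF R.R] subrng_power[OF R.R])
  thus "q \<in> poly_over k \<Longrightarrow> pev cst xvar q \<in> R" .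
  show "yy \<in> R"
  proof (rule ccontr)
    assume "yy \<notin> R"
    hence yi: "inverse yy \<in> max_ideal R" by (intro R.not_in_R KK_gen)
    have M: "inverse yy ^ n \<in> max_ideal R" if "n > 0" for n
      using that yi R.max_ideal_sub
      by (cases n) (auto intro!: R.max_mult[OF _ yi] subrng_power[OF R.R] simp: power_Suc2 simp del: power_Suc)
    have "pev cst xvar f * inverse yy ^ p \<in> max_ideal R"
      using p_ge_2 by (intro R.max_mult M pevR f) simp
    hence "pev cst xvar f * inverse yy ^ p + inverse yy ^ (p - 1) \<in> max_ideal R"
      using p_ge_2 by (intro R.max_add M) simp_all
    moreover have "pev cst xvar f * inverse yy ^ p + inverse yy ^ (p - 1) = 1"
    proof -
      have "yy ^ p = yy ^ (p - 1) * yy" using power_minus_mult[of p yy] p_ge_2 by simp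
      thus ?thesis using yy_neq_0 by (simp add: yvar_eq[symmetric] field_simps)
    qed
    ultimately show False using R.one_not_max by simp
  qed
qed

text \<open>Rationality supplies residues c and b of x and y in \<open>k\<close>, and these
  determine the place.\<close>

lemma rational_places_eq:
  assumes k: "subfld k" and f: "f \<in> poly_over k"
  shows "rational_places k (KK k) = place_ring k ` pts k"
proof
  show "place_ring k ` pts k \<subseteq> rational_places k (KK k)"
    using rational_residue[OF k f] place_ring_in_places by (auto simp: rational_places_def)
  show "rational_places k (KK k) \<subseteq> place_ring k ` pts k"
  proof
    fix R assume "R \<in> rational_places k (KK k)"
    hence R: "R \<in> places k (KK k)" and rat: "\<And>z. z \<in> R \<Longrightarrow> \<exists>c\<in>k. z - cst c \<in> max_ideal R"
      by (auto simp: rational_places_def)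
    show "R \<in> place_ring k ` pts k"
    proof (cases "xvar \<in> R")
      case False
      thus ?thesis using inf_unique[OF k f R False] by (auto simp: pts_def)
    next
      case True
      obtain c b where "c \<in> k" "xvar - cst c \<in> max_ideal R" "b \<in> k" "yy - cst b \<in> max_ideal R"
        using rat[OF True] rat[OF y_in_R(1)[OF k f R True]] by blast
      thus ?thesis using fin_place_eq[OF k f R] by blast
    qed
  qed
qed

text \<open>The ring contains x exactly at affine points, and there the residues of x and y recover
  the coordinates.\<close>

lemma inj_place_ring: "inj_on (place_ring k) (pts k)"
proof (rule inj_onI)
  fix P Q assume P: "P \<in> pts k" and Q: "Q \<in> pts k" and eq: "place_ring k P = place_ring k Q"
  show "P = Q"
  proof (cases "P = None \<or> Q = None")
    case True
    thus ?thesis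
    proof (cases "P = None \<and> Q = None")
      case False
      hence "xvar \<in> place_ring k P \<longleftrightarrow> xvar \<notin> place_ring k Q"
        using True place_ring_gens(1)[of _ _ k] P Q by (cases P; cases Q) (auto simp: xvar_not_in_inf)
      thus ?thesis using eq by simp
    qed auto
  next
    case False
    then obtain c b c' b' where PQ: "P = Some (c, b)" "Q = Some (c', b')" by auto
    have PU: "P \<in> pts UNIV" using P pts_mono[of k UNIV] by auto
    interpret R: valuation_ring "KK k" "place_ring k P" by (rule valuation_place_ring[OF PU])
    have c0: "a = 0" if "cst a \<in> max_ideal (place_ring k P)" for a :: 'k
      using that by (auto simp: max_place_ring[OF PU] ordv_0_cst[OF PU] rhom_eq_0_iff[OF rhom_cst])
    have m: "xvar - cst c \<in> max_ideal (place_ring k P)" "xvar - cst c' \<in> max_ideal (place_ring k P)"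
      "yy - cst b \<in> max_ideal (place_ring k P)" "yy - cst b' \<in> max_ideal (place_ring k P)"
      using place_ring_gens(2,3)[of c b k] place_ring_gens(2,3)[of c' b' k] P Q eq unfolding PQ by simp_all
    have "(xvar - cst c) - (xvar - cst c') \<in> max_ideal (place_ring k P)"
      by (rule R.max_diff[OF m(1,2)])
    moreover have "(yy - cst b) - (yy - cst b') \<in> max_ideal (place_ring k P)"
      by (rule R.max_diff[OF m(3,4)])
    ultimately have "cst (c' - c) \<in> max_ideal (place_ring k P)" "cst (b' - b) \<in> max_ideal (place_ring k P)"
      by (simp_all add: rhom_simps[OF rhom_cst])
    hence "c' - c = 0" "b' - b = 0" using c0 by blast+
    thus ?thesis by (simp add: PQ)
  qed
qed

text \<open>The summand 1 is the place at infinity, which is rational over every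
  \<open>k\<close>.\<close>

lemma card_rational_places:
  assumes k: "subfld k" and f: "f \<in> poly_over k" and fin: "finite k"
  shows "card (rational_places k (KK k)) = 1 + card {(c, b). c \<in> k \<and> b \<in> k \<and> b ^ p - b = poly f c}"
proof -
  have "finite {(c, b). c \<in> k \<and> b \<in> k \<and> b ^ p - b = poly f c}"
    by (rule finite_subset[of _ "k \<times> k"]) (use fin in auto)
  thus ?thesis
    unfolding rational_places_eq[OF k f] card_image[OF inj_place_ring]
    unfolding pts_def by (subst card_insert_disjoint) (auto simp: card_image)
qed

text \<open>A nonzero combination \<open>D\<close> of \<open>r\<close> and \<open>mp\<close> of
  least degree in y divides \<open>mp\<close> up to a factor in k[x]. If its degree were positive,
  this multiple of \<open>mp\<close> would be a product of two factors of degree below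
  \<open>p\<close>, against \<open>generic_independent\<close>; so \<open>D\<close> lies in
  k[x].\<close>

lemma bezout_x:
  assumes "E h \<noteq> 0"
  obtains a c where "c \<noteq> 0" "E a * E h = pev cst xvar c"
proof -
  obtain r q where r: "degree r < p" "h = mp * q + r"
    using reduce_degree[of UNIV h] by (auto simp: poly_over_UNIV subrng_def)
  have Emp: "E mp = 0" by (intro ev_mp rhom_cst yvar_eq)
  have Er: "E h = E r" by (simp add: r Emp E_simps)
  hence r0: "r \<noteq> 0" using assms by (auto simp: E_simps)
  let ?P = "\<lambda>D. D \<noteq> 0 \<and> (\<exists>a b. D = a * r + b * mp)"
  have "r = 1 * r + 0 * mp" by simp
  hence Pr: "?P r" using r0 by blast
  have "\<exists>D. ?P D \<and> (\<forall>D'. ?P D' \<longrightarrow> degree D \<le> degree D')" by (rule ex_has_least_nat[of ?P r, OF Pr])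
  then obtain D where D: "?P D" and min: "\<And>D'. ?P D' \<Longrightarrow> degree D \<le> degree D'" by blast
  obtain a b where ab: "D = a * r + b * mp" using D by blast
  have dD: "degree D < p" using min[OF Pr] r by simp
  obtain kap rho where kr: "pseudo_divmod mp D = (kap, rho)" by fastforce
  define e where "e = coeff D (degree D) ^ (Suc (degree mp) - degree D)"
  have eq: "smult e mp = D * kap + rho" and rho: "rho = 0 \<or> degree rho < degree D"
    using pseudo_divmod[OF _ kr] D by (auto simp: e_def)
  have e0: "e \<noteq> 0" using D by (auto simp: e_def)
  have "rho = smult e mp - D * kap" using eq by simp
  also have "\<dots> = (- a * kap) * r + ([:e:] - b * kap) * mp" unfolding ab by (simp add: algebra_simps)
  finally have "?P rho" if "rho \<noteq> 0" using that by blast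
  hence "rho = 0" using rho min[of rho] by fastforce
  hence eq: "smult e mp = D * kap" using eq by simp
  have kap0: "kap \<noteq> 0" using eq e0 mp_neq_0 by auto
  have deg: "p = degree D + degree kap"
    using arg_cong[OF eq, of degree] D kap0 e0 by (simp add: degree_mp degree_mult_eq)
  have "degree D = 0"
  proof (rule ccontr)
    assume "degree D \<noteq> 0"
    hence "E D \<noteq> 0" "E kap \<noteq> 0" using generic_independent[OF generic_E] D kap0 dD deg by auto
    moreover have "E (smult e mp) = 0" by (simp add: ev_smult[OF rhom_cst] Emp)
    ultimately show False by (simp add: eq E_simps)
  qed
  then obtain c where c: "D = [:c:]" using degree_eq_zeroE by blast
  have "E a * E h = E D" unfolding ab Er by (simp add: E_simps Emp)
  moreover have "c \<noteq> 0" using D c by auto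
  ultimately show ?thesis using that[of c a] c by (simp add: ev_const[OF rhom_cst])
qed

lemma KU_form:
  assumes "z \<in> KU"
  obtains g c where "c \<noteq> 0" "z = E g / pev cst xvar c"
proof -
  obtain g h where gh: "E h \<noteq> 0" "z = E g / E h" using KU_cases[OF assms] by blast
  obtain a c where ac: "c \<noteq> 0" "E a * E h = pev cst xvar c" by (rule bezout_x[OF gh(1)])
  have "pev cst xvar c \<noteq> 0" using ac by (simp add: pev_cst_xvar)
  hence "E a \<noteq> 0" using ac by auto
  hence "z = E (g * a) / pev cst xvar c" using gh by (simp add: E_simps flip: ac(2))
  thus ?thesis using that ac by blast
qed

text \<open>The polynomial splits into linear factors and the maximal ideal is prime, so one of the
  factors lies in it.\<close>

lemma closed_residue:
  assumes R: "R \<in> places UNIV KU" and t: "t \<in> R" and "q \<noteq> 0" "pev cst t q \<in> max_ideal R"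
  shows "\<exists>c. t - cst c \<in> max_ideal R"
  using assms(3,4)
proof (induction "degree q" arbitrary: q rule: less_induct)
  case less
  interpret R: valuation_ring KU R using R by (simp add: places_alt)
  have cR: "cst a \<in> R" for a using R by (auto simp: places_alt)
  have cM: "a = 0" if "cst a \<in> max_ideal R" for a
  proof (rule ccontr)
    assume "a \<noteq> 0"
    have "cst (inverse a) * cst a \<in> max_ideal R" by (intro R.max_mult that cR)
    thus False using \<open>a \<noteq> 0\<close> R.one_not_max by (simp add: rhom_1[OF rhom_cst] flip: rhom_mult[OF rhom_cst])
  qed
  show ?case
  proof (cases "degree q = 0")
    case True
    then obtain a where "q = [:a:]" using degree_eq_zeroE by blast
    thus ?thesis using less.prems cM by (auto simp: pev_const[OF rhom_cst])
  next
    case False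
    then obtain c where "poly q c = 0" using alg_closed_imp_poly_has_root[of q] by auto
    then obtain r where r: "q = [:-c, 1:] * r" by (auto simp: poly_eq_0_iff_dvd)
    have r0: "r \<noteq> 0" using r less.prems by auto
    have "degree q = degree [:-c, 1:] + degree r" unfolding r using r0 by (intro degree_mult_eq) auto
    hence lt: "degree r < degree q" by simp
    have pr: "pev cst t r \<in> R"
      using t cR by (auto simp: pev_altdef[OF rhom_cst] intro!: subrng_sum[OF R.R] subrng_mult[OF R.R] subrng_power[OF R.R])
    have tc: "t - cst c \<in> R" by (intro subrng_diff[OF R.R] t cR)
    have "pev cst t q = (t - cst c) * pev cst t r"
      by (simp add: r rhom_simps[OF rhom_pev[OF rhom_cst]] pev_pCons[OF rhom_cst] pev_0[OF rhom_cst]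
        rhom_simps[OF rhom_cst] pev_smult[OF rhom_cst] algebra_simps)
    hence "t - cst c \<in> max_ideal R \<or> pev cst t r \<in> max_ideal R"
      using R.prime_max[OF tc pr] less.prems by simp
    thus ?thesis using less.hyps[OF lt r0] by blast
  qed
qed

lemma places_UNIV_eq: "places UNIV KU = place_ring UNIV ` pts UNIV"
proof
  have fU: "f \<in> poly_over UNIV" by (simp add: poly_over_UNIV)
  show "place_ring UNIV ` pts UNIV \<subseteq> places UNIV KU" using place_ring_in_places by auto
  show "places UNIV KU \<subseteq> place_ring UNIV ` pts UNIV"
  proof
    fix R assume R: "R \<in> places UNIV KU"
    interpret R: valuation_ring KU R using R by (simp add: places_alt)
    show "R \<in> place_ring UNIV ` pts UNIV"
    proof (cases "xvar \<in> R")
      case False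
      thus ?thesis using inf_unique[OF subfld_UNIV fU R False] by (auto simp: pts_def)
    next
      case True
      note yR = y_in_R(1)[OF subfld_UNIV fU R True] and pR = y_in_R(2)[OF subfld_UNIV fU R True, unfolded poly_over_UNIV, OF UNIV_I]
      have ER: "E g \<in> R" for g
        using yR pR by (auto simp: ev_altdef[OF rhom_cst] intro!: subrng_sum[OF R.R] subrng_mult[OF R.R] subrng_power[OF R.R])
      \<comment> \<open>If no nonzero polynomial in x were in the maximal ideal, all denominators in
        \<open>KU_form\<close> would be invertible and \<open>R\<close> would be the whole
        field.\<close>
      have "\<exists>q. q \<noteq> 0 \<and> pev cst xvar q \<in> max_ideal R"
      proof (rule ccontr)
        assume no: "\<not> ?thesis"
        have "z \<in> R" if "z \<in> KU" for z
        proof -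
          obtain g c where gc: "c \<noteq> 0" "z = E g / pev cst xvar c" by (rule KU_form[OF \<open>z \<in> KU\<close>])
          have "inverse (pev cst xvar c) \<in> R" using no gc by (intro R.unit_inverse pR) auto
          thus ?thesis using ER by (simp add: gc divide_inverse subrng_mult[OF R.R])
        qed
        thus False using R R.R_sub_K by (auto simp: places_alt)
      qed
      then obtain c where c: "xvar - cst c \<in> max_ideal R" using closed_residue[OF R True] by blast
      \<comment> \<open>The value of Y^p - Y - f(c) at y lies in the maximal ideal, so
        \<open>closed_residue\<close> also yields the residue b of y.\<close>
      define Q where "Q = monom 1 p - monom 1 1 - [:poly f c:]"
      have "coeff Q p = 1" using p_ge_2 by (auto simp: Q_def coeff_pCons split: nat.splits)
      hence Q0: "Q \<noteq> 0" by auto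
      obtain f1 where f1: "f = [:-c, 1:] * f1 + [:poly f c:]"
        using poly_split_root[OF subfld_subrng[OF subfld_UNIV] fU, of c] by auto
      have "pev cst yy Q = pev cst xvar f - cst (poly f c)"
        by (simp add: Q_def rhom_simps[OF rhom_pev[OF rhom_cst]] pev_monom[OF rhom_cst] pev_const[OF rhom_cst]
          rhom_1[OF rhom_cst] yvar_eq)
      also have "\<dots> = pev cst xvar f1 * (xvar - cst c)"
        by (subst f1) (simp add: rhom_simps[OF rhom_pev[OF rhom_cst]] pev_pCons[OF rhom_cst] pev_0[OF rhom_cst]
          rhom_simps[OF rhom_cst] pev_smult[OF rhom_cst] algebra_simps)
      also have "\<dots> \<in> max_ideal R" by (intro R.max_mult c pR)
      finally obtain b where "yy - cst b \<in> max_ideal R" using closed_residue[OF R yR Q0] by blast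
      thus ?thesis using fin_place_eq[OF subfld_UNIV fU R UNIV_I UNIV_I c] by blast
    qed
  qed
qed

end

section \<open>A lower bound for the genus\<close>

lemma vector_space_cst: "vector_space (\<lambda>c z. cst c * z :: 'k::field ratfun_closure)"
  by unfold_locales (simp_all add: rhom_simps[OF rhom_cst] algebra_simps)

interpretation VS: vector_space "\<lambda>c z. cst c * z :: 'k::field ratfun_closure"
  by (rule vector_space_cst)

context as_curve
begin

lemma cst_inverse: "cst (inverse a) = inverse (cst (a :: 'k))"
  using cst_divide[of 1 a] by (simp add: rhom_1[OF rhom_cst] inverse_eq_divide)

lemma ex_ord_1: "P \<in> pts UNIV \<Longrightarrow> \<exists>t\<in>KU. t \<noteq> 0 \<and> ordv P t = 1"
proof (cases P)
  case None
  \<comment> \<open>Since \<open>p\<close> and \<open>d\<close> are coprime, some monomial with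
    integer exponents has order 1 at infinity.\<close>
  obtain u v where uv: "int p * u + int d * v = 1"
    using bezout_int[of "int p" "int d"] coprime_pd by (auto simp: mult.commute)
  have "ordv P (mon (- u) (- v)) = 1" using uv by (simp add: None ordv_mon)
  thus ?thesis using mon_neq_0 mon_KK by blast
next
  case (Some cb)
  assume "P \<in> pts UNIV"
  moreover obtain c b where "P = Some (c, b)" using Some by (cases cb) auto
  ultimately show ?thesis using ordv_x_minus_c[of c b] x_minus_c(2)[of c] cst_KU KK_gen
    by (intro bexI[of _ "xvar - cst c"] KK_ops) auto
qed

text \<open>Lets the definition of the genus, which quantifies over uniformizers, be read in terms
  of \<open>ordv\<close>.\<close>

lemma uniformizer_iff:
  assumes P: "P \<in> pts UNIV"
  shows "uniformizer (place_ring UNIV P) t \<longleftrightarrow> t \<in> KU \<and> t \<noteq> 0 \<and> ordv P t = 1"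
proof
  assume t: "t \<in> KU \<and> t \<noteq> 0 \<and> ordv P t = 1"
  have "max_ideal (place_ring UNIV P) = (\<lambda>z. t * z) ` place_ring UNIV P"
  proof
    show "(\<lambda>z. t * z) ` place_ring UNIV P \<subseteq> max_ideal (place_ring UNIV P)"
    proof safe
      fix z assume z: "z \<in> place_ring UNIV P"
      have "t * z = 0 \<or> 0 < ordv P (t * z)"
        using t z ordv_mult[OF P, of t z] by (cases "z = 0") (auto simp: place_ring_def)
      moreover have "t * z \<in> KU" using t z by (auto simp: place_ring_def intro: KK_ops)
      ultimately show "t * z \<in> max_ideal (place_ring UNIV P)"
        unfolding max_place_ring[OF P] by blast
    qed
    show "max_ideal (place_ring UNIV P) \<subseteq> (\<lambda>z. t * z) ` place_ring UNIV P"
    proof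
      fix z assume z: "z \<in> max_ideal (place_ring UNIV P)"
      have "ordv P (z * inverse t) = ordv P z - 1" if "z \<noteq> 0"
        using that t z by (subst ordv_mult[OF P]) (auto simp: max_place_ring[OF P] ordv_inverse[OF P] KK_ops)
      hence "0 \<le> ordv P (z * inverse t)" using z ordv_0_cst[OF P] by (cases "z = 0") (auto simp: max_place_ring[OF P])
      moreover have "z * inverse t \<in> KU" using z t unfolding max_place_ring[OF P] by (auto intro: KK_ops)
      ultimately have "z * inverse t \<in> place_ring UNIV P" by (simp add: place_ring_def)
      moreover have "z = t * (z * inverse t)" using t by simp
      ultimately show "z \<in> (\<lambda>z. t * z) ` place_ring UNIV P" by blast
    qed
  qed
  thus "uniformizer (place_ring UNIV P) t" using t by (auto simp: uniformizer_def place_ring_def)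
next
  assume t: "uniformizer (place_ring UNIV P) t"
  obtain s where s: "s \<in> KU" "s \<noteq> 0" "ordv P s = 1" using ex_ord_1[OF P] by blast
  hence "s \<in> max_ideal (place_ring UNIV P)" by (simp add: max_place_ring[OF P])
  then obtain z where z: "z \<in> place_ring UNIV P" "s = t * z" using t by (auto simp: uniformizer_def)
  have tK: "t \<in> KU" using t by (auto simp: uniformizer_def place_ring_def)
  have nz: "t \<noteq> 0" "z \<noteq> 0" using z s by auto
  have "1 \<in> place_ring UNIV P" by (simp add: place_ring_def ordv_0_cst[OF P] KK_ops)
  hence "t * 1 \<in> max_ideal (place_ring UNIV P)" using t unfolding uniformizer_def by blast
  hence "0 < ordv P t" using nz by (auto simp: max_place_ring[OF P])
  moreover have "ordv P t + ordv P z = 1" using ordv_mult[OF P, of t z] nz tK z s by (simp add: place_ring_def)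
  ultimately show "t \<in> KU \<and> t \<noteq> 0 \<and> ordv P t = 1" using tK nz z by (simp add: place_ring_def)
qed

text \<open>The space of a divisor that is given by its multiplicities at points instead of
  places.\<close>

definition LL :: "(('k \<times> 'k) option \<Rightarrow> int) \<Rightarrow> 'k ratfun_closure set" where
  "LL n = {z \<in> KU. z \<noteq> 0 \<longrightarrow> (\<forall>P\<in>pts UNIV. 0 \<le> ordv P z + n P)}"

lemma riemann_roch_space_eq: "riemann_roch_space KU D = LL (\<lambda>P. D (place_ring UNIV P))"
proof -
  have "(\<forall>t. uniformizer (place_ring UNIV P) t \<longrightarrow> z * t powi n \<in> place_ring UNIV P)
      \<longleftrightarrow> (z \<noteq> 0 \<longrightarrow> 0 \<le> ordv P z + n)" if P: "P \<in> pts UNIV" and z: "z \<in> KU" for P z n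
  proof -
    have *: "z * t powi n \<in> place_ring UNIV P \<longleftrightarrow> (z \<noteq> 0 \<longrightarrow> 0 \<le> ordv P z + n)"
      if "uniformizer (place_ring UNIV P) t" for t
    proof -
      have t: "t \<in> KU" "t \<noteq> 0" "ordv P t = 1" using that uniformizer_iff[OF P] by auto
      have "ordv P (z * t powi n) = ordv P z + n" if "z \<noteq> 0"
        using that t z by (subst ordv_mult[OF P]) (auto simp: ordv_powi[OF P] KK_ops power_int_not_zero)
      moreover have "z * t powi n \<in> KU" using z t by (intro KK_ops)
      ultimately show ?thesis by (cases "z = 0") (auto simp: place_ring_def ordv_0_cst[OF P])
    qed
    moreover have "\<exists>t. uniformizer (place_ring UNIV P) t" using ex_ord_1[OF P] uniformizer_iff[OF P] by blast
    ultimately show ?thesis by blast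
  qed
  thus ?thesis unfolding riemann_roch_space_def LL_def places_UNIV_eq by auto
qed

lemma LL_mono: "(\<And>P. P \<in> pts UNIV \<Longrightarrow> n P \<le> n' P) \<Longrightarrow> LL n \<subseteq> LL n'"
  unfolding LL_def by fastforce

lemma LL_cong: "(\<And>P. P \<in> pts UNIV \<Longrightarrow> n P = n' P) \<Longrightarrow> LL n = LL n'"
  by (intro antisym LL_mono) auto

lemma LL_cmult: "z \<in> LL n \<Longrightarrow> cst c * z \<in> LL n"
proof (cases "cst c * z = 0")
  case False
  assume z: "z \<in> LL n"
  have "ordv P (cst c * z) = ordv P z" if "P \<in> pts UNIV" for P
    using False z by (subst ordv_mult[OF that]) (auto simp: LL_def ordv_0_cst[OF that] cst_KU)
  thus ?thesis using z False by (auto simp: LL_def cst_KU KK_ops)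
next
  case True
  show ?thesis unfolding True by (simp add: LL_def KK_ops)
qed

lemma LL_add: "z \<in> LL n \<Longrightarrow> w \<in> LL n \<Longrightarrow> z + w \<in> LL n"
proof -
  assume zw: "z \<in> LL n" "w \<in> LL n"
  show ?thesis
  proof (cases "z = 0 \<or> w = 0")
    case False
    have "- n P \<le> ordv P (z + w)" if "P \<in> pts UNIV" "z + w \<noteq> 0" for P
    proof -
      have "- n P \<le> ordv P z" "- n P \<le> ordv P w" using zw False that(1) by (force simp: LL_def)+
      thus ?thesis using zw that by (intro ordv_add[OF that(1)]) (auto simp: LL_def)
    qed
    thus ?thesis using zw by (force simp: LL_def intro: KK_ops)
  qed (use zw in auto)
qed

text \<open>If the space grows, let \<open>v0\<close> be new. For \<open>v\<close> in the larger
  space, v / v0 is regular at \<open>P\<close>, and subtracting its residue times \<open>v0\<close>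
  from \<open>v\<close> gains one order; so \<open>v0\<close> and the old basis span.\<close>

lemma dim_step:
  assumes P: "P \<in> pts UNIV" and fd: "LL (n(P := n P + 1)) \<subseteq> VS.span F" "finite F"
  shows "VS.dim (LL (n(P := n P + 1))) \<le> VS.dim (LL n) + 1"
proof -
  let ?n' = "n(P := n P + 1)"
  have sub: "LL n \<subseteq> LL ?n'" by (rule LL_mono) auto
  obtain B where B: "B \<subseteq> LL n" "VS.independent B" "LL n \<subseteq> VS.span B" "card B = VS.dim (LL n)"
    using VS.basis_exists by blast
  have finB: "finite B" using VS.independent_span_bound[OF fd(2) B(2)] B(1) sub fd(1) by blast
  show ?thesis
  proof (cases "LL ?n' \<subseteq> LL n")
    case True
    hence "LL ?n' = LL n" using sub by auto
    thus ?thesis by simp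
  next
    case False
    then obtain v0 where v0: "v0 \<in> LL ?n'" "v0 \<notin> LL n" by blast
    have v0': "v0 \<in> KU" "v0 \<noteq> 0" using v0 by (auto simp: LL_def)
    obtain Q where "Q \<in> pts UNIV" "ordv Q v0 + n Q < 0" using v0 v0' by (auto simp: LL_def not_le)
    moreover from this have "0 \<le> ordv Q v0 + ?n' Q" using v0 v0' by (simp add: LL_def)
    ultimately have ord0: "ordv P v0 = - n P - 1" by (cases "Q = P") auto
    have "LL ?n' \<subseteq> VS.span (insert v0 B)"
    proof
      fix v assume v: "v \<in> LL ?n'"
      define u where "u = v * inverse v0"
      have uK: "u \<in> KU" using v v0' by (auto simp: u_def LL_def intro: KK_ops)
      have "0 \<le> ordv P u"
      proof (cases "v = 0")
        case False
        have "ordv P u = ordv P v - ordv P v0"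
          unfolding u_def using v v0' False by (subst ordv_mult[OF P]) (auto simp: LL_def ordv_inverse[OF P] KK_ops)
        moreover have "0 \<le> ordv P v + (n P + 1)" using v False P by (auto simp: LL_def)
        ultimately show ?thesis using ord0 by simp
      qed (simp add: u_def ordv_0_cst[OF P])
      then obtain c where c: "u - cst c = 0 \<or> 0 < ordv P (u - cst c)" using ordv_residue[OF P uK] by blast
      define w where "w = v + cst (- c) * v0"
      have w: "w \<in> LL ?n'" unfolding w_def by (intro LL_add LL_cmult v v0)
      have weq: "w = (u - cst c) * v0" using v0' by (simp add: w_def u_def rhom_simps[OF rhom_cst] algebra_simps)
      have "w \<in> LL n"
      proof (cases "w = 0")
        case False
        have ne: "u - cst c \<noteq> 0" using False weq by auto
        have "ordv P w = ordv P (u - cst c) + ordv P v0"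
          unfolding weq using ne v0' uK by (intro ordv_mult[OF P] KK_ops cst_KU) auto
        hence "0 \<le> ordv P w + n P" using ord0 c ne by simp
        moreover have "0 \<le> ordv Q w + n Q" if "Q \<in> pts UNIV" "Q \<noteq> P" for Q
          using w False that by (auto simp: LL_def)
        ultimately show ?thesis using w by (auto simp: LL_def)
      qed (simp add: LL_def KK_ops)
      hence "w \<in> VS.span (insert v0 B)" using B(3) VS.span_mono[of B "insert v0 B"] by blast
      moreover have "cst c * v0 \<in> VS.span (insert v0 B)" by (intro VS.span_scale VS.span_base) simp
      ultimately have "w + cst c * v0 \<in> VS.span (insert v0 B)" by (rule VS.span_add)
      thus "v \<in> VS.span (insert v0 B)" by (simp add: w_def rhom_simps[OF rhom_cst])
    qed
    hence "VS.dim (LL ?n') \<le> card (insert v0 B)" using finB by (intro VS.dim_le_card) auto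
    also have "\<dots> \<le> card B + 1" using finB by (simp add: card_insert_if)
    finally show ?thesis using B by simp
  qed
qed

text \<open>Adding a point raises the degree by 1 and the dimension by at most 1. Hence degree minus
  dimension can be bounded by passing to a larger divisor whose space is known.\<close>

lemma deg_dim_mono:
  assumes "finite A" "A \<subseteq> pts UNIV" "\<And>P. P \<in> A \<Longrightarrow> n P \<le> n' P" "\<And>P. P \<in> pts UNIV - A \<Longrightarrow> n P = n' P"
    and fd: "LL n' \<subseteq> VS.span F" "finite F"
  shows "(\<Sum>P\<in>A. n P) - int (VS.dim (LL n)) \<le> (\<Sum>P\<in>A. n' P) - int (VS.dim (LL n'))"
  using assms(3,4)
proof (induction "nat (\<Sum>P\<in>A. n' P - n P)" arbitrary: n rule: less_induct)
  case less
  show ?case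
  proof (cases "\<exists>P\<in>A. n P \<noteq> n' P")
    case False
    hence "LL n = LL n'" using less.prems by (intro LL_cong) auto
    moreover have "(\<Sum>P\<in>A. n P) = (\<Sum>P\<in>A. n' P)" using False by (intro sum.cong) auto
    ultimately show ?thesis by simp
  next
    case True
    then obtain P where P: "P \<in> A" "n P < n' P" using less.prems(1) by force
    have PU: "P \<in> pts UNIV" using P assms(2) by auto
    let ?m = "n(P := n P + 1)"
    have m: "\<And>Q. Q \<in> A \<Longrightarrow> ?m Q \<le> n' Q" "\<And>Q. Q \<in> pts UNIV - A \<Longrightarrow> ?m Q = n' Q"
      using less.prems P by auto
    have sm: "(\<Sum>Q\<in>A. ?m Q) = (\<Sum>Q\<in>A. n Q) + 1"
      using P(1) assms(1) by (simp add: sum.remove[of A P])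
    have "0 \<le> (\<Sum>P\<in>A. n' P - ?m P)" using m by (intro sum_nonneg) (simp add: algebra_simps)
    hence "nat (\<Sum>P\<in>A. n' P - ?m P) < nat (\<Sum>P\<in>A. n' P - n P)"
      using sm by (simp add: sum_subtractf)
    from less.hyps[OF this m] have "(\<Sum>P\<in>A. ?m P) - int (VS.dim (LL ?m)) \<le> (\<Sum>P\<in>A. n' P) - int (VS.dim (LL n'))" .
    moreover have "LL ?m \<subseteq> LL n'" using m by (intro LL_mono) (metis DiffI order_refl)
    hence "VS.dim (LL ?m) \<le> VS.dim (LL n) + 1" using fd by (intro dim_step[OF PU]) auto
    ultimately show ?thesis using sm by linarith
  qed
qed

lemma of_nat_frob: "(of_nat i :: 'k) ^ p = of_nat i"
  using p_ge_2 by (induction i) (simp_all add: frob_add power_0_left)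

text \<open>The fibre is a coset of the prime field.\<close>

lemma card_fibre: "card {b. b ^ p - b = (a :: 'k)} = p" "finite {b. b ^ p - b = (a :: 'k)}"
proof -
  define Q where "Q = monom 1 p + (- monom 1 1 - [:a:])"
  have "degree (- monom 1 1 - [:a:]) < degree (monom 1 p :: 'k poly)"
    using p_ge_2 by (intro le_less_trans[OF degree_diff_le_max]) (auto simp: degree_monom_eq)
  hence dQ: "degree Q = p"
    unfolding Q_def by (subst degree_add_eq_left) (simp_all add: degree_monom_eq)
  have Q0: "Q \<noteq> 0" using dQ p_ge_2 by auto
  have set: "{b. b ^ p - b = a} = {b. poly Q b = 0}"
    by (auto simp: Q_def poly_monom algebra_simps)
  show fin: "finite {b. b ^ p - b = a}" unfolding set using Q0 by (rule poly_roots_finite)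
  have "card {b. b ^ p - b = a} \<le> p" unfolding set using card_poly_roots_bound[OF Q0] dQ by simp
  moreover have "p \<le> card {b. b ^ p - b = a}"
  proof -
    obtain b where b: "poly Q b = 0" using alg_closed_imp_poly_has_root[of Q] dQ p_ge_2 by auto
    hence b: "b ^ p - b = a" using set by auto
    have inj: "inj_on (\<lambda>i. b + of_nat i) {..<p}"
    proof (rule inj_onI)
      fix i j assume ij: "i \<in> {..<p}" "j \<in> {..<p}" "b + of_nat i = b + of_nat j"
      show "i = j"
        using ij of_nat_eq_iff_char_dvd[of i j, where 'a='k] of_nat_eq_iff_char_dvd[of j i, where 'a='k] char_p
          dvd_imp_le[of p "j - i"] dvd_imp_le[of p "i - j"]
        by (cases i j rule: linorder_cases) auto
    qed
    have "(\<lambda>i. b + of_nat i) ` {..<p} \<subseteq> {b. b ^ p - b = a}"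
      using b by (auto simp: frob_add of_nat_frob)
    from card_mono[OF fin this] show ?thesis using card_image[OF inj] by simp
  qed
  ultimately show "card {b. b ^ p - b = a} = p" by simp
qed

text \<open>The denominator in x is removed root by root. At a root c the numerator, reduced to
  degree below \<open>p\<close> in y, vanishes at the \<open>p\<close> points above c, so its
  restriction to x = c is the zero polynomial and x - c can be cancelled.\<close>

lemma regular_fin:
  assumes "z \<in> KU" "\<And>c b. Some (c, b) \<in> pts UNIV \<Longrightarrow> 0 \<le> ordv (Some (c, b)) z"
  shows "\<exists>g. degree g < p \<and> z = E g"
proof -
  have "\<exists>g. z = E g" if "q \<noteq> 0" "z = E g / pev cst xvar q" for q g
    using that
  proof (induction "degree q" arbitrary: q g rule: less_induct)
    case less
    obtain r s where r: "degree r < p" "g = mp * s + r"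
      using reduce_degree[of UNIV g] by (auto simp: poly_over_UNIV subrng_def)
    have Er: "E g = E r" using ev_mp[OF rhom_cst yvar_eq] by (simp add: r E_simps)
    have q0: "pev cst xvar q \<noteq> 0" using less.prems by (simp add: pev_cst_xvar)
    show ?case
    proof (cases "degree q = 0")
      case True
      then obtain a where "q = [:a:]" using degree_eq_zeroE by blast
      hence "z = E (pc (inverse a) * g)" using less.prems
        by (simp add: pev_const[OF rhom_cst] E_simps E_pc cst_inverse divide_inverse)
      thus ?thesis by blast
    next
      case False
      then obtain c where c: "poly q c = 0" using alg_closed_imp_poly_has_root[of q] by auto
      then obtain q' where q': "q = [:-c, 1:] * q'" by (auto simp: poly_eq_0_iff_dvd)
      have q'0: "q' \<noteq> 0" using q' less.prems by auto
      have "degree q = degree [:-c, 1:] + degree q'" unfolding q' using q'0 by (intro degree_mult_eq) auto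
      hence lt: "degree q' < degree q" by simp
      define G where "G = map_poly (\<lambda>q. poly q c) r"
      have at: "at2 c b r = poly G b" for b
      proof -
        have "pev (\<lambda>a. a) c = (\<lambda>q. poly q c)" by (simp add: fun_eq_iff pev_id)
        thus ?thesis by (simp add: at2_def ev_def pev_def[of "\<lambda>q. poly q c"] G_def)
      qed
      have "poly G b = 0" if b: "b ^ p - b = poly f c" for b
      proof (rule ccontr)
        assume ne: "poly G b \<noteq> 0"
        have P: "Some (c, b) \<in> pts UNIV" using b by (auto simp: pts_def)
        note o1 = ordv_E_eq_0[OF P, of r, unfolded at, OF ne]
        have "0 < ordv (Some (c, b)) (E [:q:])"
          using q0 c by (intro ordv_E_pos[OF P]) (auto simp: at2_gens ev_const[OF rhom_cst])
        moreover have "ordv (Some (c, b)) z = ordv (Some (c, b)) (E r) - ordv (Some (c, b)) (E [:q:])"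
        proof -
          have zq: "z = E r * inverse (E [:q:])"
            unfolding less.prems(2) Er divide_inverse ev_const[OF rhom_cst] ..
          have "E [:q:] \<noteq> 0" using q0 by (simp add: ev_const[OF rhom_cst])
          thus ?thesis unfolding zq using o1
            by (subst ordv_mult[OF P]) (auto simp: ordv_inverse[OF P E_KU] intro: KK_ops E_KU)
        qed
        ultimately show False using assms(2)[OF P] o1 by simp
      qed
      hence sub: "{b. b ^ p - b = poly f c} \<subseteq> {b. poly G b = 0}" by auto
      have "G = 0"
      proof (rule ccontr)
        assume G0: "G \<noteq> 0"
        have "p \<le> card {b. poly G b = 0}"
          using card_mono[OF poly_roots_finite[OF G0] sub] card_fibre(1) by simp
        also have "\<dots> \<le> degree G" by (rule card_poly_roots_bound[OF G0])
        also have "\<dots> \<le> degree r" unfolding G_def by (rule map_poly_degree_leq)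
        finally show False using r by simp
      qed
      hence "poly (coeff r j) c = 0" for j
        using coeff_map_poly[of "\<lambda>q. poly q c" r j] by (simp add: G_def)
      hence "[:[:-c, 1:]:] dvd r" by (simp add: const_poly_dvd_iff poly_eq_0_iff_dvd)
      then obtain r' where r': "r = [:[:-c, 1:]:] * r'" by (elim dvdE)
      have "E r = (xvar - cst c) * E r'"
        unfolding r' rhom_mult[OF rhom_E] by (simp add: ev_const[OF rhom_cst] pev_pCons[OF rhom_cst] pev_0[OF rhom_cst] rhom_simps[OF rhom_cst])
      moreover have "pev cst xvar q = (xvar - cst c) * pev cst xvar q'"
        unfolding q' rhom_mult[OF rhom_pev[OF rhom_cst]] by (simp add: pev_pCons[OF rhom_cst] pev_0[OF rhom_cst] rhom_simps[OF rhom_cst])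
      ultimately have "z = E r' / pev cst xvar q'"
        using x_minus_c(2)[of c] less.prems Er by simp
      thus ?thesis by (rule less.hyps[OF lt q'0])
    qed
  qed
  moreover obtain g0 q where "q \<noteq> 0" "z = E g0 / pev cst xvar q" by (rule KU_form[OF assms(1)])
  ultimately obtain g where g: "z = E g" by blast
  obtain r s where r: "degree r < p" "g = mp * s + r"
    using reduce_degree[of UNIV g] by (auto simp: poly_over_UNIV subrng_def)
  have "E g = E r" using ev_mp[OF rhom_cst yvar_eq] by (simp add: r E_simps)
  thus ?thesis using r g by auto
qed

end

section \<open>Spaces of functions with prescribed poles, and the genus\<close>

context as_curve
begin

interpretation VS: vector_space "\<lambda>c z. cst c * z :: 'k ratfun_closure"
  by (rule vector_space_cst)

text \<open>Exponents of the monomials with a pole of order at most \<open>r\<close> at infinity.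
  They index a basis of the functions that have no other pole and respect this bound.\<close>

definition wts :: "nat \<Rightarrow> (nat \<times> nat) set" where
  "wts r = {(i, j). j < p \<and> p * i + d * j \<le> r}"

lemma finite_wts: "finite (wts r)"
proof (rule finite_subset)
  show "wts r \<subseteq> {..r} \<times> {..<p}"
  proof
    fix x assume "x \<in> wts r"
    then obtain i j where ij: "x = (i, j)" "j < p" "p * i + d * j \<le> r" by (auto simp: wts_def)
    have "1 * i \<le> p * i" using p_ge_2 by (intro mult_le_mono1) simp
    hence "i \<le> r" using ij(3) by linarith
    thus "x \<in> {..r} \<times> {..<p}" using ij by simp
  qed
qed auto

definition val :: "nat \<times> nat \<Rightarrow> nat" where
  "val = (\<lambda>(i, j). p * i + d * j)"

lemma inj_val: "inj_on val (wts r)"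
proof (rule inj_onI)
  fix x y assume xy: "x \<in> wts r" "y \<in> wts r" "val x = val y"
  obtain i j i' j' where [simp]: "x = (i, j)" "y = (i', j')" by (cases x; cases y) auto
  have "j = j'" using wt_inj[of i j i' j'] xy by (simp add: wts_def val_def)
  thus "x = y" using xy p_ge_2 by (simp add: val_def)
qed

text \<open>From \<open>p * d\<close> on, every integer is of the form pi + dj with j < p.\<close>

lemma card_wts_lower: "int r - int (p * d) \<le> int (card (wts r))"
proof -
  have "{p * d..<r} \<subseteq> val ` wts r"
  proof
    fix v assume v: "v \<in> {p * d..<r}"
    obtain i0 where "[d * i0 = 1] (mod p)"
      using cong_solve_coprime_nat[of d p] coprime_pd by (auto simp: coprime_commute)
    hence "[d * i0 * v = 1 * v] (mod p)" by (rule cong_scalar_right)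
    then obtain j0 where j0: "[d * j0 = v] (mod p)" by (auto simp: mult.assoc)
    define j where "j = j0 mod p"
    have j: "[d * j = v] (mod p)" "j < p"
      using j0 p_ge_2 by (auto simp: j_def cong_def mod_mult_right_eq)
    have "d * j \<le> d * p" using j by simp
    moreover have "d * p \<le> v" using v by (simp add: mult.commute)
    ultimately have le: "d * j \<le> v" by linarith
    hence "p dvd v - d * j" using j(1) mod_eq_dvd_iff_nat[OF le, of p] by (simp add: cong_def)
    then obtain i where "v - d * j = p * i" by (elim dvdE)
    hence "v = p * i + d * j" using le by simp
    thus "v \<in> val ` wts r" using j v by (intro image_eqI[of _ _ "(i, j)"]) (auto simp: val_def wts_def)
  qed
  hence "card {p * d..<r} \<le> card (val ` wts r)" using finite_wts by (intro card_mono) auto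
  hence "r \<le> card (wts r) + p * d" using card_image[OF inj_val, of r] by simp
  hence "int r \<le> int (card (wts r) + p * d)" by (simp only: of_nat_le_iff)
  thus ?thesis by simp
qed

text \<open>The gap symmetry \<open>s \<mapsto> pd - p - d - s\<close> of the semigroup generated by \<open>p\<close> and \<open>d\<close>.\<close>

lemma card_wts_upper: "2 * card (wts (p * d - p - d)) \<le> (p - 1) * (d - 1)"
proof -
  define r where "r = p * d - p - d"
  obtain a b where ab: "p = a + 2" "d = b + 2" using p_ge_2 d_ge_2 by (metis add.commute le_Suc_ex)
  have pd: "p + d \<le> p * d" unfolding ab by (simp add: algebra_simps)
  have r: "p * d = r + p + d" using pd by (simp add: r_def)
  have rs: "(p - 1) * (d - 1) = r + 1"
    using r unfolding ab by (simp add: algebra_simps)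
  define V where "V = val ` wts r"
  have V: "V \<subseteq> {..r}" by (auto simp: V_def wts_def val_def)
  have "(\<lambda>v. r - v) ` V \<subseteq> {..r} - V"
  proof
    fix u assume "u \<in> (\<lambda>v. r - v) ` V"
    then obtain i j where ij: "u = r - (p * i + d * j)" "p * i + d * j \<le> r" by (auto simp: V_def wts_def val_def)
    have "u \<notin> V"
    proof
      assume "u \<in> V"
      then obtain i' j' where "u = p * i' + d * j'" by (auto simp: V_def wts_def val_def)
      hence "p * (i + i' + 1) + d * (j + j' + 1) = p * d" using ij r by (simp add: algebra_simps)
      hence eq: "p * (i + i' + 1) + d * (j + j' + 1) = p * d" .
      have "p dvd p * (i + i' + 1) + d * (j + j' + 1)" unfolding eq by simp
      hence "p dvd d * (j + j' + 1)" using dvd_add_right_iff[of p "p * (i + i' + 1)"] by (metis dvd_triv_left)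
      hence "p dvd j + j' + 1" using coprime_dvd_mult_right_iff[OF coprime_pd] by blast
      hence "p \<le> j + j' + 1" by (rule dvd_imp_le) simp
      hence "d * p \<le> d * (j + j' + 1)" by (rule mult_le_mono2)
      moreover have "p * (i + i' + 1) \<ge> 1" using p_ge_2 by simp
      ultimately show False using eq by (simp add: mult.commute)
    qed
    thus "u \<in> {..r} - V" using ij by auto
  qed
  hence "card ((\<lambda>v. r - v) ` V) \<le> card ({..r} - V)" by (intro card_mono) auto
  moreover have "card ((\<lambda>v. r - v) ` V) = card V"
  proof (intro card_image inj_onI)
    fix x y assume "x \<in> V" "y \<in> V" "r - x = r - y"
    moreover from this V have "x \<le> r" "y \<le> r" by auto
    ultimately show "x = y" by linarith
  qed
  moreover have "card ({..r} - V) = r + 1 - card V"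
    using V by (subst card_Diff_subset) (auto intro: finite_subset)
  moreover have "card V = card (wts r)" unfolding V_def by (rule card_image[OF inj_val])
  moreover have "card V \<le> r + 1" using card_mono[of "{..r}" V] V by simp
  ultimately have "2 * card (wts r) \<le> r + 1" by linarith
  thus ?thesis unfolding rs r_def [symmetric] .
qed

text \<open>A common denominator: multiplying by it trades poles of order up to \<open>N\<close>
  above \<open>S\<close> for a pole of order \<open>p * N * card S\<close> at infinity.\<close>

definition hS :: "'k set \<Rightarrow> nat \<Rightarrow> 'k ratfun_closure" where
  "hS S N = (\<Prod>c\<in>S. (xvar - cst c) ^ N)"

text \<open>The divisor with multiplicity \<open>r\<close> at infinity and \<open>N\<close> at every
  point above \<open>S\<close>; every divisor is bounded by one of these.\<close>

definition nS :: "'k set \<Rightarrow> nat \<Rightarrow> nat \<Rightarrow> ('k \<times> 'k) option \<Rightarrow> int" where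
  "nS S N r = (\<lambda>P. case P of None \<Rightarrow> int r | Some (c, b) \<Rightarrow> if c \<in> S then int N else 0)"

lemma hS_KU: "hS S N \<in> KU" and hS_neq_0: "hS S N \<noteq> 0"
proof -
  show "hS S N \<in> KU" unfolding hS_def by (intro KK_ops KK_gen cst_KU)
  show "hS S N \<noteq> 0" unfolding hS_def using x_minus_c(2) by (cases "finite S") auto
qed

lemma ordv_prod:
  assumes P: "P \<in> pts UNIV" and "finite S" "\<And>c. c \<in> S \<Longrightarrow> u c \<in> KU \<and> u c \<noteq> 0"
  shows "ordv P (prod u S) = (\<Sum>c\<in>S. ordv P (u c))"
  using assms(2,3)
proof (induction S rule: finite_induct)
  case (insert c S)
  have "prod u S \<in> KU" "prod u S \<noteq> 0" using insert by (auto intro!: KK_ops)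
  thus ?case using insert by (simp add: ordv_mult[OF P])
qed (simp add: ordv_0_cst[OF P])

lemma ordv_hS:
  assumes "finite S"
  shows "Some (c, b) \<in> pts UNIV \<Longrightarrow> ordv (Some (c, b)) (hS S N) = (if c \<in> S then int N else 0)"
    and "ordv None (hS S N) = - int (p * N * card S)"
proof -
  have x: "xvar - cst c \<in> KU" for c by (intro KK_ops KK_gen cst_KU)
  have *: "ordv P (hS S N) = (\<Sum>c\<in>S. int N * ordv P (xvar - cst c))" if "P \<in> pts UNIV" for P
    unfolding hS_def using assms x x_minus_c(2)
    by (subst ordv_prod[OF that]) (auto simp: ordv_power[OF that] KK_gen cst_KU intro!: KK_ops)
  {
    assume P: "Some (c, b) \<in> pts UNIV"
    have "ordv (Some (c, b)) (xvar - cst c') = (if c' = c then 1 else 0)" for c'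
    proof (cases "c' = c")
      case False
      hence "at2 c b (px - pc c') \<noteq> 0" by (simp add: at2_simps at2_gens)
      thus ?thesis using False ordv_E_eq_0(2)[OF P] by (simp add: x_minus_c(1))
    qed (use ordv_x_minus_c[OF P] in simp)
    thus "ordv (Some (c, b)) (hS S N) = (if c \<in> S then int N else 0)"
      unfolding *[OF P] using assms by (simp add: sum.delta if_distrib[of "\<lambda>x. _ * x"] cong: if_cong)
  }
  have N: "None \<in> pts UNIV" by (simp add: pts_def)
  have "ordv None (xvar - cst c) = - int p" for c
  proof -
    have "phi None (xvar - cst c) = pev fls_const (fst (loc None)) [:-c, 1:]"
      by (simp add: phi_hom[OF N] KK_gen cst_KU phi_x[OF N] phi_cst[OF N] pev_pCons[OF rhom_fls_const] pev_0[OF rhom_fls_const])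
    thus ?thesis using fls_subdegree_pev_neg[of "fst (loc None)" p "[:-c, 1:]"] local_loc[OF N] p_ge_2
      by (simp add: ordv_def local_at_def)
  qed
  thus "ordv None (hS S N) = - int (p * N * card S)" by (simp add: *[OF N] algebra_simps)
qed

text \<open>Multiplying by \<open>hS\<close> removes the affine poles, so \<open>regular_fin\<close>
  gives a polynomial of degree below \<open>p\<close> in y. The distinct weights of its terms
  prevent cancellation at infinity, so each monomial obeys the pole bound.\<close>

lemma LL_nS:
  fixes N r :: nat
  assumes S: "finite S"
  defines "B \<equiv> (\<lambda>(i, j). xvar ^ i * yy ^ j * inverse (hS S N)) ` wts (r + p * N * card S)"
  shows "LL (nS S N r) \<subseteq> VS.span B" and "VS.dim (LL (nS S N r)) = card (wts (r + p * N * card S))"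
proof -
  define R where "R = r + p * N * card S"
  define \<beta> where "\<beta> = (\<lambda>(i, j). xvar ^ i * yy ^ j * inverse (hS S N))"
  have B: "B = \<beta> ` wts R" by (simp add: B_def \<beta>_def R_def)
  have N: "None \<in> pts UNIV" by (simp add: pts_def)
  show sub: "LL (nS S N r) \<subseteq> VS.span B"
  proof
    fix z assume z: "z \<in> LL (nS S N r)"
    hence zK: "z \<in> KU" by (simp add: LL_def)
    show "z \<in> VS.span B"
    proof (cases "z = 0")
      case True
      thus ?thesis by (simp add: VS.span_zero)
    next
      case False
      define w where "w = z * hS S N"
      have wK: "w \<in> KU" "w \<noteq> 0" using zK False hS_KU hS_neq_0 by (auto simp: w_def intro: KK_ops)
      have ow: "ordv P w = ordv P z + ordv P (hS S N)" if "P \<in> pts UNIV" for P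
        unfolding w_def by (rule ordv_mult[OF that zK hS_KU False hS_neq_0])
      have "0 \<le> ordv (Some (c, b)) w" if P: "Some (c, b) \<in> pts UNIV" for c b
      proof -
        have "0 \<le> ordv (Some (c, b)) z + nS S N r (Some (c, b))" using z False P unfolding LL_def by blast
        thus ?thesis by (simp add: ow[OF P] ordv_hS(1)[OF S P] nS_def)
      qed
      then obtain g where g: "degree g < p" "w = E g" using regular_fin[OF wK(1)] by blast
      have "g \<noteq> 0" using wK g by (auto simp: E_simps)
      then obtain j where j: "dominant g j" using ex_dominant g by blast
      have "ordv None w = - int (wt g j)"
        unfolding g ordv_def phi_E[OF N] using local_loc[OF N] ev_inf(2)[OF _ _ j] by (auto simp: local_at_def)
      moreover have "0 \<le> ordv None z + nS S N r None" using z False N unfolding LL_def by blast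
      ultimately have wj: "wt g j \<le> R"
        using ow[OF N] ordv_hS(2)[OF S, of N] by (simp add: nS_def R_def flip: of_nat_add of_nat_mult)
      have mem: "(i, j') \<in> wts R" if "coeff (coeff g j') i \<noteq> 0" for i j'
      proof -
        have c: "coeff g j' \<noteq> 0" using that by auto
        have "p * i \<le> p * degree (coeff g j')" using that by (intro mult_le_mono2 le_degree)
        moreover have "wt g j' \<le> wt g j" using j c by (cases "j' = j") (auto simp: dominant_def)
        ultimately have "p * i + d * j' \<le> R" using wj unfolding wt_def by linarith
        moreover have "j' < p" using le_degree[OF c] g by simp
        ultimately show ?thesis by (simp add: wts_def)
      qed
      have "z = inverse (hS S N) * E g"
        unfolding g(2)[symmetric] w_def using hS_neq_0[of S N] by simp
      also have "\<dots> = (\<Sum>j\<le>degree g. \<Sum>i\<le>degree (coeff g j). cst (coeff (coeff g j) i) * \<beta> (i, j))"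
        by (simp add: ev_altdef[OF rhom_cst] pev_altdef[OF rhom_cst] sum_distrib_left sum_distrib_right \<beta>_def mult_ac)
      also have "\<dots> \<in> VS.span B"
      proof (intro VS.span_sum)
        fix i j'
        show "cst (coeff (coeff g j') i) * \<beta> (i, j') \<in> VS.span B"
        proof (cases "coeff (coeff g j') i = 0")
          case False
          hence "\<beta> (i, j') \<in> B" using mem by (auto simp: B)
          thus ?thesis by (intro VS.span_scale VS.span_base)
        qed (simp add: rhom_0[OF rhom_cst] VS.span_zero)
      qed
      finally show ?thesis .
    qed
  qed
  have \<beta>_sum: "u ij = 0" if sum: "(\<Sum>ij\<in>wts R. cst (u ij) * \<beta> ij) = 0" and ij: "ij \<in> wts R" for u ij
  proof -
    define g where "g = (\<Sum>(i, j)\<in>wts R. monom (monom (u (i, j)) i) j)"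
    have "E g = (\<Sum>(i, j)\<in>wts R. cst (u (i, j)) * (xvar ^ i * yy ^ j))"
      unfolding g_def rhom_sum[OF rhom_E] by (intro sum.cong refl) (auto simp: ev_monom[OF rhom_cst] pev_monom[OF rhom_cst])
    hence "E g * inverse (hS S N) = (\<Sum>ij\<in>wts R. cst (u ij) * \<beta> ij)"
      by (simp add: sum_distrib_left sum_distrib_right \<beta>_def split_def mult_ac)
    hence "E g = 0" using sum hS_neq_0[of S N] by simp
    moreover have "degree g < p"
      unfolding g_def using p_ge_2
      by (intro degree_sum_less) (auto simp: wts_def intro: le_less_trans[OF degree_monom_le])
    ultimately have "g = 0" using generic_independent[OF generic_E] by blast
    obtain i j where [simp]: "ij = (i, j)" by (cases ij)
    have "coeff (coeff g j) i = (\<Sum>ij'\<in>wts R. if ij' = (i, j) then u ij' else 0)"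
      unfolding g_def coeff_sum by (intro sum.cong refl) (auto split: if_splits)
    also have "\<dots> = u (i, j)" using ij finite_wts by simp
    finally show ?thesis using \<open>g = 0\<close> by simp
  qed
  have inj: "inj_on \<beta> (wts R)"
  proof (rule inj_onI, rule ccontr)
    fix x y assume xy: "x \<in> wts R" "y \<in> wts R" "\<beta> x = \<beta> y" "x \<noteq> y"
    define u where "u = (\<lambda>z. if z = x then 1 else if z = y then -1 else 0 :: 'k)"
    have "(\<Sum>ij\<in>wts R. cst (u ij) * \<beta> ij) = (\<Sum>ij\<in>{x, y}. cst (u ij) * \<beta> ij)"
      using xy finite_wts by (intro sum.mono_neutral_right) (auto simp: u_def rhom_0[OF rhom_cst])
    also have "\<dots> = 0" using xy by (simp add: u_def rhom_simps[OF rhom_cst])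
    finally have "u x = 0" using \<beta>_sum xy by blast
    thus False by (simp add: u_def)
  qed
  have "VS.independent B"
  proof (rule VS.independent_if_scalars_zero)
    show "finite B" unfolding B using finite_wts by simp
    fix u v assume s: "(\<Sum>v\<in>B. cst (u v) * v) = 0" and v: "v \<in> B"
    have "(\<Sum>ij\<in>wts R. cst (u (\<beta> ij)) * \<beta> ij) = 0" using s unfolding B by (simp add: sum.reindex[OF inj])
    from \<beta>_sum[of "u \<circ> \<beta>", unfolded o_def, OF this] v show "u v = 0" by (auto simp: B)
  qed
  moreover have "B \<subseteq> LL (nS S N r)"
  proof
    fix z assume "z \<in> B"
    then obtain i j where ij: "(i, j) \<in> wts R" "z = xvar ^ i * yy ^ j * inverse (hS S N)" by (auto simp: B \<beta>_def)
    have mK: "xvar ^ i * yy ^ j \<in> KU" "xvar ^ i * yy ^ j \<noteq> 0"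
      using xvar_neq_0 yy_neq_0 by (auto intro!: KK_ops KK_gen)
    have oz: "ordv P z = ordv P (xvar ^ i * yy ^ j) - ordv P (hS S N)" if "P \<in> pts UNIV" for P
      unfolding ij(2) using mK hS_KU hS_neq_0 by (subst ordv_mult[OF that]) (auto simp: ordv_inverse[OF that] KK_ops)
    have "0 \<le> ordv P z + nS S N r P" if P: "P \<in> pts UNIV" for P
    proof (cases P)
      case None
      have "ordv None (xvar ^ i * yy ^ j) = - int (p * i + d * j)" using ordv_mon[of "int i" "int j"] by (simp add: mon_nat)
      moreover have "int (p * i + d * j) \<le> int R" using ij by (simp only: of_nat_le_iff) (simp add: wts_def)
      ultimately show ?thesis unfolding None oz[OF N] ordv_hS(2)[OF S] by (simp add: nS_def R_def)
    next
      case (Some cb)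
      obtain c b where P': "P = Some (c, b)" using Some by (cases cb) auto
      have "xvar ^ i * yy ^ j = E (px ^ i * py ^ j)" by (simp add: E_simps E_px E_py)
      hence "0 \<le> ordv (Some (c, b)) (xvar ^ i * yy ^ j)" using phi_fin_E(1) P P' by metis
      thus ?thesis using P unfolding P' by (simp add: oz ordv_hS(1)[OF S] nS_def)
    qed
    moreover have "z \<in> KU" unfolding ij(2) by (intro KK_ops mK hS_KU)
    ultimately show "z \<in> LL (nS S N r)" by (simp add: LL_def)
  qed
  ultimately have "card B = VS.dim (LL (nS S N r))" using sub by (intro VS.basis_card_eq_dim)
  thus "VS.dim (LL (nS S N r)) = card (wts (r + p * N * card S))"
    using card_image[OF inj] by (simp add: B R_def)
qed

lemma divisor_deg_eq:
  assumes D: "D \<in> divisors KU" and A: "finite A" "A \<subseteq> pts UNIV" "\<And>P. P \<in> pts UNIV - A \<Longrightarrow> D (place_ring UNIV P) = 0"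
  shows "divisor_deg D = (\<Sum>P\<in>A. D (place_ring UNIV P))"
proof -
  have "{R. D R \<noteq> 0} \<subseteq> place_ring UNIV ` A"
  proof
    fix R assume R: "R \<in> {R. D R \<noteq> 0}"
    hence "R \<in> place_ring UNIV ` pts UNIV" using D unfolding divisors_def places_UNIV_eq by auto
    thus "R \<in> place_ring UNIV ` A" using A(3) R by auto
  qed
  hence "divisor_deg D = (\<Sum>R\<in>place_ring UNIV ` A. D R)"
    unfolding divisor_deg_def using A by (intro sum.mono_neutral_left) auto
  also have "\<dots> = (\<Sum>P\<in>A. D (place_ring UNIV P))"
    using inj_on_subset[OF inj_place_ring A(2)] by (simp add: sum.reindex)
  finally show ?thesis .
qed

definition rr_defect :: "('k ratfun_closure set \<Rightarrow> int) \<Rightarrow> int" where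
  "rr_defect D = divisor_deg D - int (riemann_roch_dim KU D) + 1"

text \<open>The supremum in \<open>genus\<close> is meaningful only over a bounded set. The divisor
  is enlarged to some \<open>nS S N N\<close>, whose space has a known dimension by
  \<open>LL_nS\<close>.\<close>

lemma rr_defect_bound:
  assumes D: "D \<in> divisors KU"
  shows "rr_defect D \<le> int (p * d) + 1"
proof -
  define n where "n = (\<lambda>P. D (place_ring UNIV P))"
  define A0 where "A0 = {P \<in> pts UNIV. n P \<noteq> 0}"
  have "finite (place_ring UNIV ` A0)"
    by (rule finite_subset[of _ "{R. D R \<noteq> 0}"]) (use D in \<open>auto simp: A0_def n_def divisors_def\<close>)
  moreover have "inj_on (place_ring UNIV) A0" by (rule inj_on_subset[OF inj_place_ring]) (auto simp: A0_def)
  ultimately have finA0: "finite A0" by (simp add: finite_image_iff)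
  define S where "S = {c. \<exists>b. Some (c, b) \<in> A0}"
  have "S \<subseteq> (\<lambda>P. fst (the P)) ` A0" unfolding S_def by force
  hence finS: "finite S" using finA0 finite_surj by blast
  define N where "N = (\<Sum>P\<in>A0. nat \<bar>n P\<bar>)"
  have nN: "n P \<le> int N" if "P \<in> A0" for P
  proof -
    have "nat \<bar>n P\<bar> \<le> N" unfolding N_def using that finA0 by (intro member_le_sum) auto
    thus ?thesis by linarith
  qed
  define F where "F = Sigma S (\<lambda>c. {b. b ^ p - b = poly f c})"
  have finF: "finite F" unfolding F_def using finS card_fibre(2) by blast
  have "card F = (\<Sum>c\<in>S. card {b. b ^ p - b = poly f c})"
    unfolding F_def using finS card_fibre(2) by (intro card_SigmaI) auto
  hence cardF: "card F = p * card S" by (simp add: card_fibre(1))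
  define A where "A = insert None (Some ` F)"
  have A: "finite A" "A \<subseteq> pts UNIV" unfolding A_def using finF by (auto simp: F_def pts_def)
  have out: "n P = 0" if "P \<in> pts UNIV - A" for P
    using that by (auto simp: A_def F_def A0_def S_def pts_def)
  let ?n' = "nS S N N"
  have n': "n P \<le> ?n' P" if P: "P \<in> A" for P
  proof (cases "P \<in> A0")
    case True
    thus ?thesis using nN[OF True] P by (auto simp: nS_def A_def F_def split: option.splits)
  next
    case False
    hence "n P = 0" using P A by (auto simp: A0_def)
    thus ?thesis by (auto simp: nS_def split: option.splits)
  qed
  have out': "?n' P = 0" if "P \<in> pts UNIV - A" for P
    using that by (auto simp: nS_def A_def F_def pts_def split: option.splits)
  note fd = LL_nS[OF finS, of N N]
  have "(\<Sum>P\<in>A. n P) - int (VS.dim (LL n)) \<le> (\<Sum>P\<in>A. ?n' P) - int (VS.dim (LL ?n'))"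
    using finite_wts by (intro deg_dim_mono[OF A n' _ fd(1)]) (auto simp: out out')
  also have "(\<Sum>P\<in>A. ?n' P) = int (N + p * N * card S)"
  proof -
    have "(\<Sum>P\<in>A. ?n' P) = int N + (\<Sum>P\<in>Some ` F. ?n' P)"
      unfolding A_def using finF by (subst sum.insert) (auto simp: nS_def)
    also have "(\<Sum>P\<in>Some ` F. ?n' P) = (\<Sum>cb\<in>F. int N)"
    proof -
      have "(\<Sum>P\<in>Some ` F. ?n' P) = (\<Sum>cb\<in>F. ?n' (Some cb))" by (subst sum.reindex) auto
      also have "\<dots> = (\<Sum>cb\<in>F. int N)" by (intro sum.cong refl) (auto simp: nS_def F_def)
      finally show ?thesis .
    qed
    finally show ?thesis by (simp add: cardF)
  qed
  also have "\<dots> - int (VS.dim (LL ?n')) \<le> int (p * d)"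
    using card_wts_lower[of "N + p * N * card S"] fd(2) by simp
  finally have "(\<Sum>P\<in>A. n P) - int (VS.dim (LL n)) \<le> int (p * d)" .
  moreover have "divisor_deg D = (\<Sum>P\<in>A. n P)"
    unfolding n_def using out by (intro divisor_deg_eq[OF D A]) (auto simp: n_def)
  moreover have "riemann_roch_dim KU D = VS.dim (LL n)"
    unfolding riemann_roch_dim_def riemann_roch_space_eq n_def ..
  ultimately show ?thesis by (simp add: rr_defect_def)
qed

text \<open>Tests the supremum on r times the point at infinity, where r = pd - p - d is the largest
  integer not of the form pi + dj. By the gap symmetry at most half of the r + 1 = (p - 1)(d - 1)
  integers from 0 to r are pole orders.\<close>

lemma genus_lower: "(p - 1) * (d - 1) \<le> 2 * genus KU"
proof -
  define r where "r = p * d - p - d"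
  obtain a b where ab: "p = a + 2" "d = b + 2" using p_ge_2 d_ge_2 by (metis add.commute le_Suc_ex)
  have rs: "(p - 1) * (d - 1) = r + 1" unfolding r_def ab by (simp add: algebra_simps)
  define R0 where "R0 = place_ring UNIV None"
  define D where "D = (\<lambda>R. if R = R0 then int r else 0)"
  have N: "None \<in> pts UNIV" by (simp add: pts_def)
  have D: "D \<in> divisors KU"
  proof -
    have "{R. D R \<noteq> 0} \<subseteq> {R0}" by (auto simp: D_def)
    thus ?thesis using place_ring_in_places[OF N] finite_subset[of _ "{R0}"] unfolding divisors_def R0_def by blast
  qed
  have DP: "D (place_ring UNIV P) = nS {} 0 r P" if "P \<in> pts UNIV" for P
  proof -
    have "place_ring UNIV P = R0 \<longleftrightarrow> P = None"
      unfolding R0_def using inj_onD[OF inj_place_ring _ that N] by auto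
    thus ?thesis by (auto simp: D_def nS_def split: option.splits)
  qed
  have "divisor_deg D = (\<Sum>P\<in>{None}. D (place_ring UNIV P))"
    using N by (intro divisor_deg_eq[OF D]) (auto simp: DP nS_def split: option.splits)
  hence 1: "divisor_deg D = int r" by (simp add: D_def R0_def)
  have "riemann_roch_dim KU D = VS.dim (LL (nS {} 0 r))"
    unfolding riemann_roch_dim_def riemann_roch_space_eq using LL_cong[OF DP] by simp
  hence 2: "riemann_roch_dim KU D = card (wts r)" using LL_nS(2)[of "{}" 0 r] by simp
  have "rr_defect D \<le> (SUP D\<in>divisors KU. rr_defect D)"
    using rr_defect_bound by (intro cSUP_upper D bdd_aboveI2)
  moreover have "genus KU = nat (SUP D\<in>divisors KU. rr_defect D)"
    by (simp add: genus_def rr_defect_def)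
  ultimately have "rr_defect D \<le> int (genus KU)" by linarith
  moreover have "int (2 * card (wts r)) \<le> int (r + 1)" using card_wts_upper rs by (simp only: of_nat_le_iff) (simp add: r_def)
  ultimately have "int (r + 1) \<le> int (2 * genus KU)" by (simp add: rr_defect_def 1 2)
  thus ?thesis unfolding rs by (simp only: of_nat_le_iff)
qed

end

section \<open>Reduction of roots of unity\<close>

text \<open>The minimal polynomial of \<xi> over the integers. Taken primitive it is irreducible,
  hence prime by unique factorisation, and its leading coefficient is a unit because it divides the
  monic X^N - 1.\<close>

lemma int_poly_annihilator:
  fixes \<xi> :: complex
  assumes "N > 0" "\<xi> ^ N = 1"
  obtains m :: "int poly" where "degree m > 0" "is_unit (lead_coeff m)"
    "\<And>P. pev of_int \<xi> P = 0 \<longleftrightarrow> m dvd P"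
proof -
  have h: "rhom (of_int :: int \<Rightarrow> complex)" by (rule rhomI) simp_all
  let ?e = "pev of_int \<xi> :: int poly \<Rightarrow> complex"
  note e = rhom_simps[OF rhom_pev[OF h]]
  define P0 :: "int poly" where "P0 = monom 1 N - 1"
  have P0: "?e P0 = 0" using assms by (simp add: P0_def e pev_monom[OF h])
  have "coeff P0 N = 1" using assms by (simp add: P0_def coeff_1)
  hence P00: "P0 \<noteq> 0" by auto
  let ?I = "\<lambda>P. P \<noteq> 0 \<and> ?e P = 0"
  have "\<exists>m. ?I m \<and> (\<forall>P. ?I P \<longrightarrow> degree m \<le> degree P)"
    by (rule ex_has_least_nat[of ?I P0]) (use P0 P00 in auto)
  then obtain m0 where m0: "?I m0" and min0: "\<And>P. ?I P \<Longrightarrow> degree m0 \<le> degree P" by blast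
  define m where "m = primitive_part m0"
  have m0_eq: "m0 = smult (Polynomial.content m0) m" by (simp add: m_def)
  have cm: "Polynomial.content m = 1" using m0 by (simp add: m_def)
  have c0: "Polynomial.content m0 \<noteq> 0" using m0 by simp
  have em: "?e m = 0" using m0 m0_eq c0 by (metis pev_smult[OF h] mult_eq_0_iff of_int_eq_0_iff)
  have m_ne: "m \<noteq> 0" using m0 m0_eq by auto
  have "degree m0 = degree m" by (subst m0_eq) (use c0 in simp)
  hence min: "?I P \<Longrightarrow> degree m \<le> degree P" for P using min0 by simp
  have deg: "degree m > 0"
  proof (rule ccontr)
    assume "\<not> degree m > 0"
    then obtain a where "m = [:a:]" using degree_eq_zeroE by blast
    thus False using em m_ne by (simp add: pev_const[OF h])
  qed
  have "irreducible m"
  proof (rule irreducibleI)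
    show "m \<noteq> 0" by (rule m_ne)
    show "\<not> is_unit m" using deg by (auto simp: is_unit_poly_iff)
    fix a b assume ab: "m = a * b"
    have nz: "a \<noteq> 0" "b \<noteq> 0" using ab m_ne by auto
    have dm: "degree m = degree a + degree b" unfolding ab by (rule degree_mult_eq[OF nz])
    have cab: "Polynomial.content a * Polynomial.content b = 1" using cm unfolding ab by (simp add: content_mult)
    have unit: "is_unit u" if "degree u = 0" "Polynomial.content u dvd 1" for u :: "int poly"
    proof -
      obtain v where v: "u = [:v:]" using \<open>degree u = 0\<close> degree_eq_zeroE by blast
      have "v dvd 1" using that(2) by (auto simp: v content_def cCons_def split: if_splits)
      thus ?thesis by (simp add: v is_unit_const_poly_iff)
    qed
    have "?e a = 0 \<or> ?e b = 0" using em unfolding ab by (simp add: e)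
    thus "is_unit a \<or> is_unit b"
    proof
      assume "?e a = 0"
      hence "degree b = 0" using min[of a] nz dm by simp
      moreover have "Polynomial.content b dvd 1" using cab by (metis dvd_triv_right)
      ultimately show ?thesis using unit by blast
    next
      assume "?e b = 0"
      hence "degree a = 0" using min[of b] nz dm by simp
      moreover have "Polynomial.content a dvd 1" using cab by (metis dvd_triv_left)
      ultimately show ?thesis using unit by blast
    qed
  qed
  hence prime: "prime_elem m" by (rule irreducible_imp_prime_elem)
  have dvd: "?e P = 0 \<longleftrightarrow> m dvd P" for P
  proof
    assume "m dvd P"
    thus "?e P = 0" using em by (auto simp: e elim!: dvdE)
  next
    assume eP: "?e P = 0"
    obtain q r where qr: "pseudo_divmod P m = (q, r)" by fastforce
    define c where "c = coeff m (degree m) ^ (Suc (degree P) - degree m)"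
    have eq: "smult c P = m * q + r" and r: "r = 0 \<or> degree r < degree m"
      using pseudo_divmod[OF m_ne qr] by (auto simp: c_def)
    have c: "c \<noteq> 0" using m_ne by (auto simp: c_def)
    have "?e r = 0" using arg_cong[OF eq, of ?e] eP em by (simp add: e pev_smult[OF h])
    hence "r = 0" using r min[of r] by force
    hence "m dvd [:c:] * P" using eq by simp
    hence "m dvd [:c:] \<or> m dvd P" by (rule prime_elem_dvd_multD[OF prime])
    moreover have "\<not> m dvd [:c:]"
    proof
      assume "m dvd [:c:]"
      hence "degree m \<le> degree [:c:]" using c by (intro dvd_imp_degree_le) auto
      thus False using deg by simp
    qed
    ultimately show "m dvd P" by blast
  qed
  have "m dvd P0" using dvd P0 by blast
  then obtain q where q: "P0 = m * q" by (elim dvdE)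
  have "lead_coeff P0 = lead_coeff m * lead_coeff q" unfolding q by (rule lead_coeff_mult)
  moreover have "lead_coeff P0 = 1"
  proof -
    have "degree (- 1 :: int poly) < degree (monom 1 N :: int poly)" using assms(1) by (simp add: degree_monom_eq)
    hence "degree (monom 1 N + (- 1) :: int poly) = N" using degree_add_eq_left by (metis degree_monom_eq zero_neq_one)
    hence "degree P0 = N" by (simp add: P0_def)
    thus ?thesis using \<open>coeff P0 N = 1\<close> by simp
  qed
  ultimately have "is_unit (lead_coeff m)" by (metis dvd_triv_left)
  thus ?thesis using that deg dvd by blast
qed

text \<open>A local subring of the complex numbers with its residue map: \<open>Ov_inverse\<close>
  says that elements with nonzero residue are units. The values of \<open>\<phi>\<close> outside
  \<open>Ov\<close> are left unspecified.\<close>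

locale reduction =
  fixes Ov :: "complex set" and \<phi> :: "complex \<Rightarrow> 'k::field"
  assumes Ov_1: "1 \<in> Ov" and Ov_diff: "a \<in> Ov \<Longrightarrow> b \<in> Ov \<Longrightarrow> a - b \<in> Ov"
    and Ov_mult: "a \<in> Ov \<Longrightarrow> b \<in> Ov \<Longrightarrow> a * b \<in> Ov"
    and \<phi>_1: "\<phi> 1 = 1" and \<phi>_diff: "a \<in> Ov \<Longrightarrow> b \<in> Ov \<Longrightarrow> \<phi> (a - b) = \<phi> a - \<phi> b"
    and \<phi>_mult: "a \<in> Ov \<Longrightarrow> b \<in> Ov \<Longrightarrow> \<phi> (a * b) = \<phi> a * \<phi> b"
    and Ov_inverse: "a \<in> Ov \<Longrightarrow> \<phi> a \<noteq> 0 \<Longrightarrow> inverse a \<in> Ov"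
begin

lemma Ov_0: "0 \<in> Ov" and \<phi>_0: "\<phi> 0 = 0"
  using Ov_diff[OF Ov_1 Ov_1] \<phi>_diff[OF Ov_1 Ov_1] by simp_all

lemma Ov_uminus: "a \<in> Ov \<Longrightarrow> - a \<in> Ov" and \<phi>_uminus: "a \<in> Ov \<Longrightarrow> \<phi> (- a) = - \<phi> a"
  using Ov_diff[OF Ov_0, of a] \<phi>_diff[OF Ov_0, of a] by (simp_all add: \<phi>_0)

lemma Ov_add: "a \<in> Ov \<Longrightarrow> b \<in> Ov \<Longrightarrow> a + b \<in> Ov"
  and \<phi>_add: "a \<in> Ov \<Longrightarrow> b \<in> Ov \<Longrightarrow> \<phi> (a + b) = \<phi> a + \<phi> b"
  using Ov_diff[of a "- b"] Ov_uminus[of b] \<phi>_diff[of a "- b"] \<phi>_uminus[of b] by simp_all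

lemma Ov_sum: "(\<And>i. i \<in> A \<Longrightarrow> u i \<in> Ov) \<Longrightarrow> sum u A \<in> Ov"
  by (induction A rule: infinite_finite_induct) (auto intro: Ov_0 Ov_add)

lemma \<phi>_sum: "(\<And>i. i \<in> A \<Longrightarrow> u i \<in> Ov) \<Longrightarrow> \<phi> (sum u A) = (\<Sum>i\<in>A. \<phi> (u i))"
  by (induction A rule: infinite_finite_induct) (auto simp: \<phi>_0 \<phi>_add Ov_sum)

lemma Ov_power: "a \<in> Ov \<Longrightarrow> a ^ n \<in> Ov" and \<phi>_power: "a \<in> Ov \<Longrightarrow> \<phi> (a ^ n) = \<phi> a ^ n"
proof -
  have "a \<in> Ov \<Longrightarrow> a ^ n \<in> Ov \<and> \<phi> (a ^ n) = \<phi> a ^ n"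
    by (induction n) (auto simp: \<phi>_1 \<phi>_mult intro: Ov_1 Ov_mult)
  thus "a \<in> Ov \<Longrightarrow> a ^ n \<in> Ov" "a \<in> Ov \<Longrightarrow> \<phi> (a ^ n) = \<phi> a ^ n" by blast+
qed

lemma Ov_of_nat: "of_nat n \<in> Ov" and \<phi>_of_nat: "\<phi> (of_nat n) = of_nat n"
proof -
  have "of_nat n \<in> Ov \<and> \<phi> (of_nat n) = of_nat n"
    by (induction n) (auto simp: Ov_0 \<phi>_0 \<phi>_1 Ov_1 \<phi>_add intro: Ov_add)
  thus "of_nat n \<in> Ov" "\<phi> (of_nat n) = of_nat n" by blast+
qed

lemma \<phi>_inverse: "a \<in> Ov \<Longrightarrow> \<phi> a \<noteq> 0 \<Longrightarrow> \<phi> (inverse a) = inverse (\<phi> a)"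
proof -
  assume a: "a \<in> Ov" "\<phi> a \<noteq> 0"
  have "a \<noteq> 0" using a \<phi>_0 by auto
  hence "\<phi> a * \<phi> (inverse a) = 1" using a Ov_inverse by (simp add: \<phi>_1 flip: \<phi>_mult)
  thus ?thesis by (simp add: inverse_unique)
qed

end

text \<open>Z[\<xi>] is mapped to \<open>'k\<close> by sending \<xi> to a root
  \<open>\<beta>\<close> of its minimal polynomial, and the fractions whose denominator has nonzero
  image form \<open>Ov\<close>. The root exists because the leading coefficient is a unit, so the
  degree does not drop on reduction.\<close>

lemma ex_reduction:
  assumes N: "N > 0"
  shows "\<exists>Ov (\<phi> :: complex \<Rightarrow> 'k::alg_closed_field). reduction Ov \<phi> \<and> (\<forall>z. z ^ N = 1 \<longrightarrow> z \<in> Ov)"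
proof -
  define \<xi> where "\<xi> = cis (2 * pi / real N)"
  have "bij_betw (\<lambda>k. cis (2 * pi * real k / real N)) {..<N} {z. z ^ N = 1}"
    by (rule Complex.bij_betw_roots_unity[OF N])
  hence roots: "\<exists>k. z = \<xi> ^ k" if "z ^ N = 1" for z
  proof -
    have "z \<in> (\<lambda>k. cis (2 * pi * real k / real N)) ` {..<N}"
      using \<open>bij_betw _ _ _\<close> that by (auto simp: bij_betw_def)
    then obtain k where "z = cis (2 * pi * real k / real N)" by blast
    hence "z = \<xi> ^ k" by (simp add: \<xi>_def Complex.DeMoivre mult_ac)
    thus ?thesis ..
  qed
  have "\<xi> ^ N = 1" using N by (simp add: \<xi>_def Complex.DeMoivre)
  then obtain m :: "int poly" where m: "degree m > 0" "is_unit (lead_coeff m)" "\<And>P. pev of_int \<xi> P = 0 \<longleftrightarrow> m dvd P"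
    using int_poly_annihilator[OF N] by blast
  have hc: "rhom (of_int :: int \<Rightarrow> complex)" and hk: "rhom (of_int :: int \<Rightarrow> 'k)"
    by (rule rhomI; simp)+
  have "(of_int (lead_coeff m) :: 'k) \<noteq> 0"
  proof -
    have "lead_coeff m = 1 \<or> lead_coeff m = -1" using m(2) by (simp add: abs_if split: if_splits)
    thus ?thesis by auto
  qed
  hence "degree (map_poly of_int m :: 'k poly) = degree m" by (intro map_poly_degree_eq) auto
  then obtain \<beta> :: 'k where "poly (map_poly of_int m) \<beta> = 0" using alg_closed_imp_poly_has_root m(1) by metis
  hence \<beta>: "pev of_int \<beta> m = 0" by (simp add: pev_def)
  let ?c = "pev of_int \<xi> :: int poly \<Rightarrow> complex" and ?k = "pev of_int \<beta> :: int poly \<Rightarrow> 'k"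
  note c = rhom_simps[OF rhom_pev[OF hc]] and k = rhom_simps[OF rhom_pev[OF hk]]
  have ker: "?k P = 0" if "?c P = 0" for P
    using that \<beta> by (auto simp: m(3) k elim!: dvdE)
  define Ov where "Ov = {?c P / ?c Q | P Q. ?k Q \<noteq> 0}"
  define \<phi> where "\<phi> z = (SOME w. \<exists>P Q. ?k Q \<noteq> 0 \<and> z = ?c P / ?c Q \<and> w = ?k P / ?k Q)" for z
  have \<phi>: "\<phi> (?c P / ?c Q) = ?k P / ?k Q" if Q: "?k Q \<noteq> 0" for P Q
  proof -
    have "\<exists>w P' Q'. ?k Q' \<noteq> 0 \<and> ?c P / ?c Q = ?c P' / ?c Q' \<and> w = ?k P' / ?k Q'" using Q by blast
    from someI_ex[OF this] obtain P' Q' where *: "?k Q' \<noteq> 0" "?c P / ?c Q = ?c P' / ?c Q'" "\<phi> (?c P / ?c Q) = ?k P' / ?k Q'"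
      unfolding \<phi>_def by blast
    have "?c Q \<noteq> 0" "?c Q' \<noteq> 0" using ker Q * by blast+
    hence "?c (P * Q' - P' * Q) = 0" using *(2) by (simp add: c frac_eq_eq)
    hence "?k (P * Q' - P' * Q) = 0" by (rule ker)
    thus ?thesis unfolding *(3) using * Q by (simp add: k frac_eq_eq)
  qed
  have "reduction Ov \<phi>"
  proof
    show "1 \<in> Ov" by (auto simp: Ov_def c k intro!: exI[of _ 1])
    show "\<phi> 1 = 1" using \<phi>[of 1 1] by (simp add: c k)
  next
    fix a b assume "a \<in> Ov" "b \<in> Ov"
    then obtain P Q P' Q' where a: "a = ?c P / ?c Q" "?k Q \<noteq> 0" and b: "b = ?c P' / ?c Q'" "?k Q' \<noteq> 0"
      unfolding Ov_def by blast
    have nz: "?c Q \<noteq> 0" "?c Q' \<noteq> 0" using ker a b by blast+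
    have QQ: "?k (Q * Q') \<noteq> 0" using a b by (simp add: k)
    have d: "a - b = ?c (P * Q' - P' * Q) / ?c (Q * Q')" and t: "a * b = ?c (P * P') / ?c (Q * Q')"
      unfolding a b using nz by (simp_all add: c diff_frac_eq)
    show "a - b \<in> Ov" "a * b \<in> Ov" unfolding d t Ov_def using QQ by blast+
    show "\<phi> (a - b) = \<phi> a - \<phi> b" "\<phi> (a * b) = \<phi> a * \<phi> b"
      unfolding d t \<phi>[OF QQ] unfolding a(1) b(1) \<phi>[OF a(2)] \<phi>[OF b(2)]
      using a(2) b(2) by (simp_all add: k diff_frac_eq)
  next
    fix a assume "a \<in> Ov" "\<phi> a \<noteq> 0"
    then obtain P Q where a: "a = ?c P / ?c Q" "?k Q \<noteq> 0" unfolding Ov_def by blast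
    hence "?k P \<noteq> 0" using \<open>\<phi> a \<noteq> 0\<close> \<phi>[OF a(2)] by auto
    moreover have "inverse a = ?c Q / ?c P" by (simp add: a)
    ultimately show "inverse a \<in> Ov" unfolding Ov_def by blast
  qed
  moreover have "z \<in> Ov" if z: "z ^ N = 1" for z
  proof -
    obtain i where "z = \<xi> ^ i" using roots[OF z] by blast
    hence "z = ?c (monom 1 i) / ?c 1" by (simp add: pev_monom[OF hc] c)
    moreover have "?k 1 \<noteq> 0" by (simp add: k)
    ultimately show ?thesis unfolding Ov_def by blast
  qed
  ultimately show ?thesis by blast
qed

text \<open>\<open>Ov\<close> contains the \<open>p\<close>-th roots of unity, for the additive
  characters, and those of order dividing \<open>p ^ M - 1\<close>, for the lifts of finite fields.
  The fields to be lifted are \<open>FQ m\<close> with \<open>m\<close> dividing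
  \<open>M\<close>.\<close>

locale teichmuller = reduction Ov \<phi> for Ov and \<phi> :: "complex \<Rightarrow> 'k::alg_closed_field" +
  fixes p M :: nat and \<zeta> :: complex
  assumes prime_p: "prime p" and p_ge_3: "p \<ge> 3" and char_p: "CHAR('k) = p" and M_pos: "M > 0"
    and roots_Ov: "z ^ (p * (p ^ M - 1)) = 1 \<Longrightarrow> z \<in> Ov"
    and zeta_p: "\<zeta> ^ p = 1" and zeta_ne_1: "\<zeta> \<noteq> 1"
begin

definition FQ :: "nat \<Rightarrow> 'k set" where "FQ m = {x. x ^ (p ^ m) = x}"

text \<open>Zero and the roots of unity of order dividing \<open>p ^ m - 1\<close>: the Teichmueller
  representatives of \<open>FQ m\<close>.\<close>

definition TQ :: "nat \<Rightarrow> complex set" where "TQ m = {z. z ^ (p ^ m) = z}"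

lemma p_pos [simp]: "p > 0" "p \<noteq> 0"
  using p_ge_3 by simp_all

lemma of_nat_p: "(of_nat p :: 'k) = 0"
  using of_nat_CHAR[where 'a='k] by (simp only: char_p)

lemma frob_m: "(x + y :: 'k) ^ (p ^ m) = x ^ (p ^ m) + y ^ (p ^ m)"
  by (rule freshmans_dream') (simp_all add: char_p prime_p)

lemma pm_gt_0: "p ^ m > 0" and pm_gt_1: "m > 0 \<Longrightarrow> p ^ m > 2"
proof -
  show "p ^ m > 0" using p_ge_3 by simp
  show "p ^ m > 2" if "m > 0"
    using p_ge_3 that self_le_power[of p m] by linarith
qed

lemma of_nat_pm: "m > 0 \<Longrightarrow> (of_nat (p ^ m) :: 'k) = 0"
  by (simp add: of_nat_p)

lemma of_nat_pm_1: "m > 0 \<Longrightarrow> (of_nat (p ^ m - 1) :: 'k) = -1"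
  using pm_gt_1[of m] of_nat_pm[of m] by (simp add: of_nat_diff)

lemma power_pm_1:
  fixes x :: "'b::idom"
  shows "x ^ (p ^ m) = x \<longleftrightarrow> x = 0 \<or> x ^ (p ^ m - 1) = 1"
proof -
  have "x ^ (p ^ m) = x ^ (p ^ m - 1) * x" using power_minus_mult[OF pm_gt_0] by metis
  thus ?thesis by auto
qed

lemma iterate_pm: "x ^ (p ^ m) = x \<Longrightarrow> x ^ (p ^ (m * j)) = x" for x :: "'b::comm_semiring_1"
  by (induction j) (simp_all add: power_add power_mult)

lemma FQ_mono: "m dvd m' \<Longrightarrow> FQ m \<subseteq> FQ m'" and TQ_mono: "m dvd m' \<Longrightarrow> TQ m \<subseteq> TQ m'"
  by (auto simp: FQ_def TQ_def elim!: dvdE intro: iterate_pm)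

lemma FQ_closed:
  shows "0 \<in> FQ m" "1 \<in> FQ m" "x \<in> FQ m \<Longrightarrow> y \<in> FQ m \<Longrightarrow> x + y \<in> FQ m"
    "x \<in> FQ m \<Longrightarrow> y \<in> FQ m \<Longrightarrow> x - y \<in> FQ m"
    "x \<in> FQ m \<Longrightarrow> y \<in> FQ m \<Longrightarrow> x * y \<in> FQ m" "x \<in> FQ m \<Longrightarrow> inverse x \<in> FQ m" "x \<in> FQ m \<Longrightarrow> - x \<in> FQ m"
    "x \<in> FQ m \<Longrightarrow> x ^ n \<in> FQ m" "x \<in> FQ m \<Longrightarrow> y \<in> FQ m \<Longrightarrow> x / y \<in> FQ m"
proof -
  show 0: "0 \<in> FQ m" and "1 \<in> FQ m" using pm_gt_0[of m] by (auto simp: FQ_def power_0_left)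
  show add: "x \<in> FQ m \<Longrightarrow> y \<in> FQ m \<Longrightarrow> x + y \<in> FQ m" for x y
    by (simp add: FQ_def frob_m)
  show mult: "x \<in> FQ m \<Longrightarrow> y \<in> FQ m \<Longrightarrow> x * y \<in> FQ m" for x y
    by (simp add: FQ_def power_mult_distrib)
  show inv: "x \<in> FQ m \<Longrightarrow> inverse x \<in> FQ m" for x
    by (simp add: FQ_def power_inverse)
  show minus: "x \<in> FQ m \<Longrightarrow> - x \<in> FQ m" for x
  proof -
    assume x: "x \<in> FQ m"
    have "(x + - x) ^ (p ^ m) = x ^ (p ^ m) + (- x) ^ (p ^ m)" by (rule frob_m)
    hence "x + (- x) ^ (p ^ m) = 0" using x pm_gt_0[of m] by (simp add: FQ_def power_0_left)
    thus ?thesis by (simp add: FQ_def add_eq_0_iff)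
  qed
  show "x \<in> FQ m \<Longrightarrow> y \<in> FQ m \<Longrightarrow> x - y \<in> FQ m" using add[of x "- y"] minus[of y] by simp
  show "x ^ n \<in> FQ m" if "x \<in> FQ m"
  proof -
    have "(x ^ n) ^ (p ^ m) = (x ^ (p ^ m)) ^ n" by (simp only: mult.commute flip: power_mult)
    thus ?thesis using that by (simp add: FQ_def)
  qed
  show "x \<in> FQ m \<Longrightarrow> y \<in> FQ m \<Longrightarrow> x / y \<in> FQ m" using mult[of x "inverse y"] inv[of y] by (simp add: divide_inverse)
qed

lemma FQ_sum: "(\<And>i. i \<in> A \<Longrightarrow> u i \<in> FQ m) \<Longrightarrow> sum u A \<in> FQ m"
  by (induction A rule: infinite_finite_induct) (auto intro: FQ_closed)

lemma TQ_Ov: "z \<in> TQ M \<Longrightarrow> z \<in> Ov"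
proof -
  assume "z \<in> TQ M"
  hence "z = 0 \<or> z ^ (p ^ M - 1) = 1" by (simp add: TQ_def power_pm_1)
  moreover have "z \<in> Ov" if "z ^ (p ^ M - 1) = 1"
    using that by (intro roots_Ov) (simp add: mult.commute[of p] power_mult)
  ultimately show ?thesis using Ov_0 by auto
qed

lemma zeta_Ov: "\<zeta> \<in> Ov"
  using zeta_p by (intro roots_Ov) (simp add: power_mult)

lemma TQ_mult: "z \<in> TQ m \<Longrightarrow> w \<in> TQ m \<Longrightarrow> z * w \<in> TQ m"
  by (simp add: TQ_def power_mult_distrib)

lemma phi_TQ: "z \<in> TQ M \<Longrightarrow> \<phi> z \<in> FQ M"
  using TQ_Ov[of z] by (simp add: TQ_def FQ_def flip: \<phi>_power)

lemma phi_TQ_0: "z \<in> TQ M \<Longrightarrow> \<phi> z = 0 \<Longrightarrow> z = 0"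
proof (rule ccontr)
  assume z: "z \<in> TQ M" "\<phi> z = 0" "z \<noteq> 0"
  hence "z ^ (p ^ M - 1) = 1" by (simp add: TQ_def power_pm_1)
  hence "\<phi> z ^ (p ^ M - 1) = 1" using TQ_Ov[OF z(1)] by (simp add: \<phi>_1 flip: \<phi>_power)
  thus False using z pm_gt_1[OF M_pos] by (simp add: power_0_left split: if_splits)
qed

text \<open>If the quotient u of two nonzero elements had residue 1 without being 1, the vanishing
  sum of the powers u^i for i < p^M - 1 would reduce to p^M - 1 = -1.\<close>

lemma phi_inj: "inj_on \<phi> (TQ M)"
proof (rule inj_onI)
  fix z w assume zw: "z \<in> TQ M" "w \<in> TQ M" "\<phi> z = \<phi> w"
  show "z = w"
  proof (cases "w = 0")
    case True
    thus ?thesis using zw phi_TQ_0[of z] by (simp add: \<phi>_0)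
  next
    case False
    hence w0: "\<phi> w \<noteq> 0" using phi_TQ_0 zw by blast
    define n where "n = p ^ M - 1"
    have z0: "z \<noteq> 0" using w0 zw by (auto simp: \<phi>_0)
    define u where "u = z * inverse w"
    have iw: "inverse w \<in> Ov" using TQ_Ov zw w0 by (intro Ov_inverse) auto
    have uO: "u \<in> Ov" unfolding u_def using zw TQ_Ov iw by (intro Ov_mult) auto
    have u1: "\<phi> u = 1" unfolding u_def using zw TQ_Ov iw w0 by (simp add: \<phi>_mult \<phi>_inverse)
    have un: "u ^ n = 1"
      unfolding u_def using zw z0 False by (simp add: TQ_def power_pm_1 n_def power_mult_distrib power_inverse)
    have "u = 1"
    proof (rule ccontr)
      assume "u \<noteq> 1"
      hence "(\<Sum>i<n. u ^ i) = 0" using un by (simp add: sum_gp_strict)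
      hence "\<phi> (\<Sum>i<n. u ^ i) = 0" by (simp add: \<phi>_0)
      hence "of_nat n = (0 :: 'k)" using uO by (simp add: \<phi>_sum \<phi>_power Ov_power u1)
      thus False using of_nat_pm_1[OF M_pos] by (simp add: n_def)
    qed
    thus ?thesis using False by (simp add: u_def field_simps)
  qed
qed

lemma card_TQ: "m > 0 \<Longrightarrow> card (TQ m) = p ^ m" and finite_TQ: "m > 0 \<Longrightarrow> finite (TQ m)"
proof -
  assume m: "m > 0"
  have TQ: "TQ m = insert 0 {z. z ^ (p ^ m - 1) = 1}" by (auto simp: TQ_def power_pm_1)
  have n: "p ^ m - 1 > 0" using pm_gt_1[OF m] by simp
  have fin: "finite {z :: complex. z ^ (p ^ m - 1) = 1}" using n by (rule finite_roots_unity[unfolded One_nat_def Suc_le_eq])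
  thus "finite (TQ m)" by (simp add: TQ)
  show "card (TQ m) = p ^ m"
    unfolding TQ using fin n card_roots_unity_eq[OF n] by (subst card_insert_disjoint) (auto simp: power_0_left)
qed

lemma finite_FQ: "m > 0 \<Longrightarrow> finite (FQ m)" and card_FQ_le: "m > 0 \<Longrightarrow> card (FQ m) \<le> p ^ m"
proof -
  assume m: "m > 0"
  define Q :: "'k poly" where "Q = monom 1 (p ^ m) + (- monom 1 1)"
  have "degree Q = p ^ m"
    unfolding Q_def using pm_gt_1[OF m] by (subst degree_add_eq_left) (simp_all add: degree_monom_eq)
  moreover from this have "Q \<noteq> 0" using pm_gt_1[OF m] by auto
  moreover have "FQ m = {x. poly Q x = 0}" by (auto simp: FQ_def Q_def poly_monom)
  ultimately show "finite (FQ m)" "card (FQ m) \<le> p ^ m"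
    using poly_roots_finite[of Q] card_poly_roots_bound[of Q] by auto
qed

text \<open>By counting: the injective image has p^M elements, and \<open>FQ M\<close> consists of
  the roots of a polynomial of degree p^M.\<close>

lemma phi_TQ_M: "\<phi> ` TQ M = FQ M"
proof (rule card_subset_eq[OF finite_FQ[OF M_pos]])
  show "\<phi> ` TQ M \<subseteq> FQ M" using phi_TQ by auto
  moreover have "card (\<phi> ` TQ M) = p ^ M" using card_image[OF phi_inj] card_TQ[OF M_pos] by simp
  ultimately show "card (\<phi> ` TQ M) = card (FQ M)"
    using card_FQ_le[OF M_pos] card_mono[OF finite_FQ[OF M_pos], of "\<phi> ` TQ M"] by simp
qed

definition tch :: "'k \<Rightarrow> complex" where "tch = the_inv_into (TQ M) \<phi>"

lemma tch: "x \<in> FQ M \<Longrightarrow> tch x \<in> TQ M \<and> \<phi> (tch x) = x"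
  unfolding tch_def using the_inv_into_into[OF phi_inj _ subset_refl] f_the_inv_into_f[OF phi_inj] phi_TQ_M by blast

lemma tch_eqI: "z \<in> TQ M \<Longrightarrow> \<phi> z = x \<Longrightarrow> tch x = z"
  unfolding tch_def using the_inv_into_f_f[OF phi_inj] by blast

lemma tch_Ov: "x \<in> FQ M \<Longrightarrow> tch x \<in> Ov"
  using tch TQ_Ov by blast

lemma tch_mult: "x \<in> FQ M \<Longrightarrow> y \<in> FQ M \<Longrightarrow> tch (x * y) = tch x * tch y"
  using tch[of x] tch[of y] TQ_Ov by (intro tch_eqI) (auto intro: TQ_mult simp: \<phi>_mult)

lemma tch_0: "tch 0 = 0" and tch_1: "tch 1 = 1"
  using pm_gt_0[of M] by (auto intro!: tch_eqI simp: TQ_def \<phi>_0 \<phi>_1 power_0_left)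

lemma tch_power: "x \<in> FQ M \<Longrightarrow> tch (x ^ n) = tch x ^ n"
  by (induction n) (auto simp: tch_1 tch_mult FQ_closed)

lemma tch_TQ: "m dvd M \<Longrightarrow> x \<in> FQ m \<Longrightarrow> tch x \<in> TQ m"
proof -
  assume m: "m dvd M" "x \<in> FQ m"
  hence x: "x \<in> FQ M" using FQ_mono by blast
  have "tch x ^ (p ^ m) = tch (x ^ (p ^ m))" by (simp add: tch_power[OF x])
  also have "x ^ (p ^ m) = x" using m by (simp add: FQ_def)
  finally show ?thesis by (simp add: TQ_def)
qed

lemma tch_bij: "m dvd M \<Longrightarrow> bij_betw tch (FQ m) (TQ m)"
proof (rule bij_betw_byWitness[where f' = \<phi>])
  assume m: "m dvd M"
  show "\<forall>x\<in>FQ m. \<phi> (tch x) = x" using tch FQ_mono[OF m] by blast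
  show "\<forall>z\<in>TQ m. tch (\<phi> z) = z" using tch_eqI TQ_mono[OF m] by blast
  show "tch ` FQ m \<subseteq> TQ m" using tch_TQ[OF m] by blast
  show "\<phi> ` TQ m \<subseteq> FQ m"
    using TQ_mono[OF m] TQ_Ov by (force simp: FQ_def TQ_def simp flip: \<phi>_power)
qed

lemma card_FQ: "m dvd M \<Longrightarrow> m > 0 \<Longrightarrow> card (FQ m) = p ^ m"
  using bij_betw_same_card[OF tch_bij] card_TQ by simp

text \<open>When the exponent is no multiple of p^m - 1, multiplication by some w with w^e \<noteq>
  1 permutes the roots of unity and forces the sum to be 0. Since 0 belongs to \<open>TQ m\<close>
  and 0^0 = 1, the exponent 0 gives p^m instead of p^m - 1.\<close>

lemma sum_TQ_power:
  assumes m: "m > 0"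
  shows "(\<Sum>z\<in>TQ m. z ^ e) = (if e = 0 then of_nat (p ^ m) else if (p ^ m - 1) dvd e then of_nat (p ^ m - 1) else 0)"
proof -
  define n where "n = p ^ m - 1"
  define A where "A = {z :: complex. z ^ n = 1}"
  have n: "n > 0" using pm_gt_1[OF m] by (simp add: n_def)
  have TQ: "TQ m = insert 0 A" by (auto simp: TQ_def A_def power_pm_1 n_def)
  have finA: "finite A" using finite_TQ[OF m] by (simp add: TQ)
  have A0: "0 \<notin> A" using n by (simp add: A_def power_0_left)
  have cardA: "card A = n" unfolding A_def by (rule card_roots_unity_eq[OF n])
  have eq: "(\<Sum>z\<in>TQ m. z ^ e) = 0 ^ e + (\<Sum>z\<in>A. z ^ e)" unfolding TQ using finA A0 by simp
  consider "e = 0" | "e > 0" "n dvd e" | "\<not> n dvd e" by (cases "e = 0") auto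
  thus ?thesis
  proof cases
    case 1
    thus ?thesis using eq cardA n by (simp add: n_def)
  next
    case 2
    have "z ^ e = 1" if "z \<in> A" for z using that 2 by (auto simp: A_def power_mult elim!: dvdE)
    thus ?thesis using eq cardA 2 by (simp add: n_def power_0_left)
  next
    case 3
    define r where "r = e mod n"
    have r: "0 < r" "r < n" using 3 n by (auto simp: r_def mod_greater_zero_iff_not_dvd)
    have "\<exists>w\<in>A. w ^ e \<noteq> 1"
    proof (rule ccontr)
      assume no: "\<not> (\<exists>w\<in>A. w ^ e \<noteq> 1)"
      have "A \<subseteq> {z. z ^ r = 1}"
      proof
        fix z assume z: "z \<in> A"
        have "z ^ e = z ^ (n * (e div n) + r)" by (simp add: r_def)
        also have "\<dots> = z ^ r" using z by (simp add: power_add power_mult A_def)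
        finally show "z \<in> {z. z ^ r = 1}" using no z by auto
      qed
      moreover have "finite {z :: complex. z ^ r = 1}" using r by (intro finite_roots_unity) simp
      ultimately have "card A \<le> card {z :: complex. z ^ r = 1}" by (rule card_mono[rotated])
      thus False using card_roots_unity_eq[OF r(1)] cardA r by simp
    qed
    then obtain w where w: "w \<in> A" "w ^ e \<noteq> 1" by blast
    have "w \<noteq> 0" using w A0 by auto
    have "bij_betw (\<lambda>z. w * z) A A"
    proof (rule bij_betw_byWitness[where f' = "\<lambda>z. inverse w * z"])
      show "(\<lambda>z. w * z) ` A \<subseteq> A" "(\<lambda>z. inverse w * z) ` A \<subseteq> A"
        using w by (auto simp: A_def power_mult_distrib power_inverse)
    qed (use \<open>w \<noteq> 0\<close> in auto)
    hence "(\<Sum>z\<in>A. z ^ e) = (\<Sum>z\<in>A. (w * z) ^ e)" by (simp add: sum.reindex_bij_betw[of "\<lambda>z. w * z" A A "\<lambda>z. z ^ e"])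
    also have "\<dots> = w ^ e * (\<Sum>z\<in>A. z ^ e)" by (simp add: power_mult_distrib sum_distrib_left)
    finally have "(\<Sum>z\<in>A. z ^ e) * (1 - w ^ e) = 0" by (simp add: algebra_simps)
    hence "(\<Sum>z\<in>A. z ^ e) = 0" using w by simp
    moreover have "e > 0" using 3 by (cases e) auto
    ultimately show ?thesis using eq 3 by (simp add: n_def power_0_left)
  qed
qed

lemma sum_tch_power:
  assumes m: "m > 0" "m dvd M"
  shows "(\<Sum>x\<in>FQ m. tch x ^ e) = (if e = 0 then of_nat (p ^ m) else if (p ^ m - 1) dvd e then of_nat (p ^ m - 1) else 0)"
  using sum_TQ_power[OF m(1), of e] sum.reindex_bij_betw[OF tch_bij[OF m(2)], of "\<lambda>z. z ^ e"] by simp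

lemma sum_FQ_power:
  assumes m: "m > 0" "m dvd M"
  shows "(\<Sum>x\<in>FQ m. x ^ e) = (if e > 0 \<and> (p ^ m - 1) dvd e then -1 else 0)"
proof -
  have "x ^ e = \<phi> (tch x ^ e)" "tch x ^ e \<in> Ov" if "x \<in> FQ m" for x
    using tch[of x] tch_Ov[of x] FQ_mono[OF m(2)] that by (auto simp: \<phi>_power intro: Ov_power)
  hence "(\<Sum>x\<in>FQ m. x ^ e) = \<phi> (\<Sum>x\<in>FQ m. tch x ^ e)" by (simp add: \<phi>_sum)
  also have "\<dots> = (if e > 0 \<and> (p ^ m - 1) dvd e then -1 else 0)"
    unfolding sum_tch_power[OF m] using of_nat_pm[OF m(1)] of_nat_pm_1[OF m(1)]
    by (simp add: \<phi>_0 \<phi>_of_nat del: of_nat_power of_nat_diff)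
  finally show ?thesis .
qed

section \<open>The trace and the additive characters\<close>

definition tr :: "nat \<Rightarrow> 'k \<Rightarrow> 'k" where "tr m x = (\<Sum>i<m. x ^ (p ^ i))"

text \<open>The additive character of the prime field that takes 1 to \<zeta>. As \<zeta>^p = 1, any
  other representing natural number gives the same value, by \<open>chi_of_nat\<close>.\<close>

definition chi :: "'k \<Rightarrow> complex" where "chi y = \<zeta> ^ (LEAST i. of_nat i = y)"

definition psi :: "nat \<Rightarrow> 'k \<Rightarrow> complex" where "psi m x = chi (tr m x)"

lemma FQ_1: "FQ (Suc 0) = of_nat ` {..<p}"
proof (rule sym, rule card_subset_eq[OF finite_FQ])
  show sub: "of_nat ` {..<p} \<subseteq> FQ (Suc 0)"
  proof safe
    fix i show "of_nat i \<in> FQ (Suc 0)" by (induction i) (auto intro: FQ_closed)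
  qed
  have inj: "inj_on (of_nat :: nat \<Rightarrow> 'k) {..<p}"
  proof (rule inj_onI)
    fix i j assume ij: "i \<in> {..<p}" "j \<in> {..<p}" "of_nat i = (of_nat j :: 'k)"
    show "i = j"
      using ij of_nat_eq_iff_char_dvd[of i j, where 'a='k] of_nat_eq_iff_char_dvd[of j i, where 'a='k] char_p
        dvd_imp_le[of p "j - i"] dvd_imp_le[of p "i - j"]
      by (cases i j rule: linorder_cases) auto
  qed
  show "card (of_nat ` {..<p} :: 'k set) = card (FQ (Suc 0))"
    using card_image[OF inj] card_FQ_le[of "Suc 0"] card_mono[OF finite_FQ sub] by simp
qed simp

lemma chi_of_nat: "chi (of_nat n) = \<zeta> ^ n"
proof -
  define i where "i = (LEAST i. of_nat i = (of_nat n :: 'k))"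
  have "of_nat i = (of_nat n :: 'k)" unfolding i_def by (rule LeastI[of _ n]) simp
  moreover have "i \<le> n" unfolding i_def by (rule Least_le) simp
  ultimately have "p dvd n - i"
    using of_nat_eq_iff_char_dvd[of i n, where 'a='k] char_p by (cases "i = n") auto
  then obtain k where "n - i = p * k" by (elim dvdE)
  hence "n = i + p * k" using \<open>i \<le> n\<close> by simp
  hence "\<zeta> ^ n = \<zeta> ^ i" by (simp add: power_add power_mult zeta_p)
  thus ?thesis by (simp add: chi_def i_def)
qed

lemma chi_add: "y \<in> FQ (Suc 0) \<Longrightarrow> z \<in> FQ (Suc 0) \<Longrightarrow> chi (y + z) = chi y * chi z"
  unfolding FQ_1 by (auto simp: chi_of_nat power_add simp flip: of_nat_add)

lemma chi_0: "chi 0 = 1"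
  using chi_of_nat[of 0] by simp

lemma chi_eq_1: "y \<in> FQ (Suc 0) \<Longrightarrow> chi y = 1 \<Longrightarrow> y = 0"
proof -
  assume y: "y \<in> FQ (Suc 0)" "chi y = 1"
  then obtain n where n: "y = of_nat n" "n < p" by (auto simp: FQ_1)
  hence zn: "\<zeta> ^ n = 1" using y by (simp add: chi_of_nat)
  show "y = 0"
  proof (rule ccontr)
    assume "y \<noteq> 0"
    hence "n > 0" using n by (cases n) auto
    hence "coprime n p" using n(2) prime_p by (metis coprime_commute nat_dvd_not_less prime_imp_coprime)
    then obtain k where "[n * k = 1] (mod p)" using cong_solve_coprime_nat[of n p] by auto
    hence "n * k mod p = 1" using p_ge_3 by (simp add: cong_def)
    hence "n * k = p * (n * k div p) + 1" by (metis mult.commute div_mult_mod_eq)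
    hence "(\<zeta> ^ n) ^ k = \<zeta> ^ (p * (n * k div p) + 1)" by (simp flip: power_mult)
    thus False using zn zeta_ne_1 by (simp add: power_add power_mult zeta_p)
  qed
qed

lemma tr_FQ: "x \<in> FQ m \<Longrightarrow> tr m x \<in> FQ (Suc 0)"
proof -
  assume x: "x \<in> FQ m"
  have sum: "(\<Sum>i\<in>A. u i) ^ p = (\<Sum>i\<in>A. u i ^ p)" for u :: "nat \<Rightarrow> 'k" and A
    by (rule freshmans_dream_sum) (simp_all add: char_p prime_p)
  have "tr m x ^ p = (\<Sum>i<m. x ^ (p ^ Suc i))"
    by (simp add: tr_def sum mult.commute flip: power_mult)
  also have "\<dots> = tr m x"
  proof -
    have "(\<Sum>i<m. x ^ (p ^ Suc i)) + x = (\<Sum>i<Suc m. x ^ (p ^ i))"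
      by (subst sum.lessThan_Suc_shift) simp
    also have "\<dots> = tr m x + x" using x by (simp add: tr_def FQ_def)
    finally show ?thesis by simp
  qed
  finally show ?thesis by (simp add: FQ_def)
qed

lemma tr_add: "tr m (x + y) = tr m x + tr m y"
  by (simp add: tr_def frob_m sum.distrib)

lemma tr_frob: "x \<in> FQ m \<Longrightarrow> tr m (x ^ p) = tr m x"
proof -
  assume x: "x \<in> FQ m"
  have "tr m (x ^ p) + x = (\<Sum>i<Suc m. x ^ (p ^ i))"
    by (subst sum.lessThan_Suc_shift) (simp add: tr_def flip: power_mult)
  also have "\<dots> = tr m x + x" using x by (simp add: tr_def FQ_def)
  finally show ?thesis by simp
qed

lemma psi_add: "x \<in> FQ m \<Longrightarrow> y \<in> FQ m \<Longrightarrow> psi m (x + y) = psi m x * psi m y"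
  by (simp add: psi_def tr_add chi_add tr_FQ)

lemma psi_0: "psi m 0 = 1"
proof -
  have "tr m 0 = 0" using pm_gt_0 by (simp add: tr_def power_0_left)
  thus ?thesis by (simp add: psi_def chi_0)
qed

lemma psi_sum: "finite A \<Longrightarrow> (\<And>i. i \<in> A \<Longrightarrow> u i \<in> FQ m) \<Longrightarrow> psi m (sum u A) = (\<Prod>i\<in>A. psi m (u i))"
  by (induction A rule: finite_induct) (auto simp: psi_0 psi_add FQ_sum)

end

section \<open>Gauss sums\<close>

context teichmuller
begin

definition vpi :: complex where "vpi = \<zeta> - 1"

lemma varpi_Ov: "vpi \<in> Ov" and varpi_ne_0: "vpi \<noteq> 0"
  using zeta_ne_1 by (auto simp: vpi_def intro: Ov_diff Ov_1 zeta_Ov)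

text \<open>In characteristic \<open>p\<close> the only \<open>p\<close>-th root of unity is
  1.\<close>

lemma phi_zeta: "\<phi> \<zeta> = 1"
proof -
  have "\<phi> \<zeta> ^ p = 1" using zeta_p zeta_Ov by (simp add: \<phi>_1 flip: \<phi>_power)
  hence "1 = (1 + (\<phi> \<zeta> - 1)) ^ p" by simp
  also have "\<dots> = 1 + (\<phi> \<zeta> - 1) ^ p" using frob_m[of 1 "\<phi> \<zeta> - 1" 1] by simp
  finally have "(\<phi> \<zeta> - 1) ^ p = 0" by simp
  thus ?thesis by simp
qed

lemma phi_varpi: "\<phi> vpi = 0"
  by (simp add: vpi_def \<phi>_diff zeta_Ov Ov_1 phi_zeta \<phi>_1)

text \<open>The congruence z = c \<pi>^K modulo higher order, with \<pi> = \<open>vpi\<close>. As c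
  = 0 is allowed, one relation expresses both a divisibility and a leading coefficient, and it is
  stable under sums and products.\<close>

definition res :: "nat \<Rightarrow> complex \<Rightarrow> 'k \<Rightarrow> bool" where
  "res K z c \<longleftrightarrow> (\<exists>u\<in>Ov. z = vpi ^ K * u \<and> \<phi> u = c)"

lemma res_Ov: "z \<in> Ov \<Longrightarrow> res 0 z (\<phi> z)"
  by (auto simp: res_def)

lemma res_mult: "res K z c \<Longrightarrow> res K' z' c' \<Longrightarrow> res (K + K') (z * z') (c * c')"
  unfolding res_def by (elim bexE conjE) (auto simp: power_add \<phi>_mult intro!: bexI[OF _ Ov_mult])

lemma res_add: "res K z c \<Longrightarrow> res K z' c' \<Longrightarrow> res K (z + z') (c + c')"
  unfolding res_def by (elim bexE conjE) (auto simp: \<phi>_add distrib_left intro!: bexI[OF _ Ov_add])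

lemma res_0: "res K 0 0"
  by (auto simp: res_def \<phi>_0 intro!: bexI[OF _ Ov_0])

lemma res_uminus: "res K z c \<Longrightarrow> res K (- z) (- c)"
  unfolding res_def by (elim bexE conjE) (auto simp: \<phi>_uminus intro!: bexI[OF _ Ov_uminus])

lemma res_sum: "(\<And>i. i \<in> A \<Longrightarrow> res K (u i) (c i)) \<Longrightarrow> res K (sum u A) (sum c A)"
  by (induction A rule: infinite_finite_induct) (auto intro: res_0 res_add)

lemma res_prod: "finite A \<Longrightarrow> (\<And>i. i \<in> A \<Longrightarrow> res (K i) (u i) (c i)) \<Longrightarrow> res (sum K A) (prod u A) (prod c A)"
proof (induction A rule: finite_induct)
  case empty
  thus ?case using res_Ov[OF Ov_1] by (simp add: \<phi>_1)
qed (auto intro!: res_mult)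

lemma res_power: "res K z c \<Longrightarrow> res (n * K) (z ^ n) (c ^ n)"
proof (induction n)
  case 0
  thus ?case using res_Ov[OF Ov_1] by (simp add: \<phi>_1)
qed (auto intro!: res_mult)

lemma res_weaken: "res K z c \<Longrightarrow> K' < K \<Longrightarrow> res K' z 0"
proof -
  assume "res K z c" and K: "K' < K"
  then obtain u where u: "u \<in> Ov" "z = vpi ^ K * u" unfolding res_def by blast
  have "z = vpi ^ K' * (vpi ^ (K - K') * u)" using K u by (simp flip: power_add mult.assoc)
  moreover have "\<phi> (vpi ^ (K - K') * u) = 0"
    using K u varpi_Ov by (simp add: \<phi>_mult \<phi>_power Ov_power phi_varpi power_0_left)
  ultimately show ?thesis unfolding res_def using u varpi_Ov by (blast intro: Ov_mult Ov_power)
qed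

lemma res_divide_unit: "res K z c \<Longrightarrow> w \<in> Ov \<Longrightarrow> \<phi> w \<noteq> 0 \<Longrightarrow> res K (z / w) (c / \<phi> w)"
  using res_mult[of K z c 0 "inverse w" "\<phi> (inverse w)"] res_Ov[of "inverse w"] Ov_inverse \<phi>_inverse
  by (simp add: divide_inverse)

text \<open>Expands (1 + \<pi>)^p = 1: apart from 1, p \<pi> and \<pi>^p, all terms are divisible by
  p \<pi>^2, so p times a unit with residue 1 equals -\<pi>^(p-1).\<close>

lemma res_p: "res (p - 1) (of_nat p) (- 1)"
proof -
  define s where "s = (\<Sum>k\<in>{2..<p}. of_nat ((p choose k) div p) * vpi ^ (k - 2))"
  have sO: "s \<in> Ov" unfolding s_def by (intro Ov_sum Ov_mult Ov_of_nat Ov_power varpi_Ov)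
  have "(\<Sum>k\<in>{2..<p}. of_nat (p choose k) * vpi ^ k) = of_nat p * vpi ^ 2 * s"
    unfolding s_def sum_distrib_left
  proof (intro sum.cong refl)
    fix k assume k: "k \<in> {2..<p}"
    have "p dvd p choose k" using k prime_p by (intro dvd_choose_prime) auto
    hence "of_nat (p choose k) = of_nat p * (of_nat ((p choose k) div p) :: complex)" by (simp flip: of_nat_mult)
    moreover have "vpi ^ k = vpi ^ 2 * vpi ^ (k - 2)" 
    proof -
      obtain k' where "k = 2 + k'" using k le_Suc_ex[of 2 k] by auto
      thus ?thesis by (simp only: power_add) simp
    qed
    ultimately show "of_nat (p choose k) * vpi ^ k = of_nat p * vpi ^ 2 * (of_nat ((p choose k) div p) * vpi ^ (k - 2))"
      by (simp add: mult_ac)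
  qed
  moreover have "(vpi + 1) ^ p = (\<Sum>k\<le>p. of_nat (p choose k) * vpi ^ k)"
    by (simp add: binomial_ring)
  moreover have "{..p} = insert 0 (insert 1 (insert p {2..<p}))" using p_ge_3 by auto
  ultimately have "(vpi + 1) ^ p = 1 + of_nat p * vpi + vpi ^ p + of_nat p * vpi ^ 2 * s"
    using p_ge_3 by simp
  moreover have "(vpi + 1) ^ p = 1" using zeta_p by (simp add: vpi_def)
  moreover have "vpi ^ p = vpi ^ (p - 1) * vpi" using power_minus_mult[of p vpi] by simp
  ultimately have "vpi * (of_nat p * (1 + vpi * s) + vpi ^ (p - 1)) = 0"
    by (simp add: algebra_simps power2_eq_square)
  hence eq: "of_nat p * (1 + vpi * s) = - (vpi ^ (p - 1))" using varpi_ne_0 by (simp add: add_eq_0_iff2)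
  have w: "1 + vpi * s \<in> Ov" "\<phi> (1 + vpi * s) = 1"
    using sO varpi_Ov by (auto simp: \<phi>_add \<phi>_mult phi_varpi \<phi>_1 Ov_1 Ov_mult intro: Ov_add)
  have "1 + vpi * s \<noteq> 0" using w \<phi>_0 by auto
  hence "of_nat p = vpi ^ (p - 1) * (- inverse (1 + vpi * s))" using eq by (simp add: field_simps)
  moreover have "- inverse (1 + vpi * s) \<in> Ov" "\<phi> (- inverse (1 + vpi * s)) = -1"
    using w Ov_inverse by (simp_all add: Ov_uminus \<phi>_uminus \<phi>_inverse)
  ultimately show ?thesis unfolding res_def by blast
qed

text \<open>\<zeta>^i - 1 = \<pi> (1 + \<zeta> + ... + \<zeta>^(i-1)), and the sum has residue
  i.\<close>

lemma res_psi: "x \<in> FQ m \<Longrightarrow> res 1 (psi m x - 1) (tr m x)"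
proof -
  assume "x \<in> FQ m"
  then obtain i where i: "tr m x = of_nat i" using tr_FQ[of x m] unfolding FQ_1 by blast
  have "\<zeta> ^ i - 1 = vpi * (\<Sum>j<i. \<zeta> ^ j)" unfolding vpi_def by (rule power_diff_1_eq)
  moreover have "(\<Sum>j<i. \<zeta> ^ j) \<in> Ov" "\<phi> (\<Sum>j<i. \<zeta> ^ j) = of_nat i"
    using zeta_Ov by (auto simp: \<phi>_sum \<phi>_power Ov_power phi_zeta intro: Ov_sum Ov_power)
  ultimately show ?thesis unfolding res_def psi_def i chi_of_nat by force
qed

text \<open>The Gauss sum of the additive character \<open>psi m\<close> and the \<open>k\<close>-th
  power of the inverse Teichmueller character.\<close>

definition gs :: "nat \<Rightarrow> nat \<Rightarrow> complex" where
  "gs m k = (\<Sum>v\<in>FQ m - {0}. psi m v * tch (inverse v) ^ k)"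

context
  fixes m :: nat assumes m: "m > 0" "m dvd M"
begin

lemma FQ_M: "x \<in> FQ m \<Longrightarrow> x \<in> FQ M"
  using FQ_mono[OF m(2)] by blast

lemma fin_FQ: "finite (FQ m)"
  by (rule finite_FQ[OF m(1)])

lemma bij_inverse: "bij_betw inverse (FQ m - {0}) (FQ m - {0})"
  by (rule bij_betw_byWitness[where f' = inverse]) (auto intro: FQ_closed)

lemma sum_tch_inverse:
  assumes "0 < k" "k < p ^ m - 1"
  shows "(\<Sum>v\<in>FQ m - {0}. tch (inverse v) ^ k) = 0" "(\<Sum>v\<in>FQ m - {0}. tch v ^ k) = 0"
proof -
  have "(\<Sum>v\<in>FQ m. tch v ^ k) = 0"
    using sum_tch_power[OF m, of k] assms nat_dvd_not_less[of k "p ^ m - 1"] by simp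
  thus 1: "(\<Sum>v\<in>FQ m - {0}. tch v ^ k) = 0"
    using assms by (simp add: sum.remove[OF fin_FQ FQ_closed(1)] tch_0 power_0_left)
  have "(\<Sum>v\<in>FQ m - {0}. tch (inverse v) ^ k) = (\<Sum>v\<in>FQ m - {0}. tch v ^ k)"
    by (rule sum.reindex_bij_betw[OF bij_inverse])
  thus "(\<Sum>v\<in>FQ m - {0}. tch (inverse v) ^ k) = 0" using 1 by simp
qed

lemma sum_FQ_nz_power:
  assumes "0 < k" "k < p ^ m - 1"
  shows "(\<Sum>v\<in>FQ m - {0}. v ^ k) = 0"
proof -
  have "(\<Sum>v\<in>FQ m. v ^ k) = 0"
    using sum_FQ_power[OF m, of k] assms nat_dvd_not_less[of k "p ^ m - 1"] by auto
  thus ?thesis using assms by (simp add: sum.remove[OF fin_FQ FQ_closed(1)] power_0_left)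
qed

lemma Q_gt_2: "p ^ m > 2"
  by (rule pm_gt_1[OF m(1)])

text \<open>Multiplied out, the trace gives the sums of v^(p^i - 1) over nonzero v. They vanish for
  0 < i < m, and i = 0 counts p^m - 1 = -1 elements.\<close>

lemma sum_trace: "(\<Sum>v\<in>FQ m - {0}. tr m v * inverse v) = -1"
proof -
  have "(\<Sum>v\<in>FQ m - {0}. tr m v * inverse v) = (\<Sum>v\<in>FQ m - {0}. \<Sum>i<m. v ^ (p ^ i - 1))"
    unfolding tr_def sum_distrib_right
  proof (intro sum.cong refl)
    fix v i assume "v \<in> FQ m - {0}"
    moreover have "v ^ (p ^ i) = v ^ (p ^ i - 1) * v" using power_minus_mult[OF pm_gt_0] by metis
    ultimately show "v ^ (p ^ i) * inverse v = v ^ (p ^ i - 1)" by simp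
  qed
  also have "\<dots> = (\<Sum>i<m. \<Sum>v\<in>FQ m - {0}. v ^ (p ^ i - 1))" by (rule sum.swap)
  also have "\<dots> = (\<Sum>i<m. if i = 0 then -1 else 0)"
  proof (intro sum.cong refl)
    fix i assume i: "i \<in> {..<m}"
    show "(\<Sum>v\<in>FQ m - {0}. v ^ (p ^ i - 1)) = (if i = 0 then -1 else 0)"
    proof (cases "i = 0")
      case True
      thus ?thesis using of_nat_pm_1[OF m(1)] fin_FQ FQ_closed(1)[of m]
        by (simp add: card_Diff_singleton card_FQ[OF m(2,1)])
    next
      case False
      have "p ^ i < p ^ m" using i p_ge_3 by (intro power_strict_increasing) auto
      hence "p ^ i - 1 < p ^ m - 1" using pm_gt_1[of i] False by simp
      thus ?thesis using pm_gt_1[of i] False by (simp add: sum_FQ_nz_power)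
    qed
  qed
  also have "\<dots> = -1" using m by simp
  finally show ?thesis .
qed

lemma tch_inv_Ov: "v \<in> FQ m \<Longrightarrow> tch (inverse v) \<in> Ov"
  by (intro tch_Ov FQ_M FQ_closed)

lemma phi_tch_inv: "v \<in> FQ m \<Longrightarrow> \<phi> (tch (inverse v)) = inverse v"
  using tch[of "inverse v"] FQ_M[OF FQ_closed(6)] by blast

text \<open>The multiplicative character sums to 0, so \<open>psi m v\<close> may be replaced by
  \<open>psi m v - 1\<close>, whose leading coefficient is the trace.\<close>

lemma res_gs_1: "res 1 (gs m 1) (-1)"
proof -
  have "gs m 1 = (\<Sum>v\<in>FQ m - {0}. (psi m v - 1) * tch (inverse v)) + (\<Sum>v\<in>FQ m - {0}. tch (inverse v) ^ 1)"
    by (simp add: gs_def left_diff_distrib sum_subtractf)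
  also have "(\<Sum>v\<in>FQ m - {0}. tch (inverse v) ^ 1) = 0"
    using Q_gt_2 by (intro sum_tch_inverse) auto
  finally have eq: "gs m 1 = (\<Sum>v\<in>FQ m - {0}. (psi m v - 1) * tch (inverse v))" by simp
  have "res (1 + 0) ((psi m v - 1) * tch (inverse v)) (tr m v * inverse v)" if "v \<in> FQ m - {0}" for v
    using that res_Ov[OF tch_inv_Ov[of v]] phi_tch_inv[of v] by (intro res_mult res_psi) auto
  hence "res 1 (gs m 1) (\<Sum>v\<in>FQ m - {0}. tr m v * inverse v)"
    unfolding eq by (intro res_sum) simp
  thus ?thesis by (simp only: sum_trace)
qed

lemma psi_frob: "v \<in> FQ m \<Longrightarrow> psi m (v ^ p) = psi m v"
  by (simp add: psi_def tr_frob)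

lemma bij_frob: "bij_betw (\<lambda>v. v ^ p) (FQ m - {0}) (FQ m - {0})"
proof -
  have "inj_on (\<lambda>v. v ^ p) (FQ m - {0})"
  proof (rule inj_onI)
    fix v w assume vw: "v \<in> FQ m - {0}" "w \<in> FQ m - {0}" "v ^ p = w ^ p"
    have "((v - w) + w) ^ p = (v - w) ^ p + w ^ p" using frob_m[of "v - w" w 1] by simp
    hence "(v - w) ^ p = 0" using vw by simp
    thus "v = w" by simp
  qed
  moreover have "(\<lambda>v. v ^ p) ` (FQ m - {0}) \<subseteq> FQ m - {0}" by (auto intro: FQ_closed)
  ultimately show ?thesis using fin_FQ by (simp add: bij_betw_def endo_inj_surj)
qed

text \<open>Substituting v^p for v leaves the trace unchanged.\<close>

lemma gs_frob: "gs m (p * k) = gs m k"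
proof -
  have "gs m k = (\<Sum>v\<in>FQ m - {0}. psi m (v ^ p) * tch (inverse (v ^ p)) ^ k)"
    unfolding gs_def by (rule sum.reindex_bij_betw[OF bij_frob, symmetric])
  also have "\<dots> = gs m (p * k)"
    unfolding gs_def
  proof (intro sum.cong refl)
    fix v assume v: "v \<in> FQ m - {0}"
    have "tch (inverse (v ^ p)) = tch (inverse v) ^ p"
      using v FQ_M[OF FQ_closed(6)] by (simp add: power_inverse tch_power flip: power_inverse)
    thus "psi m (v ^ p) * tch (inverse (v ^ p)) ^ k = psi m v * tch (inverse v) ^ (p * k)"
      using v by (simp add: psi_frob power_mult)
  qed
  finally show ?thesis ..
qed

text \<open>The Jacobi sum of the \<open>a\<close>-th and the first power of the inverse
  Teichmueller character.\<close>

definition jac :: "nat \<Rightarrow> complex" where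
  "jac a = (\<Sum>x\<in>FQ m - {0, 1}. tch (inverse x) ^ a * tch (inverse (1 - x)))"

lemma tch_m_mult: "x \<in> FQ m \<Longrightarrow> y \<in> FQ m \<Longrightarrow> tch (x * y) = tch x * tch y"
  by (intro tch_mult FQ_M)

text \<open>Pairs with u + v = w \<noteq> 0 are written as u = w x, v = w (1 - x). The pairs with u
  + v = 0 contribute a full sum of a character that is nontrivial because a + 1 < p^m - 1.\<close>

lemma gs_step:
  assumes a: "0 < a" "a + 1 < p ^ m - 1"
  shows "gs m a * gs m 1 = jac a * gs m (a + 1)"
proof -
  let ?F = "FQ m - {0}"
  define h where "h = (\<lambda>(u, v). psi m (u + v) * (tch (inverse u) ^ a * tch (inverse v)))"
  have "gs m a * gs m 1 = (\<Sum>u\<in>?F. \<Sum>v\<in>?F. h (u, v))"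
    unfolding gs_def sum_product h_def
    by (intro sum.cong refl) (auto simp: psi_add)
  also have "\<dots> = (\<Sum>uv\<in>?F \<times> ?F. h uv)" by (simp add: sum.cartesian_product)
  also have "?F \<times> ?F = (\<lambda>u. (u, - u)) ` ?F \<union> {(u, v). u \<in> ?F \<and> v \<in> ?F \<and> u + v \<noteq> 0}"
    by (auto simp: image_iff add_eq_0_iff FQ_closed)
  also have "(\<Sum>uv\<in>\<dots>. h uv) = (\<Sum>uv\<in>(\<lambda>u. (u, - u)) ` ?F. h uv) + (\<Sum>uv\<in>{(u, v). u \<in> ?F \<and> v \<in> ?F \<and> u + v \<noteq> 0}. h uv)"
  proof (rule sum.union_disjoint)
    show "finite {(u, v). u \<in> ?F \<and> v \<in> ?F \<and> u + v \<noteq> 0}"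
      by (rule finite_subset[of _ "?F \<times> ?F"]) (use fin_FQ in auto)
  qed (use fin_FQ in auto)
  also have "(\<Sum>uv\<in>(\<lambda>u. (u, - u)) ` ?F. h uv) = (\<Sum>u\<in>?F. h (u, - u))"
    by (subst sum.reindex) (auto simp: inj_on_def)
  also have "\<dots> = (\<Sum>u\<in>?F. tch (inverse u) ^ (a + 1) * tch (-1))"
  proof (intro sum.cong refl)
    fix u assume u: "u \<in> ?F"
    have "tch (inverse (- u)) = tch (inverse u * (-1))" by simp
    also have "\<dots> = tch (inverse u) * tch (-1)" using u by (intro tch_m_mult FQ_closed) auto
    finally show "h (u, - u) = tch (inverse u) ^ (a + 1) * tch (-1)" by (simp add: h_def psi_0)
  qed
  also have "\<dots> = 0" using a by (simp only: sum_distrib_right[symmetric] sum_tch_inverse) simp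
  also have "(\<Sum>uv\<in>{(u, v). u \<in> ?F \<and> v \<in> ?F \<and> u + v \<noteq> 0}. h uv)
      = (\<Sum>(x, w)\<in>(FQ m - {0, 1}) \<times> ?F. (tch (inverse x) ^ a * tch (inverse (1 - x))) * (psi m w * tch (inverse w) ^ (a + 1)))"
  proof (rule sum.reindex_bij_witness[where i = "\<lambda>(x, w). (w * x, w * (1 - x))" and j = "\<lambda>(u, v). (u / (u + v), u + v)"], goal_cases)
    case (1 uv)
    thus ?case by (auto simp: field_simps)
  next
    case (2 uv)
    thus ?case by (auto simp: FQ_closed field_simps)
  next
    case (3 xw)
    thus ?case by (auto simp: field_simps)
  next
    case (4 xw)
    thus ?case by (auto simp: FQ_closed algebra_simps)
  next
    case (5 uv)
    then obtain u v where uv: "uv = (u, v)" "u \<in> FQ m" "v \<in> FQ m" "u \<noteq> 0" "v \<noteq> 0" "u + v \<noteq> 0" by auto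
    define w where "w = u + v"
    define x where "x = u / w"
    have xw: "w \<in> FQ m" "x \<in> FQ m" "w \<noteq> 0" "x \<noteq> 0" "1 - x \<noteq> 0" "1 - x \<in> FQ m" "u = w * x" "v = w * (1 - x)"
      using uv by (auto simp: w_def x_def FQ_closed field_simps)
    have "tch (inverse u) = tch (inverse w) * tch (inverse x)" "tch (inverse v) = tch (inverse w) * tch (inverse (1 - x))"
      unfolding xw(7,8) inverse_mult_distrib using xw by (auto intro!: tch_m_mult FQ_closed)
    thus ?case unfolding uv by (simp add: h_def w_def[symmetric] x_def[symmetric] power_mult_distrib mult_ac)
  qed
  also have "\<dots> = jac a * gs m (a + 1)"
    unfolding jac_def gs_def sum_product by (simp add: sum.cartesian_product)
  finally show ?thesis by simp
qed

lemma jac_Ov: "jac a \<in> Ov"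
  unfolding jac_def by (intro Ov_sum Ov_mult Ov_power tch_inv_Ov) (auto intro: FQ_closed)

text \<open>After the substitution x = 1/y the summand becomes a geometric sum plus 1/(y - 1). Power
  sums over the whole field vanish in degrees up to a, so the omitted elements 0 and 1 contribute -1
  - (a + 1), and the reciprocals add 1.\<close>

lemma phi_jac:
  assumes a: "0 < a" "a + 1 < p ^ m - 1"
  shows "\<phi> (jac a) = - of_nat (a + 1)"
proof -
  let ?G = "FQ m - {0, 1}"
  have "\<phi> (jac a) = (\<Sum>x\<in>?G. inverse x ^ a * inverse (1 - x))"
    unfolding jac_def
    by (subst \<phi>_sum) (auto intro!: sum.cong Ov_mult Ov_power tch_inv_Ov FQ_closed
      simp: \<phi>_mult \<phi>_power Ov_power tch_inv_Ov phi_tch_inv FQ_closed)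
  also have "\<dots> = (\<Sum>y\<in>?G. inverse (inverse y) ^ a * inverse (1 - inverse y))"
    by (rule sum.reindex_bij_witness[where i = inverse and j = inverse]) (auto simp: FQ_closed)
  also have "\<dots> = (\<Sum>y\<in>?G. (\<Sum>i<Suc a. y ^ i) + inverse (y - 1))"
  proof (intro sum.cong refl)
    fix y assume y: "y \<in> ?G"
    hence y1: "y - 1 \<noteq> 0" "y \<noteq> 0" by auto
    have "y ^ Suc a - 1 = (y - 1) * (\<Sum>i<Suc a. y ^ i)" by (rule power_diff_1_eq)
    hence "(\<Sum>i<Suc a. y ^ i) = (y ^ Suc a - 1) / (y - 1)" using y1 by simp
    moreover have "inverse (1 - inverse y) = y / (y - 1)"
    proof -
      have "1 - inverse y = (y - 1) / y" using y1 by (simp add: diff_divide_distrib inverse_eq_divide)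
      thus ?thesis by simp
    qed
    ultimately show "inverse (inverse y) ^ a * inverse (1 - inverse y) = (\<Sum>i<Suc a. y ^ i) + inverse (y - 1)"
      using y1 by (simp add: inverse_eq_divide diff_divide_distrib mult.commute)
  qed
  also have "\<dots> = (\<Sum>y\<in>?G. \<Sum>i<Suc a. y ^ i) + (\<Sum>y\<in>?G. inverse (y - 1))" by (rule sum.distrib)
  also have "(\<Sum>y\<in>?G. \<Sum>i<Suc a. y ^ i) = - of_nat (a + 2)"
  proof -
    have "(\<Sum>y\<in>FQ m. \<Sum>i<Suc a. y ^ i) = (\<Sum>i<Suc a. \<Sum>y\<in>FQ m. y ^ i)" by (rule sum.swap)
    also have "\<dots> = 0"
    proof (rule sum.neutral, rule ballI)
      fix i assume "i \<in> {..<Suc a}"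
      hence "\<not> (i > 0 \<and> (p ^ m - 1) dvd i)" using a nat_dvd_not_less[of i "p ^ m - 1"] by auto
      thus "(\<Sum>y\<in>FQ m. y ^ i) = 0" using sum_FQ_power[OF m, of i] by simp
    qed
    finally have "(\<Sum>y\<in>FQ m. \<Sum>i<Suc a. y ^ i) = 0" .
    moreover have eq: "FQ m = insert 0 (insert 1 ?G)" using FQ_closed(1,2)[of m] by auto
    have "sum h (FQ m) = h 0 + (h 1 + sum h ?G)" for h :: "'k \<Rightarrow> 'k"
      by (subst eq) (use fin_FQ in simp)
    from trans[OF this[of "\<lambda>y. \<Sum>i<Suc a. y ^ i", symmetric] calculation(1)] have A: "(\<Sum>i<Suc a. (0::'k) ^ i) + ((\<Sum>i<Suc a. (1::'k) ^ i) + (\<Sum>y\<in>?G. \<Sum>i<Suc a. y ^ i)) = 0" .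
    have s0: "(\<Sum>i<Suc a. (0::'k) ^ i) = 1" by (subst sum.lessThan_Suc_shift) simp
    have s1: "(\<Sum>i<Suc a. (1::'k) ^ i) = of_nat a + 1" by simp
    have "1 + (of_nat a + 1 + s) = 0 \<Longrightarrow> s = - of_nat (a + 2)" for s :: 'k
      by (simp add: eq_neg_iff_add_eq_0 algebra_simps)
    thus ?thesis using A unfolding s0 s1 by blast
  qed
  also have "(\<Sum>y\<in>?G. inverse (y - 1)) = 1"
  proof -
    have "(\<Sum>y\<in>?G. inverse (y - 1)) = (\<Sum>z\<in>FQ m - {0, -1}. inverse z)"
      by (rule sum.reindex_bij_witness[where i = "\<lambda>z. z + 1" and j = "\<lambda>y. y - 1"])
         (auto simp: FQ_closed add_eq_0_iff2)
    moreover have "(\<Sum>z\<in>FQ m - {0}. inverse z) = (\<Sum>z\<in>FQ m - {0}. z ^ 1)"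
      using sum.reindex_bij_betw[OF bij_inverse, of "\<lambda>z. z"] by simp
    hence "(\<Sum>z\<in>FQ m - {0}. inverse z) = 0" using sum_FQ_nz_power[of 1] Q_gt_2 by simp
    moreover have "(\<Sum>z\<in>FQ m - {0}. inverse z) = inverse (-1) + (\<Sum>z\<in>FQ m - {0} - {-1}. inverse z)"
      using fin_FQ by (intro sum.remove) (auto intro: FQ_closed)
    moreover have "FQ m - {0} - {-1} = FQ m - {0, -1}" by auto
    ultimately show ?thesis by (simp add: algebra_simps eq_neg_iff_add_eq_0)
  qed
  finally show ?thesis by simp
qed

end

end

section \<open>Stickelberger's congruence and the expansion of the additive character\<close>

context teichmuller
begin

definition dg :: "nat \<Rightarrow> nat \<Rightarrow> nat" where "dg k j = k div p ^ j mod p"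

definition sd :: "nat \<Rightarrow> nat \<Rightarrow> nat" where "sd m k = (\<Sum>j<m. dg k j)"

text \<open>The denominator in Stickelberger's congruence, the product of the factorials of the
  base-\<open>p\<close> digits.\<close>

definition fc :: "nat \<Rightarrow> nat \<Rightarrow> 'k" where "fc m k = (\<Prod>j<m. of_nat (fact (dg k j)))"

lemma dg_lt: "dg k j < p"
  by (simp add: dg_def)

lemma fact_nonzero: "i < p \<Longrightarrow> (of_nat (fact i) :: 'k) \<noteq> 0"
  using prime_p by (simp add: of_nat_eq_0_iff_char_dvd char_p prime_dvd_fact_iff)

lemma dg_mult_p: "dg (p * k) 0 = 0" "dg (p * k) (Suc j) = dg k j"
  by (simp_all add: dg_def div_mult2_eq)

lemma dg_Suc:
  assumes "\<not> p dvd Suc a"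
  shows "dg (Suc a) 0 = Suc (dg a 0)" "dg (Suc a) (Suc j) = dg a (Suc j)"
proof -
  show "dg (Suc a) 0 = Suc (dg a 0)"
    using assms by (auto simp: dg_def mod_Suc dvd_eq_mod_eq_0)
  have "Suc a div p = a div p" using assms by (simp add: div_Suc dvd_eq_mod_eq_0)
  thus "dg (Suc a) (Suc j) = dg a (Suc j)" by (simp add: dg_def div_mult2_eq)
qed

context
  fixes m :: nat assumes m: "m > 0" "m dvd M"
begin

lemma sd_fc_mult_p:
  assumes "p * k < p ^ m"
  shows "sd m (p * k) = sd m k" "fc m (p * k) = fc m k"
proof -
  obtain m' where m': "m = Suc m'" using m by (cases m) auto
  have "k < p ^ m'" using assms by (simp add: m')
  hence 0: "dg k m' = 0" by (simp add: dg_def)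
  show "sd m (p * k) = sd m k"
    unfolding sd_def m' by (subst sum.lessThan_Suc_shift) (simp add: dg_mult_p 0)
  show "fc m (p * k) = fc m k"
    unfolding fc_def m' by (subst prod.lessThan_Suc_shift) (simp add: dg_mult_p 0)
qed

text \<open>No carry occurs, so only the last digit grows, and the new one is congruent to
  \<open>Suc a\<close> modulo \<open>p\<close>.\<close>

lemma sd_fc_Suc:
  assumes "\<not> p dvd Suc a"
  shows "sd m (Suc a) = sd m a + 1" "fc m (Suc a) = fc m a * of_nat (Suc a)"
proof -
  obtain m' where m': "m = Suc m'" using m by (cases m) auto
  show "sd m (Suc a) = sd m a + 1"
    unfolding sd_def m' sum.lessThan_Suc_shift by (simp add: dg_Suc[OF assms])
  have "(of_nat (Suc a) :: 'k) = of_nat (Suc (dg a 0))"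
  proof -
    have "Suc a = p * (Suc a div p) + dg (Suc a) 0" by (simp add: dg_def)
    hence "(of_nat (Suc a) :: 'k) = of_nat p * of_nat (Suc a div p) + of_nat (dg (Suc a) 0)"
      by (metis of_nat_add of_nat_mult)
    thus ?thesis by (simp only: of_nat_p dg_Suc[OF assms]) simp
  qed
  thus "fc m (Suc a) = fc m a * of_nat (Suc a)"
    unfolding fc_def m' prod.lessThan_Suc_shift by (simp add: dg_Suc[OF assms] del: of_nat_Suc of_nat_fact) (simp add: algebra_simps)
qed

text \<open>Stickelberger's congruence, by induction on \<open>k\<close>. If \<open>p\<close>
  divides \<open>k\<close>, \<open>gs_frob\<close> removes the factor and shifts the digits.
  Otherwise \<open>k = Suc a\<close> arises without a carry, and \<open>gs_step\<close> divides by a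
  Jacobi sum, a unit with residue -k.\<close>

lemma res_gs: "0 < k \<Longrightarrow> k < p ^ m - 1 \<Longrightarrow> res (sd m k) (gs m k) (- inverse (fc m k))"
proof (induction k rule: less_induct)
  case (less k)
  consider "p dvd k" | "\<not> p dvd k" "k = 1" | "\<not> p dvd k" "k > 1" using less by linarith
  thus ?case
  proof cases
    case 1
    then obtain k' where k': "k = p * k'" by (elim dvdE)
    have "k' > 0" using less k' by (cases k') auto
    moreover have "k' < k" using k' \<open>k' > 0\<close> p_ge_3 by simp
    ultimately have "res (sd m k') (gs m k') (- inverse (fc m k'))" using less by auto
    moreover have "p * k' < p ^ m" using less k' by simp
    ultimately show ?thesis using gs_frob[OF m, of k'] sd_fc_mult_p[of k'] by (simp add: k')
  next
    case 2
    have d0: "dg 0 j = 0" for j by (simp add: dg_def)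
    have "sd m 0 = 0" "fc m 0 = 1" by (simp_all add: sd_def fc_def d0)
    hence "sd m 1 = 1" "fc m 1 = 1" using sd_fc_Suc[of 0] 2 by simp_all
    thus ?thesis using res_gs_1[OF m] 2 by simp
  next
    case 3
    then obtain a where a: "k = Suc a" "a > 0" by (cases k) auto
    have aQ: "a + 1 < p ^ m - 1" using less a by simp
    have IH: "res (sd m a) (gs m a) (- inverse (fc m a))" using less a by simp
    have "res (sd m a + 1) (gs m a * gs m 1) (- inverse (fc m a) * (-1))"
      by (rule res_mult[OF IH res_gs_1[OF m]])
    hence R: "res (sd m a + 1) (jac m a * gs m (Suc a)) (inverse (fc m a))"
      using gs_step[OF m a(2) aQ] by simp
    have J: "jac m a \<in> Ov" "\<phi> (jac m a) = - of_nat (Suc a)" using jac_Ov[OF m] phi_jac[OF m a(2) aQ] by auto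
    have k0: "(of_nat (Suc a) :: 'k) \<noteq> 0" using 3 a by (simp add: of_nat_eq_0_iff_char_dvd char_p del: of_nat_Suc)
    have J0: "jac m a \<noteq> 0" using J(2) k0 \<phi>_0 by (metis neg_equal_0_iff_equal)
    have "res (sd m a + 1) (jac m a * gs m (Suc a) / jac m a) (inverse (fc m a) / \<phi> (jac m a))"
      using J k0 by (intro res_divide_unit[OF R]) (auto simp del: of_nat_Suc)
    moreover have "inverse (fc m a) / \<phi> (jac m a) = - inverse (fc m (Suc a))"
      using 3 a k0 by (simp add: J sd_fc_Suc divide_inverse del: of_nat_Suc)
    ultimately show ?thesis using 3 a J0 by (simp add: sd_fc_Suc)
  qed
qed

text \<open>Let q = p^m. For u \<noteq> 0, Fourier inversion expresses \<open>psi m u\<close> by the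
  powers k < q - 1 of \<open>tch u\<close>, with the constant term -1/(q - 1). This constant is
  split into 1 and -q/(q - 1), the latter moved to the exponent q - 1, so that the expansion also
  holds at u = 0.\<close>

definition cG :: "nat \<Rightarrow> complex" where
  "cG k = (if k = 0 then 1 else if k = p ^ m - 1 then - of_nat (p ^ m) / of_nat (p ^ m - 1) else gs m k / of_nat (p ^ m - 1))"

lemma wilson: "(of_nat (fact (p - 1)) :: 'k) = -1"
proof -
  have "[fact (p - 1) = - 1] (mod int p)" using wilson_theorem[OF prime_p] by simp
  hence "int p dvd fact (p - 1) + 1" by (simp add: cong_iff_dvd_diff)
  hence "int p dvd int (fact (p - 1) + 1)" by (simp add: add.commute)
  hence "p dvd fact (p - 1) + 1" by (simp only: int_dvd_int_iff)
  hence "(of_nat (fact (p - 1) + 1) :: 'k) = 0" by (simp only: of_nat_eq_0_iff_char_dvd char_p)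
  hence "(of_nat (fact (p - 1)) :: 'k) + 1 = 0" by (simp only: of_nat_add of_nat_1)
  thus ?thesis by (simp only: eq_neg_iff_add_eq_0)
qed

lemma dg_top: "j < m \<Longrightarrow> dg (p ^ m - 1) j = p - 1"
proof -
  assume j: "j < m"
  have "p ^ m = p ^ j * p ^ (m - j)" using j by (simp flip: power_add)
  moreover have "p ^ j * (p ^ (m - j) - 1) = p ^ j * p ^ (m - j) - p ^ j" by (simp add: diff_mult_distrib2)
  moreover have "p ^ j \<le> p ^ j * p ^ (m - j)" using pm_gt_0[of "m - j"] by (simp add: Suc_le_eq)
  moreover have "p ^ j > 0" by simp
  ultimately have "p ^ m - 1 = p ^ j * (p ^ (m - j) - 1) + (p ^ j - 1)" by linarith
  moreover have "(b * y + (b - 1)) div b = y" if "b > 0" for b y :: nat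
    by (rule div_nat_eqI) (use that in auto)
  ultimately have top: "(p ^ m - 1) div p ^ j = p ^ (m - j) - 1" using \<open>p ^ j > 0\<close> by metis
  have "p ^ (m - j) = p * p ^ (m - j - 1)" using j by (metis power_eq_if diff_is_0_eq not_le)
  moreover have "p * 1 \<le> p * p ^ (m - j - 1)" using pm_gt_0[of "m - j - 1"] by (intro mult_le_mono2) linarith
  moreover have "p * (p ^ (m - j - 1) - 1) = p * p ^ (m - j - 1) - p" by (simp add: diff_mult_distrib2)
  ultimately have "p ^ (m - j) - 1 = p * (p ^ (m - j - 1) - 1) + (p - 1)" using p_ge_3 by linarith
  hence "(p ^ (m - j) - 1) mod p = p - 1" by (simp add: mod_mult_self4)
  thus ?thesis using top by (simp add: dg_def)
qed

lemma Qm1: "of_nat (p ^ m - 1) \<in> Ov" "\<phi> (of_nat (p ^ m - 1)) = -1" "(of_nat (p ^ m - 1) :: complex) \<noteq> 0"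
  using pm_gt_1[OF m(1)] of_nat_pm_1[OF m(1)] by (simp_all only: Ov_of_nat \<phi>_of_nat of_nat_eq_0_iff)

text \<open>At the added exponent p^m - 1 all digits are p - 1; Wilson's theorem and
  \<open>res_p\<close> show that it obeys the same formula as the Gauss sums.\<close>

lemma res_cG:
  assumes "k < p ^ m"
  shows "res (sd m k) (cG k) (inverse (fc m k))"
proof -
  consider "k = 0" | "k = p ^ m - 1" "k \<noteq> 0" | "0 < k" "k < p ^ m - 1" using assms by linarith
  thus ?thesis
  proof cases
    case 1
    have d0: "dg 0 j = 0" for j by (simp add: dg_def)
    show ?thesis using 1 res_Ov[OF Ov_1] by (simp add: cG_def sd_def fc_def d0 \<phi>_1)
  next
    case 2
    have dk: "dg k j = p - 1" if "j < m" for j using dg_top[OF that] 2 by simp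
    have "sd m k = m * (p - 1)" by (simp add: sd_def dk)
    moreover have "fc m k = (-1) ^ m" using wilson by (simp add: fc_def dk del: of_nat_fact)
    moreover have "inverse ((-1) ^ m) = ((-1) ^ m :: 'k)" by (cases "even m") auto
    moreover have "res (m * (p - 1)) (- of_nat (p ^ m) / of_nat (p ^ m - 1)) ((-1) ^ m)"
      using res_divide_unit[OF res_uminus[OF res_power[OF res_p, of m]] Qm1(1)] Qm1(2) by simp
    ultimately show ?thesis using 2 by (simp add: cG_def)
  next
    case 3
    have "cG k = gs m k / of_nat (p ^ m - 1)" using 3 by (simp add: cG_def)
    thus ?thesis using res_divide_unit[OF res_gs[OF 3] Qm1(1)] Qm1(2) by (simp del: of_nat_power of_nat_diff)
  qed
qed

text \<open>By \<open>sum_trace\<close> the trace is not identically 0, so \<open>psi m\<close>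
  takes some value other than 1; translation by such an element multiplies the sum by that
  value.\<close>

lemma sum_psi: "(\<Sum>v\<in>FQ m. psi m v) = 0"
proof -
  have "\<exists>v\<in>FQ m - {0}. tr m v \<noteq> 0"
  proof (rule ccontr)
    assume "\<not> ?thesis"
    hence "(\<Sum>v\<in>FQ m - {0}. tr m v * inverse v) = 0" by (intro sum.neutral) auto
    thus False using sum_trace[OF m] by simp
  qed
  then obtain a where a: "a \<in> FQ m" "tr m a \<noteq> 0" by blast
  have pa: "psi m a \<noteq> 1" using chi_eq_1[OF tr_FQ[OF a(1)]] a by (auto simp: psi_def)
  have "bij_betw (\<lambda>v. a + v) (FQ m) (FQ m)"
    by (rule bij_betw_byWitness[where f' = "\<lambda>v. v - a"]) (use a in \<open>auto intro: FQ_closed\<close>)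
  from sum.reindex_bij_betw[OF this, of "psi m"]
  have "(\<Sum>v\<in>FQ m. psi m v) = (\<Sum>v\<in>FQ m. psi m (a + v))" by simp
  also have "\<dots> = psi m a * (\<Sum>v\<in>FQ m. psi m v)"
    unfolding sum_distrib_left using a by (intro sum.cong refl) (simp add: psi_add)
  finally have "(\<Sum>v\<in>FQ m. psi m v) * (1 - psi m a) = 0" by (simp add: algebra_simps)
  thus ?thesis using pa by simp
qed

lemma psi_expand:
  assumes u: "u \<in> FQ m"
  shows "psi m u = (\<Sum>k<p ^ m. cG k * tch u ^ k)"
proof -
  define n where "n = p ^ m - 1"
  have n: "n > 1" "p ^ m = Suc n" using pm_gt_1[OF m(1)] by (auto simp: n_def)
  obtain n' where n': "n = Suc n'" using n by (cases n) auto
  have split: "(\<Sum>k<p ^ m. cG k * tch u ^ k) = 1 + (\<Sum>k<n'. cG (Suc k) * tch u ^ Suc k) + cG n * tch u ^ n"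
    unfolding n(2) n' by (subst sum.lessThan_Suc_shift) (simp add: cG_def n' n(2) n_def[symmetric])
  show ?thesis
  proof (cases "u = 0")
    case True
    thus ?thesis unfolding split using n by (simp add: psi_0 tch_0)
  next
    case False
    have uM: "u \<in> FQ M" by (rule FQ_M[OF m u])
    have un: "tch u ^ n = 1"
    proof -
      have "u ^ n = 1" using u False power_pm_1[of u m] by (simp add: FQ_def n_def)
      thus ?thesis using tch_power[OF uM, of n] tch_1 by simp
    qed
    have n0: "(of_nat n :: complex) \<noteq> 0" using n by simp
    have "(\<Sum>k<n. gs m k * tch u ^ k) = (\<Sum>v\<in>FQ m - {0}. psi m v * (\<Sum>k<n. tch (u * inverse v) ^ k))"
    proof -
      have "(\<Sum>k<n. gs m k * tch u ^ k) = (\<Sum>k<n. \<Sum>v\<in>FQ m - {0}. psi m v * tch (u * inverse v) ^ k)"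
        unfolding gs_def sum_distrib_right
        by (intro sum.cong refl) (use u in \<open>auto simp: tch_m_mult[OF m] FQ_closed power_mult_distrib mult_ac\<close>)
      also have "\<dots> = (\<Sum>v\<in>FQ m - {0}. psi m v * (\<Sum>k<n. tch (u * inverse v) ^ k))"
        unfolding sum_distrib_left by (rule sum.swap)
      finally show ?thesis .
    qed
    also have "\<dots> = (\<Sum>v\<in>FQ m - {0}. if v = u then psi m u * of_nat n else 0)"
    proof (intro sum.cong refl)
      fix v assume v: "v \<in> FQ m - {0}"
      define w where "w = u * inverse v"
      have w: "w \<in> FQ m" "w \<noteq> 0" using u v False by (auto simp: w_def FQ_closed)
      have wn: "tch w ^ n = 1"
      proof -
        have "w ^ n = 1" using w power_pm_1[of w m] by (simp add: FQ_def n_def)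
        thus ?thesis using tch_power[OF FQ_M[OF m w(1)], of n] tch_1 by simp
      qed
      show "psi m v * (\<Sum>k<n. tch (u * inverse v) ^ k) = (if v = u then psi m u * of_nat n else 0)"
      proof (cases "v = u")
        case True
        thus ?thesis using v by (simp add: tch_1)
      next
        case ne: False
        have "tch w \<noteq> 1"
        proof
          assume "tch w = 1"
          hence "w = 1" using tch[OF FQ_M[OF m w(1)]] \<phi>_1 by auto
          thus False using ne v by (simp add: w_def field_simps)
        qed
        hence "(\<Sum>k<n. tch w ^ k) = 0" using wn by (simp add: sum_gp_strict)
        thus ?thesis using ne by (simp add: w_def)
      qed
    qed
    also have "\<dots> = psi m u * of_nat n" using u False fin_FQ[OF m] by simp
    finally have "(\<Sum>k<n. gs m k * tch u ^ k) = psi m u * of_nat n" .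
    moreover have "(\<Sum>k<n. gs m k * tch u ^ k) = gs m 0 + (\<Sum>k<n'. gs m (Suc k) * tch u ^ Suc k)"
      unfolding n' by (subst sum.lessThan_Suc_shift) simp
    moreover have "gs m 0 = -1"
    proof -
      have "(\<Sum>v\<in>FQ m. psi m v) = psi m 0 + (\<Sum>v\<in>FQ m - {0}. psi m v)"
        by (rule sum.remove[OF fin_FQ[OF m] FQ_closed(1)])
      thus ?thesis using sum_psi by (simp add: gs_def psi_0 eq_neg_iff_add_eq_0 add.commute)
    qed
    moreover have "(\<Sum>k<n'. cG (Suc k) * tch u ^ Suc k) = (\<Sum>k<n'. gs m (Suc k) * tch u ^ Suc k) / of_nat n"
    proof -
      have "cG (Suc k) = gs m (Suc k) / of_nat n" if "k < n'" for k
        unfolding cG_def n_def[symmetric] using that n' by simp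
      thus ?thesis unfolding sum_divide_distrib by (intro sum.cong refl) simp
    qed
    ultimately have A: "(\<Sum>k<n'. cG (Suc k) * tch u ^ Suc k) = (psi m u * of_nat n + 1) / of_nat n"
      by (simp add: diff_eq_eq)
    have "of_nat (p ^ m) = of_nat n + (1 :: complex)" using n(2) by simp
    hence "cG n = - (of_nat n + 1) / of_nat n"
      unfolding cG_def n_def[symmetric] using n by simp
    moreover have "x = 1 + (x * y + 1) / y + - (y + 1) / y" if "y \<noteq> 0" for x y :: complex
      using that by (simp add: add_divide_distrib diff_divide_distrib)
    ultimately show ?thesis unfolding split un A using n0 by simp
  qed
qed

end

end

section \<open>Exponential sums\<close>

lemma carry_aux:
  fixes u v P D :: int
  shows "u + v < P - 1 \<Longrightarrow> (P - D) * 1 \<le> u \<Longrightarrow> (D - 1) * 1 \<le> v \<Longrightarrow> False"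
    and "u + v < P - 1 + D \<Longrightarrow> (P - D) * 2 \<le> u \<Longrightarrow> (D - 1) * 1 \<le> v \<Longrightarrow> P > 2 * D \<Longrightarrow> False"
  by (simp_all add: algebra_simps)

text \<open>The carries \<open>c\<^sub>j\<close> of a multiple of \<open>p\<^sup>m - 1\<close> give \<open>A\<^sub>j = p c\<^sub>j\<^sub>+\<^sub>1 - c\<^sub>j\<close>, and \<open>w\<^sub>j \<ge> w + c\<^sub>j\<^sub>+\<^sub>1 - c\<^sub>j\<close>.\<close>

lemma carry_step:
  fixes p d w w0 c0 c1 A :: nat
  assumes "p > d" "d \<ge> 1" "d * w < p - 1 + d" "A + c0 = p * c1" "A \<le> d * w0" "c0 \<ge> 1"
  shows "w + c1 \<le> w0 + c0" and "c1 \<ge> 1"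
    and "p > 2 * d \<Longrightarrow> w + c1 = w0 + c0 \<Longrightarrow> c1 = 1"
proof -
  show c1: "c1 \<ge> 1" using assms by (cases c1) auto
  have "int d * int w < int p - 1 + int d"
  proof -
    have "int (d * w) < int (p - 1 + d)" using assms(3) by (simp only: of_nat_less_iff)
    thus ?thesis using assms by (simp add: of_nat_diff)
  qed
  hence 1: "int d * int w < int p - 1 + int d" .
  have 2: "int p * int c1 - int c0 \<le> int d * int w0"
  proof -
    have "int (p * c1) \<le> int (d * w0 + c0)" using assms(4,5) by (simp only: of_nat_le_iff)
    thus ?thesis by simp
  qed
  have k0: "(int d - 1) * int c0 \<ge> (int d - 1) * 1" using assms by (intro mult_left_mono) auto
  show "w + c1 \<le> w0 + c0"
  proof (rule ccontr)
    assume "\<not> ?thesis"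
    hence "int w0 + int c0 \<le> int w + int c1 - 1" by simp
    hence "int d * (int w0 + int c0) \<le> int d * (int w + int c1 - 1)" by (intro mult_left_mono) auto
    hence "(int p - int d) * int c1 + (int d - 1) * int c0 < int p - 1" using 1 2 by (simp add: algebra_simps)
    moreover have "(int p - int d) * int c1 \<ge> (int p - int d) * 1" using assms c1 by (intro mult_left_mono) auto
    ultimately show False using k0 carry_aux(1) by blast
  qed
  show "c1 = 1" if p2: "p > 2 * d" and eq: "w + c1 = w0 + c0"
  proof (rule ccontr)
    assume "c1 \<noteq> 1"
    hence "c1 \<ge> 2" using c1 by simp
    have "int d * (int w0 + int c0) = int d * (int w + int c1)" using eq by (metis of_nat_add)
    hence "(int p - int d) * int c1 + (int d - 1) * int c0 < int p - 1 + int d" using 1 2 by (simp add: algebra_simps)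
    moreover have "(int p - int d) * int c1 \<ge> (int p - int d) * 2" using assms \<open>c1 \<ge> 2\<close> by (intro mult_left_mono) auto
    moreover have "int p > 2 * int d" using p2 by linarith
    ultimately show False using k0 carry_aux(2) by blast
  qed
qed

text \<open>The carry inequalities telescope. The incoming and outgoing carries \<open>c0\<close>
  and \<open>cm\<close> are kept apart for the induction. In the extremal case every step is an
  equality, which for p > 2d forces all carries after \<open>c0\<close> to be 1.\<close>

lemma carry_sum:
  fixes p d w :: nat
  assumes "p > d" "d \<ge> 1" "d * w < p - 1 + d"
  shows "(\<Sum>j<m. A j * p ^ j) + c0 = cm * p ^ m \<Longrightarrow> c0 \<ge> 1 \<Longrightarrow> (\<And>j. j < m \<Longrightarrow> A j \<le> d * W j)
    \<Longrightarrow> m * w + cm \<le> (\<Sum>j<m. W j) + c0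
      \<and> (p > 2 * d \<longrightarrow> m > 0 \<longrightarrow> m * w + cm = (\<Sum>j<m. W j) + c0 \<longrightarrow>
          cm = 1 \<and> A 0 + c0 = p \<and> W 0 + c0 = w + 1 \<and> (\<forall>j. 0 < j \<and> j < m \<longrightarrow> A j = p - 1 \<and> W j = w))"
proof (induction m arbitrary: A W c0)
  case 0
  thus ?case by simp
next
  case (Suc m)
  have p0: "p > 0" using assms by simp
  have "(\<Sum>j<Suc m. A j * p ^ j) = A 0 + p * (\<Sum>j<m. A (Suc j) * p ^ j)"
    by (subst sum.lessThan_Suc_shift) (simp add: sum_distrib_left mult_ac)
  hence eq: "A 0 + c0 + p * (\<Sum>j<m. A (Suc j) * p ^ j) = p * (cm * p ^ m)" using Suc.prems(1) by (simp add: mult_ac)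
  hence "p dvd A 0 + c0" by (metis dvd_add_left_iff dvd_triv_left)
  then obtain c1 where c1: "A 0 + c0 = p * c1" by (elim dvdE)
  have "p * (c1 + (\<Sum>j<m. A (Suc j) * p ^ j)) = p * (cm * p ^ m)" using eq c1 by (simp add: distrib_left)
  hence eq': "(\<Sum>j<m. A (Suc j) * p ^ j) + c1 = cm * p ^ m" using p0 by simp
  have A0: "A 0 \<le> d * W 0" using Suc.prems by simp
  note step = carry_step[OF assms c1 A0 Suc.prems(2)]
  note IH = Suc.IH[OF eq' step(2), of "\<lambda>j. W (Suc j)"]
  have IH1: "m * w + cm \<le> (\<Sum>j<m. W (Suc j)) + c1" using IH Suc.prems by simp
  have sW: "(\<Sum>j<Suc m. W j) = W 0 + (\<Sum>j<m. W (Suc j))" by (rule sum.lessThan_Suc_shift)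
  have eqcase: "cm = 1 \<and> A 0 + c0 = p \<and> W 0 + c0 = w + 1 \<and> (\<forall>j. 0 < j \<and> j < Suc m \<longrightarrow> A j = p - 1 \<and> W j = w)"
    if p2: "p > 2 * d" and tot: "Suc m * w + cm = (\<Sum>j<Suc m. W j) + c0"
  proof -
    have e1: "w + c1 = W 0 + c0" and e2: "m * w + cm = (\<Sum>j<m. W (Suc j)) + c1"
      using tot step(1) IH1 unfolding sW by auto
    have c11: "c1 = 1" by (rule step(3)[OF p2 e1])
    show ?thesis
    proof (cases "m = 0")
      case True
      thus ?thesis using e1 e2 c11 c1 by simp
    next
      case False
      have *: "cm = 1 \<and> A 1 + c1 = p \<and> W 1 + c1 = w + 1 \<and> (\<forall>j. 0 < j \<and> j < m \<longrightarrow> A (Suc j) = p - 1 \<and> W (Suc j) = w)"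
        using IH Suc.prems p2 e2 False by simp
      have "A j = p - 1 \<and> W j = w" if j: "0 < j" "j < Suc m" for j
      proof (cases "j = 1")
        case True
        thus ?thesis using * c11 by auto
      next
        case False
        then obtain i where i: "j = Suc i" "0 < i" "i < m" using j by (cases j) auto
        thus ?thesis using * by blast
      qed
      moreover have "A 0 + c0 = p" "W 0 + c0 = w + 1" using c1 e1 c11 by auto
      ultimately show ?thesis using * by blast
    qed
  qed
  have "Suc m * w + cm \<le> (\<Sum>j<Suc m. W j) + c0" using step(1) IH1 unfolding sW mult_Suc by linarith
  thus ?case using eqcase by blast
qed

section \<open>The leading term of the exponential sums\<close>

context teichmuller
begin

definition expsum :: "nat \<Rightarrow> 'k poly \<Rightarrow> complex" where
  "expsum m f = (\<Sum>x\<in>FQ m. psi m (poly f x))"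

text \<open>Each digit position of \<open>K\<close> is the multi-index of a monomial of f^w in
  degree p - 1.\<close>

definition good :: "nat \<Rightarrow> nat \<Rightarrow> nat \<Rightarrow> (nat \<Rightarrow> nat) \<Rightarrow> bool" where
  "good m d w K \<longleftrightarrow> (\<forall>j<m. (\<Sum>i\<le>d. i * dg (K i) j) = p - 1 \<and> (\<Sum>i\<le>d. dg (K i) j) = w)"

lemma digit_expansion: "k < p ^ m \<Longrightarrow> (\<Sum>j<m. dg k j * p ^ j) = k"
proof (induction m arbitrary: k)
  case (Suc m)
  have "k div p < p ^ m" using Suc.prems by (simp add: less_mult_imp_div_less mult.commute)
  hence IH: "(\<Sum>j<m. dg (k div p) j * p ^ j) = k div p" by (rule Suc.IH)
  have d: "dg k (Suc j) = dg (k div p) j" for j by (simp add: dg_def div_mult2_eq)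
  have "(\<Sum>j<Suc m. dg k j * p ^ j) = dg k 0 + p * (\<Sum>j<m. dg (k div p) j * p ^ j)"
    by (subst sum.lessThan_Suc_shift) (simp add: d sum_distrib_left mult_ac)
  thus ?case unfolding IH by (simp add: dg_def)
qed simp

context
  fixes m d w :: nat and f :: "'k poly"
  assumes m: "m > 0" "m dvd M" and d: "degree f \<le> d" "d \<ge> 2" "p > d"
    and w: "p - 1 \<le> d * w" "d * w < p - 1 + d" and f: "\<And>i. coeff f i \<in> FQ m"
begin

definition expo :: "(nat \<Rightarrow> nat) \<Rightarrow> nat" where "expo K = (\<Sum>i\<le>d. i * K i)"

definition term_coeff :: "(nat \<Rightarrow> nat) \<Rightarrow> complex" where
  "term_coeff K = (\<Prod>i\<le>d. cG m (K i) * tch (coeff f i) ^ K i)"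

text \<open>\<open>psi\<close> turns the sum of the terms of f into a product, and each factor is
  expanded by \<open>psi_expand\<close>; \<open>K i\<close> is the exponent chosen in the
  \<open>i\<close>-th factor.\<close>

lemma expsum_expand:
  "expsum m f = (\<Sum>K\<in>PiE {..d} (\<lambda>_. {..<p ^ m}). term_coeff K * (\<Sum>x\<in>FQ m. tch x ^ expo K))"
proof -
  have "psi m (poly f x) = (\<Sum>K\<in>PiE {..d} (\<lambda>_. {..<p ^ m}). term_coeff K * tch x ^ expo K)" if x: "x \<in> FQ m" for x
  proof -
    have "poly f x = (\<Sum>i\<le>d. coeff f i * x ^ i)"
      unfolding poly_altdef using d(1) by (intro sum.mono_neutral_left) (auto simp: coeff_eq_0)
    hence "psi m (poly f x) = (\<Prod>i\<le>d. psi m (coeff f i * x ^ i))"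
      using x f by (simp add: psi_sum FQ_closed)
    also have "\<dots> = (\<Prod>i\<le>d. \<Sum>k<p ^ m. cG m k * tch (coeff f i) ^ k * tch x ^ (i * k))"
    proof (intro prod.cong refl)
      fix i
      have "tch (coeff f i * x ^ i) = tch (coeff f i) * tch x ^ i"
        using x f FQ_M[OF m] by (simp add: tch_mult tch_power FQ_closed)
      thus "psi m (coeff f i * x ^ i) = (\<Sum>k<p ^ m. cG m k * tch (coeff f i) ^ k * tch x ^ (i * k))"
        using x f by (simp add: psi_expand[OF m] FQ_closed power_mult_distrib mult.assoc flip: power_mult)
    qed
    also have "\<dots> = (\<Sum>K\<in>PiE {..d} (\<lambda>_. {..<p ^ m}). \<Prod>i\<le>d. cG m (K i) * tch (coeff f i) ^ K i * tch x ^ (i * K i))"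
      by (rule prod_sum_PiE) auto
    also have "\<dots> = (\<Sum>K\<in>PiE {..d} (\<lambda>_. {..<p ^ m}). term_coeff K * tch x ^ expo K)"
      by (simp add: prod.distrib term_coeff_def expo_def power_sum)
    finally show ?thesis .
  qed
  hence "expsum m f = (\<Sum>x\<in>FQ m. \<Sum>K\<in>PiE {..d} (\<lambda>_. {..<p ^ m}). term_coeff K * tch x ^ expo K)"
    by (simp add: expsum_def)
  also have "\<dots> = (\<Sum>K\<in>PiE {..d} (\<lambda>_. {..<p ^ m}). \<Sum>x\<in>FQ m. term_coeff K * tch x ^ expo K)" by (rule sum.swap)
  finally show ?thesis by (simp add: sum_distrib_left)
qed

lemma res_term_coeff:
  assumes "K \<in> PiE {..d} (\<lambda>_. {..<p ^ m})"
  shows "res (\<Sum>i\<le>d. sd m (K i)) (term_coeff K) (\<Prod>i\<le>d. inverse (fc m (K i)) * coeff f i ^ K i)"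
  unfolding term_coeff_def
proof (rule res_prod)
  fix i assume "i \<in> {..d}"
  hence "K i < p ^ m" using assms by auto
  hence 1: "res (sd m (K i)) (cG m (K i)) (inverse (fc m (K i)))" by (rule res_cG[OF m])
  have fM: "coeff f i \<in> FQ M" by (rule FQ_M[OF m f])
  have "\<phi> (tch (coeff f i) ^ K i) = coeff f i ^ K i"
    using tch[OF fM] tch_Ov[OF fM] by (simp add: \<phi>_power)
  hence "res 0 (tch (coeff f i) ^ K i) (coeff f i ^ K i)"
    using res_Ov[OF Ov_power[OF tch_Ov[OF fM]], of "K i"] by simp
  thus "res (sd m (K i)) (cG m (K i) * tch (coeff f i) ^ K i) (inverse (fc m (K i)) * coeff f i ^ K i)"
    using res_mult[OF 1] by fastforce
qed simp

text \<open>For \<open>expo K = 0\<close> the sum over x is p^m, whose order m(p - 1) has to exceed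
  mw.\<close>

lemma w_lt: "w < p - 1"
proof (rule ccontr)
  assume "\<not> w < p - 1"
  hence "d * (p - 1) \<le> d * w" by simp
  hence "d * (p - 1) < p - 1 + d" using w by linarith
  moreover obtain a b where "d = a + 2" "p = b + 3" using d p_ge_3 by (metis add.commute le_Suc_ex)
  ultimately show False by (simp add: algebra_simps)
qed

lemma expo_digits:
  assumes "K \<in> PiE {..d} (\<lambda>_. {..<p ^ m})"
  shows "expo K = (\<Sum>j<m. (\<Sum>i\<le>d. i * dg (K i) j) * p ^ j)"
proof -
  have "expo K = (\<Sum>i\<le>d. i * (\<Sum>j<m. dg (K i) j * p ^ j))"
    unfolding expo_def using assms by (intro sum.cong refl arg_cong2[of _ _ _ _ "(*)"] digit_expansion[symmetric]) auto
  also have "\<dots> = (\<Sum>i\<le>d. \<Sum>j<m. i * dg (K i) j * p ^ j)" by (simp add: sum_distrib_left mult_ac)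
  also have "\<dots> = (\<Sum>j<m. \<Sum>i\<le>d. i * dg (K i) j * p ^ j)" by (rule sum.swap)
  finally show ?thesis by (simp add: sum_distrib_right)
qed

text \<open>Writing \<open>expo K\<close> as c(p^m - 1), the column sums \<open>A\<close> together
  with \<open>c\<close> add up to c p^m. So the carry \<open>c\<close> enters at the bottom and
  leaves at the top, and \<open>carry_sum\<close> applies with both outer carries equal to
  \<open>c\<close>.\<close>

lemma weight_bound:
  assumes K: "K \<in> PiE {..d} (\<lambda>_. {..<p ^ m})" and e: "expo K > 0" "(p ^ m - 1) dvd expo K"
  shows "m * w \<le> (\<Sum>i\<le>d. sd m (K i))"
    and "p > 2 * d \<Longrightarrow> m * w = (\<Sum>i\<le>d. sd m (K i)) \<Longrightarrow> good m d w K"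
proof -
  obtain c where c: "expo K = (p ^ m - 1) * c" using e by (elim dvdE)
  have c1: "c \<ge> 1" using c e by (cases c) auto
  define A where "A = (\<lambda>j. \<Sum>i\<le>d. i * dg (K i) j)"
  define W where "W = (\<lambda>j. \<Sum>i\<le>d. dg (K i) j)"
  obtain n where "p ^ m = Suc n" using pm_gt_0[of m] gr0_implies_Suc by blast
  hence "c + (p ^ m - 1) * c = c * p ^ m" by simp
  hence eq: "(\<Sum>j<m. A j * p ^ j) + c = c * p ^ m"
    using expo_digits[OF K] c by (simp add: A_def)
  have AW: "A j \<le> d * W j" for j
    unfolding A_def W_def sum_distrib_left by (intro sum_mono mult_le_mono1) simp
  have sW: "(\<Sum>i\<le>d. sd m (K i)) = (\<Sum>j<m. W j)" unfolding sd_def W_def by (rule sum.swap)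
  have d1: "d \<ge> 1" using d by simp
  note cs = carry_sum[OF d(3) d1 w(2) eq c1 AW]
  show "m * w \<le> (\<Sum>i\<le>d. sd m (K i))" using cs sW by simp
  assume p2: "p > 2 * d" and tot: "m * w = (\<Sum>i\<le>d. sd m (K i))"
  hence *: "c = 1 \<and> A 0 + c = p \<and> W 0 + c = w + 1 \<and> (\<forall>j. 0 < j \<and> j < m \<longrightarrow> A j = p - 1 \<and> W j = w)"
    using cs m sW by simp
  have "A j = p - 1 \<and> W j = w" if "j < m" for j
    using * that by (cases "j = 0") auto
  thus "good m d w K" by (simp add: good_def A_def W_def)
qed

lemma good_props:
  assumes K: "K \<in> PiE {..d} (\<lambda>_. {..<p ^ m})" and g: "good m d w K"
  shows "expo K = p ^ m - 1" "(\<Sum>i\<le>d. sd m (K i)) = m * w"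
proof -
  have "expo K = (\<Sum>j<m. (p - 1) * p ^ j)" using expo_digits[OF K] g by (simp add: good_def)
  also have "\<dots> = p ^ m - 1"
  proof -
    obtain q where q: "p = Suc q" using p_pos(1) gr0_implies_Suc by blast
    have "(\<Sum>j<m. (p - 1) * p ^ j) + 1 = p ^ m" by (induction m) (auto simp: q)
    thus ?thesis by linarith
  qed
  finally show "expo K = p ^ m - 1" .
  have "(\<Sum>i\<le>d. sd m (K i)) = (\<Sum>j<m. \<Sum>i\<le>d. dg (K i) j)" unfolding sd_def by (rule sum.swap)
  thus "(\<Sum>i\<le>d. sd m (K i)) = m * w" using g by (simp add: good_def)
qed

text \<open>The power sum over x is p^m for exponent 0, p^m - 1 for positive multiples of p^m - 1,
  and 0 otherwise. Only the second case can contribute in order mw.\<close>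

lemma res_term:
  assumes K: "K \<in> PiE {..d} (\<lambda>_. {..<p ^ m})"
  shows "\<exists>c. res (m * w) (term_coeff K * (\<Sum>x\<in>FQ m. tch x ^ expo K)) c
     \<and> (p > 2 * d \<longrightarrow> c = (if good m d w K then - (\<Prod>i\<le>d. inverse (fc m (K i)) * coeff f i ^ K i) else 0))"
proof -
  note rt = res_term_coeff[OF K]
  have Q1: "p ^ m - 1 > 0" using pm_gt_1[OF m(1)] by simp
  consider "expo K = 0" | "expo K > 0" "(p ^ m - 1) dvd expo K" | "expo K > 0" "\<not> (p ^ m - 1) dvd expo K" by blast
  thus ?thesis
  proof cases
    case 1
    have ng: "\<not> good m d w K" using good_props(1)[OF K] Q1 1 by auto
    have "res (m * (p - 1)) (of_nat (p ^ m)) ((-1) ^ m)" using res_power[OF res_p, of m] by simp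
    hence "res ((\<Sum>i\<le>d. sd m (K i)) + m * (p - 1)) (term_coeff K * of_nat (p ^ m))
      ((\<Prod>i\<le>d. inverse (fc m (K i)) * coeff f i ^ K i) * (-1) ^ m)" by (rule res_mult[OF rt])
    moreover have "m * w < (\<Sum>i\<le>d. sd m (K i)) + m * (p - 1)"
    proof -
      have "m * w < m * (p - 1)" using w_lt m by simp
      thus ?thesis by linarith
    qed
    ultimately have "res (m * w) (term_coeff K * of_nat (p ^ m)) 0" by (rule res_weaken)
    thus ?thesis using 1 ng sum_tch_power[OF m, of 0] by (intro exI[of _ 0]) simp
  next
    case 2
    have s: "(\<Sum>x\<in>FQ m. tch x ^ expo K) = of_nat (p ^ m - 1)" using sum_tch_power[OF m, of "expo K"] 2 by simp
    have "res ((\<Sum>i\<le>d. sd m (K i)) + 0) (term_coeff K * of_nat (p ^ m - 1))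
       ((\<Prod>i\<le>d. inverse (fc m (K i)) * coeff f i ^ K i) * (-1))"
      using res_mult[OF rt res_Ov[OF Qm1(1)[OF m]]] Qm1(2)[OF m] by simp
    hence r: "res (\<Sum>i\<le>d. sd m (K i)) (term_coeff K * (\<Sum>x\<in>FQ m. tch x ^ expo K))
       (- (\<Prod>i\<le>d. inverse (fc m (K i)) * coeff f i ^ K i))" by (simp add: s)
    show ?thesis
    proof (cases "m * w = (\<Sum>i\<le>d. sd m (K i))")
      case True
      thus ?thesis using r weight_bound(2)[OF K 2]
        by (intro exI[of _ "- (\<Prod>i\<le>d. inverse (fc m (K i)) * coeff f i ^ K i)"]) auto
    next
      case False
      hence "m * w < (\<Sum>i\<le>d. sd m (K i))" using weight_bound(1)[OF K 2] by simp
      hence "res (m * w) (term_coeff K * (\<Sum>x\<in>FQ m. tch x ^ expo K)) 0" by (rule res_weaken[OF r])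
      moreover have "\<not> good m d w K" using good_props(2)[OF K] False by auto
      ultimately show ?thesis by (intro exI[of _ 0]) auto
    qed
  next
    case 3
    have "\<not> good m d w K" using good_props(1)[OF K] 3 by auto
    moreover have "(\<Sum>x\<in>FQ m. tch x ^ expo K) = 0" using sum_tch_power[OF m, of "expo K"] 3 by simp
    ultimately show ?thesis using res_0 by (intro exI[of _ 0]) simp
  qed
qed

lemma res_expsum:
  "\<exists>c. res (m * w) (expsum m f) c \<and>
    (p > 2 * d \<longrightarrow> c = - (\<Sum>K | K \<in> PiE {..d} (\<lambda>_. {..<p ^ m}) \<and> good m d w K.
        \<Prod>i\<le>d. inverse (fc m (K i)) * coeff f i ^ K i))"
proof -
  let ?P = "PiE {..d} (\<lambda>_. {..<p ^ m})"
  have "\<forall>K\<in>?P. \<exists>c. res (m * w) (term_coeff K * (\<Sum>x\<in>FQ m. tch x ^ expo K)) c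
     \<and> (p > 2 * d \<longrightarrow> c = (if good m d w K then - (\<Prod>i\<le>d. inverse (fc m (K i)) * coeff f i ^ K i) else 0))"
    using res_term by blast
  from bchoice[OF this] obtain c where "\<forall>K\<in>?P. res (m * w) (term_coeff K * (\<Sum>x\<in>FQ m. tch x ^ expo K)) (c K)
     \<and> (p > 2 * d \<longrightarrow> c K = (if good m d w K then - (\<Prod>i\<le>d. inverse (fc m (K i)) * coeff f i ^ K i) else 0))" ..
  hence c: "\<And>K. K \<in> ?P \<Longrightarrow> res (m * w) (term_coeff K * (\<Sum>x\<in>FQ m. tch x ^ expo K)) (c K)"
    "\<And>K. K \<in> ?P \<Longrightarrow> p > 2 * d \<Longrightarrow> c K = (if good m d w K then - (\<Prod>i\<le>d. inverse (fc m (K i)) * coeff f i ^ K i) else 0)"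
    by blast+
  have fin: "finite ?P" by (intro finite_PiE) auto
  have "res (m * w) (expsum m f) (\<Sum>K\<in>?P. c K)"
    unfolding expsum_expand by (rule res_sum) (rule c(1))
  moreover have "(\<Sum>K\<in>?P. c K) = - (\<Sum>K | K \<in> ?P \<and> good m d w K. \<Prod>i\<le>d. inverse (fc m (K i)) * coeff f i ^ K i)" if "p > 2 * d"
  proof -
    have "(\<Sum>K\<in>?P. c K) = (\<Sum>K\<in>?P. if good m d w K then - (\<Prod>i\<le>d. inverse (fc m (K i)) * coeff f i ^ K i) else 0)"
      using c(2)[OF _ that] by (intro sum.cong refl) blast
    also have "\<dots> = (\<Sum>K | K \<in> ?P \<and> good m d w K. - (\<Prod>i\<le>d. inverse (fc m (K i)) * coeff f i ^ K i))"
      by (rule sum.inter_filter[OF fin, symmetric])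
    finally show ?thesis by (simp add: sum_negf)
  qed
  ultimately show ?thesis by blast
qed

end

end

section \<open>The leading term as the norm of a coefficient of a power of f\<close>

context teichmuller
begin

text \<open>The term y^n / n! of the exponential series, meaningful for n < p; it turns the
  multinomial theorem into a product formula.\<close>

definition divpow :: "nat \<Rightarrow> 'k poly \<Rightarrow> 'k poly" where
  "divpow n y = smult (inverse (of_nat (fact n))) (y ^ n)"

lemma divpow_add:
  assumes "n < p"
  shows "divpow n (y + z) = (\<Sum>j\<le>n. divpow j y * divpow (n - j) z)"
proof -
  have smult_sum: "smult c (sum u A) = (\<Sum>i\<in>A. smult c (u i))" for c :: 'k and u :: "nat \<Rightarrow> 'k poly" and A
    by (induction A rule: infinite_finite_induct) (simp_all add: smult_add_right)
  have "divpow n (y + z) = (\<Sum>j\<le>n. smult (inverse (of_nat (fact n))) (of_nat (n choose j) * y ^ j * z ^ (n - j)))"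
    by (simp add: divpow_def binomial_ring smult_sum)
  also have "\<dots> = (\<Sum>j\<le>n. divpow j y * divpow (n - j) z)"
  proof (intro sum.cong refl)
    fix j assume "j \<in> {..n}"
    hence j: "j \<le> n" by simp
    have nz: "(of_nat (fact n) :: 'k) \<noteq> 0" "(of_nat (fact j) :: 'k) \<noteq> 0" "(of_nat (fact (n - j)) :: 'k) \<noteq> 0"
      using assms j by (simp_all add: fact_nonzero del: of_nat_fact)
    have "fact j * fact (n - j) * (n choose j) = (fact n :: nat)" by (rule binomial_fact_lemma[OF j])
    hence "of_nat (fact n) = (of_nat (fact j) * of_nat (fact (n - j)) * of_nat (n choose j) :: 'k)"
      by (metis of_nat_mult)
    hence eq: "inverse (of_nat (fact n)) * of_nat (n choose j) = (inverse (of_nat (fact j)) * inverse (of_nat (fact (n - j))) :: 'k)"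
      using nz by (simp add: field_simps del: of_nat_fact)
    have "smult (inverse (of_nat (fact n))) (of_nat (n choose j) * y ^ j * z ^ (n - j))
        = smult (inverse (of_nat (fact n)) * of_nat (n choose j)) (y ^ j * z ^ (n - j))"
      by (simp add: of_nat_poly mult.assoc)
    thus "smult (inverse (of_nat (fact n))) (of_nat (n choose j) * y ^ j * z ^ (n - j)) = divpow j y * divpow (n - j) z"
      unfolding eq by (simp add: divpow_def mult.commute)
  qed
  finally show ?thesis .
qed

text \<open>The multinomial theorem. Restricting the indices to values below \<open>p\<close> loses
  nothing, since their sum is n < p.\<close>

lemma divpow_sum:
  assumes "finite I" "n < p"
  shows "divpow n (sum y I) = (\<Sum>u\<in>PiE I (\<lambda>_. {..<p}). if sum u I = n then \<Prod>i\<in>I. divpow (u i) (y i) else 0)"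
  using assms
proof (induction I arbitrary: n rule: finite_induct)
  case empty
  thus ?case by (cases "n = 0") (auto simp: divpow_def)
next
  case (insert i I)
  let ?P = "PiE I (\<lambda>_. {..<p})"
  let ?T = "\<lambda>I n u. if sum u I = n then \<Prod>i\<in>I. divpow (u i) (y i) else 0"
  have upd: "sum (u(i := k)) I = sum u I" "(\<Prod>j\<in>I. divpow ((u(i := k)) j) (y j)) = (\<Prod>j\<in>I. divpow (u j) (y j))" for u k
    using insert.hyps by (intro sum.cong prod.cong; auto)+
  have "(\<Sum>u\<in>PiE (insert i I) (\<lambda>_. {..<p}). ?T (insert i I) n u)
      = (\<Sum>(k, u)\<in>{..<p} \<times> ?P. ?T (insert i I) n (u(i := k)))"
    unfolding PiE_insert_eq
    by (subst sum.reindex[OF inj_combinator[OF insert.hyps(2)]]) (simp add: split_def)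
  also have "\<dots> = (\<Sum>k<p. \<Sum>u\<in>?P. ?T (insert i I) n (u(i := k)))" by (simp add: sum.cartesian_product)
  also have "\<dots> = (\<Sum>k<p. if k \<le> n then divpow k (y i) * (\<Sum>u\<in>?P. ?T I (n - k) u) else 0)"
  proof (intro sum.cong refl)
    fix k assume "k \<in> {..<p}"
    have "?T (insert i I) n (u(i := k)) = (if k \<le> n then divpow k (y i) * ?T I (n - k) u else 0)" for u
      using insert.hyps upd[of u k] by auto
    thus "(\<Sum>u\<in>?P. ?T (insert i I) n (u(i := k))) = (if k \<le> n then divpow k (y i) * (\<Sum>u\<in>?P. ?T I (n - k) u) else 0)"
      by (simp add: sum_distrib_left)
  qed
  also have "\<dots> = (\<Sum>k\<in>{..n}. divpow k (y i) * (\<Sum>u\<in>?P. ?T I (n - k) u))"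
    using insert.prems by (intro sum.mono_neutral_cong_right) auto
  also have "\<dots> = (\<Sum>k\<in>{..n}. divpow k (y i) * divpow (n - k) (sum y I))"
    using insert.prems by (intro sum.cong refl arg_cong2[of _ _ _ _ "(*)"] insert.IH[symmetric]) auto
  also have "\<dots> = divpow n (sum y (insert i I))"
    using insert.hyps by (simp add: divpow_add[OF insert.prems])
  finally show ?case ..
qed

definition Uset :: "nat \<Rightarrow> nat \<Rightarrow> (nat \<Rightarrow> nat) set" where
  "Uset d w = {u \<in> PiE {..d} (\<lambda>_. {..<p}). (\<Sum>i\<le>d. i * u i) = p - 1 \<and> (\<Sum>i\<le>d. u i) = w}"

lemma finite_Uset: "finite (Uset d w)"
  unfolding Uset_def by (rule finite_subset[of _ "PiE {..d} (\<lambda>_. {..<p})"]) (auto intro: finite_PiE)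

lemma coeff_power_Uset:
  fixes f :: "'k poly"
  assumes "degree f \<le> d" "w < p"
  shows "coeff (f ^ w) (p - 1) / of_nat (fact w)
     = (\<Sum>u\<in>Uset d w. \<Prod>i\<le>d. inverse (of_nat (fact (u i))) * coeff f i ^ u i)"
proof -
  let ?P = "PiE {..d} (\<lambda>_. {..<p})"
  have f: "f = (\<Sum>i\<le>d. monom (coeff f i) i)"
    using poly_as_sum_of_monoms'[OF assms(1)] by simp
  have pm: "(\<Prod>i\<in>A. monom (c i) (n i)) = monom (\<Prod>i\<in>A. c i) (\<Sum>i\<in>A. n i)"
    if "finite A" for A and c :: "nat \<Rightarrow> 'k" and n
    using that by (induction A rule: finite_induct) (auto simp: mult_monom one_pCons monom_0)
  have dm: "divpow k (monom a i) = monom (inverse (of_nat (fact k)) * a ^ k) (i * k)" for k a i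
    by (simp add: divpow_def monom_power smult_monom)
  have fin: "finite ?P" by (intro finite_PiE) auto
  have "coeff (divpow w f) (p - 1) = (\<Sum>u\<in>?P. coeff (if (\<Sum>i\<le>d. u i) = w then \<Prod>i\<le>d. divpow (u i) (monom (coeff f i) i) else 0) (p - 1))"
    by (subst f, subst divpow_sum[OF _ assms(2)]) (simp_all add: coeff_sum)
  also have "\<dots> = (\<Sum>u\<in>?P. if u \<in> Uset d w then \<Prod>i\<le>d. inverse (of_nat (fact (u i))) * coeff f i ^ u i else 0)"
    by (intro sum.cong refl) (auto simp: dm pm Uset_def simp del: of_nat_fact)
  also have "\<dots> = (\<Sum>u\<in>Uset d w. \<Prod>i\<le>d. inverse (of_nat (fact (u i))) * coeff f i ^ u i)"
    using fin by (intro sum.mono_neutral_cong_right) (auto simp: Uset_def)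
  finally show ?thesis by (simp add: divpow_def divide_inverse mult.commute)
qed

lemma digits_of_sum:
  "(\<And>j. j < m \<Longrightarrow> v j < p) \<Longrightarrow> (\<Sum>j<m. v j * p ^ j) < p ^ m \<and> (\<forall>j<m. dg (\<Sum>j<m. v j * p ^ j) j = v j)"
proof (induction m arbitrary: v)
  case (Suc m)
  let ?s = "\<Sum>j<m. v (Suc j) * p ^ j"
  have eq: "(\<Sum>j<Suc m. v j * p ^ j) = v 0 + p * ?s"
    by (subst sum.lessThan_Suc_shift) (simp add: sum_distrib_left mult_ac)
  have v0: "v 0 < p" using Suc.prems by simp
  have IH: "?s < p ^ m \<and> (\<forall>j<m. dg ?s j = v (Suc j))" using Suc by simp
  have "v 0 + p * ?s < p * (?s + 1)" using v0 by simp
  also have "p * (?s + 1) \<le> p * p ^ m" using IH by (intro mult_le_mono2) simp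
  finally have lt: "v 0 + p * ?s < p ^ Suc m" by simp
  have div: "(v 0 + p * ?s) div p = ?s" using v0 by simp
  have "dg (v 0 + p * ?s) j = v j" if j: "j < Suc m" for j
  proof (cases j)
    case 0
    thus ?thesis using v0 by (simp add: dg_def)
  next
    case (Suc i)
    have "dg (v 0 + p * ?s) (Suc i) = dg ?s i" unfolding dg_def power_Suc div_mult2_eq div ..
    thus ?thesis using IH Suc j by simp
  qed
  thus ?case unfolding eq using lt by simp
qed simp

lemma of_nat_frob_pow: "(of_nat n :: 'k) ^ (p ^ j) = of_nat n"
proof -
  have "(of_nat n :: 'k) \<in> FQ j" by (induction n) (auto intro: FQ_closed)
  thus ?thesis by (simp add: FQ_def)
qed

text \<open>A good \<open>K\<close>, read by digit positions, is a choice of one element of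
  \<open>Uset\<close> per position. The weights p^j of the positions become powers of Frobenius,
  which is additive and fixes the factorials, so the sum factors.\<close>

lemma good_sum:
  "(\<Sum>K | K \<in> PiE {..d} (\<lambda>_. {..<p ^ m}) \<and> good m d w K. \<Prod>i\<le>d. inverse (fc m (K i)) * a i ^ K i)
   = (\<Prod>j<m. (\<Sum>u\<in>Uset d w. \<Prod>i\<le>d. inverse (of_nat (fact (u i))) * a i ^ u i) ^ (p ^ j))"
proof -
  define h where "h = (\<lambda>u j. \<Prod>i\<le>d. inverse (of_nat (fact (u i)) :: 'k) * a i ^ (u i * p ^ j))"
  have "(\<Prod>j<m. (\<Sum>u\<in>Uset d w. \<Prod>i\<le>d. inverse (of_nat (fact (u i))) * a i ^ u i) ^ (p ^ j))
      = (\<Prod>j<m. \<Sum>u\<in>Uset d w. h u j)"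
  proof (intro prod.cong refl)
    fix j
    have "(\<Sum>u\<in>Uset d w. \<Prod>i\<le>d. inverse (of_nat (fact (u i))) * a i ^ u i) ^ (p ^ j)
        = (\<Sum>u\<in>Uset d w. (\<Prod>i\<le>d. inverse (of_nat (fact (u i))) * a i ^ u i) ^ (p ^ j))"
      by (rule freshmans_dream_sum') (simp_all add: char_p prime_p)
    also have "\<dots> = (\<Sum>u\<in>Uset d w. h u j)"
      by (simp add: h_def prod_power_distrib power_mult_distrib power_inverse of_nat_frob_pow power_mult del: of_nat_fact)
    finally show "(\<Sum>u\<in>Uset d w. \<Prod>i\<le>d. inverse (of_nat (fact (u i))) * a i ^ u i) ^ (p ^ j) = (\<Sum>u\<in>Uset d w. h u j)" .
  qed
  also have "\<dots> = (\<Sum>\<kappa>\<in>PiE {..<m} (\<lambda>_. Uset d w). \<Prod>j<m. h (\<kappa> j) j)"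
    by (rule prod_sum_PiE) (auto simp: finite_Uset)
  also have "\<dots> = (\<Sum>K | K \<in> PiE {..d} (\<lambda>_. {..<p ^ m}) \<and> good m d w K. \<Prod>i\<le>d. inverse (fc m (K i)) * a i ^ K i)"
  proof (rule sum.reindex_bij_witness[where
        j = "\<lambda>\<kappa>. \<lambda>i\<in>{..d}. \<Sum>j<m. \<kappa> j i * p ^ j" and i = "\<lambda>K. \<lambda>j\<in>{..<m}. \<lambda>i\<in>{..d}. dg (K i) j"])
    fix \<kappa> assume \<kappa>: "\<kappa> \<in> PiE {..<m} (\<lambda>_. Uset d w)"
    define K where "K = (\<lambda>i\<in>{..d}. \<Sum>j<m. \<kappa> j i * p ^ j)"
    have \<kappa>U: "\<kappa> j \<in> Uset d w" if "j < m" for j using \<kappa> that by auto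
    have lt: "\<kappa> j i < p" if "j < m" "i \<le> d" for i j using \<kappa>U[OF that(1)] that(2) by (auto simp: Uset_def)
    have Ki: "K i < p ^ m" "\<And>j. j < m \<Longrightarrow> dg (K i) j = \<kappa> j i" if "i \<le> d" for i
      using digits_of_sum[of m "\<lambda>j. \<kappa> j i"] lt that by (auto simp: K_def)
    show "(\<lambda>j\<in>{..<m}. \<lambda>i\<in>{..d}. dg ((\<lambda>i\<in>{..d}. \<Sum>j<m. \<kappa> j i * p ^ j) i) j) = \<kappa>"
    proof (rule PiE_ext[OF _ \<kappa>])
      show "(\<lambda>j\<in>{..<m}. \<lambda>i\<in>{..d}. dg ((\<lambda>i\<in>{..d}. \<Sum>j<m. \<kappa> j i * p ^ j) i) j) \<in> PiE {..<m} (\<lambda>_. Uset d w)"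
      proof (rule PiE_I)
        fix j assume j: "j \<in> {..<m}"
        have "(\<lambda>i\<in>{..d}. dg (K i) j) = \<kappa> j"
          using \<kappa>U[of j] j Ki by (intro extensionalityI[of _ "{..d}"]) (auto simp: Uset_def PiE_def)
        thus "(\<lambda>j\<in>{..<m}. \<lambda>i\<in>{..d}. dg ((\<lambda>i\<in>{..d}. \<Sum>j<m. \<kappa> j i * p ^ j) i) j) j \<in> Uset d w"
          using \<kappa>U[of j] j by (simp add: K_def)
      qed simp
      fix j assume j: "j \<in> {..<m}"
      have "(\<lambda>i\<in>{..d}. dg (K i) j) = \<kappa> j"
        using \<kappa>U[of j] j Ki by (intro extensionalityI[of _ "{..d}"]) (auto simp: Uset_def PiE_def)
      thus "(\<lambda>j\<in>{..<m}. \<lambda>i\<in>{..d}. dg ((\<lambda>i\<in>{..d}. \<Sum>j<m. \<kappa> j i * p ^ j) i) j) j = \<kappa> j"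
        using j by (simp add: K_def)
    qed
    have "good m d w K"
      unfolding good_def
    proof (intro allI impI)
      fix j assume j: "j < m"
      have "(\<Sum>i\<le>d. i * dg (K i) j) = (\<Sum>i\<le>d. i * \<kappa> j i)" "(\<Sum>i\<le>d. dg (K i) j) = (\<Sum>i\<le>d. \<kappa> j i)"
        using Ki(2)[OF _ j] by (intro sum.cong; simp)+
      thus "(\<Sum>i\<le>d. i * dg (K i) j) = p - 1 \<and> (\<Sum>i\<le>d. dg (K i) j) = w"
        using \<kappa>U[OF j] by (simp add: Uset_def)
    qed
    moreover have "K \<in> PiE {..d} (\<lambda>_. {..<p ^ m})" using Ki(1) by (auto simp: K_def)
    ultimately show "(\<lambda>i\<in>{..d}. \<Sum>j<m. \<kappa> j i * p ^ j) \<in> {K. K \<in> PiE {..d} (\<lambda>_. {..<p ^ m}) \<and> good m d w K}"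
      by (simp add: K_def)
  next
    fix K assume "K \<in> {K. K \<in> PiE {..d} (\<lambda>_. {..<p ^ m}) \<and> good m d w K}"
    hence K: "K \<in> PiE {..d} (\<lambda>_. {..<p ^ m})" and g: "good m d w K" by auto
    have Km: "K i < p ^ m" if "i \<le> d" for i using K that by auto
    show "(\<lambda>i\<in>{..d}. \<Sum>j<m. (\<lambda>j\<in>{..<m}. \<lambda>i\<in>{..d}. dg (K i) j) j i * p ^ j) = K"
      using K digit_expansion[OF Km] by (intro extensionalityI[of _ "{..d}"]) (auto simp: PiE_def)
    show "(\<lambda>j\<in>{..<m}. \<lambda>i\<in>{..d}. dg (K i) j) \<in> PiE {..<m} (\<lambda>_. Uset d w)"
      using g by (auto simp: Uset_def good_def dg_lt)
    have "(\<Prod>i\<le>d. inverse (fc m (K i)) * a i ^ K i) = (\<Prod>i\<le>d. \<Prod>j<m. inverse (of_nat (fact (dg (K i) j))) * a i ^ (dg (K i) j * p ^ j))"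
    proof (intro prod.cong refl)
      fix i assume "i \<in> {..d}"
      hence "a i ^ K i = a i ^ (\<Sum>j<m. dg (K i) j * p ^ j)" using digit_expansion[OF Km[of i]] by simp
      also have "\<dots> = (\<Prod>j<m. a i ^ (dg (K i) j * p ^ j))" by (rule power_sum)
      finally show "inverse (fc m (K i)) * a i ^ K i = (\<Prod>j<m. inverse (of_nat (fact (dg (K i) j))) * a i ^ (dg (K i) j * p ^ j))"
        by (simp add: fc_def prod.distrib prod_inversef[symmetric] o_def del: of_nat_fact)
    qed
    also have "\<dots> = (\<Prod>j<m. \<Prod>i\<le>d. inverse (of_nat (fact (dg (K i) j))) * a i ^ (dg (K i) j * p ^ j))"
      by (rule prod.swap)
    also have "\<dots> = (\<Prod>j<m. h ((\<lambda>j\<in>{..<m}. \<lambda>i\<in>{..d}. dg (K i) j) j) j)"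
      by (intro prod.cong refl) (simp add: h_def)
    finally have "(\<Prod>j<m. h ((\<lambda>j\<in>{..<m}. \<lambda>i\<in>{..d}. dg (K i) j) j) j) = (\<Prod>i\<le>d. inverse (fc m (K i)) * a i ^ K i)" ..
    note this
  next
    fix \<kappa> assume \<kappa>: "\<kappa> \<in> PiE {..<m} (\<lambda>_. Uset d w)"
    define K where "K = (\<lambda>i\<in>{..d}. \<Sum>j<m. \<kappa> j i * p ^ j)"
    have \<kappa>U: "\<kappa> j \<in> Uset d w" if "j < m" for j using \<kappa> that by auto
    have lt: "\<kappa> j i < p" if "j < m" "i \<le> d" for i j using \<kappa>U[OF that(1)] that(2) by (auto simp: Uset_def)
    have Ki: "\<And>j. j < m \<Longrightarrow> dg (K i) j = \<kappa> j i" if "i \<le> d" for i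
      using digits_of_sum[of m "\<lambda>j. \<kappa> j i"] lt that by (auto simp: K_def)
    have "(\<Prod>i\<le>d. inverse (fc m (K i)) * a i ^ K i) = (\<Prod>i\<le>d. \<Prod>j<m. inverse (of_nat (fact (\<kappa> j i))) * a i ^ (\<kappa> j i * p ^ j))"
    proof (intro prod.cong refl)
      fix i assume i: "i \<in> {..d}"
      hence "a i ^ K i = a i ^ (\<Sum>j<m. \<kappa> j i * p ^ j)" by (simp add: K_def)
      also have "\<dots> = (\<Prod>j<m. a i ^ (\<kappa> j i * p ^ j))" by (rule power_sum)
      moreover have "fc m (K i) = (\<Prod>j<m. of_nat (fact (\<kappa> j i)))"
        unfolding fc_def using Ki i by (intro prod.cong refl) simp
      ultimately show "inverse (fc m (K i)) * a i ^ K i = (\<Prod>j<m. inverse (of_nat (fact (\<kappa> j i))) * a i ^ (\<kappa> j i * p ^ j))"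
        by (simp add: prod.distrib prod_inversef[symmetric] o_def del: of_nat_fact)
    qed
    also have "\<dots> = (\<Prod>j<m. h (\<kappa> j) j)" unfolding h_def by (rule prod.swap)
    finally show "(\<Prod>i\<le>d. inverse (fc m ((\<lambda>i\<in>{..d}. \<Sum>j<m. \<kappa> j i * p ^ j) i)) * a i ^ (\<lambda>i\<in>{..d}. \<Sum>j<m. \<kappa> j i * p ^ j) i) = (\<Prod>j<m. h (\<kappa> j) j)"
      unfolding K_def .
  qed
  finally show ?thesis ..
qed

lemma coeff_power_FQ: "(\<And>i. coeff f i \<in> FQ m) \<Longrightarrow> coeff (f ^ n) i \<in> FQ m"
proof (induction n arbitrary: i)
  case 0
  thus ?case by (auto simp: coeff_1 intro: FQ_closed)
next
  case (Suc n)
  thus ?case by (auto simp: coeff_mult intro!: FQ_sum FQ_closed)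
qed

text \<open>\<open>H\<close> is fixed by the \<nu>-th power of Frobenius, so the product runs n
  times through the same \<nu> factors.\<close>

lemma norm_power:
  assumes "H \<in> FQ \<nu>"
  shows "(\<Prod>j<\<nu> * n. H ^ (p ^ j)) = (\<Prod>j<\<nu>. H ^ (p ^ j)) ^ n"
proof (induction n)
  case (Suc n)
  have "(\<Prod>j<\<nu> * Suc n. H ^ (p ^ j)) = (\<Prod>j<\<nu> * n. H ^ (p ^ j)) * (\<Prod>j\<in>{\<nu> * n..<\<nu> * n + \<nu>}. H ^ (p ^ j))"
    using prod.atLeastLessThan_concat[of 0 "\<nu> * n" "\<nu> * n + \<nu>" "\<lambda>j. H ^ (p ^ j)"] by (simp add: atLeast0LessThan add.commute)
  also have "(\<Prod>j\<in>{\<nu> * n..<\<nu> * n + \<nu>}. H ^ (p ^ j)) = (\<Prod>j<\<nu>. H ^ (p ^ (\<nu> * n + j)))"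
    using prod.shift_bounds_nat_ivl[of "\<lambda>j. H ^ (p ^ j)" 0 "\<nu> * n" \<nu>] by (simp add: atLeast0LessThan add.commute)
  also have "\<dots> = (\<Prod>j<\<nu>. H ^ (p ^ j))"
  proof (intro prod.cong refl)
    fix j
    have "H ^ (p ^ (\<nu> * n)) = H" using assms by (intro iterate_pm) (simp add: FQ_def)
    thus "H ^ (p ^ (\<nu> * n + j)) = H ^ (p ^ j)" by (simp add: power_add power_mult)
  qed
  finally show ?case using Suc by simp
qed simp

lemma res_expsum_norm:
  fixes f :: "'k poly"
  assumes \<nu>: "\<nu> > 0" "n > 0" "\<nu> * n dvd M" and d: "degree f \<le> d" "d \<ge> 2" "p > d"
    and w: "p - 1 \<le> d * w" "d * w < p - 1 + d" and f: "\<And>i. coeff f i \<in> FQ \<nu>"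
  shows "\<exists>c. res (\<nu> * n * w) (expsum (\<nu> * n) f) c \<and>
    (p > 2 * d \<longrightarrow> c = - ((\<Prod>j<\<nu>. (coeff (f ^ w) (p - 1) / of_nat (fact w)) ^ (p ^ j)) ^ n))"
proof -
  have m: "\<nu> * n > 0" using \<nu> by simp
  have f': "coeff f i \<in> FQ (\<nu> * n)" for i using f FQ_mono[of \<nu> "\<nu> * n"] by auto
  define H where "H = coeff (f ^ w) (p - 1) / of_nat (fact w)"
  have "(of_nat k :: 'k) \<in> FQ \<nu>" for k by (induction k) (auto intro: FQ_closed)
  hence H: "H \<in> FQ \<nu>" unfolding H_def using f by (intro FQ_closed coeff_power_FQ)
  have wp: "w < p" using w_lt[OF m \<nu>(3) d w f'] by simp
  obtain c where c: "res (\<nu> * n * w) (expsum (\<nu> * n) f) c \<and> (p > 2 * d \<longrightarrow> c = - (\<Sum>K | K \<in> PiE {..d} (\<lambda>_. {..<p ^ (\<nu> * n)}) \<and> good (\<nu> * n) d w K.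
        \<Prod>i\<le>d. inverse (fc (\<nu> * n) (K i)) * coeff f i ^ K i))"
    using res_expsum[OF m \<nu>(3) d w f'] ..
  have "(\<Sum>K | K \<in> PiE {..d} (\<lambda>_. {..<p ^ (\<nu> * n)}) \<and> good (\<nu> * n) d w K.
        \<Prod>i\<le>d. inverse (fc (\<nu> * n) (K i)) * coeff f i ^ K i) = (\<Prod>j<\<nu>. H ^ (p ^ j)) ^ n"
    unfolding good_sum coeff_power_Uset[OF d(1) wp, symmetric] H_def[symmetric] by (rule norm_power[OF H])
  thus ?thesis using c unfolding H_def by metis
qed

end

section \<open>The L-functions\<close>

text \<open>\<open>map_poly h\<close> is itself an evaluation, at the polynomial X with the
  coefficients embedded as constants, so \<open>rhom_pev\<close> applies.\<close>

lemma map_poly_rhom: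
  assumes h: "rhom h"
  shows "rhom (map_poly h)"
proof -
  have H: "rhom (\<lambda>a. [:h a:])"
    by (rule rhomI) (simp_all add: rhom_simps[OF h] one_pCons)
  have "pev (\<lambda>a. [:h a:]) [:0, 1:] g = map_poly h g" for g
    by (induction g) (simp_all add: pev_0[OF H] pev_pCons[OF H] map_poly_pCons rhom_0[OF h])
  hence "map_poly h = pev (\<lambda>a. [:h a:]) [:0, 1:]" by auto
  thus ?thesis using rhom_pev[OF H] by simp
qed

lemma rhom_prod_mset: "rhom h \<Longrightarrow> h (prod_mset A) = prod_mset (image_mset h A)"
  by (induction A) (simp_all add: rhom_1 rhom_mult)

lemma rhom_sum_mset: "rhom h \<Longrightarrow> h (sum_mset A) = sum_mset (image_mset h A)"
  by (induction A) (simp_all add: rhom_0 rhom_add)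

lemma proots_linear_prod: "proots (\<Prod>x\<in>#A. [:- x, 1 :: 'a::idom:]) = A"
  and linear_prod_monic: "lead_coeff (\<Prod>x\<in>#A. [:- x, 1 :: 'a::idom:]) = 1"
proof -
  have *: "proots (\<Prod>x\<in>#A. [:- x, 1 :: 'a:]) = A \<and> lead_coeff (\<Prod>x\<in>#A. [:- x, 1 :: 'a:]) = 1 \<and> (\<Prod>x\<in>#A. [:- x, 1 :: 'a:]) \<noteq> 0"
  proof (induction A)
    case (add x A)
    have "[:- x, 1:] \<noteq> 0" by simp
    hence "proots ([:- x, 1:] * (\<Prod>x\<in>#A. [:- x, 1 :: 'a:])) = proots [:- x, 1:] + proots (\<Prod>x\<in>#A. [:- x, 1 :: 'a:])"
      using add by (intro proots_mult) auto
    hence "proots ([:- x, 1:] * (\<Prod>x\<in>#A. [:- x, 1 :: 'a:])) = {#x#} + A"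
      using add by (simp only: proots_linear_factor) simp
    moreover have "lead_coeff ([:- x, 1:] * (\<Prod>x\<in>#A. [:- x, 1 :: 'a:])) = 1"
      using add by (simp only: lead_coeff_mult) simp
    moreover have "[:- x, 1:] * (\<Prod>x\<in>#A. [:- x, 1 :: 'a:]) \<noteq> 0" using add \<open>[:- x, 1:] \<noteq> 0\<close> by (simp only: mult_eq_0_iff) simp
    ultimately show ?case by (simp only: image_mset_add_mset prod_mset.add_mset) simp
  qed simp
  thus "proots (\<Prod>x\<in>#A. [:- x, 1 :: 'a:]) = A" "lead_coeff (\<Prod>x\<in>#A. [:- x, 1 :: 'a:]) = 1" by blast+
qed

lemma monic_eq_linear_prod:
  fixes g :: "'a::alg_closed_field poly"
  assumes "lead_coeff g = 1"
  shows "g = (\<Prod>x\<in>#proots g. [:- x, 1:])" "size (proots g) = degree g"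
proof -
  have "g \<noteq> 0" using assms by auto
  then obtain A where A: "size A = degree g" "g = smult (lead_coeff g) (\<Prod>x\<in>#A. [:- x, 1:])"
    using alg_closed_imp_factorization by blast
  hence g: "g = (\<Prod>x\<in>#A. [:- x, 1:])" using assms by simp
  hence "proots g = A" by (simp only: proots_linear_prod)
  thus "g = (\<Prod>x\<in>#proots g. [:- x, 1:])" "size (proots g) = degree g" using g A by simp_all
qed

lemma monic_dvd_iff:
  fixes g h :: "'a::alg_closed_field poly"
  assumes "lead_coeff g = 1" "lead_coeff h = 1"
  shows "g dvd h \<longleftrightarrow> proots g \<subseteq># proots h"
proof
  assume "g dvd h"
  then obtain k where k: "h = g * k" by (elim dvdE)
  have "g * k \<noteq> 0" using assms k by auto
  thus "proots g \<subseteq># proots h" unfolding k by (simp add: proots_mult)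
next
  assume "proots g \<subseteq># proots h"
  then obtain B where B: "proots h = proots g + B" by (metis mset_subset_eq_exists_conv)
  have "h = (\<Prod>x\<in>#proots g + B. [:- x, 1:])" using monic_eq_linear_prod(1)[OF assms(2)] by (simp only: B)
  also have "\<dots> = (\<Prod>x\<in>#proots g. [:- x, 1:]) * (\<Prod>x\<in>#B. [:- x, 1:])" by simp
  also have "(\<Prod>x\<in>#proots g. [:- x, 1:]) = g" using monic_eq_linear_prod(1)[OF assms(1)] ..
  finally show "g dvd h" by (rule dvdI)
qed

context teichmuller
begin

context
  fixes \<nu> d :: nat and f :: "'k poly"
  assumes \<nu>: "\<nu> > 0" and deg_f: "degree f = d" and lc_f: "lead_coeff f = 1" and f: "\<And>i. coeff f i \<in> FQ \<nu>"
    and d_p: "\<not> p dvd d" and d_ge: "d \<ge> 2"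
begin

definition frob :: "'k \<Rightarrow> 'k" where "frob a = a ^ (p ^ \<nu>)"

lemma rhom_frob: "rhom frob"
  by (rule rhomI) (simp_all add: frob_def frob_m power_mult_distrib)

lemma inj_frob: "inj frob"
proof (rule injI)
  fix a b assume "frob a = frob b"
  hence "frob (a - b) = 0" by (simp add: rhom_diff[OF rhom_frob])
  thus "a = b" using rhom_eq_0_iff[OF rhom_frob] by auto
qed

lemma FQ_frob: "a \<in> FQ \<nu> \<longleftrightarrow> frob a = a"
  by (simp add: FQ_def frob_def)

lemma frob_pow: "(frob ^^ i) a = a ^ (p ^ (\<nu> * i))"
  by (induction i) (simp_all add: frob_def power_add mult.commute flip: power_mult)

lemma FQ_frob_pow: "a \<in> FQ (\<nu> * n) \<longleftrightarrow> (frob ^^ n) a = a"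
  by (simp add: FQ_def frob_pow)

text \<open>Monic polynomials over the field with p^\<nu> elements, kept inside the polynomials over
  the algebraic closure so that their roots are at hand.\<close>

definition Gm :: "nat \<Rightarrow> 'k poly set" where
  "Gm l = {g. lead_coeff g = 1 \<and> degree g = l \<and> (\<forall>i. coeff g i \<in> FQ \<nu>)}"

lemma coeffs_FQ_iff: "(\<forall>i. coeff g i \<in> FQ \<nu>) \<longleftrightarrow> map_poly frob g = g"
  by (auto simp: poly_eq_iff coeff_map_poly rhom_0[OF rhom_frob] FQ_frob)

lemma GmD:
  assumes "g \<in> Gm l"
  shows "lead_coeff g = 1" "degree g = l" "coeff g i \<in> FQ \<nu>" "map_poly frob g = g" "g \<noteq> 0"
proof -
  show *: "lead_coeff g = 1" using assms unfolding Gm_def by blast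
  show "degree g = l" "coeff g i \<in> FQ \<nu>" using assms unfolding Gm_def by blast+
  show "map_poly frob g = g" using assms unfolding Gm_def coeffs_FQ_iff by blast
  show "g \<noteq> 0" using * by auto
qed

lemma GmI: "lead_coeff g = 1 \<Longrightarrow> degree g = l \<Longrightarrow> map_poly frob g = g \<Longrightarrow> g \<in> Gm l"
  unfolding Gm_def coeffs_FQ_iff by blast

lemma finite_Gm: "finite (Gm l)"
proof (rule finite_subset)
  show "Gm l \<subseteq> (\<lambda>c. \<Sum>i\<le>l. monom (c i) i) ` PiE {..l} (\<lambda>_. FQ \<nu>)"
  proof
    fix g assume g: "g \<in> Gm l"
    have "g = (\<Sum>i\<le>l. monom (restrict (coeff g) {..l} i) i)"
      using g poly_as_sum_of_monoms[of g] by (simp add: Gm_def)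
    moreover have "restrict (coeff g) {..l} \<in> PiE {..l} (\<lambda>_. FQ \<nu>)" using g by (simp add: Gm_def)
    ultimately show "g \<in> (\<lambda>c. \<Sum>i\<le>l. monom (c i) i) ` PiE {..l} (\<lambda>_. FQ \<nu>)" by blast
  qed
qed (intro finite_imageI finite_PiE, auto simp: finite_FQ[OF \<nu>])

lemma Gm_mult:
  assumes g: "g \<in> Gm k" and h: "h \<in> Gm l"
  shows "g * h \<in> Gm (k + l)"
proof (rule GmI)
  show "degree (g * h) = k + l" using degree_mult_eq[OF GmD(5)[OF g] GmD(5)[OF h]] unfolding GmD(2)[OF g] GmD(2)[OF h] .
  show "lead_coeff (g * h) = 1" unfolding lead_coeff_mult GmD(1)[OF g] GmD(1)[OF h] by simp
  show "map_poly frob (g * h) = g * h"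
    unfolding rhom_mult[OF map_poly_rhom[OF rhom_frob]] GmD(4)[OF g] GmD(4)[OF h] ..
qed

lemma Gm_divide:
  assumes g: "g \<in> Gm k" and gh: "g * h \<in> Gm l"
  shows "k \<le> l" "h \<in> Gm (l - k)"
proof -
  have h0: "h \<noteq> 0" using GmD(5)[OF gh] by auto
  have deg: "degree h + k = l" using degree_mult_eq[OF GmD(5)[OF g] h0] unfolding GmD(2)[OF g] GmD(2)[OF gh] by simp
  thus "k \<le> l" by simp
  have "g * map_poly frob h = g * h"
    using rhom_mult[OF map_poly_rhom[OF rhom_frob], of g h] unfolding GmD(4)[OF g] GmD(4)[OF gh] ..
  hence fh: "map_poly frob h = h" by (subst (asm) mult_left_cancel[OF GmD(5)[OF g]])
  show "h \<in> Gm (l - k)"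
  proof (rule GmI[OF _ _ fh])
    show "lead_coeff h = 1" using lead_coeff_mult[of g h] unfolding GmD(1)[OF g] GmD(1)[OF gh] mult_1_left ..
    show "degree h = l - k" using deg by simp
  qed
qed

lemma proots_frob: "g \<in> Gm l \<Longrightarrow> image_mset frob (proots g) = proots g"
proof -
  assume g: "g \<in> Gm l"
  have eq: "g = (\<Prod>x\<in>#proots g. [:- x, 1:])" by (rule monic_eq_linear_prod(1)[OF GmD(1)[OF g]])
  have lin: "map_poly frob [:- x, 1:] = [:- frob x, 1:]" for x
    by (simp add: map_poly_pCons rhom_simps[OF rhom_frob])
  have "g = map_poly frob g" using GmD(4)[OF g] ..
  also have "\<dots> = map_poly frob (\<Prod>x\<in>#proots g. [:- x, 1:])" using eq by simp
  also have "\<dots> = (\<Prod>x\<in>#proots g. [:- frob x, 1:])"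
    by (simp only: rhom_prod_mset[OF map_poly_rhom[OF rhom_frob]] image_mset.compositionality o_def lin)
  also have "\<dots> = (\<Prod>x\<in>#image_mset frob (proots g). [:- x, 1:])"
    by (simp only: image_mset.compositionality o_def)
  finally have "proots g = proots (\<Prod>x\<in>#image_mset frob (proots g). [:- x, 1:])" by simp
  thus ?thesis by (simp only: proots_linear_prod)
qed

lemma count_image_mset_inj: "inj h \<Longrightarrow> count (image_mset h A) (h x) = count A x"
  by (induction A) (auto dest: injD)

lemma count_frob_pow: "g \<in> Gm l \<Longrightarrow> count (proots g) ((frob ^^ i) b) = count (proots g) b"
proof (induction i)
  case (Suc i)
  have "count (image_mset frob (proots g)) (frob ((frob ^^ i) b)) = count (proots g) ((frob ^^ i) b)"
    by (rule count_image_mset_inj[OF inj_frob])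
  thus ?case using Suc proots_frob[OF Suc.prems] by simp
qed simp

text \<open>Additive in g, with values in the ground field because Frobenius permutes the roots. So
  \<open>psi \<nu> (lam g)\<close> is multiplicative in g, and its generating series by degree is
  the L-function.\<close>

definition lam :: "'k poly \<Rightarrow> 'k" where "lam g = (\<Sum>b\<in>#proots g. poly f b)"

lemma poly_f_frob: "frob (poly f b) = poly f (frob b)"
proof -
  have "map_poly frob f = f" using f coeffs_FQ_iff by blast
  thus ?thesis using pev_comp[OF rhom_id rhom_frob, of b f] by (simp add: pev_def)
qed

lemma lam_FQ: "g \<in> Gm l \<Longrightarrow> lam g \<in> FQ \<nu>"
proof -
  assume g: "g \<in> Gm l"
  have "frob (lam g) = (\<Sum>b\<in>#image_mset frob (proots g). poly f b)"
    by (simp add: lam_def rhom_sum_mset[OF rhom_frob] image_mset.compositionality o_def poly_f_frob)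
  thus ?thesis by (simp add: FQ_frob proots_frob[OF g] lam_def)
qed

lemma lam_mult: "g \<in> Gm k \<Longrightarrow> h \<in> Gm l \<Longrightarrow> lam (g * h) = lam g + lam h"
proof -
  assume "g \<in> Gm k" "h \<in> Gm l"
  hence "g * h \<noteq> 0" using GmD(5) by auto
  thus ?thesis by (simp add: lam_def proots_mult)
qed

text \<open>For x in the extension of degree n this is the characteristic polynomial of x over the
  ground field, a power of the minimal polynomial.\<close>

definition gx :: "'k \<Rightarrow> nat \<Rightarrow> 'k poly" where
  "gx x n = (\<Prod>b\<in>#image_mset (\<lambda>i. (frob ^^ i) x) (mset_set {..<n}). [:- b, 1:])"

lemma gx_Suc: "gx x (Suc n) = [:- (frob ^^ n) x, 1:] * gx x n"
proof -
  have "mset_set {..<Suc n} = add_mset n (mset_set {..<n})" by (simp add: lessThan_Suc)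
  thus ?thesis unfolding gx_def by (simp only: image_mset_add_mset prod_mset.add_mset)
qed

lemma gx_0: "gx x 0 = 1"
  by (simp add: gx_def)

lemma proots_gx: "proots (gx x n) = image_mset (\<lambda>i. (frob ^^ i) x) (mset_set {..<n})"
  unfolding gx_def by (rule proots_linear_prod)

lemma gx_monic: "lead_coeff (gx x n) = 1" and degree_gx: "degree (gx x n) = n"
proof -
  show m: "lead_coeff (gx x n) = 1" unfolding gx_def by (rule linear_prod_monic)
  show "degree (gx x n) = n" using monic_eq_linear_prod(2)[OF m] by (simp add: proots_gx)
qed

text \<open>Frobenius shifts the list of roots by one place. The two end factors account for the
  difference; they coincide when x lies in the extension of degree n.\<close>

lemma gx_shift: "map_poly frob (gx x n) * [:- x, 1:] = [:- (frob ^^ n) x, 1:] * gx x n"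
proof (induction n)
  case (Suc n)
  have lin: "map_poly frob [:- b, 1:] = [:- frob b, 1:]" for b
    by (simp add: map_poly_pCons rhom_simps[OF rhom_frob])
  have "map_poly frob (gx x (Suc n)) = [:- (frob ^^ Suc n) x, 1:] * map_poly frob (gx x n)"
    unfolding gx_Suc rhom_mult[OF map_poly_rhom[OF rhom_frob]] lin by simp
  hence "map_poly frob (gx x (Suc n)) * [:- x, 1:] = [:- (frob ^^ Suc n) x, 1:] * (map_poly frob (gx x n) * [:- x, 1:])"
    by (simp only: mult.assoc)
  thus ?case unfolding Suc gx_Suc .
qed (simp add: gx_0 rhom_1[OF map_poly_rhom[OF rhom_frob]])

lemma gx_Gm: "x \<in> FQ (\<nu> * n) \<Longrightarrow> gx x n \<in> Gm n"
proof -
  assume x: "x \<in> FQ (\<nu> * n)"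
  have "[:- x, 1:] * map_poly frob (gx x n) = [:- x, 1:] * gx x n"
    using gx_shift[of x n] x by (simp only: FQ_frob_pow mult.commute)
  hence "map_poly frob (gx x n) = gx x n" by (subst (asm) mult_left_cancel) auto
  thus ?thesis by (intro GmI gx_monic degree_gx)
qed

lemma lam_gx: "lam (gx x n) = (\<Sum>i<n. (frob ^^ i) (poly f x))"
proof -
  have "poly f ((frob ^^ i) x) = (frob ^^ i) (poly f x)" for i
    by (induction i) (simp_all add: poly_f_frob[symmetric])
  thus ?thesis by (simp add: lam_def proots_gx image_mset.compositionality o_def sum_unfold_sum_mset)
qed

text \<open>Transitivity of the trace: for x in the extension of degree n,
  \<open>lam (gx x n)\<close> is the trace of f(x) to the ground field.\<close>

lemma psi_lam_gx: "psi \<nu> (lam (gx x n)) = psi (\<nu> * n) (poly f x)"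
proof -
  have "tr \<nu> (\<Sum>i<n. (frob ^^ i) y) = tr (\<nu> * n) y" for y
  proof (induction n)
    case 0
    show ?case by (simp add: tr_def power_0_left)
  next
    case (Suc n)
    have "tr (\<nu> * Suc n) y = (\<Sum>j<\<nu> * n. y ^ (p ^ j)) + (\<Sum>j\<in>{\<nu> * n..<\<nu> * n + \<nu>}. y ^ (p ^ j))"
      using sum.atLeastLessThan_concat[of 0 "\<nu> * n" "\<nu> * n + \<nu>" "\<lambda>j. y ^ (p ^ j)"]
      by (simp add: atLeast0LessThan add.commute tr_def)
    also have "(\<Sum>j\<in>{\<nu> * n..<\<nu> * n + \<nu>}. y ^ (p ^ j)) = (\<Sum>j<\<nu>. y ^ (p ^ (\<nu> * n + j)))"
      using sum.shift_bounds_nat_ivl[of "\<lambda>j. y ^ (p ^ j)" 0 "\<nu> * n" \<nu>] by (simp add: atLeast0LessThan add.commute)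
    also have "\<dots> = tr \<nu> ((frob ^^ n) y)" by (simp add: tr_def frob_pow power_add power_mult)
    finally show ?case using Suc by (simp add: tr_add tr_def[of "\<nu> * n"])
  qed
  thus ?thesis by (simp add: psi_def lam_gx)
qed

definition cc :: "nat \<Rightarrow> complex" where "cc l = (\<Sum>g\<in>Gm l. psi \<nu> (lam g))"

text \<open>The \<open>n\<close> with \<open>gx b n\<close> dividing \<open>g\<close> are the multiples \<open>ek\<close>, \<open>k \<le> ord\<^sub>b g\<close>, of the period \<open>e\<close> of \<open>b\<close>.\<close>

lemma card_divisors_gx:
  assumes g: "g \<in> Gm l" and b: "b \<in># proots g"
  shows "card {n \<in> {1..l}. b \<in> FQ (\<nu> * n) \<and> gx b n dvd g} = count (proots g) b"
proof -
  define r where "r = count (proots g) b"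
  let ?u = "\<lambda>i. (frob ^^ i) b"
  have inj: "?u (i + j) = ?u i \<Longrightarrow> ?u j = b" for i j
    by (induction i) (use inj_frob in \<open>auto dest: injD\<close>)
  have "?u i \<in># proots g" for i
    using count_frob_pow[OF g, of i b] b by (metis count_greater_zero_iff)
  hence "range ?u \<subseteq> set_mset (proots g)" by auto
  hence "finite (range ?u)" by (rule finite_subset) simp
  hence "\<not> inj ?u" using finite_imageD infinite_UNIV_nat by blast
  then obtain i j where ij: "i < j" "?u i = ?u j" by (metis linorder_inj_onI' UNIV_I)
  hence "?u (i + (j - i)) = ?u i" by simp
  from inj[OF this] have ex: "\<exists>e>0. ?u e = b" using ij(1) by (intro exI[of _ "j - i"]) simp
  define e where "e = (LEAST e. e > 0 \<and> ?u e = b)"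
  have e: "e > 0" "?u e = b" and min: "\<And>e'. e' > 0 \<Longrightarrow> ?u e' = b \<Longrightarrow> e \<le> e'"
    using LeastI_ex[OF ex] Least_le[of "\<lambda>e. e > 0 \<and> ?u e = b"] unfolding e_def by auto
  have mult: "?u (e * k + i) = ?u i" for k i
  proof (induction k arbitrary: i)
    case (Suc k)
    have "?u (e * Suc k + i) = ?u (e * k + (i + e))" by (simp add: algebra_simps)
    also have "\<dots> = ?u (i + e)" by (rule Suc)
    also have "\<dots> = ?u i" using e by (simp add: funpow_add)
    finally show ?case .
  qed simp
  have period: "?u n = b \<longleftrightarrow> e dvd n" for n
  proof
    assume "?u n = b"
    hence "?u (n mod e) = b" using mult[of "n div e" "n mod e"] by simp
    hence "n mod e = 0" using min[of "n mod e"] mod_less_divisor[OF e(1), of n] by (cases "n mod e = 0") auto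
    thus "e dvd n" by auto
  next
    assume "e dvd n"
    thus "?u n = b" using mult[of _ 0] by (auto elim!: dvdE)
  qed
  define D where "D = proots (gx b e)"
  have countD: "count D c \<le> 1" for c
  proof -
    have "inj_on ?u {..<e}"
    proof (rule linorder_inj_onI')
      fix i j assume ij: "i \<in> {..<e}" "j \<in> {..<e}" "i < j"
      show "?u i \<noteq> ?u j"
      proof
        assume "?u i = ?u j"
        hence "?u (i + (j - i)) = ?u i" using ij by simp
        from inj[OF this] show False using min[of "j - i"] ij by auto
      qed
    qed
    hence "D = mset_set (?u ` {..<e})" unfolding D_def proots_gx by (rule image_mset_mset_set)
    thus ?thesis by (simp add: count_mset_set')
  qed
  have gpow: "gx b (e * k) = gx b e ^ k" for k
  proof -
    have "gx b (e * k + i) = gx b (e * k) * gx b i" for k i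
      by (induction i) (simp_all only: add_0_right add_Suc_right gx_Suc gx_0 mult mult_1_right mult.left_commute)
    thus ?thesis by (induction k) (simp_all add: gx_0 mult.commute add.commute)
  qed
  have dvd: "gx b (e * k) dvd g \<longleftrightarrow> k \<le> r" for k
  proof -
    have gm: "lead_coeff g = 1" by (rule GmD(1)[OF g])
    have "gx b (e * k) dvd g \<longleftrightarrow> repeat_mset k D \<subseteq># proots g"
      using monic_dvd_iff[OF gx_monic gm, of b "e * k"] unfolding gpow proots_power D_def .
    also have "\<dots> \<longleftrightarrow> (\<forall>c. k * count D c \<le> count (proots g) c)" by (simp add: subseteq_mset_def)
    also have "\<dots> \<longleftrightarrow> k \<le> r"
    proof
      assume *: "\<forall>c. k * count D c \<le> count (proots g) c"
      have "b \<in># D" unfolding D_def proots_gx using e(1) by (auto intro!: image_eqI[of _ _ 0])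
      hence "count D b \<ge> 1" by (simp add: Suc_le_eq)
      hence "count D b = 1" using countD[of b] by (intro le_antisym)
      thus "k \<le> r" using *[rule_format, of b] by (simp add: r_def)
    next
      assume k: "k \<le> r"
      show "\<forall>c. k * count D c \<le> count (proots g) c"
      proof
        fix c
        show "k * count D c \<le> count (proots g) c"
        proof (cases "c \<in># D")
          case True
          then obtain i where "c = ?u i" unfolding D_def proots_gx by auto
          hence "count (proots g) c = r" by (simp add: count_frob_pow[OF g] r_def)
          moreover have "k * count D c \<le> k * 1" using countD by (intro mult_le_mono2)
          ultimately show ?thesis using k by linarith
        next
          case False
          thus ?thesis by (simp add: not_in_iff)
        qed
      qed
    qed
    finally show ?thesis .
  qed
  have "{n \<in> {1..l}. b \<in> FQ (\<nu> * n) \<and> gx b n dvd g} = (\<lambda>k. e * k) ` {1..r}"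
  proof (intro equalityI subsetI)
    fix n assume n: "n \<in> {n \<in> {1..l}. b \<in> FQ (\<nu> * n) \<and> gx b n dvd g}"
    hence "e dvd n" using period by (simp add: FQ_frob_pow)
    then obtain k where "n = e * k" by (elim dvdE)
    thus "n \<in> (\<lambda>k. e * k) ` {1..r}" using n dvd by (auto simp: Suc_le_eq)
  next
    fix n assume "n \<in> (\<lambda>k. e * k) ` {1..r}"
    then obtain k where k': "n = e * k" "k \<in> {1..r}" by (rule imageE)
    hence k: "n = e * k" "1 \<le> k" "k \<le> r" by simp_all
    have "gx b n dvd g" using k dvd by simp
    moreover from this have "degree (gx b n) \<le> degree g" using GmD(5)[OF g] by (intro dvd_imp_degree_le)
    hence "n \<le> l" by (simp only: degree_gx GmD(2)[OF g])
    ultimately show "n \<in> {n \<in> {1..l}. b \<in> FQ (\<nu> * n) \<and> gx b n dvd g}"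
      using k e(1) period by (simp add: FQ_frob_pow Suc_le_eq)
  qed
  moreover have "inj_on (\<lambda>k. e * k) {1..r}" using e(1) by (intro inj_onI) simp
  ultimately show ?thesis by (simp add: card_image r_def)
qed

text \<open>The logarithmic derivative of the Euler product, obtained by counting. Each
  \<open>g\<close> of degree \<open>l\<close> arises as \<open>gx x n * h\<close> from exactly
  \<open>l\<close> triples: by \<open>card_divisors_gx\<close> a root of multiplicity r admits r
  values of n, and the multiplicities add up to \<open>l\<close>.\<close>

lemma cc_recursion: "of_nat l * cc l = (\<Sum>n\<in>{1..l}. expsum (\<nu> * n) f * cc (l - n))"
proof -
  define T where "T = Sigma {1..l} (\<lambda>n. FQ (\<nu> * n) \<times> Gm (l - n))"
  define pr where "pr = (\<lambda>(n, x, h). gx x n * h)"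
  have finT: "finite T" unfolding T_def using \<nu> by (intro finite_SigmaI) (auto simp: finite_FQ finite_Gm)
  have prT: "pr t \<in> Gm l" if "t \<in> T" for t
  proof -
    obtain n x h where t: "t = (n, x, h)" by (cases t) auto
    have "gx x n * h \<in> Gm (n + (l - n))" using that by (intro Gm_mult gx_Gm) (auto simp: T_def t)
    thus ?thesis using that by (simp add: pr_def t T_def)
  qed
  have "(\<Sum>n\<in>{1..l}. expsum (\<nu> * n) f * cc (l - n)) = (\<Sum>n\<in>{1..l}. \<Sum>(x, h)\<in>FQ (\<nu> * n) \<times> Gm (l - n). psi \<nu> (lam (gx x n * h)))"
  proof (intro sum.cong refl)
    fix n assume n: "n \<in> {1..l}"
    have "expsum (\<nu> * n) f * cc (l - n) = (\<Sum>x\<in>FQ (\<nu> * n). \<Sum>h\<in>Gm (l - n). psi (\<nu> * n) (poly f x) * psi \<nu> (lam h))"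
      unfolding expsum_def cc_def by (rule sum_product)
    also have "\<dots> = (\<Sum>x\<in>FQ (\<nu> * n). \<Sum>h\<in>Gm (l - n). psi \<nu> (lam (gx x n * h)))"
    proof (intro sum.cong refl)
      fix x h assume x: "x \<in> FQ (\<nu> * n)" and h: "h \<in> Gm (l - n)"
      note G = gx_Gm[OF x]
      show "psi (\<nu> * n) (poly f x) * psi \<nu> (lam h) = psi \<nu> (lam (gx x n * h))"
        unfolding lam_mult[OF G h] psi_add[OF lam_FQ[OF G] lam_FQ[OF h]] psi_lam_gx ..
    qed
    finally show "expsum (\<nu> * n) f * cc (l - n) = (\<Sum>(x, h)\<in>FQ (\<nu> * n) \<times> Gm (l - n). psi \<nu> (lam (gx x n * h)))"
      by (simp add: sum.cartesian_product)
  qed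
  also have "\<dots> = (\<Sum>t\<in>T. psi \<nu> (lam (pr t)))"
    unfolding T_def pr_def using \<nu> by (subst sum.Sigma) (auto simp: finite_FQ finite_Gm split_def)
  also have "\<dots> = (\<Sum>g\<in>Gm l. \<Sum>t\<in>{t \<in> T. pr t = g}. psi \<nu> (lam (pr t)))"
    using prT by (intro sum.group[symmetric] finT finite_Gm) auto
  also have "\<dots> = (\<Sum>g\<in>Gm l. of_nat l * psi \<nu> (lam g))"
  proof (intro sum.cong refl)
    fix g assume g: "g \<in> Gm l"
    define N where "N = (\<lambda>b. {n \<in> {1..l}. b \<in> FQ (\<nu> * n) \<and> gx b n dvd g})"
    have "bij_betw (\<lambda>(n, x, h). (x, n)) {t \<in> T. pr t = g} (Sigma (set_mset (proots g)) N)"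
      unfolding bij_betw_def
    proof
      show "inj_on (\<lambda>(n, x, h). (x, n)) {t \<in> T. pr t = g}"
      proof (rule inj_onI)
        fix s t assume st: "s \<in> {t \<in> T. pr t = g}" "t \<in> {t \<in> T. pr t = g}" "(\<lambda>(n, x, h). (x, n)) s = (\<lambda>(n, x, h). (x, n)) t"
        obtain n x h h' where [simp]: "s = (n, x, h)" "t = (n, x, h')" using st(3) by (cases s; cases t) auto
        have "gx x n * h = gx x n * h'" using st by (simp add: pr_def)
        moreover have "gx x n \<noteq> 0" using gx_monic[of x n] by auto
        ultimately show "s = t" by simp
      qed
      show "(\<lambda>(n, x, h). (x, n)) ` {t \<in> T. pr t = g} = Sigma (set_mset (proots g)) N"
      proof (intro equalityI subsetI)
        fix y assume "y \<in> (\<lambda>(n, x, h). (x, n)) ` {t \<in> T. pr t = g}"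
        then obtain n x h where y: "y = (x, n)" "(n, x, h) \<in> T" "gx x n * h = g" by (auto simp: pr_def)
        have dv: "gx x n dvd g" using y(3) by auto
        have "x \<in># proots (gx x n)" unfolding proots_gx using y(2) by (auto simp: T_def intro!: image_eqI[of _ _ 0])
        hence "x \<in># proots g" using dv monic_dvd_iff[OF gx_monic, of g x n] GmD(1)[OF g] by (auto dest: mset_subset_eqD)
        thus "y \<in> Sigma (set_mset (proots g)) N" using y dv by (auto simp: N_def T_def)
      next
        fix y assume "y \<in> Sigma (set_mset (proots g)) N"
        then obtain x n where y: "y = (x, n)" "n \<in> {1..l}" "x \<in> FQ (\<nu> * n)" "gx x n dvd g" by (auto simp: N_def)
        then obtain h where h: "g = gx x n * h" by (elim dvdE)
        have "h \<in> Gm (l - n)" using Gm_divide(2)[OF gx_Gm[OF y(3)]] g h by blast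
        hence "(n, x, h) \<in> {t \<in> T. pr t = g}" using y h by (simp add: T_def pr_def)
        thus "y \<in> (\<lambda>(n, x, h). (x, n)) ` {t \<in> T. pr t = g}" using y(1) by (intro image_eqI[of _ _ "(n, x, h)"]) auto
      qed
    qed
    hence "card {t \<in> T. pr t = g} = card (Sigma (set_mset (proots g)) N)" by (rule bij_betw_same_card)
    also have "\<dots> = (\<Sum>b\<in>set_mset (proots g). card (N b))" by (intro card_SigmaI) (auto simp: N_def)
    also have "\<dots> = (\<Sum>b\<in>set_mset (proots g). count (proots g) b)"
      unfolding N_def by (intro sum.cong refl card_divisors_gx[OF g])
    also have "\<dots> = size (proots g)" by (simp add: size_multiset_overloaded_eq)
    also have "\<dots> = l" using monic_eq_linear_prod(2)[OF GmD(1)[OF g]] GmD(2)[OF g] by simp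
    finally have "card {t \<in> T. pr t = g} = l" .
    moreover have "(\<Sum>t\<in>{t \<in> T. pr t = g}. psi \<nu> (lam (pr t))) = (\<Sum>t\<in>{t \<in> T. pr t = g}. psi \<nu> (lam g))"
      by (intro sum.cong refl) simp
    ultimately show "(\<Sum>t\<in>{t \<in> T. pr t = g}. psi \<nu> (lam (pr t))) = of_nat l * psi \<nu> (lam g)" by simp
  qed
  also have "\<dots> = of_nat l * cc l" by (simp add: cc_def sum_distrib_left)
  finally show ?thesis ..
qed

lemma cc_0: "cc 0 = 1"
proof -
  have "Gm 0 = {1}"
  proof (intro equalityI subsetI)
    fix g assume g: "g \<in> Gm 0"
    then obtain a where a: "g = [:a:]" using degree_eq_zeroE[of g] GmD(2)[OF g] by blast
    hence "a = 1" using GmD(1)[OF g] by simp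
    with a have "g = [:1:]" by simp
    thus "g \<in> {1}" by (simp add: one_pCons)
  qed (auto simp: Gm_def coeff_1 intro: FQ_closed)
  thus ?thesis by (simp add: cc_def lam_def psi_0)
qed

end

end

section \<open>Vanishing from degree d on, and the top coefficient\<close>

unbundle no vec_syntax

definition dlog :: "'a::field fps \<Rightarrow> 'a fps" where "dlog U = fps_X * fps_deriv U * inverse U"

lemma dlog_mult:
  assumes "fps_nth U 0 \<noteq> 0" "fps_nth V 0 \<noteq> 0"
  shows "dlog (U * V) = dlog U + dlog V"
proof -
  have "U * inverse U = 1" "V * inverse V = 1" using assms by (simp_all add: inverse_mult_eq_1')
  moreover have "dlog (U * V) = fps_X * fps_deriv U * inverse U * (V * inverse V) + fps_X * fps_deriv V * inverse V * (U * inverse U)"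
    by (simp add: dlog_def fps_inverse_mult algebra_simps)
  ultimately show ?thesis by (simp add: dlog_def)
qed

text \<open>A factor congruent to 1 modulo X^m affects the logarithmic derivative only from degree m
  on.\<close>

lemma dlog_high:
  fixes Z :: "'a::field fps"
  assumes "m > 0"
  shows "dlog (1 + fps_X ^ m * Z) = fps_X ^ m * ((of_nat m * Z + fps_X * fps_deriv Z) * inverse (1 + fps_X ^ m * Z))"
proof -
  obtain m' where m': "m = Suc m'" using assms by (cases m) auto
  have dX: "fps_deriv (fps_X ^ m :: 'a fps) = of_nat m * fps_X ^ m'" unfolding m' fps_deriv_power' by simp
  have Xm: "fps_X ^ m = fps_X * (fps_X ^ m' :: 'a fps)" by (simp add: m')
  have "fps_X * fps_deriv (1 + fps_X ^ m * Z) = fps_X * (of_nat m * fps_X ^ m') * Z + fps_X * fps_X ^ m * fps_deriv Z"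
    by (simp only: fps_deriv_add fps_deriv_1 fps_deriv_mult dX) (simp add: algebra_simps)
  also have "\<dots> = fps_X ^ m * (of_nat m * Z + fps_X * fps_deriv Z)" unfolding Xm by (simp add: algebra_simps)
  finally have "fps_X * fps_deriv (1 + fps_X ^ m * Z) = fps_X ^ m * (of_nat m * Z + fps_X * fps_deriv Z)" .
  thus ?thesis by (simp add: dlog_def mult.assoc)
qed

lemma inverse_1_minus_cX: "inverse (1 - fps_const c * fps_X) = Abs_fps (\<lambda>n. c ^ n :: 'a::field)"
proof (rule fps_inverse_unique, rule fps_ext)
  fix n
  show "((1 - fps_const c * fps_X) * Abs_fps (\<lambda>n. c ^ n)) $ n = (1 :: 'a fps) $ n"
    by (cases n) (simp_all add: left_diff_distrib mult.assoc)
qed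

lemma dlog_linear: "dlog (1 - fps_const c * fps_X) $ k = (if k = 0 then 0 else - (c ^ k))"
  for c :: "'a::field"
  unfolding dlog_def inverse_1_minus_cX by (cases k) (simp_all add: mult.assoc)

text \<open>The map permutes \<open>S\<close> and so multiplies the sum by u \<noteq> 1.\<close>

lemma sum_shift_zero:
  fixes F :: "'a \<Rightarrow> 'b::idom"
  assumes S: "finite S" and inj: "inj_on \<tau> S" and maps: "\<And>x. x \<in> S \<Longrightarrow> \<tau> x \<in> S"
    and F: "\<And>x. x \<in> S \<Longrightarrow> F (\<tau> x) = F x * u" and u: "u \<noteq> 1"
  shows "(\<Sum>x\<in>S. F x) = 0"
proof -
  have "\<tau> ` S = S" using endo_inj_surj[OF S _ inj] maps by blast
  hence "(\<Sum>x\<in>S. F x) = (\<Sum>x\<in>S. F (\<tau> x))" using sum.reindex[OF inj, of F] by simp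
  also have "\<dots> = (\<Sum>x\<in>S. F x) * u" by (simp add: F sum_distrib_right)
  finally have "(\<Sum>x\<in>S. F x) * (1 - u) = 0" by (simp add: algebra_simps)
  thus ?thesis using u by simp
qed

context teichmuller
begin

context
  fixes \<nu> d :: nat and f :: "'k poly"
  assumes \<nu>: "\<nu> > 0" and deg_f: "degree f = d" and lc_f: "lead_coeff f = 1" and f: "\<And>i. coeff f i \<in> FQ \<nu>"
    and d_p: "\<not> p dvd d" and d_ge: "d \<ge> 2"
begin

text \<open>Extends \<open>lam\<close>, up to the contribution of the constant term of f, to a
  homomorphism on power series with constant term 1, so that polynomials may be perturbed and
  truncated.\<close>

definition lamf :: "'k fps \<Rightarrow> 'k" where "lamf U = - (\<Sum>k\<in>{1..d}. coeff f k * dlog U $ k)"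

lemma lamf_mult: "U $ 0 = 1 \<Longrightarrow> V $ 0 = 1 \<Longrightarrow> lamf (U * V) = lamf U + lamf V"
  by (simp add: lamf_def dlog_mult ring_distribs sum.distrib)

lemma lamf_1: "lamf 1 = 0"
  by (simp add: lamf_def dlog_def)

text \<open>Only the top term of f, whose coefficient is 1, meets a change in degree d.\<close>

lemma lamf_high:
  assumes "V $ 0 = 1" "U = V + fps_X ^ d * Z"
  shows "lamf U = lamf V - of_nat d * Z $ 0"
proof -
  define Z' where "Z' = Z * inverse V"
  have inv: "V * inverse V = 1" using assms(1) by (simp add: inverse_mult_eq_1')
  have "V * (1 + fps_X ^ d * Z') = V + fps_X ^ d * Z * (V * inverse V)" by (simp add: Z'_def algebra_simps)
  hence U: "U = V * (1 + fps_X ^ d * Z')" using assms(2) inv by simp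
  have d0: "d > 0" using d_ge by simp
  have "dlog (1 + fps_X ^ d * Z') $ k = (if k < d then 0 else of_nat d * Z' $ 0)" if "k \<le> d" for k
    using that d0 unfolding dlog_high[OF d0] fps_X_power_mult_nth by (simp add: fps_of_nat[symmetric] fps_mult_nth_0)
  hence "(\<Sum>k\<in>{1..d}. coeff f k * dlog (1 + fps_X ^ d * Z') $ k) = (\<Sum>k\<in>{1..d}. if k = d then coeff f d * (of_nat d * Z' $ 0) else 0)"
    by (intro sum.cong refl) auto
  also have "\<dots> = of_nat d * Z' $ 0" using d0 lc_f deg_f by simp
  finally have "lamf (1 + fps_X ^ d * Z') = - (of_nat d * Z' $ 0)" by (simp add: lamf_def)
  moreover have "Z' $ 0 = Z $ 0" by (simp add: Z'_def assms(1))
  moreover have "(1 + fps_X ^ d * Z') $ 0 = 1" using d0 by simp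
  ultimately show ?thesis unfolding U by (simp add: lamf_mult assms(1))
qed

definition RU :: "'k poly \<Rightarrow> 'k fps" where "RU g = fps_of_poly (reflect_poly g)"

lemma RU_nth: "RU g $ n = (if degree g < n then 0 else coeff g (degree g - n))"
  by (simp add: RU_def coeff_reflect_poly)

text \<open>Newton's identities: the power sums of the roots are the coefficients of the logarithmic derivative of the reversed polynomial.\<close>

lemma lam_linear_prod:
  "(\<Sum>b\<in>#A. poly f b) = of_nat (size A) * coeff f 0 + lamf (RU (\<Prod>x\<in>#A. [:- x, 1:])) \<and> RU (\<Prod>x\<in>#A. [:- x, 1:]) $ 0 = 1"
proof (induction A)
  case empty
  show ?case by (simp add: RU_def lamf_1)
next
  case (add x A)
  let ?P = "\<Prod>x\<in>#A. [:- x, 1:]"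
  have lin: "RU [:- x, 1:] = 1 - fps_const x * fps_X"
    by (rule fps_ext) (auto simp: RU_nth coeff_pCons split: nat.split)
  have split: "RU (\<Prod>x\<in>#add_mset x A. [:- x, 1:]) = RU [:- x, 1:] * RU ?P"
    unfolding RU_def by (simp only: image_mset_add_mset prod_mset.add_mset reflect_poly_mult fps_of_poly_mult)
  have "lamf (1 - fps_const x * fps_X) = (\<Sum>k\<in>{1..d}. coeff f k * x ^ k)"
    unfolding lamf_def dlog_linear sum_negf[symmetric] by (intro sum.cong refl) auto
  moreover have "poly f x = coeff f 0 + (\<Sum>k\<in>{1..d}. coeff f k * x ^ k)"
  proof -
    have "poly f x = (\<Sum>k\<in>{0..d}. coeff f k * x ^ k)" by (simp add: poly_altdef deg_f atMost_atLeast0)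
    thus ?thesis by (simp add: sum.atLeast_Suc_atMost[of 0 d])
  qed
  moreover have "lamf (RU [:- x, 1:] * RU ?P) = lamf (RU [:- x, 1:]) + lamf (RU ?P)"
    using add by (intro lamf_mult) (simp_all add: lin)
  ultimately show ?case using add unfolding split by (simp add: lin algebra_simps)
qed

lemma lam_RU: "g \<in> Gm \<nu> l \<Longrightarrow> lam f g = of_nat l * coeff f 0 + lamf (RU g)" and RU_0: "g \<in> Gm \<nu> l \<Longrightarrow> RU g $ 0 = 1"
proof -
  assume g: "g \<in> Gm \<nu> l"
  note m = monic_eq_linear_prod[OF GmD(1)[OF \<nu> deg_f lc_f f d_p d_ge g]]
  show "lam f g = of_nat l * coeff f 0 + lamf (RU g)" "RU g $ 0 = 1"
    using lam_linear_prod[of "proots g"] GmD(2)[OF \<nu> deg_f lc_f f d_p d_ge g] unfolding m(1)[symmetric] lam_def[OF \<nu> deg_f lc_f f d_p d_ge] m(2) by simp_all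
qed

end

end

context teichmuller
begin

lemma of_nat_FQ: "(of_nat n :: 'k) \<in> FQ m"
  by (induction n) (simp_all add: FQ_closed)

context
  fixes \<nu> d :: nat and f :: "'k poly"
  assumes \<nu>: "\<nu> > 0" and deg_f: "degree f = d" and lc_f: "lead_coeff f = 1" and f: "\<And>i. coeff f i \<in> FQ \<nu>"
    and d_p: "\<not> p dvd d" and d_ge: "d \<ge> 2" and \<nu>M: "\<nu> dvd M"
begin

private lemmas ctx = \<nu> deg_f lc_f f d_p d_ge
private lemmas GmD' = GmD[OF ctx]
private lemmas lam_FQ' = lam_FQ[OF ctx]
private lemmas finite_Gm' = finite_Gm[OF ctx]
private lemmas lamf_high' = lamf_high[OF ctx]
private lemmas lamf_mult' = lamf_mult[OF ctx]
private lemmas lam_RU' = lam_RU[OF ctx]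
private lemmas RU_0' = RU_0[OF ctx]
private lemmas RU_nth' = RU_nth[OF ctx]

lemma of_nat_d: "(of_nat d :: 'k) \<noteq> 0"
  using d_p by (simp add: of_nat_eq_0_iff_char_dvd char_p)

lemma ex_psi_ne_1: "a \<in> FQ \<nu> \<Longrightarrow> a \<noteq> 0 \<Longrightarrow> \<exists>s\<in>FQ \<nu>. psi \<nu> (a * s) \<noteq> 1"
proof -
  assume a: "a \<in> FQ \<nu>" "a \<noteq> 0"
  have "\<exists>v\<in>FQ \<nu>. psi \<nu> v \<noteq> 1"
  proof (rule ccontr)
    assume "\<not> ?thesis"
    hence "(\<Sum>v\<in>FQ \<nu>. psi \<nu> v) = of_nat (card (FQ \<nu>))" by simp
    thus False using sum_psi[OF \<nu> \<nu>M] card_FQ[OF \<nu>M \<nu>] by simp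
  qed
  then obtain v where v: "v \<in> FQ \<nu>" "psi \<nu> v \<noteq> 1" by blast
  hence "psi \<nu> (a * (v / a)) \<noteq> 1" using a by simp
  thus ?thesis using v a FQ_closed(9) by blast
qed

text \<open>Replacing \<open>g\<close> by \<open>g + s x\<^bsup>l-d\<^esup>\<close> changes \<open>lam g\<close> by \<open>- d s\<close>.\<close>

lemma cc_high:
  assumes "l \<ge> d"
  shows "cc \<nu> f l = 0"
proof -
  obtain s where s: "s \<in> FQ \<nu>" "psi \<nu> (- of_nat d * s) \<noteq> 1"
    using ex_psi_ne_1[OF FQ_closed(7)[OF of_nat_FQ], of d] of_nat_d by auto
  define \<tau> where "\<tau> = (\<lambda>g :: 'k poly. g + monom s (l - d))"
  have deg: "degree (monom s (l - d)) < l" 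
    using degree_monom_le[of s "l - d"] assms d_ge by linarith
  have \<tau>: "degree (\<tau> g) = l" "coeff (\<tau> g) l = 1" if g: "g \<in> Gm \<nu> l" for g
  proof -
    show "degree (\<tau> g) = l" unfolding \<tau>_def using degree_add_eq_left[of "monom s (l - d)" g] deg GmD'(2)[OF g] by simp
    show "coeff (\<tau> g) l = 1" unfolding \<tau>_def using GmD'(1,2)[OF g] deg assms d_ge by (simp add: coeff_eq_0)
  qed
  have \<tau>G: "\<tau> g \<in> Gm \<nu> l" if g: "g \<in> Gm \<nu> l" for g
  proof -
    have "coeff (\<tau> g) i \<in> FQ \<nu>" for i
      unfolding \<tau>_def coeff_add by (intro FQ_closed GmD'[OF g]) (simp add: s FQ_closed)
    thus ?thesis unfolding Gm_def[OF ctx] using \<tau>[OF g] by auto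
  qed
  have "RU (\<tau> g) = RU g + fps_X ^ d * fps_const s" if g: "g \<in> Gm \<nu> l" for g
  proof (rule fps_ext)
    fix n
    have R: "RU g $ n = (if l < n then 0 else coeff g (l - n))"
      and R': "RU (\<tau> g) $ n = (if l < n then 0 else coeff (\<tau> g) (l - n))"
      using \<tau>(1)[OF g] GmD'(2)[OF g] by (simp_all add: RU_nth')
    have sX: "(fps_X ^ d * fps_const s) $ n = (if n = d then s else 0)"
      by (auto simp: fps_X_power_mult_nth)
    have "coeff (monom s (l - d)) (l - n) = (if n = d then s else 0)" if "n \<le> l"
      using that assms by (auto simp: coeff_monom)
    hence "coeff (\<tau> g) (l - n) = coeff g (l - n) + (if n = d then s else 0)" if "n \<le> l"
      using that by (simp add: \<tau>_def)
    thus "RU (\<tau> g) $ n = (RU g + fps_X ^ d * fps_const s) $ n"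
      unfolding fps_add_nth R R' sX using assms by (cases "l < n") simp_all
  qed
  hence "lamf d f (RU (\<tau> g)) = lamf d f (RU g) - of_nat d * s" if g: "g \<in> Gm \<nu> l" for g
    using lamf_high'[OF RU_0'[OF g], of "RU (\<tau> g)" "fps_const s"] g by simp
  hence "lam f (\<tau> g) = lam f g + - of_nat d * s" if g: "g \<in> Gm \<nu> l" for g
    using lam_RU'[OF g] lam_RU'[OF \<tau>G[OF g]] g by simp
  hence "psi \<nu> (lam f (\<tau> g)) = psi \<nu> (lam f g) * psi \<nu> (- of_nat d * s)" if g: "g \<in> Gm \<nu> l" for g
    using psi_add[OF lam_FQ'[OF g], of "- of_nat d * s"] s g by (simp add: FQ_closed of_nat_FQ)
  moreover have "inj_on \<tau> (Gm \<nu> l)" by (intro inj_onI) (simp add: \<tau>_def)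
  ultimately show ?thesis
    unfolding cc_def[OF ctx] using finite_Gm' \<tau>G s(2) by (intro sum_shift_zero[where \<tau>=\<tau> and u="psi \<nu> (- of_nat d * s)"]) auto
qed

text \<open>The reversed monic polynomials of degree d - 1. They also represent the series with
  constant term 1 modulo X^d, so truncated multiplication makes them a group.\<close>

definition VV :: "'k fps set" where "VV = {U. U $ 0 = 1 \<and> (\<forall>k. U $ k \<in> FQ \<nu>) \<and> (\<forall>k\<ge>d. U $ k = 0)}"

lemma RU_rev: "g \<in> Gm \<nu> l \<Longrightarrow> i \<le> l \<Longrightarrow> RU g $ (l - i) = coeff g i"
  using GmD'(2)[of g l] by (simp add: RU_nth')

lemma RU_bij: "bij_betw RU (Gm \<nu> (d - 1)) VV"
  unfolding bij_betw_def
proof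
  show "inj_on RU (Gm \<nu> (d - 1))"
  proof (rule inj_onI)
    fix g h assume gh: "g \<in> Gm \<nu> (d - 1)" "h \<in> Gm \<nu> (d - 1)" "RU g = RU h"
    show "g = h"
    proof (rule poly_eqI)
      fix i
      show "coeff g i = coeff h i"
      proof (cases "i \<le> d - 1")
        case True
        thus ?thesis using arg_cong[OF gh(3), of "\<lambda>U. U $ (d - 1 - i)"] by (simp only: RU_rev[OF gh(1)] RU_rev[OF gh(2)])
      next
        case False
        thus ?thesis using GmD'(2)[OF gh(1)] GmD'(2)[OF gh(2)] by (simp add: coeff_eq_0)
      qed
    qed
  qed
  show "RU ` Gm \<nu> (d - 1) = VV"
  proof (intro equalityI subsetI)
    fix U assume "U \<in> RU ` Gm \<nu> (d - 1)"
    then obtain g where g: "g \<in> Gm \<nu> (d - 1)" "U = RU g" by blast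
    thus "U \<in> VV" using RU_0'[OF g(1)] GmD'(2,3)[OF g(1)] d_ge by (auto simp: VV_def RU_nth' FQ_closed)
  next
    fix U assume U: "U \<in> VV"
    define g where "g = (\<Sum>i\<le>d - 1. monom (U $ (d - 1 - i)) i)"
    have cg: "coeff g i = (if i \<le> d - 1 then U $ (d - 1 - i) else 0)" for i
      by (simp add: g_def coeff_sum)
    have deg: "degree g = d - 1"
    proof (rule antisym)
      show "degree g \<le> d - 1" by (rule degree_le) (simp add: cg)
      show "d - 1 \<le> degree g" by (rule le_degree) (use U in \<open>simp add: cg VV_def\<close>)
    qed
    have "g \<in> Gm \<nu> (d - 1)" unfolding Gm_def[OF ctx] using U deg by (auto simp: cg VV_def FQ_closed)
    moreover have "RU g = U"
      by (rule fps_ext) (use U d_ge in \<open>auto simp: RU_nth' deg cg VV_def not_less\<close>)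
    ultimately show "U \<in> RU ` Gm \<nu> (d - 1)" by blast
  qed
qed

lemma finite_VV: "finite VV"
  using bij_betw_finite[OF RU_bij] finite_Gm' by simp

lemma lamf_VV: "U \<in> VV \<Longrightarrow> lamf d f U \<in> FQ \<nu>"
proof -
  assume "U \<in> VV"
  then obtain g where g: "g \<in> Gm \<nu> (d - 1)" "U = RU g" using RU_bij by (auto simp: bij_betw_def)
  hence "lamf d f U = lam f g - of_nat (d - 1) * coeff f 0" using lam_RU'[OF g(1)] by simp
  thus ?thesis using lam_FQ'[OF g(1)] f by (simp only:) (intro FQ_closed of_nat_FQ f)
qed

lemma mult_FQ: "(\<forall>k. U $ k \<in> FQ \<nu>) \<Longrightarrow> (\<forall>k. V $ k \<in> FQ \<nu>) \<Longrightarrow> (U * V) $ k \<in> FQ \<nu>" for U V :: "'k fps"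
  unfolding fps_mult_nth by (intro FQ_sum FQ_closed) auto

lemma cut_VV: "U \<in> VV \<Longrightarrow> V \<in> VV \<Longrightarrow> fps_cutoff d (U * V) \<in> VV"
  using mult_FQ[of U V] d_ge by (auto simp: VV_def FQ_closed)

lemma cut_decomp: "U * V = fps_cutoff d (U * V) + fps_X ^ d * fps_shift d (U * V)" for U V :: "'k fps"
  using fps_shift_cutoff'[of d "U * V"] by (simp add: add.commute)

text \<open>Truncation at X^d makes \<open>lamf\<close> fail to be additive by a multiple of the
  coefficient of X^d. This bilinear defect is what makes the sum in \<open>cc_top\<close> behave
  like a Gauss sum.\<close>

lemma lamf_cut:
  assumes "U \<in> VV" "V \<in> VV"
  shows "lamf d f (fps_cutoff d (U * V)) = lamf d f U + lamf d f V + of_nat d * (U * V) $ d"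
proof -
  have "fps_cutoff d (U * V) $ 0 = 1" using cut_VV[OF assms] by (simp add: VV_def)
  from lamf_high'[OF this cut_decomp] have "lamf d f (U * V) = lamf d f (fps_cutoff d (U * V)) - of_nat d * (U * V) $ d"
    by simp
  moreover have "lamf d f (U * V) = lamf d f U + lamf d f V" using assms by (intro lamf_mult') (auto simp: VV_def)
  ultimately show ?thesis by (simp add: algebra_simps)
qed

text \<open>The truncation determines the product modulo X^d, and \<open>V\<close> is
  invertible.\<close>

lemma cut_inj:
  assumes V: "V \<in> VV"
  shows "inj_on (\<lambda>U. fps_cutoff d (U * V)) VV"
proof (rule inj_onI)
  fix U U' assume U: "U \<in> VV" "U' \<in> VV" and eq: "fps_cutoff d (U * V) = fps_cutoff d (U' * V)"
  have "(U - U') * V = fps_X ^ d * (fps_shift d (U * V) - fps_shift d (U' * V))"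
  proof -
    have "(U - U') * V = U * V - U' * V" by (rule left_diff_distrib)
    also have "\<dots> = (fps_cutoff d (U * V) + fps_X ^ d * fps_shift d (U * V)) - (fps_cutoff d (U' * V) + fps_X ^ d * fps_shift d (U' * V))"
      by (intro arg_cong2[of _ _ _ _ "(-)"] cut_decomp)
    finally show ?thesis unfolding eq by (simp add: right_diff_distrib)
  qed
  hence "(U - U') * (V * inverse V) = fps_X ^ d * ((fps_shift d (U * V) - fps_shift d (U' * V)) * inverse V)"
    by (simp only: mult.assoc[symmetric])
  moreover have "V * inverse V = 1" using V by (simp add: inverse_mult_eq_1' VV_def)
  ultimately have *: "U - U' = fps_X ^ d * ((fps_shift d (U * V) - fps_shift d (U' * V)) * inverse V)" by simp
  show "U = U'"
  proof (rule fps_ext)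
    fix n
    show "U $ n = U' $ n"
    proof (cases "n < d")
      case True
      thus ?thesis using arg_cong[OF *, of "\<lambda>W. W $ n"] unfolding fps_X_power_mult_nth by simp
    next
      case False
      thus ?thesis using U by (simp add: VV_def)
    qed
  qed
qed

text \<open>If W \<noteq> 1, some W_i with 0 < i < d is nonzero. Adding s X^(d-i) to V changes the
  coefficient of X^d by s W_i, and s can be chosen so that \<open>psi\<close> detects the
  change.\<close>

lemma sum_psi_dual:
  assumes W: "W \<in> VV"
  shows "(\<Sum>V\<in>VV. psi \<nu> (of_nat d * (W * V) $ d)) = (if W = 1 then of_nat (card VV) else 0)"
proof (cases "W = 1")
  case True
  have "psi \<nu> (of_nat d * (W * V) $ d) = 1" if "V \<in> VV" for V using that True by (simp add: VV_def psi_0)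
  thus ?thesis using True by simp
next
  case False
  then obtain i where i: "W $ i \<noteq> (1 :: 'k fps) $ i" by (auto simp: fps_eq_iff)
  have ipos: "i > 0"
  proof (rule ccontr)
    assume "\<not> i > 0"
    thus False using i W by (simp add: VV_def)
  qed
  hence Wi0: "W $ i \<noteq> 0" using i by (simp add: fps_one_nth)
  have "i < d"
  proof (rule ccontr)
    assume "\<not> i < d"
    thus False using Wi0 W by (simp add: VV_def)
  qed
  with ipos Wi0 have i0: "0 < i" "i < d" "W $ i \<noteq> 0" by simp_all
  have Wi: "W $ i \<in> FQ \<nu>" using W by (simp add: VV_def)
  have "of_nat d * W $ i \<noteq> 0" using of_nat_d i0(3) by (simp only: mult_eq_0_iff) simp
  from ex_psi_ne_1[OF FQ_closed(5)[OF of_nat_FQ Wi] this]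
  obtain s where s: "s \<in> FQ \<nu>" "psi \<nu> (of_nat d * W $ i * s) \<noteq> 1" by (elim bexE)
  define \<tau> where "\<tau> = (\<lambda>V. V + fps_const s * fps_X ^ (d - i) :: 'k fps)"
  have "\<tau> V \<in> VV" if "V \<in> VV" for V
    using that s i0 by (auto simp: VV_def \<tau>_def FQ_closed)
  moreover have "psi \<nu> (of_nat d * (W * \<tau> V) $ d) = psi \<nu> (of_nat d * (W * V) $ d) * psi \<nu> (of_nat d * W $ i * s)" if "V \<in> VV" for V
  proof -
    have "W * \<tau> V = W * V + fps_const s * (W * fps_X ^ (d - i))" by (simp add: \<tau>_def algebra_simps)
    hence "(W * \<tau> V) $ d = (W * V) $ d + s * W $ i" using i0 by (simp add: fps_X_power_mult_right_nth)
    hence "of_nat d * (W * \<tau> V) $ d = of_nat d * (W * V) $ d + of_nat d * W $ i * s" by (simp add: algebra_simps)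
    moreover have "(W * V) $ d \<in> FQ \<nu>" using W that by (intro mult_FQ) (auto simp: VV_def)
    ultimately show ?thesis using psi_add[of "of_nat d * (W * V) $ d" \<nu> "of_nat d * W $ i * s"] s Wi
      by (simp add: FQ_closed of_nat_FQ)
  qed
  moreover have "inj_on \<tau> VV" by (intro inj_onI) (simp add: \<tau>_def)
  ultimately have "(\<Sum>V\<in>VV. psi \<nu> (of_nat d * (W * V) $ d)) = 0"
    using finite_VV s(2) by (intro sum_shift_zero[where \<tau>=\<tau> and u="psi \<nu> (of_nat d * W $ i * s)"]) auto
  thus ?thesis using False by simp
qed

text \<open>Up to a root of unity, \<open>cc (d - 1)\<close> is a sum over \<open>VV\<close> whose product with its conjugate is \<open>card VV\<close>.\<close>

lemma cc_top: "cc \<nu> f (d - 1) \<noteq> 0"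
proof -
  define A where "A = (\<Sum>U\<in>VV. psi \<nu> (lamf d f U))"
  define B where "B = (\<Sum>V\<in>VV. psi \<nu> (- lamf d f V))"
  have V1: "1 \<in> VV" using d_ge by (auto simp: VV_def FQ_closed)
  have "A * B = (\<Sum>V\<in>VV. \<Sum>U\<in>VV. psi \<nu> (lamf d f U - lamf d f V))"
  proof -
    have "psi \<nu> (lamf d f U) * psi \<nu> (- lamf d f V) = psi \<nu> (lamf d f U - lamf d f V)" if "U \<in> VV" "V \<in> VV" for U V
      using psi_add[OF lamf_VV[OF that(1)], of "- lamf d f V"] lamf_VV[OF that(2)] by (simp add: FQ_closed)
    hence "A * B = (\<Sum>U\<in>VV. \<Sum>V\<in>VV. psi \<nu> (lamf d f U - lamf d f V))"
      unfolding A_def B_def sum_product by (intro sum.cong refl) auto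
    thus ?thesis by (rule trans[OF _ sum.swap])
  qed
  also have "\<dots> = (\<Sum>V\<in>VV. \<Sum>W\<in>VV. psi \<nu> (lamf d f W) * psi \<nu> (of_nat d * (W * V) $ d))"
  proof (rule sum.cong[OF refl])
    fix V assume V: "V \<in> VV"
    let ?c = "\<lambda>W. fps_cutoff d (W * V)"
    have "?c ` VV = VV" using cut_VV[OF _ V] by (intro endo_inj_surj[OF finite_VV _ cut_inj[OF V]]) blast
    hence "(\<Sum>U\<in>VV. psi \<nu> (lamf d f U - lamf d f V)) = (\<Sum>W\<in>VV. psi \<nu> (lamf d f (?c W) - lamf d f V))"
      using sum.reindex[OF cut_inj[OF V], of "\<lambda>U. psi \<nu> (lamf d f U - lamf d f V)"] by simp
    also have "\<dots> = (\<Sum>W\<in>VV. psi \<nu> (lamf d f W) * psi \<nu> (of_nat d * (W * V) $ d))"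
    proof (intro sum.cong refl)
      fix W assume W: "W \<in> VV"
      have "(W * V) $ d \<in> FQ \<nu>" using W V by (intro mult_FQ) (auto simp: VV_def)
      hence "of_nat d * (W * V) $ d \<in> FQ \<nu>" by (intro FQ_closed of_nat_FQ)
      moreover have "lamf d f (?c W) - lamf d f V = lamf d f W + of_nat d * (W * V) $ d" using lamf_cut[OF W V] by simp
      ultimately show "psi \<nu> (lamf d f (?c W) - lamf d f V) = psi \<nu> (lamf d f W) * psi \<nu> (of_nat d * (W * V) $ d)"
        using psi_add[OF lamf_VV[OF W]] by simp
    qed
    finally show "(\<Sum>U\<in>VV. psi \<nu> (lamf d f U - lamf d f V)) = (\<Sum>W\<in>VV. psi \<nu> (lamf d f W) * psi \<nu> (of_nat d * (W * V) $ d))" .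
  qed
  also have "\<dots> = (\<Sum>W\<in>VV. \<Sum>V\<in>VV. psi \<nu> (lamf d f W) * psi \<nu> (of_nat d * (W * V) $ d))" by (rule sum.swap)
  also have "\<dots> = (\<Sum>W\<in>VV. psi \<nu> (lamf d f W) * (if W = 1 then of_nat (card VV) else 0))"
    unfolding sum_distrib_left[symmetric] by (intro sum.cong refl arg_cong2[of _ _ _ _ "(*)"] sum_psi_dual)
  also have "\<dots> = (\<Sum>W\<in>VV. if W = 1 then of_nat (card VV) else 0)"
    by (intro sum.cong refl) (simp add: lamf_1[OF ctx] psi_0)
  also have "\<dots> = of_nat (card VV)" using V1 finite_VV by simp
  finally have "A \<noteq> 0" using V1 finite_VV by auto
  define e where "e = (of_nat (d - 1) :: 'k) * coeff f 0"
  have e: "e \<in> FQ \<nu>" unfolding e_def by (intro FQ_closed of_nat_FQ f)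
  have "cc \<nu> f (d - 1) = (\<Sum>g\<in>Gm \<nu> (d - 1). psi \<nu> (e + lamf d f (RU g)))"
    unfolding cc_def[OF ctx] by (intro sum.cong refl) (simp add: lam_RU' e_def)
  also have "\<dots> = (\<Sum>U\<in>VV. psi \<nu> (e + lamf d f U))" by (rule sum.reindex_bij_betw[OF RU_bij])
  also have "\<dots> = (\<Sum>U\<in>VV. psi \<nu> e * psi \<nu> (lamf d f U))" by (intro sum.cong refl psi_add e lamf_VV)
  also have "\<dots> = psi \<nu> e * A" by (simp add: A_def sum_distrib_left)
  finally have *: "cc \<nu> f (d - 1) = psi \<nu> e * A" .
  have "psi \<nu> e * psi \<nu> (- e) = 1" using psi_add[OF e FQ_closed(7)[OF e]] psi_0 by simp
  hence "psi \<nu> e \<noteq> 0" by auto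
  thus ?thesis using * \<open>A \<noteq> 0\<close> by simp
qed

end

end

section \<open>Reduction of a single L-function, and the count of affine points\<close>

context teichmuller
begin

context
  fixes \<nu> d w :: nat and f :: "'k poly"
  assumes \<nu>: "\<nu> > 0" and deg_f: "degree f = d" and lc_f: "lead_coeff f = 1" and f: "\<And>i. coeff f i \<in> FQ \<nu>"
    and d_ge: "d \<ge> 2" and pd: "p > d" and nM: "\<And>n. 0 < n \<Longrightarrow> n < d \<Longrightarrow> \<nu> * n dvd M"
    and w: "p - 1 \<le> d * w" "d * w < p - 1 + d"
begin

lemma p_not_dvd_d: "\<not> p dvd d"
  using nat_dvd_not_less[of d p] d_ge pd by simp

lemma nu_dvd_M: "\<nu> dvd M"
  using nM[of 1] d_ge by simp

definition gam :: 'k where "gam = (\<Prod>j<\<nu>. (coeff (f ^ w) (p - 1) / of_nat (fact w)) ^ (p ^ j))"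

lemma ex_res_cc:
  "\<exists>c. res (\<nu> * w * l) (cc \<nu> f l) c \<and> (l = 0 \<longrightarrow> c = 1) \<and> (p > 2 * d \<longrightarrow> (l = 1 \<longrightarrow> c = - gam) \<and> (l \<ge> 2 \<longrightarrow> c = 0))"
proof (induction l rule: less_induct)
  case (less l)
  note ctx = \<nu> deg_f lc_f f p_not_dvd_d d_ge
  consider "l = 0" | "l \<ge> d" | "0 < l" "l < d" by linarith
  thus ?case
  proof cases
    case 1
    have "res 0 1 (\<phi> 1)" using res_Ov[of 1] Ov_1 by simp
    thus ?thesis using 1 d_ge by (simp add: cc_0[OF ctx] \<phi>_1)
  next
    case 2
    thus ?thesis using d_ge by (intro exI[of _ 0]) (simp add: cc_high[OF ctx nu_dvd_M] res_0)
  next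
    case 3
    define Q where "Q = (\<lambda>k c. res (\<nu> * w * k) (cc \<nu> f k) c \<and> (k = 0 \<longrightarrow> c = 1) \<and>
        (p > 2 * d \<longrightarrow> (k = 1 \<longrightarrow> c = - gam) \<and> (k \<ge> 2 \<longrightarrow> c = 0)))"
    have "\<forall>k\<in>{..<l}. \<exists>c. Q k c" unfolding Q_def using less.IH by simp
    then obtain C where "\<forall>k\<in>{..<l}. Q k (C k)" using bchoice by blast
    hence C: "\<And>k. k < l \<Longrightarrow> res (\<nu> * w * k) (cc \<nu> f k) (C k) \<and> (k = 0 \<longrightarrow> C k = 1) \<and>
        (p > 2 * d \<longrightarrow> (k = 1 \<longrightarrow> C k = - gam) \<and> (k \<ge> 2 \<longrightarrow> C k = 0))"
      by (simp add: Q_def)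
    have "\<exists>c. res (\<nu> * n * w) (expsum (\<nu> * n) f) c \<and> (p > 2 * d \<longrightarrow> c = - (gam ^ n))" if "n \<in> {1..l}" for n
      using res_expsum_norm[OF \<nu> _ _ _ d_ge pd w f, of n] nM[of n] that 3 deg_f by (simp add: gam_def)
    then obtain e where e: "\<And>n. n \<in> {1..l} \<Longrightarrow> res (\<nu> * n * w) (expsum (\<nu> * n) f) (e n) \<and> (p > 2 * d \<longrightarrow> e n = - (gam ^ n))"
      by metis
    define S where "S = (\<Sum>n\<in>{1..l}. e n * C (l - n))"
    have "res (\<nu> * w * l) (\<Sum>n\<in>{1..l}. expsum (\<nu> * n) f * cc \<nu> f (l - n)) S"
      unfolding S_def
    proof (rule res_sum)
      fix n assume n: "n \<in> {1..l}"
      hence "res (\<nu> * n * w + \<nu> * w * (l - n)) (expsum (\<nu> * n) f * cc \<nu> f (l - n)) (e n * C (l - n))"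
        using e[OF n] C[of "l - n"] by (intro res_mult) auto
      moreover have "\<nu> * n * w + \<nu> * w * (l - n) = \<nu> * w * (n + (l - n))" by (simp only: algebra_simps)
      ultimately show "res (\<nu> * w * l) (expsum (\<nu> * n) f * cc \<nu> f (l - n)) (e n * C (l - n))" using n by simp
    qed
    hence "res (\<nu> * w * l) (of_nat l * cc \<nu> f l) S" by (simp only: cc_recursion[OF ctx])
    moreover have l: "(of_nat l :: 'k) \<noteq> 0"
      using 3 pd nat_dvd_not_less[of l p] by (simp add: of_nat_eq_0_iff_char_dvd char_p)
    ultimately have "res (\<nu> * w * l) (of_nat l * cc \<nu> f l / of_nat l) (S / \<phi> (of_nat l))"
      by (intro res_divide_unit) (simp_all add: \<phi>_of_nat Ov_of_nat)
    hence res: "res (\<nu> * w * l) (cc \<nu> f l) (S / of_nat l)" using 3 by (simp add: \<phi>_of_nat)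
    have "(l = 1 \<longrightarrow> S / of_nat l = - gam) \<and> (l \<ge> 2 \<longrightarrow> S / of_nat l = 0)" if big: "p > 2 * d"
    proof -
      have S: "S = (\<Sum>n\<in>{1..l}. - (gam ^ n) * C (l - n))" unfolding S_def using e big by (intro sum.cong refl) auto
      have C0: "C 0 = 1" using C[of 0] 3 by simp
      \<comment> \<open>Only the terms n = l - 1 and n = l survive; with C_1 = -\<gamma> and C_0 = 1
        they are \<gamma>^l and -\<gamma>^l.\<close>
      have "S = 0" if l2: "l \<ge> 2"
      proof -
        obtain l' where l': "l = Suc (Suc l')" using l2 by (metis add_2_eq_Suc le_Suc_ex)
        have C1: "C 1 = - gam" using C[of 1] big l2 by simp
        have "(\<Sum>n\<in>{1..l'}. - (gam ^ n) * C (l - n)) = 0" using C big l' by (intro sum.neutral) auto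
        hence "S = - (gam ^ Suc l') * C 1 + - (gam ^ l) * C 0" unfolding S l' by simp
        thus ?thesis using C0 C1 l' by simp
      qed
      moreover have "S = - gam" if "l = 1" using S C0 that by simp
      ultimately show ?thesis by auto
    qed
    thus ?thesis using res 3 by (intro exI[of _ "S / of_nat l"]) auto
  qed
qed

end

text \<open>The solutions of \<open>y\<^sup>p - y = u\<close> satisfy \<open>y\<^bsup>p^m\<^esup> - y = tr u\<close>, by telescoping.\<close>

lemma artin_schreier_fibre:
  assumes m: "m > 0" and u: "u \<in> FQ m"
  shows "card {y \<in> FQ m. y ^ p - y = u} = (if tr m u = 0 then p else 0)"
proof -
  have tel: "y ^ (p ^ m) - y = tr m u" if "y ^ p - y = u" for y
  proof -
    have "y ^ (p ^ i) - y = tr i u" for i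
    proof (induction i)
      case (Suc i)
      have "u ^ (p ^ i) = (y ^ p) ^ (p ^ i) - y ^ (p ^ i)"
        using frob_m[of u y i] that by (simp add: algebra_simps)
      hence "y ^ (p ^ Suc i) - y ^ (p ^ i) = u ^ (p ^ i)" by (simp flip: power_mult)
      thus ?case using Suc by (simp add: tr_def algebra_simps)
    qed (simp add: tr_def)
    thus ?thesis .
  qed
  show ?thesis
  proof (cases "tr m u = 0")
    case False
    moreover have "tr m u = 0" if "y \<in> FQ m" "y ^ p - y = u" for y
      using tel[OF that(2)] that(1) by (simp add: FQ_def)
    ultimately have E: "{y \<in> FQ m. y ^ p - y = u} = {}" by blast
    show ?thesis unfolding E using False by simp
  next
    case True
    define P where "P = Polynomial.monom 1 p - [:u, 1 :: 'k:]"
    have "coeff P p = 1" using p_ge_3 by (simp add: P_def coeff_pCons split: nat.split)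
    hence "p \<le> degree P" by (intro le_degree) simp
    hence "degree P > 0" using p_ge_3 by simp
    then obtain y0 where "poly P y0 = 0" using alg_closed_imp_poly_has_root by blast
    hence y0: "y0 ^ p - y0 = u" by (simp add: P_def poly_monom algebra_simps)
    have "{y \<in> FQ m. y ^ p - y = u} = (\<lambda>c. y0 + c) ` FQ (Suc 0)"
    proof (intro equalityI subsetI)
      fix y assume "y \<in> {y \<in> FQ m. y ^ p - y = u}"
      hence "y ^ p - y = y0 ^ p - y0" using y0 by simp
      hence "(y - y0) ^ p = y - y0" using frob_m[of "y - y0" y0 1] by (simp add: algebra_simps)
      thus "y \<in> (\<lambda>c. y0 + c) ` FQ (Suc 0)" by (intro image_eqI[of _ _ "y - y0"]) (simp_all add: FQ_def)
    next
      fix y assume "y \<in> (\<lambda>c. y0 + c) ` FQ (Suc 0)"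
      then obtain c where c: "y = y0 + c" "c ^ p = c" by (auto simp: FQ_def)
      have "y ^ p - y = u" using frob_m[of y0 c 1] c y0 by simp
      moreover from tel[OF this] have "y \<in> FQ m" using True by (simp add: FQ_def)
      ultimately show "y \<in> {y \<in> FQ m. y ^ p - y = u}" by simp
    qed
    moreover have "card ((\<lambda>c. y0 + c) ` FQ (Suc 0)) = card (FQ (Suc 0))" by (intro card_image inj_onI) simp
    moreover have "card (FQ (Suc 0)) = p" using card_FQ[of "Suc 0"] by simp
    ultimately show ?thesis using True by simp
  qed
qed

lemma sum_psi_powers:
  assumes u: "u \<in> FQ m"
  shows "(\<Sum>a<p. psi m u ^ a) = (if tr m u = 0 then of_nat p else 0)"
proof (cases "tr m u = 0")
  case True
  thus ?thesis using chi_of_nat[of 0] by (simp add: psi_def)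
next
  case False
  have t: "tr m u \<in> FQ (Suc 0)" by (rule tr_FQ[OF u])
  then obtain n where n: "tr m u = of_nat n" unfolding FQ_1 by auto
  have ne: "psi m u \<noteq> 1" using chi_eq_1[OF t] False by (auto simp: psi_def)
  have "psi m u ^ p = (\<zeta> ^ p) ^ n" unfolding psi_def n chi_of_nat by (simp add: mult.commute flip: power_mult)
  hence "psi m u ^ p = 1" by (simp add: zeta_p)
  thus ?thesis using ne False by (simp add: geometric_sum)
qed

text \<open>The size of the fibre over x is a sum over the characters of the prime field, and the
  trivial one contributes p^m in total.\<close>

lemma card_as_points_affine:
  assumes m: "m > 0" "m dvd M" and f: "\<And>i. coeff f i \<in> FQ m"
  shows "of_nat (card {(x, y). x \<in> FQ m \<and> y \<in> FQ m \<and> y ^ p - y = poly f x}) =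
    of_nat (p ^ m) + (\<Sum>a\<in>{1..<p}. \<Sum>x\<in>FQ m. psi m (poly f x) ^ a)"
proof -
  have pf: "poly f x \<in> FQ m" if "x \<in> FQ m" for x
    unfolding poly_altdef using that f by (intro FQ_sum FQ_closed)
  have fin: "finite (FQ m)" by (rule finite_FQ[OF m(1)])
  have "{(x, y). x \<in> FQ m \<and> y \<in> FQ m \<and> y ^ p - y = poly f x} = Sigma (FQ m) (\<lambda>x. {y \<in> FQ m. y ^ p - y = poly f x})"
    by auto
  hence "of_nat (card {(x, y). x \<in> FQ m \<and> y \<in> FQ m \<and> y ^ p - y = poly f x}) =
      (\<Sum>x\<in>FQ m. of_nat (card {y \<in> FQ m. y ^ p - y = poly f x}) :: complex)"
    using fin by (simp add: card_SigmaI)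
  also have "\<dots> = (\<Sum>x\<in>FQ m. \<Sum>a<p. psi m (poly f x) ^ a)"
    by (intro sum.cong refl) (simp add: artin_schreier_fibre[OF m(1) pf] sum_psi_powers[OF pf])
  also have "\<dots> = (\<Sum>a<p. \<Sum>x\<in>FQ m. psi m (poly f x) ^ a)" by (rule sum.swap)
  also have "{..<p} = insert 0 {1..<p}" using p_ge_3 by auto
  also have "(\<Sum>a\<in>insert 0 {1..<p}. \<Sum>x\<in>FQ m. psi m (poly f x) ^ a) = of_nat (card (FQ m)) + (\<Sum>a\<in>{1..<p}. \<Sum>x\<in>FQ m. psi m (poly f x) ^ a)"
    by simp
  finally show ?thesis by (simp only: card_FQ[OF m(2,1)])
qed

end

section \<open>Products of L-functions and their reduction\<close>

lemma log_deriv_coeffs: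
  fixes F :: "'a::comm_ring_1 fps"
  shows "(\<forall>l. of_nat l * F $ l = (\<Sum>n\<in>{1..l}. s n * F $ (l - n))) \<longleftrightarrow>
    fps_X * fps_deriv F = Abs_fps (\<lambda>n. if n = 0 then 0 else s n) * F"
proof -
  have "(Abs_fps (\<lambda>n. if n = 0 then 0 else s n) * F) $ l = (\<Sum>n\<in>{1..l}. s n * F $ (l - n))" for l
    unfolding fps_mult_nth by (simp add: sum.atLeast_Suc_atMost[of 0 l])
  moreover have "(fps_X * fps_deriv F) $ l = of_nat l * F $ l" for l
    by (cases l) simp_all
  ultimately show ?thesis by (simp only: fps_eq_iff)
qed

text \<open>In the form X F' = S F the recursions of the factors add up, so the product of the
  L-functions satisfies one with the summed exponential sums.\<close>

lemma log_deriv_prod: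
  fixes F :: "'i \<Rightarrow> 'a::comm_ring_1 fps"
  assumes "finite A" "\<And>a. a \<in> A \<Longrightarrow> fps_X * fps_deriv (F a) = S a * F a"
  shows "fps_X * fps_deriv (\<Prod>a\<in>A. F a) = (\<Sum>a\<in>A. S a) * (\<Prod>a\<in>A. F a)"
  using assms
proof (induction A rule: finite_induct)
  case (insert a A)
  let ?P = "\<Prod>a\<in>A. F a"
  have "fps_X * fps_deriv (F a * ?P) = (fps_X * fps_deriv (F a)) * ?P + F a * (fps_X * fps_deriv ?P)"
    by (simp add: algebra_simps)
  also have "fps_X * fps_deriv (F a) = S a * F a" using insert by simp
  also have "fps_X * fps_deriv ?P = (\<Sum>a\<in>A. S a) * ?P" using insert by simp
  finally show ?case using insert by (simp add: algebra_simps)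
qed simp

text \<open>Used with D = d - 1 for the L-functions and with D = 1 for their reductions.\<close>

lemma prod_fps_top:
  fixes F :: "'i \<Rightarrow> 'a::idom fps"
  assumes "finite A" "\<And>a l. a \<in> A \<Longrightarrow> l > D \<Longrightarrow> F a $ l = 0"
  shows "(\<Prod>a\<in>A. F a) $ (card A * D) = (\<Prod>a\<in>A. F a $ D) \<and> (\<forall>l > card A * D. (\<Prod>a\<in>A. F a) $ l = 0)"
  using assms
proof (induction A rule: finite_induct)
  case (insert a A)
  let ?P = "\<Prod>a\<in>A. F a"
  have P: "?P $ (card A * D) = (\<Prod>a\<in>A. F a $ D)" "\<And>l. l > card A * D \<Longrightarrow> ?P $ l = 0"
    using insert by auto
  have Fa: "\<And>l. l > D \<Longrightarrow> F a $ l = 0" using insert by auto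
  have z: "F a $ i * ?P $ (l - i) = 0" if "i \<noteq> D \<or> l > D + card A * D" "i \<le> l" "l \<ge> D + card A * D" for i l
  proof (cases "i > D")
    case False
    hence "l - i > card A * D" using that by auto
    thus ?thesis using P(2) by simp
  qed (simp add: Fa)
  have "(F a * ?P) $ l = 0" if "l > D + card A * D" for l
    unfolding fps_mult_nth using that by (intro sum.neutral ballI z) auto
  moreover have "(F a * ?P) $ (D + card A * D) = F a $ D * ?P $ (card A * D)"
  proof -
    have "(F a * ?P) $ (D + card A * D) = (\<Sum>i\<in>{0..D + card A * D}. if i = D then F a $ D * ?P $ (card A * D) else 0)"
      unfolding fps_mult_nth
    proof (intro sum.cong refl)
      fix i assume "i \<in> {0..D + card A * D}"
      thus "F a $ i * ?P $ (D + card A * D - i) = (if i = D then F a $ D * ?P $ (card A * D) else 0)"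
        using z[of i "D + card A * D"] by (cases "i = D") simp_all
    qed
    thus ?thesis by simp
  qed
  ultimately show ?case using insert P by simp
qed simp

context teichmuller
begin

lemma res_unique: "res K z c \<Longrightarrow> res K z c' \<Longrightarrow> c = c'"
  unfolding res_def using varpi_ne_0 by (metis mult_left_cancel power_not_zero)

lemma res_le: "res K z c \<Longrightarrow> res K' z c' \<Longrightarrow> c' \<noteq> 0 \<Longrightarrow> K \<le> K'"
  using res_weaken res_unique by (metis not_le)

lemma of_nat_eq_0: "(of_nat n :: 'k) = 0 \<longleftrightarrow> p dvd n"
  by (simp add: of_nat_eq_0_iff_char_dvd char_p)

text \<open>By \<open>res_p\<close> a factor \<open>p\<close> counts as \<pi>^(p-1) up to a unit,
  and the part prime to \<open>p\<close> has nonzero residue.\<close>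

lemma res_of_int:
  assumes "A \<noteq> 0"
  shows "\<exists>c. c \<noteq> 0 \<and> res ((p - 1) * multiplicity (int p) A) (of_int A) c"
proof -
  have "\<not> is_unit (int p)" using prime_gt_1_nat[OF prime_p] by simp
  then obtain A' where A': "A = int p ^ multiplicity (int p) A * A'" "\<not> int p dvd A'"
    using multiplicity_decompose'[OF assms, of "int p"] by metis
  let ?k = "multiplicity (int p) A"
  define n where "n = nat \<bar>A'\<bar>"
  have "\<not> p dvd n" using A'(2) by (simp add: n_def nat_dvd_iff flip: int_dvd_int_iff)
  hence n: "(of_nat n :: 'k) \<noteq> 0" by (simp add: of_nat_eq_0)
  have "res 0 (of_nat n) (of_nat n)" using res_Ov[OF Ov_of_nat, of n] by (simp add: \<phi>_of_nat)
  from res_mult[OF res_power[OF res_p, of ?k] this]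
  have R: "res ((p - 1) * ?k) (of_nat p ^ ?k * of_nat n) ((- 1) ^ ?k * of_nat n)" by (simp add: mult.commute)
  have c: "(- 1) ^ ?k * of_nat n \<noteq> (0 :: 'k)" using n by simp
  have A: "(of_int A :: complex) = of_nat p ^ ?k * of_int A'" by (subst A'(1)) simp
  show ?thesis
  proof (cases "A' \<ge> 0")
    case True
    hence "A' = int n" by (simp add: n_def)
    hence "of_int A = (of_nat p ^ ?k * of_nat n :: complex)" unfolding A by simp
    thus ?thesis using R c by metis
  next
    case False
    hence "A' = - int n" by (simp add: n_def)
    hence "of_int A = - (of_nat p ^ ?k * of_nat n :: complex)" unfolding A by simp
    thus ?thesis using res_uminus[OF R] c by (metis neg_equal_0_iff_equal)
  qed
qed

text \<open>Numerator and denominator have exact orders by \<open>res_of_int\<close>, so an order in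
  \<pi> becomes one for \<open>ord_rat\<close>, with the ramification index p - 1 as the
  factor.\<close>

lemma ord_rat_res:
  assumes b: "b \<noteq> 0" and R: "res K (of_rat b) c"
  shows "int K \<le> int (p - 1) * ord_rat p b" "c \<noteq> 0 \<Longrightarrow> int K = int (p - 1) * ord_rat p b"
proof -
  obtain A B where q: "quotient_of b = (A, B)" by force
  have B: "B > 0" using quotient_of_denom_pos[OF q] .
  have bAB: "b = of_int A / of_int B" using quotient_of_div[OF q] .
  hence A: "A \<noteq> 0" using b by auto
  obtain cA where cA: "cA \<noteq> 0" "res ((p - 1) * multiplicity (int p) A) (of_int A) cA" using res_of_int[OF A] by blast
  obtain cB where cB: "cB \<noteq> 0" "res ((p - 1) * multiplicity (int p) B) (of_int B) cB" using res_of_int[of B] B by auto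
  have "of_rat b * of_int B = (of_int A :: complex)" using B by (simp add: bAB of_rat_divide)
  hence R2: "res (K + (p - 1) * multiplicity (int p) B) (of_int A) (c * cB)" using res_mult[OF R cB(2)] by simp
  have le: "K + (p - 1) * multiplicity (int p) B \<le> (p - 1) * multiplicity (int p) A" by (rule res_le[OF R2 cA(2,1)])
  have o: "int (p - 1) * ord_rat p b = int ((p - 1) * multiplicity (int p) A) - int ((p - 1) * multiplicity (int p) B)"
    unfolding ord_rat_def q by (simp only: prod.case right_diff_distrib of_nat_mult)
  show "int K \<le> int (p - 1) * ord_rat p b" unfolding o using le by linarith
  assume "c \<noteq> 0"
  hence "(p - 1) * multiplicity (int p) A \<le> K + (p - 1) * multiplicity (int p) B" using cB(1) by (intro res_le[OF cA(2) R2]) simp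
  thus "int K = int (p - 1) * ord_rat p b" unfolding o using le by linarith
qed

text \<open>The nontrivial characters of the prime field come from the powers \<zeta>^a, so the
  results for \<zeta> carry over to all of them by interpretation.\<close>

lemma teichmuller_power:
  assumes "0 < a" "a < p"
  shows "teichmuller Ov \<phi> p M (\<zeta> ^ a)"
proof unfold_locales
  show "(\<zeta> ^ a) ^ p = 1" using zeta_p by (metis power_commutes power_mult mult.commute power_one)
  show "\<zeta> ^ a \<noteq> 1"
  proof
    assume "\<zeta> ^ a = 1"
    hence "of_nat a = (0 :: 'k)" using chi_eq_1[OF of_nat_FQ, of a] by (simp add: chi_of_nat)
    thus False using assms nat_dvd_not_less[of a p] by (simp add: of_nat_eq_0)
  qed
qed (use prime_p p_ge_3 char_p M_pos roots_Ov in auto)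

text \<open>\<zeta>^a - 1 is \<pi> times an element of residue a, so residues relative to \<zeta>^a
  convert to the common \<pi> with the factor a^K.\<close>

lemma res_power_zeta:
  assumes a: "0 < a" "a < p" and R: "teichmuller.res Ov \<phi> (\<zeta> ^ a) K z c"
  shows "res K z (of_nat a ^ K * c)"
proof -
  interpret T: teichmuller Ov \<phi> p M "\<zeta> ^ a" by (rule teichmuller_power[OF a])
  obtain u where u: "u \<in> Ov" "z = T.vpi ^ K * u" "\<phi> u = c" using R unfolding T.res_def by blast
  define v where "v = (\<Sum>i<a. \<zeta> ^ i)"
  have v: "v \<in> Ov" unfolding v_def by (intro Ov_sum Ov_power zeta_Ov)
  have "\<phi> v = (\<Sum>i<a. \<phi> (\<zeta> ^ i))" unfolding v_def by (intro \<phi>_sum Ov_power zeta_Ov)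
  hence phi_v: "\<phi> v = of_nat a" by (simp add: \<phi>_power zeta_Ov phi_zeta)
  have "T.vpi = vpi * v" unfolding T.vpi_def vpi_def v_def by (rule power_diff_1_eq)
  hence "z = vpi ^ K * (v ^ K * u)" using u(2) by (simp add: power_mult_distrib)
  moreover have "v ^ K * u \<in> Ov" by (intro Ov_mult Ov_power v u(1))
  moreover have "\<phi> (v ^ K * u) = of_nat a ^ K * c" using v u by (simp add: \<phi>_mult \<phi>_power Ov_power phi_v)
  ultimately show ?thesis unfolding res_def by blast
qed

lemma expsum_power_zeta:
  assumes a: "0 < a" "a < p"
  shows "teichmuller.expsum p (\<zeta> ^ a) m f = (\<Sum>x\<in>FQ m. psi m (poly f x) ^ a)"
proof -
  interpret T: teichmuller Ov \<phi> p M "\<zeta> ^ a" by (rule teichmuller_power[OF a])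
  have "T.psi m x = psi m x ^ a" for x
    unfolding T.psi_def psi_def T.chi_def chi_def by (simp add: mult.commute flip: power_mult)
  thus ?thesis by (simp add: T.expsum_def)
qed

text \<open>\<open>C\<close> is the reduction of \<open>F\<close> after T is rescaled by
  \<pi>^(-\<kappa>).\<close>

definition resps :: "nat \<Rightarrow> complex fps \<Rightarrow> 'k fps \<Rightarrow> bool" where
  "resps \<kappa> F C \<longleftrightarrow> (\<forall>l. res (\<kappa> * l) (F $ l) (C $ l))"

lemma resps_1: "resps \<kappa> 1 1"
  unfolding resps_def
proof
  fix l show "res (\<kappa> * l) ((1 :: complex fps) $ l) ((1 :: 'k fps) $ l)"
    using res_Ov[OF Ov_1] by (cases l) (simp_all add: res_0 \<phi>_1)
qed

lemma resps_mult:
  assumes "resps \<kappa> F C" "resps \<kappa> F' C'"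
  shows "resps \<kappa> (F * F') (C * C')"
  unfolding resps_def fps_mult_nth
proof (intro allI res_sum)
  fix l i :: nat assume "i \<in> {0..l}"
  hence "\<kappa> * i + \<kappa> * (l - i) = \<kappa> * l" by (simp flip: distrib_left)
  thus "res (\<kappa> * l) (F $ i * F' $ (l - i)) (C $ i * C' $ (l - i))"
    using assms res_mult unfolding resps_def by metis
qed

lemma resps_prod: "finite A \<Longrightarrow> (\<And>a. a \<in> A \<Longrightarrow> resps \<kappa> (F a) (C a)) \<Longrightarrow> resps \<kappa> (\<Prod>a\<in>A. F a) (\<Prod>a\<in>A. C a)"
  by (induction A rule: finite_induct) (simp_all add: resps_1 resps_mult)

context
  fixes \<nu> d w :: nat and f :: "'k poly"
  assumes \<nu>: "\<nu> > 0" and deg_f: "degree f = d" and lc_f: "lead_coeff f = 1" and f: "\<And>i. coeff f i \<in> FQ \<nu>"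
    and d_ge: "d \<ge> 2" and pd: "p > d" and nM: "\<And>n. 0 < n \<Longrightarrow> n < d \<Longrightarrow> \<nu> * n dvd M"
    and w: "p - 1 \<le> d * w" "d * w < p - 1 + d"
begin

private lemmas ctx2 = \<nu> deg_f lc_f f d_ge pd nM w
private lemmas p_d = p_not_dvd_d[OF ctx2]
private lemmas ctx1 = \<nu> deg_f lc_f f p_d d_ge

text \<open>The L-function of the \<open>a\<close>-th power of the additive character.\<close>

definition LL :: "nat \<Rightarrow> complex fps" where "LL a = Abs_fps (teichmuller.cc p (\<zeta> ^ a) \<nu> f)"

definition PP :: "complex fps" where "PP = (\<Prod>a\<in>{1..<p}. LL a)"

lemma PP_recursion: "of_nat l * PP $ l = (\<Sum>n\<in>{1..l}. (\<Sum>a\<in>{1..<p}. \<Sum>x\<in>FQ (\<nu> * n). psi (\<nu> * n) (poly f x) ^ a) * PP $ (l - n))"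
proof -
  define S where "S = (\<lambda>a. Abs_fps (\<lambda>n. if n = 0 then 0 else \<Sum>x\<in>FQ (\<nu> * n). psi (\<nu> * n) (poly f x) ^ a))"
  have "fps_X * fps_deriv (LL a) = S a * LL a" if a: "a \<in> {1..<p}" for a
  proof -
    have a': "0 < a" "a < p" using a by auto
    interpret T: teichmuller Ov \<phi> p M "\<zeta> ^ a" by (rule teichmuller_power[OF a'])
    have "\<forall>l. of_nat l * LL a $ l = (\<Sum>n\<in>{1..l}. T.expsum (\<nu> * n) f * LL a $ (l - n))"
      unfolding LL_def fps_nth_Abs_fps using T.cc_recursion[OF ctx1] by simp
    thus ?thesis unfolding log_deriv_coeffs S_def expsum_power_zeta[OF a'] .
  qed
  hence "fps_X * fps_deriv PP = (\<Sum>a\<in>{1..<p}. S a) * PP" unfolding PP_def by (intro log_deriv_prod) auto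
  also have "(\<Sum>a\<in>{1..<p}. S a) = Abs_fps (\<lambda>n. if n = 0 then 0 else \<Sum>a\<in>{1..<p}. \<Sum>x\<in>FQ (\<nu> * n). psi (\<nu> * n) (poly f x) ^ a)"
    by (rule fps_ext) (simp add: fps_sum_nth S_def)
  finally show ?thesis unfolding log_deriv_coeffs[symmetric] by blast
qed

lemma LL_coeffs:
  assumes a: "a \<in> {1..<p}"
  shows "LL a $ 0 = 1" "l \<ge> d \<Longrightarrow> LL a $ l = 0" "LL a $ (d - 1) \<noteq> 0"
    "\<exists>C. resps (\<nu> * w) (LL a) C \<and> (p > 2 * d \<and> coeff (f ^ w) (p - 1) \<noteq> 0 \<longrightarrow> C $ 1 \<noteq> 0 \<and> (\<forall>l>1. C $ l = 0))"
proof -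
  have a': "0 < a" "a < p" using a by auto
  interpret T: teichmuller Ov \<phi> p M "\<zeta> ^ a" by (rule teichmuller_power[OF a'])
  note nuM = nu_dvd_M[OF ctx2]
  show "LL a $ 0 = 1" by (simp add: LL_def T.cc_0[OF ctx1])
  show "l \<ge> d \<Longrightarrow> LL a $ l = 0" by (simp add: LL_def T.cc_high[OF ctx1 nuM])
  show "LL a $ (d - 1) \<noteq> 0" using T.cc_top[OF ctx1 nuM] by (simp add: LL_def)
  define g where "g = T.gam \<nu> w f"
  define Q where "Q = (\<lambda>l c. T.res (\<nu> * w * l) (T.cc \<nu> f l) c \<and> (l = 0 \<longrightarrow> c = 1) \<and>
    (p > 2 * d \<longrightarrow> (l = 1 \<longrightarrow> c = - g) \<and> (l \<ge> 2 \<longrightarrow> c = 0)))"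
  have "\<forall>l. \<exists>c. Q l c" unfolding Q_def g_def using T.ex_res_cc[OF ctx2] by blast
  then obtain c where c: "\<And>l. Q l (c l)" using choice[of Q] by blast
  define C where "C = Abs_fps (\<lambda>l. of_nat a ^ (\<nu> * w * l) * c l)"
  have "resps (\<nu> * w) (LL a) C"
    unfolding resps_def
  proof
    fix l
    have "T.res (\<nu> * w * l) (T.cc \<nu> f l) (c l)" using c[of l] by (simp add: Q_def)
    from res_power_zeta[OF a' this] show "res (\<nu> * w * l) (LL a $ l) (C $ l)" by (simp add: LL_def C_def)
  qed
  moreover have "C $ 1 \<noteq> 0 \<and> (\<forall>l>1. C $ l = 0)" if H: "p > 2 * d" "coeff (f ^ w) (p - 1) \<noteq> 0"
  proof -
    have wp: "w < p" using w_lt[OF \<nu> nuM eq_refl[OF deg_f] d_ge pd w f] by simp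
    have "g \<noteq> 0" using H(2) fact_nonzero[OF wp] by (simp add: g_def T.gam_def[OF ctx2])
    moreover have "(of_nat a :: 'k) \<noteq> 0" using a' nat_dvd_not_less[of a p] by (simp add: of_nat_eq_0)
    ultimately have "C $ 1 \<noteq> 0" using c[of 1] H(1) by (simp add: C_def Q_def)
    moreover have "C $ l = 0" if "l > 1" for l using c[of l] H(1) that by (simp add: C_def Q_def)
    ultimately show ?thesis by blast
  qed
  ultimately show "\<exists>C. resps (\<nu> * w) (LL a) C \<and> (p > 2 * d \<and> coeff (f ^ w) (p - 1) \<noteq> 0 \<longrightarrow> C $ 1 \<noteq> 0 \<and> (\<forall>l>1. C $ l = 0))" by blast
qed

lemma PP_0: "PP $ 0 = 1"
proof -
  have "(\<Prod>a\<in>A. F a) $ 0 = 1" if "finite A" "\<And>a. a \<in> A \<Longrightarrow> F a $ 0 = 1" for A and F :: "nat \<Rightarrow> complex fps"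
    using that by (induction A rule: finite_induct) simp_all
  from this[OF finite_atLeastLessThan LL_coeffs(1)] show ?thesis unfolding PP_def .
qed

lemma PP_top: "PP $ ((p - 1) * (d - 1)) \<noteq> 0"
proof -
  have "PP $ (card {1..<p} * (d - 1)) = (\<Prod>a\<in>{1..<p}. LL a $ (d - 1))"
    unfolding PP_def using prod_fps_top[of "{1..<p}" "d - 1" LL] LL_coeffs(2) by auto
  thus ?thesis using LL_coeffs(3) by simp
qed

text \<open>In the extremal case the reduction is a product of p - 1 linear polynomials with nonzero
  T-coefficients, so its top coefficient sits at T^(p-1).\<close>

lemma PP_res:
  "\<exists>C. resps (\<nu> * w) PP C \<and> (p > 2 * d \<and> coeff (f ^ w) (p - 1) \<noteq> 0 \<longrightarrow> C $ (p - 1) \<noteq> 0)"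
proof -
  define Q where "Q = (\<lambda>a C. resps (\<nu> * w) (LL a) C \<and> (p > 2 * d \<and> coeff (f ^ w) (p - 1) \<noteq> 0 \<longrightarrow> C $ 1 \<noteq> 0 \<and> (\<forall>l>1. C $ l = 0)))"
  have "\<forall>a\<in>{1..<p}. \<exists>C. Q a C" unfolding Q_def using LL_coeffs(4) by blast
  then obtain C where C: "\<And>a. a \<in> {1..<p} \<Longrightarrow> Q a (C a)" using bchoice[of "{1..<p}" Q] by blast
  have "resps (\<nu> * w) PP (\<Prod>a\<in>{1..<p}. C a)" unfolding PP_def using C by (intro resps_prod) (auto simp: Q_def)
  moreover have "(\<Prod>a\<in>{1..<p}. C a) $ (p - 1) \<noteq> 0" if "p > 2 * d \<and> coeff (f ^ w) (p - 1) \<noteq> 0"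
  proof -
    have "(\<Prod>a\<in>{1..<p}. C a) $ (card {1..<p} * 1) = (\<Prod>a\<in>{1..<p}. C a $ 1)"
      using C that by (intro prod_fps_top[THEN conjunct1]) (auto simp: Q_def)
    thus ?thesis using C that by (simp add: Q_def)
  qed
  ultimately show ?thesis by blast
qed

end

end

section \<open>The Newton polygon\<close>

text \<open>The hull lies in the wedge between the lines of slopes s and s' and contains the segment
  from the origin to the point over \<open>x0\<close>, so above this interval its lower boundary is
  the line of slope s.\<close>

lemma first_slope_lower_hull:
  fixes S :: "(real \<times> real) set"
  assumes 0: "(0, 0) \<in> S" and s: "(x0, s * x0) \<in> S" "x0 > 0"
    and bnd: "\<And>x y. (x, y) \<in> S \<Longrightarrow> s * x \<le> y \<and> y \<le> s' * x"
  shows "first_slope (lower_hull S) = s"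
proof -
  have conv: "convex {z. s * fst z \<le> snd z \<and> snd z \<le> s' * fst z}"
  proof -
    have "{z. s * fst z \<le> snd z \<and> snd z \<le> s' * fst z} = {z. inner (s, -1) z \<le> 0} \<inter> {z. inner (- s', 1) z \<le> 0}"
      by (auto simp: inner_prod_def)
    thus ?thesis by (simp only: convex_Int convex_halfspace_le)
  qed
  hence "convex hull S \<subseteq> {z. s * fst z \<le> snd z \<and> snd z \<le> s' * fst z}"
    using bnd by (intro hull_minimal) auto
  hence hull: "s * x \<le> y \<and> y \<le> s' * x" if "(x, y) \<in> convex hull S" for x y using that by auto
  have N: "lower_hull S t = s * t" if t: "0 \<le> t" "t \<le> x0" for t
  proof -
    have "(1 - t / x0) *\<^sub>R (0, 0) + (t / x0) *\<^sub>R (x0, s * x0) \<in> convex hull S"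
      using t s by (intro convexD[OF convex_convex_hull] hull_inc 0 s(1)) (auto simp: field_simps)
    hence "(t, s * t) \<in> convex hull S" using s(2) by (simp add: field_simps)
    thus ?thesis unfolding lower_hull_def using hull by (intro cInf_eq_minimum) auto
  qed
  show ?thesis
    unfolding first_slope_def
  proof (rule the_equality)
    show "\<exists>e>0. \<forall>t\<in>{0..e}. lower_hull S t = lower_hull S 0 + s * t"
      using s(2) N by (intro exI[of _ x0]) auto
  next
    fix r assume "\<exists>e>0. \<forall>t\<in>{0..e}. lower_hull S t = lower_hull S 0 + r * t"
    then obtain e where e: "e > 0" "\<And>t. t \<in> {0..e} \<Longrightarrow> lower_hull S t = lower_hull S 0 + r * t" by blast
    have "s * min e x0 = r * min e x0" using e(2)[of "min e x0"] N[of "min e x0"] N[of 0] e(1) s(2) by simp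
    thus "r = s" using e(1) s(2) by (simp add: min_def split: if_splits)
  qed
qed

text \<open>The extreme values of y / x are the slopes of the wedge.\<close>

lemma first_slope_finite:
  fixes T :: "(real \<times> real) set"
  assumes T: "finite T" "T \<noteq> {}" and pos: "\<And>x y. (x, y) \<in> T \<Longrightarrow> x > 0"
  shows "first_slope (lower_hull (insert (0, 0) T)) = Min ((\<lambda>(x, y). y / x) ` T)"
proof -
  let ?R = "(\<lambda>(x, y). y / x) ` T"
  have R: "finite ?R" "?R \<noteq> {}" using T by auto
  obtain x0 y0 where xy: "(x0, y0) \<in> T" "Min ?R = y0 / x0" using Min_in[OF R] by auto
  have x0: "x0 > 0" using pos xy by blast
  show ?thesis
  proof (rule first_slope_lower_hull[OF _ _ x0])
    show "(x0, Min ?R * x0) \<in> insert (0, 0) T" using xy x0 by simp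
    fix x y assume "(x, y) \<in> insert (0, 0) T"
    thus "Min ?R * x \<le> y \<and> y \<le> Max ?R * x"
    proof
      assume xyT: "(x, y) \<in> T"
      hence "y / x \<in> ?R" by force
      hence "Min ?R \<le> y / x" "y / x \<le> Max ?R" using R by auto
      thus ?thesis using pos[OF xyT] by (simp add: field_simps)
    qed simp
  qed simp
qed

section \<open>Comparison with the zeta function\<close>

lemma as_P_recursion:
  fixes f :: "'a::{field,finite} poly"
  shows "as_P p f $ 0 = 1"
    "of_nat l * as_P p f $ l = (\<Sum>n\<in>{1..l}. (of_nat (as_points p f n) - 1 - of_nat (CARD('a) ^ n)) * as_P p f $ (l - n))"
proof -
  define z where "z = as_log_zeta p f"
  have z0: "z $ 0 = 0" by (simp add: z_def as_log_zeta_def)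
  define E where "E = fps_exp 1 oo z"
  have P: "as_P p f = inverse E" by (simp add: as_P_def E_def z_def)
  have E0: "E $ 0 = 1" by (simp add: E_def)
  show "as_P p f $ 0 = 1" unfolding P by (simp add: E0)
  \<comment> \<open>From E' = E z' follows P' = -P z' for P = 1/E. Once points are counted by
    character sums, this is the recursion of \<open>PP_recursion\<close>.\<close>
  have dE: "fps_deriv E = E * fps_deriv z" unfolding E_def by (simp add: fps_compose_deriv[OF z0])
  have PE: "inverse E * E = 1" using E0 by (intro inverse_mult_eq_1) simp
  have "fps_deriv (inverse E * E) = 0" unfolding PE by simp
  hence "fps_deriv (inverse E) * E = - (inverse E * (E * fps_deriv z))" by (simp add: dE eq_neg_iff_add_eq_0 add.commute)
  hence "fps_deriv (inverse E) * E * inverse E = - (inverse E * (E * fps_deriv z)) * inverse E" by (simp only:)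
  hence "fps_deriv (inverse E) * (inverse E * E) = - (inverse E * E) * (inverse E * fps_deriv z)"
    by (simp add: algebra_simps)
  hence "fps_deriv (inverse E) = - (inverse E * fps_deriv z)" unfolding PE by simp
  hence 1: "fps_X * fps_deriv (as_P p f) = - (fps_X * fps_deriv z) * as_P p f" unfolding P by (simp add: algebra_simps)
  have 2: "- (fps_X * fps_deriv z) = Abs_fps (\<lambda>n. if n = 0 then 0 else of_nat (as_points p f n) - 1 - of_nat (CARD('a) ^ n))"
  proof (rule fps_ext)
    fix n
    show "(- (fps_X * fps_deriv z)) $ n = Abs_fps (\<lambda>n. if n = 0 then 0 else of_nat (as_points p f n) - 1 - of_nat (CARD('a) ^ n)) $ n"
    proof (cases n)
      case (Suc m)
      have "(of_nat (Suc m) :: rat) \<noteq> 0" by (simp del: of_nat_Suc)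
      thus ?thesis unfolding Suc z_def as_log_zeta_def by (simp del: of_nat_Suc power_Suc of_nat_power)
    qed simp
  qed
  show "of_nat l * as_P p f $ l = (\<Sum>n\<in>{1..l}. (of_nat (as_points p f n) - 1 - of_nat (CARD('a) ^ n)) * as_P p f $ (l - n))"
    using 1 unfolding 2 log_deriv_coeffs[symmetric] by blast
qed

lemma CHAR_eq:
  assumes "prime p" "CARD('a::{field,finite}) = p ^ \<nu>"
  shows "CHAR('a) = p"
proof -
  have "prime CHAR('a)" using finite_imp_CHAR_pos[where ?'a='a] prime_CHAR_semidom[where ?'a='a] by simp
  moreover have "CHAR('a) dvd p ^ \<nu>" using CHAR_dvd_CARD[where ?'a='a] assms(2) by simp
  ultimately have "CHAR('a) dvd p" by (rule prime_dvd_power)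
  thus ?thesis using \<open>prime CHAR('a)\<close> assms(1) primes_dvd_imp_eq by blast
qed

text \<open>Multiplication by x \<noteq> 0 permutes the nonzero elements.\<close>

lemma power_CARD_eq:
  fixes x :: "'a::{field,finite}"
  shows "x ^ CARD('a) = x"
proof (cases "x = 0")
  case False
  have "(*) x ` (UNIV - {0}) = UNIV - {0}"
    using False by (intro endo_inj_surj) (auto intro: inj_onI)
  moreover have "inj_on ((*) x) (UNIV - {0})" using False by (auto intro: inj_onI)
  ultimately have "(\<Prod>y\<in>UNIV - {0}. x * y) = \<Prod>(UNIV - {0 :: 'a})"
    using prod.reindex[of "(*) x" "UNIV - {0 :: 'a}" "\<lambda>y. y"] by (simp add: o_def)
  hence "x ^ (CARD('a) - 1) = 1" by (simp add: prod.distrib)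
  moreover have "x ^ CARD('a) = x * x ^ (CARD('a) - 1)"
    using finite_UNIV_card_ge_0[where ?'a = 'a] by (cases "CARD('a)") simp_all
  ultimately show ?thesis by simp
qed simp

lemma rhom_to_ac: "rhom to_ac"
  by (rule rhomI) simp_all

lemma newton_slopes:
  fixes f :: "'a::{field,finite} poly"
  assumes d: "d \<ge> 2" and p: "prime p" and cop: "coprime p d" and \<nu>: "\<nu> \<ge> 1" and card: "CARD('a) = p ^ \<nu>"
    and lc: "lead_coeff f = 1" and deg: "degree f = d" and pd: "p > d" and w: "p - 1 \<le> d * w" "d * w < p - 1 + d"
  shows "\<And>l. 1 \<le> l \<Longrightarrow> l \<le> 2 * as_genus p f \<Longrightarrow> as_P p f $ l \<noteq> 0 \<Longrightarrow>
      int (\<nu> * w * l) \<le> int (p - 1) * ord_rat p (as_P p f $ l)"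
    and "\<exists>l. 1 \<le> l \<and> l \<le> 2 * as_genus p f \<and> as_P p f $ l \<noteq> 0"
    and "p > 2 * d \<Longrightarrow> coeff (f ^ w) (p - 1) \<noteq> 0 \<Longrightarrow> p - 1 \<le> 2 * as_genus p f \<and> as_P p f $ (p - 1) \<noteq> 0 \<and>
      int (\<nu> * w * (p - 1)) = int (p - 1) * ord_rat p (as_P p f $ (p - 1))"
proof -
  define L where "L = 2 * as_genus p f"
  define F where "F = map_poly to_ac f"
  have cF: "coeff F i = to_ac (coeff f i)" for i by (simp add: F_def coeff_map_poly)
  have degF: "degree F = d" by (simp add: F_def degree_map_poly deg)
  have lcF: "lead_coeff F = 1" unfolding degF cF using lc deg by simp
  have charF: "CHAR('a alg_closure) = p" using CHAR_eq[OF p card] by simp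
  interpret A: as_curve p d F by unfold_locales (use p charF degF lcF cop d in auto)
  have L: "(p - 1) * (d - 1) \<le> L" using A.genus_lower by (simp add: L_def as_genus_def F_def)
  have p3: "p \<ge> 3" using pd d by simp
  have dL: "d - 1 \<le> L" and pL: "p - 1 \<le> L"
  proof -
    have *: "1 * (d - 1) \<le> (p - 1) * (d - 1)" "(p - 1) * 1 \<le> (p - 1) * (d - 1)"
      using p3 d by (intro mult_le_mono; simp)+
    show "d - 1 \<le> L" using order_trans[OF *(1) L] by (simp only: mult_1_left)
    show "p - 1 \<le> L" using order_trans[OF *(2) L] by (simp only: mult_1_right)
  qed
  \<comment> \<open>The factorial makes every extension of degree n \<le> L a subfield of the field
    with p^M elements.\<close>
  define M where "M = \<nu> * fact L"
  have M: "M > 0" using \<nu> by (simp add: M_def)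
  have nM: "\<nu> * n dvd M" if "0 < n" "n \<le> L" for n
    unfolding M_def using that by (intro mult_dvd_mono dvd_fact) auto
  have nM': "\<And>n. 0 < n \<Longrightarrow> n < d \<Longrightarrow> \<nu> * n dvd M" using nM dL by simp
  have "p ^ 1 \<le> p ^ M" using M p3 by (intro power_increasing) auto
  hence N: "p * (p ^ M - 1) > 0" using p3 by simp
  obtain Ov and \<phi> :: "complex \<Rightarrow> 'a alg_closure" where red: "reduction Ov \<phi>" "\<And>z. z ^ (p * (p ^ M - 1)) = 1 \<Longrightarrow> z \<in> Ov"
    using ex_reduction[OF N] by blast
  obtain \<zeta> :: complex where \<zeta>: "\<zeta> ^ p = 1" "\<zeta> \<noteq> 1"
  proof -
    have "card {z::complex. z ^ p = 1} = p" using p3 by (intro card_roots_unity_eq) simp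
    hence "\<not> {z::complex. z ^ p = 1} \<subseteq> {1}" using p3 card_mono[of "{1::complex}" "{z::complex. z ^ p = 1}"] by auto
    thus ?thesis using that by blast
  qed
  interpret T: teichmuller Ov \<phi> p M \<zeta>
    using red(1) by (intro teichmuller.intro teichmuller_axioms.intro) (use p p3 charF M red(2) \<zeta> in auto)
  have GF: "GF_ext n = (T.FQ (\<nu> * n) :: 'a alg_closure set)" for n by (simp add: GF_ext_def T.FQ_def card power_mult)
  have toFQ: "to_ac c \<in> T.FQ (\<nu> * n)" for c :: 'a and n
  proof -
    have "c ^ (CARD('a) ^ n) = c" by (induction n) (simp_all add: power_mult power_CARD_eq mult.commute)
    hence "to_ac (c ^ (CARD('a) ^ n)) = to_ac c" by simp
    thus ?thesis by (simp add: T.FQ_def card power_mult)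
  qed
  have FFQ: "coeff F i \<in> T.FQ (\<nu> * n)" for i n unfolding cF by (rule toFQ)
  have FFQ1: "\<And>i. coeff F i \<in> T.FQ \<nu>" using FFQ[of _ 1] by simp
  have \<nu>0: "\<nu> > 0" using \<nu> by simp
  note ctx = \<nu>0 degF lcF FFQ1 d pd nM' w
  define P where "P = T.PP \<nu> F"
  have points: "of_nat (as_points p f n) - 1 - of_nat (CARD('a) ^ n) =
      (\<Sum>a\<in>{1..<p}. \<Sum>x\<in>T.FQ (\<nu> * n). T.psi (\<nu> * n) (poly F x) ^ a)" if n: "0 < n" "n \<le> L" for n
  proof -
    have m: "\<nu> * n > 0" "\<nu> * n dvd M" using n \<nu>0 nM by auto
    have k: "subfld (T.FQ (\<nu> * n))"
      unfolding subfld_def subrng_def by (intro conjI ballI T.FQ_closed)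
    have "as_points p f n = 1 + card {(c, b). c \<in> T.FQ (\<nu> * n) \<and> b \<in> T.FQ (\<nu> * n) \<and> b ^ p - b = poly F c}"
      unfolding as_points_def GF F_def[symmetric] using FFQ
      by (intro A.card_rational_places k T.finite_FQ m(1)) (simp add: poly_over_def)
    moreover have "of_nat (CARD('a) ^ n) = (of_nat (p ^ (\<nu> * n)) :: complex)" by (simp add: card power_mult)
    ultimately show ?thesis using T.card_as_points_affine[OF m FFQ] by simp
  qed
  \<comment> \<open>Both sequences start with 1 and satisfy the same recursion in the degrees up to
    L, which determines them in characteristic 0. This transports the rational coefficients to the
    complex product.\<close>
  have bP: "of_rat (as_P p f $ l) = P $ l" if "l \<le> L" for l
    using that
  proof (induction l rule: less_induct)
    case (less l)
    show ?case
    proof (cases "l = 0")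
      case True
      thus ?thesis using T.PP_0[OF ctx] by (simp add: as_P_recursion(1) P_def)
    next
      case False
      have "of_nat l * (of_rat (as_P p f $ l) :: complex) = of_rat (of_nat l * as_P p f $ l)" by (simp add: of_rat_mult)
      also have "\<dots> = (\<Sum>n\<in>{1..l}. of_rat (of_nat (as_points p f n) - 1 - of_nat (CARD('a) ^ n)) * of_rat (as_P p f $ (l - n)))"
        unfolding as_P_recursion(2) of_rat_sum of_rat_mult ..
      also have "\<dots> = (\<Sum>n\<in>{1..l}. (\<Sum>a\<in>{1..<p}. \<Sum>x\<in>T.FQ (\<nu> * n). T.psi (\<nu> * n) (poly F x) ^ a) * P $ (l - n))"
      proof (intro sum.cong refl)
        fix n assume n: "n \<in> {1..l}"
        have n': "0 < n" "n \<le> L" using n less.prems by auto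
        have e: "of_rat (of_nat (as_points p f n) - 1 - of_nat (CARD('a) ^ n)) = (of_nat (as_points p f n) - 1 - of_nat (CARD('a) ^ n) :: complex)"
          by (simp only: of_rat_diff of_rat_of_nat_eq of_rat_1)
        have "of_rat (as_P p f $ (l - n)) = P $ (l - n)" using less.IH[of "l - n"] n less.prems by simp
        thus "of_rat (of_nat (as_points p f n) - 1 - of_nat (CARD('a) ^ n)) * of_rat (as_P p f $ (l - n)) =
            (\<Sum>a\<in>{1..<p}. \<Sum>x\<in>T.FQ (\<nu> * n). T.psi (\<nu> * n) (poly F x) ^ a) * P $ (l - n)"
          unfolding e points[OF n'] by (simp only:)
      qed
      also have "\<dots> = of_nat l * P $ l" unfolding P_def by (rule T.PP_recursion[OF ctx, symmetric])
      finally show ?thesis using False by simp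
    qed
  qed
  obtain C where C: "T.resps (\<nu> * w) P C" "p > 2 * d \<and> coeff (F ^ w) (p - 1) \<noteq> 0 \<longrightarrow> C $ (p - 1) \<noteq> 0"
    using T.PP_res[OF ctx] unfolding P_def by blast
  have R: "T.res (\<nu> * w * l) (of_rat (as_P p f $ l)) (C $ l)" if "l \<le> L" for l
    using C(1) unfolding T.resps_def bP[OF that] by blast
  show "int (\<nu> * w * l) \<le> int (p - 1) * ord_rat p (as_P p f $ l)"
    if "1 \<le> l" "l \<le> 2 * as_genus p f" "as_P p f $ l \<noteq> 0" for l
    using T.ord_rat_res(1)[OF that(3) R] that(2) by (simp add: L_def)
  have "P $ ((p - 1) * (d - 1)) \<noteq> 0" unfolding P_def by (rule T.PP_top[OF ctx])
  hence "as_P p f $ ((p - 1) * (d - 1)) \<noteq> 0" using bP[OF L] by auto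
  moreover have "1 \<le> (p - 1) * (d - 1)" using p3 d by (simp add: Suc_le_eq)
  ultimately show "\<exists>l. 1 \<le> l \<and> l \<le> 2 * as_genus p f \<and> as_P p f $ l \<noteq> 0"
    using L unfolding L_def by blast
  assume big: "p > 2 * d" and H: "coeff (f ^ w) (p - 1) \<noteq> 0"
  have "F ^ w = map_poly to_ac (f ^ w)" unfolding F_def by (rule rhom_power[OF map_poly_rhom[OF rhom_to_ac], symmetric])
  hence "coeff (F ^ w) (p - 1) \<noteq> 0" using H by (simp add: coeff_map_poly)
  hence Cne: "C $ (p - 1) \<noteq> 0" using C(2) big by blast
  have "as_P p f $ (p - 1) \<noteq> 0"
  proof
    assume "as_P p f $ (p - 1) = 0"
    hence "T.res (\<nu> * w * (p - 1)) 0 (C $ (p - 1))" using R[OF pL] by simp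
    thus False using T.res_unique[OF _ T.res_0] Cne by blast
  qed
  thus "p - 1 \<le> 2 * as_genus p f \<and> as_P p f $ (p - 1) \<noteq> 0 \<and>
      int (\<nu> * w * (p - 1)) = int (p - 1) * ord_rat p (as_P p f $ (p - 1))"
    using T.ord_rat_res(2)[OF _ R[OF pL] Cne] pL by (simp add: L_def)
qed

theorem theorem1p1:
  fixes d p \<nu> :: nat and f :: "'a::{field,finite} poly"
  assumes "d \<ge> 2"
    and "prime p" and "coprime p d"
    and "\<nu> \<ge> 1" and "CARD('a) = p ^ \<nu>"
    and "lead_coeff f = 1" and "degree f = d"
    and "as_genus p f \<ge> 3"
  shows "(p > d \<longrightarrow>
            NP\<^sub>1 p \<nu> f \<ge> real_of_int \<lceil>real (p - 1) / real d\<rceil> / real (p - 1)) \<and>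
         (p > 2 * d \<and> coeff (f ^ nat \<lceil>real (p - 1) / real d\<rceil>) (p - 1) \<noteq> 0 \<longrightarrow>
            NP\<^sub>1 p \<nu> f = real_of_int \<lceil>real (p - 1) / real d\<rceil> / real (p - 1))"
proof -
  define w where "w = nat \<lceil>real (p - 1) / real d\<rceil>"
  have "\<lceil>real (p - 1) / real d\<rceil> \<ge> \<lceil>0 :: real\<rceil>" by (intro ceiling_mono) simp
  hence wi: "\<lceil>real (p - 1) / real d\<rceil> = int w" by (simp add: w_def)
  have d0: "real d > 0" using assms(1) by simp
  have "real (p - 1) / real d \<le> real w" "real w < real (p - 1) / real d + 1"
    using wi by linarith+
  hence "real (p - 1) \<le> real d * real w" "real d * real w < real (p - 1) + real d"
    using d0 by (simp_all add: field_simps)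
  \<comment> \<open>The two inequalities characterise the ceiling of (p - 1)/d in the form used by
    the carry estimates.\<close>
  hence w: "p - 1 \<le> d * w" "d * w < p - 1 + d" by (simp_all flip: of_nat_mult of_nat_add del: of_nat_diff)
  define T where "T = {(real l, real_of_int (ord_rat p (fps_nth (as_P p f) l)) / real \<nu>) | l.
        1 \<le> l \<and> l \<le> 2 * as_genus p f \<and> fps_nth (as_P p f) l \<noteq> 0}"
  have finT: "finite T"
  proof (rule finite_subset)
    show "T \<subseteq> (\<lambda>l. (real l, real_of_int (ord_rat p (fps_nth (as_P p f) l)) / real \<nu>)) ` {1..2 * as_genus p f}"
      by (auto simp: T_def)
  qed simp
  let ?R = "(\<lambda>(x, y). y / x) ` T"
  have \<nu>0: "real \<nu> > 0" using assms(4) by simp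
  {
    assume pd: "p > d"
    have p1: "real (p - 1) > 0" using pd assms(1) by simp
    note S = newton_slopes[OF assms(1-7) pd w]
    have "T \<noteq> {}" using S(2) by (auto simp: T_def)
    hence slope: "NP\<^sub>1 p \<nu> f = Min ?R"
      unfolding NP\<^sub>1_def NP_def NP_points_def T_def[symmetric]
      by (intro first_slope_finite finT) (auto simp: T_def)
    have fin: "finite ?R" "?R \<noteq> {}" using finT \<open>T \<noteq> {}\<close> by auto
    have bound: "real w / real (p - 1) \<le> r" if r: "r \<in> ?R" for r
    proof -
      obtain l where l: "1 \<le> l" "l \<le> 2 * as_genus p f" "as_P p f $ l \<noteq> 0"
        "r = real_of_int (ord_rat p (as_P p f $ l)) / (real \<nu> * real l)" using r by (auto simp: T_def)
      have "real_of_int (int (\<nu> * w * l)) \<le> real_of_int (int (p - 1) * ord_rat p (as_P p f $ l))"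
        using S(1)[OF l(1-3)] by (simp only: of_int_le_iff)
      hence "real \<nu> * real w * real l \<le> real (p - 1) * real_of_int (ord_rat p (as_P p f $ l))" by simp
      thus ?thesis unfolding l(4) using l(1) \<nu>0 p1 by (simp add: field_simps)
    qed
    have a: "NP\<^sub>1 p \<nu> f \<ge> real w / real (p - 1)" unfolding slope using bound fin by simp
    have b: "NP\<^sub>1 p \<nu> f = real w / real (p - 1)" if H: "p > 2 * d" "coeff (f ^ w) (p - 1) \<noteq> 0"
    proof -
      note S3 = S(3)[OF H]
      have "real_of_int (int (\<nu> * w * (p - 1))) = real_of_int (int (p - 1) * ord_rat p (as_P p f $ (p - 1)))"
        using S3 by (simp only:)
      hence "real \<nu> * real w * real (p - 1) = real (p - 1) * real_of_int (ord_rat p (as_P p f $ (p - 1)))" by simp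
      hence "real w / real (p - 1) = real_of_int (ord_rat p (as_P p f $ (p - 1))) / real \<nu> / real (p - 1)"
        using \<nu>0 p1 by (simp add: field_simps)
      moreover have "(real (p - 1), real_of_int (ord_rat p (as_P p f $ (p - 1))) / real \<nu>) \<in> T"
        unfolding T_def using S3 p1 by (intro CollectI exI[of _ "p - 1"]) simp
      ultimately have "real w / real (p - 1) \<in> ?R" by force
      hence "Min ?R \<le> real w / real (p - 1)" by (rule Min_le[OF fin(1)])
      thus ?thesis using a slope by simp
    qed
    note a b
  }
  moreover have "p > 2 * d \<Longrightarrow> p > d" by simp
  ultimately show ?thesis unfolding wi nat_int of_int_of_nat_eq by blast
qed

end
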